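(* Let $d\ge1$ and let $\omega\in\mathbb{R}^d$ satisfy the diophantine condition: there are $c,\mu>0$ such that $|\mathbf n\cdot\omega|>c|\mathbf n|^{-\mu}$ for all $\mathbf n\in\mathbb{Z}^d\setminus\{0\}$. Let $\Theta=\mathbb{Z}^d\cdot\omega=\{\mathbf n\cdot\omega:\mathbf n\in\mathbb{Z}^d\}$. Then there is $W\in C^\infty(\mathbb{R};\mathbb{R})$ of the form $W(x)=\sum_{\theta\in\Theta}e^{i\theta x}w_\theta(x)$, where for all $k,N\ge0$ there is $C_{k,N}>0$ with $$|\partial_x^kw_\theta(x)|\le C_{k,N}\langle x\rangle^{-k}\langle\theta\rangle^{-N}\quad(\theta\in\Theta),\qquad|\partial_x^kw_{\mathbf n\cdot\omega}(x)|\le C_{k,N}\langle x\rangle^{-k}\langle\mathbf n\rangle^{-N}\quad(\mathbf n\in\mathbb{Z}^d),$$ such that the set $\{\tfrac{\theta^2}4:\theta\in\Theta\setminus\{0\}\}$ is contained in the point spectrum of $-\Delta+W$ on $L^2(\mathbb{R})$.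
   Context: $\Delta=\partial_x^2$ on $\mathbb{R}$ and $\langle x\rangle=(1+|x|^2)^{1/2}$. A number is in the point spectrum if it is an eigenvalue with an eigenfunction in $L^2(\mathbb{R})$. *)

theory Defs
  imports "HOL-Analysis.Analysis"
begin

definition jbracket :: "'a::real_normed_vector \<Rightarrow> real" where
  "jbracket x = sqrt (1 + (norm x)\<^sup>2)"

(* The k-th derivative is only meaningful where the lower derivatives are differentiable;
   it is used below for smooth functions only. *)
definition nth_deriv :: "nat \<Rightarrow> (real \<Rightarrow> 'a::real_normed_vector) \<Rightarrow> real \<Rightarrow> 'a" where
  "nth_deriv k f = ((\<lambda>g x. vector_derivative g (at x)) ^^ k) f"

definition smooth :: "(real \<Rightarrow> 'a::real_normed_vector) \<Rightarrow> bool" where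
  "smooth f \<longleftrightarrow> (\<forall>k x. nth_deriv k f differentiable (at x))"

definition test_function :: "(real \<Rightarrow> complex) \<Rightarrow> bool" where
  "test_function \<phi> \<longleftrightarrow> smooth \<phi> \<and> compact (closure {x. \<phi> x \<noteq> 0})"

definition L2 :: "(real \<Rightarrow> complex) set" where
  "L2 = {u. u \<in> borel_measurable lborel \<and> integrable lborel (\<lambda>x. (norm (u x))\<^sup>2)}"

(* Both u and its weak derivative v are required to be in L2, so that the integrals converge. *)
definition weak_deriv_L2 :: "nat \<Rightarrow> (real \<Rightarrow> complex) \<Rightarrow> (real \<Rightarrow> complex) \<Rightarrow> bool" where
  "weak_deriv_L2 j u v \<longleftrightarrow> u \<in> L2 \<and> v \<in> L2 \<and>
     (\<forall>\<phi>. test_function \<phi> \<longrightarrow>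
        (LINT x|lborel. u x * nth_deriv j \<phi> x) = (-1) ^ j * (LINT x|lborel. v x * \<phi> x))"

definition sobolev_H :: "nat \<Rightarrow> (real \<Rightarrow> complex) set" where
  "sobolev_H m = {u \<in> L2. \<forall>j\<le>m. \<exists>v. weak_deriv_L2 j u v}"

(* Graph of the operator - Delta + W with domain H^2 (for bounded W). Elements of L2 are
   represented by functions; the graph is invariant under changes on null sets. *)
definition schroedinger_op ::
  "(real \<Rightarrow> real) \<Rightarrow> ((real \<Rightarrow> complex) \<times> (real \<Rightarrow> complex)) set" where
  "schroedinger_op W = {(u, f). u \<in> sobolev_H 2 \<and> f \<in> L2 \<and>
     (\<exists>v. weak_deriv_L2 2 u v \<and> (AE x in lborel. f x = - v x + complex_of_real (W x) * u x))}"

definition point_spectrum :: "((real \<Rightarrow> complex) \<times> (real \<Rightarrow> complex)) set \<Rightarrow> complex set" where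
  "point_spectrum T = {z. \<exists>u \<in> L2. \<not> (AE x in lborel. u x = 0) \<and> (u, \<lambda>x. z * u x) \<in> T}"

definition int_to_real_vec :: "int ^ 'd \<Rightarrow> real ^ 'd" where
  "int_to_real_vec n = (\<chi> i. real_of_int (n $ i))"

definition diophantine :: "real ^ 'd \<Rightarrow> bool" where
  "diophantine \<omega> \<longleftrightarrow> (\<exists>c>0. \<exists>\<mu>>0. \<forall>n :: int ^ 'd. n \<noteq> 0 \<longrightarrow>
     \<bar>int_to_real_vec n \<bullet> \<omega>\<bar> > c * norm (int_to_real_vec n) powr (- \<mu>))"

definition frequency_set :: "real ^ 'd \<Rightarrow> real set" where
  "frequency_set \<omega> = {int_to_real_vec n \<bullet> \<omega> | n. True}"

end

theory Submission
  imports Defs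
begin

text \<open>
The potential is built by inserting eigenvalues with the double commutation (Gelfand--Levitan)
method, for infinitely many eigenvalues at once.

\<^bold>\<open>Insertion on the half line.\<close> Let \<open>s i\<close> be solutions of \<open>s'' = (W0 - \<kappa> i\<^sup>2) s\<close> with \<open>s i 0 = 0\<close>, let
\<open>G i j\<close> be the integral of \<open>s i * s j\<close> from \<open>0\<close> to \<open>x\<close>, and let \<open>(1 + G) \<psi> = s\<close>. Then
\<open>\<psi>'' = (W0 - 2 q' - \<kappa> i\<^sup>2) \<psi>\<close> with \<open>q = (\<Sum>j. s j * \<psi> j)\<close> (\<open>double_commutation\<close>). If \<open>W0\<close> has compact
support, \<open>s i\<close> is asymptotically a sine wave, so the diagonal entries of \<open>G\<close> grow like \<open>c i * x\<close>,
whereas \<open>\<kappa> i \<noteq> \<kappa> j\<close> keeps the other entries bounded. Hence \<open>\<psi> i\<close> decays like \<open>1 / x\<close> (\<open>\<psi>_decay\<close>) and is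
square integrable. Here the \<open>\<kappa> i\<close> enumerate all positive half frequencies \<open>(n \<bullet> \<omega>) / 2\<close>.
The normalisation \<open>s i = O(\<gamma> i)\<close> is free; it is chosen exponentially small in the lattice vector, which
beats the small denominators \<open>1 / \<bar>\<kappa> i - \<kappa> j\<bar>\<close>, as these grow only polynomially by the diophantine
condition. So \<open>1 + G\<close>, with row \<open>i\<close> divided by \<open>1 + c i * x\<close>, is a small perturbation of the identity.

\<^bold>\<open>Quasiperiodic structure.\<close> Beyond the support of \<open>W0\<close> the entries of \<open>G\<close> are \<open>c i * x\<close> plus combinations
of the waves with frequencies \<open>\<plusminus>\<kappa> i \<plusminus> \<kappa> j\<close> (\<open>gram_expansion\<close>). As \<open>2 * \<kappa> i\<close> is itself a lattice frequency, the
ansatz \<open>\<psi> i x = (\<Sum>n. exp (\<i> (\<kappa> i + n \<bullet> \<omega>) x) * \<Psi> (i, n) x)\<close> turns the equation for \<open>\<psi>\<close> into an infinite linear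
system for the \<open>\<Psi> (i, n)\<close> in which no oscillating coefficient is left: its coefficients are symbols of order zero
in \<open>x\<close>. Its Neumann series converges in norms that control any given number of
derivatives (\<open>symbol_system_solvable\<close>). So the \<open>\<Psi> (i, n)\<close> are symbols that decay exponentially in \<open>n\<close>, and
substitution gives the expansion of \<open>- 2 q'\<close> with coefficients of the same kind.

\<^bold>\<open>Reflection.\<close> The construction lives on the half line; its even reflection is smooth if the potential vanishes
near \<open>0\<close>. This is what \<open>W0\<close> is for. Near the origin the double commutation is first run
backwards, from the free solutions \<open>\<gamma> i * sin (\<kappa> i * x)\<close>; this produces a potential \<open>V\<close> (\<open>near_origin\<close>), which is cut
off at a small distance \<open>\<epsilon>\<close> to give \<open>W0\<close>. The width \<open>\<epsilon>\<close> does not depend on \<open>i\<close>, and \<open>\<epsilon> * sup \<bar>V\<bar>\<close> is small, so every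
\<open>s i\<close> stays close to \<open>\<gamma> i * sin (\<kappa> i * x)\<close> (\<open>perturbed_wave\<close>). The forward transformation then undoes the backward one
where \<open>W0 = V\<close> (\<open>gram_free\<close>): there the new potential is \<open>0\<close> and \<open>\<psi> i\<close> is a sine. Therefore the
even reflection of the potential and the odd reflection of \<open>\<psi> i\<close> are smooth on the whole line (\<open>even_potential\<close>).
\<close>

section \<open>Iterated derivatives on an open set\<close>

definition smooth_on :: "real set \<Rightarrow> (real \<Rightarrow> 'a::real_normed_vector) \<Rightarrow> bool" where
  "smooth_on U f \<longleftrightarrow> (\<forall>k. \<forall>x\<in>U. nth_deriv k f differentiable (at x))"

text \<open>Differentiability of finite order, because products and reciprocals are treated by induction on the
  order: their derivatives are expressions in functions that are differentiable one time less.\<close>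
definition diff_upto :: "nat \<Rightarrow> real set \<Rightarrow> (real \<Rightarrow> 'a::real_normed_vector) \<Rightarrow> bool" where
  "diff_upto n U f \<longleftrightarrow> (\<forall>k\<le>n. \<forall>x\<in>U. nth_deriv k f differentiable (at x))"

lemma smooth_on_UNIV: "smooth_on UNIV f \<longleftrightarrow> smooth f"
  by (simp add: smooth_on_def smooth_def)

lemma smooth_on_iff_diff_upto: "smooth_on U f \<longleftrightarrow> (\<forall>n. diff_upto n U f)"
  by (auto simp: smooth_on_def diff_upto_def)

lemma nth_deriv_0 [simp]: "nth_deriv 0 f = f"
  by (simp add: nth_deriv_def)

lemma nth_deriv_Suc: "nth_deriv (Suc k) f x = vector_derivative (nth_deriv k f) (at x)"
  by (simp add: nth_deriv_def)

lemma nth_deriv_Suc_shift: "nth_deriv (Suc k) f = nth_deriv k (nth_deriv (Suc 0) f)"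
  by (simp add: nth_deriv_def funpow_Suc_right del: funpow.simps(2))

lemma nth_deriv_add_index: "nth_deriv (j + k) f = nth_deriv j (nth_deriv k f)"
  by (simp add: nth_deriv_def funpow_add)

lemma smooth_onD:
  assumes "smooth_on U f" "x \<in> U"
  shows "(nth_deriv k f has_vector_derivative nth_deriv (Suc k) f x) (at x)"
  using assms by (simp add: smooth_on_def nth_deriv_Suc vector_derivative_works)

lemma smooth_on_has_derivs:
  assumes "smooth_on U f" "x \<in> U"
  shows "(f has_vector_derivative nth_deriv 1 f x) (at x)"
    and "(nth_deriv 1 f has_vector_derivative nth_deriv 2 f x) (at x)"
  using smooth_onD[OF assms, of 0] smooth_onD[OF assms, of 1] by (simp_all add: numeral_2_eq_2)

lemma smooth_on_subset: "smooth_on U f \<Longrightarrow> V \<subseteq> U \<Longrightarrow> smooth_on V f"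
  by (auto simp: smooth_on_def)

lemma smooth_on_Un: "smooth_on U f \<Longrightarrow> smooth_on V f \<Longrightarrow> smooth_on (U \<union> V) f"
  by (auto simp: smooth_on_def)

lemma smooth_on_deriv: "smooth_on U f \<Longrightarrow> smooth_on U (nth_deriv k f)"
  by (auto simp: smooth_on_def nth_deriv_add_index[symmetric])

lemma smooth_on_continuous: "smooth_on U f \<Longrightarrow> continuous_on U (nth_deriv k f)"
  by (meson continuous_at_imp_continuous_on differentiable_imp_continuous_within smooth_on_def)

lemma has_vector_derivative_cong_open:
  assumes "open U" "x \<in> U" "\<And>y. y \<in> U \<Longrightarrow> f y = g y"
  shows "(f has_vector_derivative D) (at x) \<longleftrightarrow> (g has_vector_derivative D) (at x)"
  using assms has_vector_derivative_transform_within_open by metis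

lemma nth_deriv_cong:
  assumes "open U" "\<And>y. y \<in> U \<Longrightarrow> f y = g y" "x \<in> U"
  shows "nth_deriv k f x = nth_deriv k g x"
  using assms(3)
proof (induction k arbitrary: x)
  case 0
  then show ?case by (simp add: assms(2))
next
  case (Suc k)
  show ?case
    unfolding nth_deriv_Suc vector_derivative_def
    by (subst has_vector_derivative_cong_open[OF assms(1) Suc.prems Suc.IH]) simp_all
qed

lemma differentiable_cong_open:
  assumes "open U" "x \<in> U" "\<And>y. y \<in> U \<Longrightarrow> f y = g y"
  shows "(f::real \<Rightarrow> 'a::real_normed_vector) differentiable (at x) \<longleftrightarrow> g differentiable (at x)"
proof -
  have "h differentiable (at x) \<longleftrightarrow> (\<exists>D. (h has_vector_derivative D) (at x))" for h :: "real \<Rightarrow> 'a"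
    by (rule iffI, rule exI, erule vector_derivative_works[THEN iffD1], erule exE, erule differentiableI_vector)
  then show ?thesis by (simp add: has_vector_derivative_cong_open[OF assms])
qed

lemma diff_upto_cong:
  assumes "open U" "\<And>y. y \<in> U \<Longrightarrow> f y = g y"
  shows "diff_upto n U f \<longleftrightarrow> diff_upto n U g"
proof -
  have "nth_deriv k f differentiable (at x) \<longleftrightarrow> nth_deriv k g differentiable (at x)" if "x \<in> U" for k x
    by (rule differentiable_cong_open[OF assms(1) that]) (use nth_deriv_cong[OF assms] in auto)
  then show ?thesis by (auto simp: diff_upto_def)
qed

lemma smooth_on_cong:
  assumes "open U" "\<And>y. y \<in> U \<Longrightarrow> f y = g y"
  shows "smooth_on U f \<longleftrightarrow> smooth_on U g"
  using diff_upto_cong[OF assms] by (simp add: smooth_on_iff_diff_upto)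

text \<open>Linear operations, substitutions and infinite sums become instances of this rule: the candidates for all
  the derivatives are known beforehand.\<close>
lemma smooth_on_tower:
  assumes "open U" "\<And>k x. x \<in> U \<Longrightarrow> (F k has_vector_derivative F (Suc k) x) (at x)"
  shows "smooth_on U (F 0)" and "\<And>k x. x \<in> U \<Longrightarrow> nth_deriv k (F 0) x = F k x"
proof -
  show *: "nth_deriv k (F 0) x = F k x" if "x \<in> U" for k x
    using that
  proof (induction k arbitrary: x)
    case (Suc k)
    have "(nth_deriv k (F 0) has_vector_derivative F (Suc k) x) (at x)"
      using has_vector_derivative_cong_open[OF assms(1) Suc.prems, of "nth_deriv k (F 0)" "F k"] Suc assms(2)
      by auto
    then show ?case by (simp add: nth_deriv_Suc vector_derivative_at)
  qed simp
  show "smooth_on U (F 0)"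
    unfolding smooth_on_def
  proof (intro allI ballI)
    fix k x assume x: "x \<in> U"
    have "(nth_deriv k (F 0) has_vector_derivative F (Suc k) x) (at x)"
      using has_vector_derivative_cong_open[OF assms(1) x, of "nth_deriv k (F 0)" "F k"] x assms(2) *
      by auto
    then show "nth_deriv k (F 0) differentiable at x" by (rule differentiableI_vector)
  qed
qed

lemma smooth_on_tower_eq:
  assumes "open U" "F 0 = f" "\<And>k x. x \<in> U \<Longrightarrow> (F k has_vector_derivative F (Suc k) x) (at x)"
  shows "smooth_on U f" and "\<And>k x. x \<in> U \<Longrightarrow> nth_deriv k f x = F k x"
  using smooth_on_tower[of U F] assms by auto

lemma diff_upto_0: "diff_upto 0 U f \<longleftrightarrow> (\<forall>x\<in>U. f differentiable (at x))"
  by (simp add: diff_upto_def)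

lemma diff_upto_Suc:
  "diff_upto (Suc n) U f \<longleftrightarrow> (\<forall>x\<in>U. f differentiable (at x)) \<and> diff_upto n U (nth_deriv (Suc 0) f)"
  unfolding diff_upto_def nth_deriv_Suc_shift[symmetric]
  by (metis (no_types, lifting) Suc_le_mono le0 nth_deriv_0 not0_implies_Suc)

lemma diff_upto_mono: "diff_upto n U f \<Longrightarrow> m \<le> n \<Longrightarrow> diff_upto m U f"
  by (auto simp: diff_upto_def)

lemma diff_uptoD: "diff_upto n U f \<Longrightarrow> x \<in> U \<Longrightarrow> (f has_vector_derivative nth_deriv (Suc 0) f x) (at x)"
  by (auto simp: diff_upto_def nth_deriv_Suc vector_derivative_works)

lemma diff_upto_add:
  assumes "open U" "diff_upto n U p" "diff_upto n U q"
  shows "diff_upto n U (\<lambda>x. p x + q x)"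
  using assms(2,3)
proof (induction n arbitrary: p q)
  case 0
  then show ?case by (auto simp: diff_upto_0)
next
  case (Suc n)
  have "nth_deriv (Suc 0) (\<lambda>x. p x + q x) x = nth_deriv (Suc 0) p x + nth_deriv (Suc 0) q x"
    if "x \<in> U" for x
    using has_vector_derivative_add[OF diff_uptoD[OF Suc.prems(1) that] diff_uptoD[OF Suc.prems(2) that]]
    by (simp add: nth_deriv_Suc[of 0 "\<lambda>x. p x + q x"] vector_derivative_at)
  then have "diff_upto n U (nth_deriv (Suc 0) (\<lambda>x. p x + q x))"
    using Suc by (subst diff_upto_cong[OF assms(1)]) (auto simp: diff_upto_Suc)
  then show ?case using Suc.prems by (auto simp: diff_upto_Suc)
qed

lemma diff_upto_SucI:
  assumes "open U" "\<And>x. x \<in> U \<Longrightarrow> (f has_vector_derivative f' x) (at x)" "diff_upto n U f'"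
  shows "diff_upto (Suc n) U f"
proof -
  have "nth_deriv (Suc 0) f x = f' x" if "x \<in> U" for x
    using assms(2)[OF that] by (simp add: nth_deriv_Suc vector_derivative_at)
  then have "diff_upto n U (nth_deriv (Suc 0) f)" using assms(3) by (subst diff_upto_cong[OF assms(1)]) auto
  then show ?thesis using assms(2) by (auto simp: diff_upto_Suc intro: differentiableI_vector)
qed

lemma diff_upto_const: "diff_upto n U (\<lambda>x. c)"
proof (induction n arbitrary: c)
  case 0
  show ?case by (simp add: diff_upto_0)
next
  case (Suc n)
  have "diff_upto (Suc n) UNIV (\<lambda>x. c)" for c :: 'a
  proof (induction n arbitrary: c)
    case 0
    show ?case by (rule diff_upto_SucI[where f'="\<lambda>_. 0"]) (auto simp: diff_upto_0)
  next
    case (Suc n)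
    show ?case by (rule diff_upto_SucI[where f'="\<lambda>_. 0"]) (auto intro: Suc)
  qed
  then show ?case by (auto simp: diff_upto_def)
qed

lemma diff_upto_mult:
  fixes f g :: "real \<Rightarrow> 'a::real_normed_algebra"
  assumes "open U" "diff_upto n U f" "diff_upto n U g"
  shows "diff_upto n U (\<lambda>x. f x * g x)"
  using assms(2,3)
proof (induction n arbitrary: f g)
  case 0
  then show ?case by (auto simp: diff_upto_0)
next
  case (Suc n)
  have D: "nth_deriv (Suc 0) (\<lambda>x. f x * g x) x = f x * nth_deriv (Suc 0) g x + nth_deriv (Suc 0) f x * g x"
    if "x \<in> U" for x
    using has_vector_derivative_mult[OF diff_uptoD[OF Suc.prems(1) that] diff_uptoD[OF Suc.prems(2) that]]
    by (simp add: nth_deriv_Suc[of 0 "\<lambda>x. f x * g x"] vector_derivative_at)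
  have "diff_upto n U (nth_deriv (Suc 0) (\<lambda>x. f x * g x))"
    by (subst diff_upto_cong[OF assms(1)], erule D, intro diff_upto_add[OF assms(1)] Suc.IH) (use Suc.prems diff_upto_mono[of "Suc n" U _ n] in \<open>auto simp: diff_upto_Suc[of n]\<close>)
  then show ?case using Suc.prems by (auto simp: diff_upto_Suc)
qed

lemma
  assumes "open U" "smooth_on U f" "smooth_on U g"
  shows smooth_on_add: "smooth_on U (\<lambda>x. f x + g x)"
    and nth_deriv_add: "x \<in> U \<Longrightarrow> nth_deriv k (\<lambda>x. f x + g x) x = nth_deriv k f x + nth_deriv k g x"
  using smooth_on_tower[of U "\<lambda>k x. nth_deriv k f x + nth_deriv k g x"] assms
  by (auto intro!: has_vector_derivative_add smooth_onD)

lemma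
  assumes "open U" "smooth_on U f" "bounded_linear h"
  shows smooth_on_linear: "smooth_on U (\<lambda>x. h (f x))"
    and nth_deriv_linear: "x \<in> U \<Longrightarrow> nth_deriv k (\<lambda>x. h (f x)) x = h (nth_deriv k f x)"
  using smooth_on_tower[of U "\<lambda>k x. h (nth_deriv k f x)"] assms
  by (auto intro!: bounded_linear.has_vector_derivative smooth_onD)

lemma
  fixes f :: "real \<Rightarrow> 'a::real_normed_algebra"
  assumes "open U" "smooth_on U f"
  shows smooth_on_cmult: "smooth_on U (\<lambda>x. c * f x)"
    and nth_deriv_cmult: "x \<in> U \<Longrightarrow> nth_deriv k (\<lambda>x. c * f x) x = c * nth_deriv k f x"
  using smooth_on_linear[OF assms bounded_linear_mult_right] nth_deriv_linear[OF assms bounded_linear_mult_right]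
  by auto

lemma
  fixes f :: "real \<Rightarrow> 'a::real_normed_vector"
  assumes "open U" "smooth_on U f"
  shows smooth_on_minus: "smooth_on U (\<lambda>x. - f x)"
    and nth_deriv_minus: "x \<in> U \<Longrightarrow> nth_deriv k (\<lambda>x. - f x) x = - nth_deriv k f x"
  using smooth_on_linear[OF assms bounded_linear_minus[OF bounded_linear_ident]]
    nth_deriv_linear[OF assms bounded_linear_minus[OF bounded_linear_ident]]
  by auto

lemma
  assumes "open U" "smooth_on U f" "smooth_on U g"
  shows smooth_on_diff: "smooth_on U (\<lambda>x. f x - g x)"
    and nth_deriv_diff: "x \<in> U \<Longrightarrow> nth_deriv k (\<lambda>x. f x - g x) x = nth_deriv k f x - nth_deriv k g x"
  using smooth_on_add[OF assms(1,2) smooth_on_minus[OF assms(1,3)]]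
    nth_deriv_add[OF assms(1,2) smooth_on_minus[OF assms(1,3)]] nth_deriv_minus[OF assms(1,3)]
  by auto

lemma
  shows smooth_on_const: "smooth_on U (\<lambda>x. c)"
    and nth_deriv_const: "nth_deriv k (\<lambda>x. c) x = (if k = 0 then c else 0)"
proof -
  have "smooth_on UNIV (\<lambda>x. c)" "\<And>x. nth_deriv k (\<lambda>x. c) x = (if k = 0 then c else 0)"
    using smooth_on_tower_eq[of UNIV "\<lambda>k x. if k = 0 then c else 0" "\<lambda>x. c"] by (auto simp: fun_eq_iff)
  then show "smooth_on U (\<lambda>x. c)" "nth_deriv k (\<lambda>x. c) x = (if k = 0 then c else 0)"
    using smooth_on_subset[of UNIV "\<lambda>x. c" U] by auto
qed

lemma smooth_on_mult:
  fixes f g :: "real \<Rightarrow> 'a::real_normed_algebra"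
  assumes "open U" "smooth_on U f" "smooth_on U g"
  shows "smooth_on U (\<lambda>x. f x * g x)"
  using assms(2,3) unfolding smooth_on_iff_diff_upto by (intro allI diff_upto_mult[OF assms(1)]) blast+

lemma
  assumes "open U" "smooth_on ((\<lambda>x. c * x + d) ` U) f"
  shows smooth_on_affine: "smooth_on U (\<lambda>x. f (c * x + d))"
    and nth_deriv_affine: "x \<in> U \<Longrightarrow> nth_deriv k (\<lambda>x. f (c * x + d)) x = c ^ k *\<^sub>R nth_deriv k f (c * x + d)"
proof -
  have "((\<lambda>x. c ^ k *\<^sub>R nth_deriv k f (c * x + d)) has_vector_derivative c ^ Suc k *\<^sub>R nth_deriv (Suc k) f (c * x + d)) (at x)"
    if "x \<in> U" for k x
  proof -
    have "((nth_deriv k f \<circ> (\<lambda>x. c * x + d)) has_vector_derivative c *\<^sub>R nth_deriv (Suc k) f (c * x + d)) (at x)"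
      by (rule vector_diff_chain_at) (use that assms in \<open>auto intro!: derivative_eq_intros smooth_onD\<close>)
    then have "((\<lambda>x. c ^ k *\<^sub>R nth_deriv k f (c * x + d)) has_vector_derivative c ^ k *\<^sub>R c *\<^sub>R nth_deriv (Suc k) f (c * x + d)) (at x)"
      unfolding o_def
      by (rule bounded_linear.has_vector_derivative[OF bounded_linear_scaleR_right])
    then show ?thesis by (simp add: mult_ac)
  qed
  then show "smooth_on U (\<lambda>x. f (c * x + d))"
    and "x \<in> U \<Longrightarrow> nth_deriv k (\<lambda>x. f (c * x + d)) x = c ^ k *\<^sub>R nth_deriv k f (c * x + d)"
    using smooth_on_tower[of U "\<lambda>k x. c ^ k *\<^sub>R nth_deriv k f (c * x + d)"] assms(1) by auto
qed

lemma smooth_on_antideriv: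
  assumes "open U" "smooth_on U f" "\<And>x. x \<in> U \<Longrightarrow> (F has_vector_derivative f x) (at x)"
  shows "smooth_on U F" and "\<And>x k. x \<in> U \<Longrightarrow> nth_deriv (Suc k) F x = nth_deriv k f x"
proof -
  define G where "G k = (case k of 0 \<Rightarrow> F | Suc j \<Rightarrow> nth_deriv j f)" for k
  have "(G k has_vector_derivative G (Suc k) x) (at x)" if "x \<in> U" for k x
    using that assms smooth_onD by (cases k) (auto simp: G_def)
  from smooth_on_tower[OF assms(1), of G, OF this]
  show "smooth_on U F" and "\<And>x k. x \<in> U \<Longrightarrow> nth_deriv (Suc k) F x = nth_deriv k f x"
    by (force simp: G_def)+
qed

subsection \<open>Normalised derivatives and the Leibniz rule\<close>

definition taylor_coeff :: "nat \<Rightarrow> (real \<Rightarrow> complex) \<Rightarrow> real \<Rightarrow> complex" where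
  "taylor_coeff k f x = nth_deriv k f x / fact k"

lemma nth_deriv_taylor_coeff: "nth_deriv k f x = fact k * taylor_coeff k f x"
  by (simp add: taylor_coeff_def)

lemma taylor_coeff_has_derivative:
  assumes "smooth_on U f" "x \<in> U"
  shows "(taylor_coeff k f has_vector_derivative of_nat (Suc k) * taylor_coeff (Suc k) f x) (at x)"
proof -
  have "(taylor_coeff k f has_vector_derivative nth_deriv (Suc k) f x / fact k) (at x)"
    unfolding taylor_coeff_def[abs_def]
    by (intro bounded_linear.has_vector_derivative[OF bounded_linear_divide] smooth_onD[OF assms])
  also have "nth_deriv (Suc k) f x / fact k = of_nat (Suc k) * taylor_coeff (Suc k) f x"
    by (simp add: taylor_coeff_def field_simps del: of_nat_Suc)
  finally show ?thesis .
qed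

text \<open>With Taylor coefficients in place of derivatives the Leibniz rule is a plain convolution,
  so the weighted sums of their norms are submultiplicative.\<close>
lemma taylor_coeff_mult:
  assumes "open U" "smooth_on U f" "smooth_on U g" "x \<in> U"
  shows "taylor_coeff k (\<lambda>x. f x * g x) x = (\<Sum>j\<le>k. taylor_coeff j f x * taylor_coeff (k - j) g x)"
  using assms(4)
proof (induction k arbitrary: x)
  case 0
  then show ?case by (simp add: taylor_coeff_def)
next
  case (Suc k)
  let ?a = "\<lambda>j. taylor_coeff j f x" and ?b = "\<lambda>j. taylor_coeff j g x"
  let ?D = "\<Sum>j\<le>k. ?a j * (of_nat (Suc (k - j)) * ?b (Suc (k - j))) + (of_nat (Suc j) * ?a (Suc j)) * ?b (k - j)"
  have sm: "smooth_on U (\<lambda>x. f x * g x)" by (rule smooth_on_mult[OF assms(1-3)])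
  have "((\<lambda>x. \<Sum>j\<le>k. taylor_coeff j f x * taylor_coeff (k - j) g x) has_vector_derivative ?D) (at x)"
    by (intro has_vector_derivative_sum has_vector_derivative_mult
        taylor_coeff_has_derivative[OF assms(2) Suc.prems] taylor_coeff_has_derivative[OF assms(3) Suc.prems])
  then have "(taylor_coeff k (\<lambda>x. f x * g x) has_vector_derivative ?D) (at x)"
    using has_vector_derivative_cong_open[OF assms(1) Suc.prems Suc.IH] by auto
  then have "of_nat (Suc k) * taylor_coeff (Suc k) (\<lambda>x. f x * g x) x = ?D"
    by (rule vector_derivative_unique_at[OF taylor_coeff_has_derivative[OF sm Suc.prems]])
  also have "?D = (\<Sum>j\<le>k. of_nat (Suc k - j) * (?a j * ?b (Suc k - j))) + (\<Sum>j\<le>k. of_nat (Suc j) * (?a (Suc j) * ?b (Suc k - Suc j)))"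
    unfolding sum.distrib[symmetric]
    by (intro sum.cong refl) (simp add: Suc_diff_le mult_ac del: of_nat_Suc)
  also have "(\<Sum>j\<le>k. of_nat (Suc k - j) * (?a j * ?b (Suc k - j))) = (\<Sum>j\<le>Suc k. of_nat (Suc k - j) * (?a j * ?b (Suc k - j)))"
    by simp
  also have "(\<Sum>j\<le>k. of_nat (Suc j) * (?a (Suc j) * ?b (Suc k - Suc j))) = (\<Sum>j\<le>Suc k. of_nat j * (?a j * ?b (Suc k - j)))"
    by (subst sum.atMost_Suc_shift) simp
  also have "(\<Sum>j\<le>Suc k. of_nat (Suc k - j) * (?a j * ?b (Suc k - j))) + (\<Sum>j\<le>Suc k. of_nat j * (?a j * ?b (Suc k - j)))
      = (\<Sum>j\<le>Suc k. of_nat (Suc k) * (?a j * ?b (Suc k - j)))"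
    unfolding sum.distrib[symmetric]
    by (intro sum.cong refl) (simp add: algebra_simps of_nat_diff)
  also have "\<dots> = of_nat (Suc k) * (\<Sum>j\<le>Suc k. ?a j * ?b (Suc k - j))"
    by (simp only: sum_distrib_left)
  finally show ?case
    by (simp only: mult_cancel_left of_nat_eq_0_iff) auto
qed

subsection \<open>Termwise differentiation of infinite sums\<close>

text \<open>Termwise differentiation goes through a quadratic remainder estimate, since such an estimate can be summed
  over a dominated family whereas differentiability cannot.\<close>
lemma has_vector_derivative_quadratic:
  fixes F :: "real \<Rightarrow> 'a::real_normed_vector"
  assumes "open U" "x \<in> U" "\<And>y. y \<in> U \<Longrightarrow> norm (F y - F x - (y - x) *\<^sub>R D) \<le> M * (y - x)\<^sup>2"
  shows "(F has_vector_derivative D) (at x)"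
proof -
  obtain r where r: "r > 0" "ball x r \<subseteq> U" using assms(1,2) open_contains_ball by blast
  show ?thesis
    unfolding has_vector_derivative_def has_derivative_at_alt
  proof (intro conjI allI impI)
    show "bounded_linear (\<lambda>h. h *\<^sub>R D)" by (rule bounded_linear_scaleR_left)
    fix e :: real assume e: "e > 0"
    let ?d = "min r (e / (\<bar>M\<bar> + 1))"
    have "norm (F y - F x - (y - x) *\<^sub>R D) \<le> e * norm (y - x)" if y: "norm (y - x) < ?d" for y
    proof -
      have "y \<in> U" using y r by (auto simp: dist_real_def)
      then have "norm (F y - F x - (y - x) *\<^sub>R D) \<le> M * (y - x)\<^sup>2" by (rule assms(3))
      also have "\<dots> \<le> ((\<bar>M\<bar> + 1) * \<bar>y - x\<bar>) * \<bar>y - x\<bar>"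
        by (simp add: power2_eq_square abs_mult_self_eq mult.assoc) (intro mult_right_mono, auto)
      also have "\<dots> \<le> e * \<bar>y - x\<bar>"
      proof (intro mult_right_mono)
        have "\<bar>y - x\<bar> < e / (\<bar>M\<bar> + 1)" using y by simp
        then show "(\<bar>M\<bar> + 1) * \<bar>y - x\<bar> \<le> e" by (simp add: field_simps add_pos_nonneg)
      qed simp
      finally show ?thesis by simp
    qed
    moreover have "?d > 0" using r e by simp
    ultimately show "\<exists>d>0. \<forall>y. norm (y - x) < d \<longrightarrow> norm (F y - F x - (y - x) *\<^sub>R D) \<le> e * norm (y - x)"
      by blast
  qed
qed

lemma second_derivative_remainder:
  fixes f :: "real \<Rightarrow> 'a::real_normed_vector"
  assumes "convex U" "x \<in> U" "y \<in> U"
    and "\<And>x. x \<in> U \<Longrightarrow> (f has_vector_derivative f' x) (at x)"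
    and "\<And>x. x \<in> U \<Longrightarrow> (f' has_vector_derivative f'' x) (at x)"
    and "\<And>x. x \<in> U \<Longrightarrow> norm (f'' x) \<le> m"
  shows "norm (f y - f x - (y - x) *\<^sub>R f' x) \<le> m * (y - x)\<^sup>2"
proof -
  have sub: "closed_segment x y \<subseteq> U" by (rule closed_segment_subset[OF assms(2,3,1)])
  have lip: "norm (f' z - f' x) \<le> m * \<bar>y - x\<bar>" if "z \<in> closed_segment x y" for z
  proof -
    have "norm (f' z - f' x) \<le> m * norm (z - x)"
    proof (rule differentiable_bound[OF assms(1), of f' "\<lambda>x h. h *\<^sub>R f'' x"])
      fix w assume w: "w \<in> U"
      show "(f' has_derivative (\<lambda>h. h *\<^sub>R f'' w)) (at w within U)"
        using assms(5)[OF w] by (simp add: has_vector_derivative_def has_derivative_at_withinI)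
      show "onorm (\<lambda>h. h *\<^sub>R f'' w) \<le> m" 
        using assms(6)[OF w] by (intro onorm_bound) (auto simp: mult.commute[of m] intro!: mult_left_mono intro: order_trans[OF norm_ge_zero])
    qed (use that sub assms in auto)
    also have "\<dots> \<le> m * \<bar>y - x\<bar>"
      using that assms(6)[OF assms(2)] segment_bound1[OF that]
      by (intro mult_left_mono) (auto simp: order_trans[OF norm_ge_zero])
    finally show ?thesis .
  qed
  have "norm (f y - f x - (y - x) *\<^sub>R f' x) \<le> norm (y - x) * (m * \<bar>y - x\<bar>)"
  proof (rule vector_differentiable_bound_linearization[where S="closed_segment x y"])
    show "closed_segment x y \<subseteq> closed_segment x y" ..
  qed (use lip sub assms(4) in \<open>auto intro: has_vector_derivative_at_within\<close>)
  then show ?thesis by (simp add: power2_eq_square algebra_simps abs_mult_self_eq)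
qed

lemma has_vector_derivative_infsum:
  fixes f :: "'i \<Rightarrow> real \<Rightarrow> 'a::banach"
  assumes U: "open U" "convex U" "x \<in> U"
    and f1: "\<And>e x. e \<in> A \<Longrightarrow> x \<in> U \<Longrightarrow> (f e has_vector_derivative f' e x) (at x)"
    and f2: "\<And>e x. e \<in> A \<Longrightarrow> x \<in> U \<Longrightarrow> (f' e has_vector_derivative f'' e x) (at x)"
    and m: "\<And>e x. e \<in> A \<Longrightarrow> x \<in> U \<Longrightarrow> norm (f'' e x) \<le> m e" "m summable_on A"
    and s: "\<And>x. x \<in> U \<Longrightarrow> (\<lambda>e. f e x) summable_on A" "\<And>x. x \<in> U \<Longrightarrow> (\<lambda>e. f' e x) summable_on A"
  shows "((\<lambda>x. \<Sum>\<^sub>\<infinity>e\<in>A. f e x) has_vector_derivative (\<Sum>\<^sub>\<infinity>e\<in>A. f' e x)) (at x)"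
proof (rule has_vector_derivative_quadratic[OF U(1,3)])
  fix y assume y: "y \<in> U"
  have diff: "((\<lambda>e. p e - q e) has_sum (P - Q)) A" if "(p has_sum P) A" "(q has_sum Q) A" for p q :: "'i \<Rightarrow> 'a" and P Q
    using has_sum_add[OF that(1), of "\<lambda>e. - q e" "- Q"] that(2) by (simp add: has_sum_uminus)
  have "((\<lambda>e. f e y - f e x - (y - x) *\<^sub>R f' e x) has_sum
      ((\<Sum>\<^sub>\<infinity>e\<in>A. f e y) - (\<Sum>\<^sub>\<infinity>e\<in>A. f e x) - (y - x) *\<^sub>R (\<Sum>\<^sub>\<infinity>e\<in>A. f' e x))) A"
    by (intro diff has_sum_scaleR has_sum_infsum s U y)
  moreover have "((\<lambda>e. m e * (y - x)\<^sup>2) has_sum ((\<Sum>\<^sub>\<infinity>e\<in>A. m e) * (y - x)\<^sup>2)) A"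
    by (intro has_sum_cmult_left has_sum_infsum m)
  ultimately show "norm ((\<Sum>\<^sub>\<infinity>e\<in>A. f e y) - (\<Sum>\<^sub>\<infinity>e\<in>A. f e x) - (y - x) *\<^sub>R (\<Sum>\<^sub>\<infinity>e\<in>A. f' e x))
      \<le> (\<Sum>\<^sub>\<infinity>e\<in>A. m e) * (y - x)\<^sup>2"
    by (rule norm_infsum_le)
      (use second_derivative_remainder[OF U(2,3) y f1 f2 m(1)] in auto)
qed

lemma
  fixes f :: "'i \<Rightarrow> real \<Rightarrow> 'a::banach"
  assumes U: "open U" "convex U"
    and f: "\<And>e. e \<in> A \<Longrightarrow> smooth_on U (f e)"
    and m: "\<And>k. m k summable_on A" "\<And>k e x. e \<in> A \<Longrightarrow> x \<in> U \<Longrightarrow> norm (nth_deriv k (f e) x) \<le> m k e"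
  shows smooth_on_infsum: "smooth_on U (\<lambda>x. \<Sum>\<^sub>\<infinity>e\<in>A. f e x)"
    and nth_deriv_infsum: "x \<in> U \<Longrightarrow> nth_deriv k (\<lambda>x. \<Sum>\<^sub>\<infinity>e\<in>A. f e x) x = (\<Sum>\<^sub>\<infinity>e\<in>A. nth_deriv k (f e) x)"
    and summable_nth_deriv: "x \<in> U \<Longrightarrow> (\<lambda>e. nth_deriv k (f e) x) abs_summable_on A"
proof -
  have abs: "(\<lambda>e. nth_deriv k (f e) x) abs_summable_on A" if "x \<in> U" for k x
    by (rule summable_on_comparison_test[OF m(1)]) (use m(2) that in auto)
  show "x \<in> U \<Longrightarrow> (\<lambda>e. nth_deriv k (f e) x) abs_summable_on A" by (rule abs)
  note s = abs_summable_summable[OF abs]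
  have "((\<lambda>x. \<Sum>\<^sub>\<infinity>e\<in>A. nth_deriv k (f e) x) has_vector_derivative (\<Sum>\<^sub>\<infinity>e\<in>A. nth_deriv (Suc k) (f e) x)) (at x)"
    if "x \<in> U" for k x
    by (rule has_vector_derivative_infsum[OF U that, of A "\<lambda>e. nth_deriv k (f e)" "\<lambda>e. nth_deriv (Suc k) (f e)"
          "\<lambda>e. nth_deriv (Suc (Suc k)) (f e)" "m (Suc (Suc k))"])
      (use f m s smooth_onD in blast)+
  from smooth_on_tower[OF U(1), of "\<lambda>k x. \<Sum>\<^sub>\<infinity>e\<in>A. nth_deriv k (f e) x", OF this]
  show "smooth_on U (\<lambda>x. \<Sum>\<^sub>\<infinity>e\<in>A. f e x)"
    and "x \<in> U \<Longrightarrow> nth_deriv k (\<lambda>x. \<Sum>\<^sub>\<infinity>e\<in>A. f e x) x = (\<Sum>\<^sub>\<infinity>e\<in>A. nth_deriv k (f e) x)"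
    by auto
qed

subsection \<open>Dominated infinite sums\<close>

lemma dominated_summable:
  fixes f :: "'i \<Rightarrow> 'b::banach"
  assumes "g summable_on A" "\<And>x. x \<in> A \<Longrightarrow> norm (f x) \<le> g x"
  shows "f summable_on A"
  by (rule abs_summable_summable[OF Infinite_Sum.abs_summable_on_comparison_test'[OF assms]])

lemma dominated_infsum:
  fixes f :: "'i \<Rightarrow> 'b::banach"
  assumes "g summable_on A" "\<And>x. x \<in> A \<Longrightarrow> norm (f x) \<le> g x"
  shows "norm (infsum f A) \<le> infsum g A"
  by (rule norm_infsum_le[OF has_sum_infsum[OF dominated_summable[OF assms]] has_sum_infsum[OF assms(1)] assms(2)])

lemma summable_on_product:
  fixes p :: "'a \<Rightarrow> real" and q :: "'b \<Rightarrow> real"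
  assumes "p summable_on UNIV" "q summable_on UNIV" "\<And>a. 0 \<le> p a" "\<And>b. 0 \<le> q b"
  shows "(\<lambda>(a, b). p a * q b) summable_on UNIV"
proof -
  have "(\<lambda>(a, b). p a * q b) summable_on (UNIV \<times> UNIV)"
  proof (rule summable_on_SigmaI)
    show "((\<lambda>y. case (x, y) of (a, b) \<Rightarrow> p a * q b) has_sum p x * infsum q UNIV) UNIV" for x
      using has_sum_cmult_right[OF has_sum_infsum[OF assms(2)], of "p x"] by simp
    show "(\<lambda>x. p x * infsum q UNIV) summable_on UNIV"
      by (rule summable_on_cmult_left[OF assms(1)])
  qed (use assms in auto)
  then show ?thesis by simp
qed

lemma infsum_swap_dominated:
  fixes F :: "'a \<Rightarrow> 'b \<Rightarrow> 'c::banach"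
  assumes "(\<lambda>(a, b). G a b) summable_on UNIV" "\<And>a b. norm (F a b) \<le> G a b"
  shows "(\<lambda>a. \<Sum>\<^sub>\<infinity>b. F a b) summable_on UNIV" "(\<lambda>b. \<Sum>\<^sub>\<infinity>a. F a b) summable_on UNIV"
    "(\<Sum>\<^sub>\<infinity>a. \<Sum>\<^sub>\<infinity>b. F a b) = (\<Sum>\<^sub>\<infinity>b. \<Sum>\<^sub>\<infinity>a. F a b)"
    "\<And>a. F a summable_on UNIV" "\<And>b. (\<lambda>a. F a b) summable_on UNIV"
proof -
  have s: "(\<lambda>(a, b). F a b) summable_on (UNIV \<times> UNIV)"
    using dominated_summable[OF assms(1), of "\<lambda>(a, b). F a b"] assms(2) by auto
  have s': "(\<lambda>(b, a). F a b) summable_on (UNIV \<times> UNIV)"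
    using s by (subst (asm) summable_on_swap) (simp add: case_prod_unfold)
  show "(\<lambda>a. \<Sum>\<^sub>\<infinity>b. F a b) summable_on UNIV"
    using summable_on_Sigma_banach[OF s] .
  show "(\<lambda>b. \<Sum>\<^sub>\<infinity>a. F a b) summable_on UNIV"
    using summable_on_Sigma_banach[OF s'] .
  show "(\<Sum>\<^sub>\<infinity>a. \<Sum>\<^sub>\<infinity>b. F a b) = (\<Sum>\<^sub>\<infinity>b. \<Sum>\<^sub>\<infinity>a. F a b)"
    by (rule infsum_swap_banach[OF s])
  have G0: "0 \<le> G a b" for a b using assms(2)[of a b] norm_ge_zero order_trans by blast
  have g: "(\<lambda>(a, b). G a b) summable_on (UNIV \<times> UNIV)" using assms(1) by simp
  have g': "(\<lambda>(b, a). G a b) summable_on (UNIV \<times> UNIV)"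
    using g by (subst (asm) summable_on_swap) (simp add: case_prod_unfold)
  show "F a summable_on UNIV" for a
    by (rule dominated_summable[OF summable_on_SigmaD1[OF g, of a]]) (auto simp: assms(2))
  show "(\<lambda>a. F a b) summable_on UNIV" for b
    by (rule dominated_summable[OF summable_on_SigmaD1[OF g', of b]]) (auto simp: assms(2))
qed

lemma has_sum_finite_sum:
  assumes "finite J" "\<And>j. j \<in> J \<Longrightarrow> (f j has_sum S j) A"
  shows "((\<lambda>e. \<Sum>j\<in>J. f j e) has_sum (\<Sum>j\<in>J. S j :: 'b::{topological_comm_monoid_add, t2_space})) A"
  using assms by (induction J) (auto intro!: has_sum_add)

section \<open>Families of symbols\<close>

text \<open>A uniform version of the symbol class: with \<open>r x = 1 + \<bar>x\<bar>\<close> the members are symbols of order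
  zero with seminorms bounded by the weights, with \<open>r x = 1\<close> they merely have bounded derivatives.
  The constants depend on the order of the derivative but not on the index.\<close>
definition symbols :: "(real \<Rightarrow> real) \<Rightarrow> real set \<Rightarrow> ('i \<Rightarrow> real \<Rightarrow> complex) \<Rightarrow> ('i \<Rightarrow> real) \<Rightarrow> bool" where
  "symbols r U f w \<longleftrightarrow> (\<forall>i. 0 \<le> w i) \<and> (\<forall>i. smooth_on U (f i)) \<and>
     (\<forall>k. \<exists>C\<ge>0. \<forall>i. \<forall>x\<in>U. r x ^ k * norm (nth_deriv k (f i) x) \<le> C * w i)"

lemma symbolsI:
  assumes "\<And>i. 0 \<le> w i" "\<And>i. smooth_on U (f i)"
    "\<And>k. \<exists>C\<ge>0. \<forall>i. \<forall>x\<in>U. r x ^ k * norm (nth_deriv k (f i) x) \<le> C * w i"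
  shows "symbols r U f w"
  using assms by (auto simp: symbols_def)

lemma symbols_smooth: "symbols r U f w \<Longrightarrow> smooth_on U (f i)"
  by (auto simp: symbols_def)

lemma symbols_nonneg: "symbols r U f w \<Longrightarrow> 0 \<le> w i"
  by (auto simp: symbols_def)

lemma symbols_bound:
  assumes "symbols r U f w"
  obtains C where "C \<ge> 0" "\<And>i x. x \<in> U \<Longrightarrow> r x ^ k * norm (nth_deriv k (f i) x) \<le> C * w i"
proof -
  have "\<exists>C\<ge>0. \<forall>i. \<forall>x\<in>U. r x ^ k * norm (nth_deriv k (f i) x) \<le> C * w i"
    using assms by (simp add: symbols_def)
  then show ?thesis using that by blast
qed

lemma symbols_bound0:
  assumes "symbols r U f w" "\<And>x. x \<in> U \<Longrightarrow> 1 \<le> r x"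
  obtains C where "C \<ge> 0" "\<And>i x. x \<in> U \<Longrightarrow> norm (nth_deriv k (f i) x) \<le> C * w i"
proof -
  obtain C where C: "C \<ge> 0" "\<And>i x. x \<in> U \<Longrightarrow> r x ^ k * norm (nth_deriv k (f i) x) \<le> C * w i"
    using symbols_bound[OF assms(1)] by blast
  have "norm (nth_deriv k (f i) x) \<le> C * w i" if "x \<in> U" for i x
    using C(2)[OF that, of i] mult_right_mono[OF one_le_power[OF assms(2)[OF that], of k], of "norm (nth_deriv k (f i) x)"]
    by simp
  with C(1) that show ?thesis by blast
qed

lemma symbols_reindex: "symbols r U f w \<Longrightarrow> symbols r U (\<lambda>j. f (h j)) (\<lambda>j. w (h j))"
  unfolding symbols_def by metis

lemma symbols_weight:
  assumes "symbols r U f w" "c \<ge> 0" "\<And>i. w i \<le> c * v i" "\<And>i. 0 \<le> v i"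
  shows "symbols r U f v"
proof (rule symbolsI)
  fix k
  obtain C where C: "C \<ge> 0" "\<And>i x. x \<in> U \<Longrightarrow> r x ^ k * norm (nth_deriv k (f i) x) \<le> C * w i"
    using symbols_bound[OF assms(1)] by blast
  have "r x ^ k * norm (nth_deriv k (f i) x) \<le> (C * c) * v i" if "x \<in> U" for i x
    using C(2)[OF that, of i] mult_left_mono[OF assms(3)[of i] C(1)] by (simp add: mult_ac)
  then show "\<exists>C\<ge>0. \<forall>i. \<forall>x\<in>U. r x ^ k * norm (nth_deriv k (f i) x) \<le> C * v i"
    using C(1) assms(2) by (intro exI[of _ "C * c"]) auto
qed (use assms symbols_smooth in auto)

lemma symbols_cmult:
  assumes "open U" "symbols r U f w"
  shows "symbols r U (\<lambda>i x. c i * f i x) (\<lambda>i. norm (c i) * w i)"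
proof (rule symbolsI)
  fix k
  obtain C where C: "C \<ge> 0" "\<And>i x. x \<in> U \<Longrightarrow> r x ^ k * norm (nth_deriv k (f i) x) \<le> C * w i"
    using symbols_bound[OF assms(2)] by blast
  have "r x ^ k * norm (nth_deriv k (\<lambda>x. c i * f i x) x) \<le> C * (norm (c i) * w i)" if "x \<in> U" for i x
    using mult_left_mono[OF C(2)[OF that, of i], of "norm (c i)"]
    by (simp add: nth_deriv_cmult[OF assms(1) symbols_smooth[OF assms(2)] that] norm_mult mult_ac)
  then show "\<exists>C\<ge>0. \<forall>i. \<forall>x\<in>U. r x ^ k * norm (nth_deriv k (\<lambda>x. c i * f i x) x) \<le> C * (norm (c i) * w i)"
    using C(1) by blast
qed (use assms symbols_smooth symbols_nonneg[OF assms(2)] in \<open>auto intro!: smooth_on_cmult\<close>)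

lemma symbols_add:
  assumes "open U" "symbols r U f w" "symbols r U g w" "\<And>x. x \<in> U \<Longrightarrow> 0 \<le> r x"
  shows "symbols r U (\<lambda>i x. f i x + g i x) w"
proof (rule symbolsI)
  fix k
  obtain C where C: "C \<ge> 0" "\<And>i x. x \<in> U \<Longrightarrow> r x ^ k * norm (nth_deriv k (f i) x) \<le> C * w i"
    using symbols_bound[OF assms(2)] by blast
  obtain D where D: "D \<ge> 0" "\<And>i x. x \<in> U \<Longrightarrow> r x ^ k * norm (nth_deriv k (g i) x) \<le> D * w i"
    using symbols_bound[OF assms(3)] by blast
  have "r x ^ k * norm (nth_deriv k (\<lambda>x. f i x + g i x) x) \<le> (C + D) * w i" if "x \<in> U" for i x
  proof -
    have "r x ^ k * norm (nth_deriv k (\<lambda>x. f i x + g i x) x)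
        \<le> r x ^ k * (norm (nth_deriv k (f i) x) + norm (nth_deriv k (g i) x))"
      unfolding nth_deriv_add[OF assms(1) symbols_smooth[OF assms(2)] symbols_smooth[OF assms(3)] that]
      by (intro mult_left_mono norm_triangle_ineq zero_le_power assms(4)[OF that])
    then show ?thesis using C(2)[OF that, of i] D(2)[OF that, of i] by (simp add: algebra_simps)
  qed
  then show "\<exists>C\<ge>0. \<forall>i. \<forall>x\<in>U. r x ^ k * norm (nth_deriv k (\<lambda>x. f i x + g i x) x) \<le> C * w i"
    using C(1) D(1) by (intro exI[of _ "C + D"]) auto
qed (use assms symbols_smooth symbols_nonneg in \<open>auto intro!: smooth_on_add\<close>)

lemma symbols_mult:
  assumes "open U" "symbols r U f w" "symbols r U g v" "\<And>x. x \<in> U \<Longrightarrow> 0 \<le> r x"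
  shows "symbols r U (\<lambda>i x. f i x * g i x) (\<lambda>i. w i * v i)"
proof (rule symbolsI)
  fix k
  have "\<forall>k. \<exists>C\<ge>0. \<forall>i. \<forall>x\<in>U. r x ^ k * norm (nth_deriv k (f i) x) \<le> C * w i"
    using assms(2) by (auto simp: symbols_def)
  then obtain C where C: "\<And>k. C k \<ge> 0" "\<And>k i x. x \<in> U \<Longrightarrow> r x ^ k * norm (nth_deriv k (f i) x) \<le> C k * w i"
    by metis
  have "\<forall>k. \<exists>C\<ge>0. \<forall>i. \<forall>x\<in>U. r x ^ k * norm (nth_deriv k (g i) x) \<le> C * v i"
    using assms(3) by (auto simp: symbols_def)
  then obtain D where D: "\<And>k. D k \<ge> 0" "\<And>k i x. x \<in> U \<Longrightarrow> r x ^ k * norm (nth_deriv k (g i) x) \<le> D k * v i"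
    by metis
  let ?E = "fact k * (\<Sum>j\<le>k. C j / fact j * (D (k - j) / fact (k - j)))"
  have "r x ^ k * norm (nth_deriv k (\<lambda>x. f i x * g i x) x) \<le> ?E * (w i * v i)" if x: "x \<in> U" for i x
  proof -
    have t: "r x ^ j * norm (taylor_coeff j (f i) x) \<le> C j / fact j * w i"
      "r x ^ j * norm (taylor_coeff j (g i) x) \<le> D j / fact j * v i" for j
      using C(2)[OF x, of j i] D(2)[OF x, of j i] by (auto simp: taylor_coeff_def norm_divide field_simps)
    have "r x ^ k * norm (taylor_coeff k (\<lambda>x. f i x * g i x) x)
        \<le> r x ^ k * (\<Sum>j\<le>k. norm (taylor_coeff j (f i) x) * norm (taylor_coeff (k - j) (g i) x))"
      unfolding taylor_coeff_mult[OF assms(1) symbols_smooth[OF assms(2)] symbols_smooth[OF assms(3)] x]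
      by (intro mult_left_mono zero_le_power assms(4)[OF x] order_trans[OF norm_sum] sum_mono)
        (simp add: norm_mult)
    also have "\<dots> = (\<Sum>j\<le>k. (r x ^ j * norm (taylor_coeff j (f i) x)) * (r x ^ (k - j) * norm (taylor_coeff (k - j) (g i) x)))"
      unfolding sum_distrib_left by (intro sum.cong refl) (simp add: power_add[symmetric] mult_ac flip: power_add)
    also have "\<dots> \<le> (\<Sum>j\<le>k. (C j / fact j * w i) * (D (k - j) / fact (k - j) * v i))"
      using C(1) D(1) symbols_nonneg[OF assms(2)] symbols_nonneg[OF assms(3)]
      by (intro sum_mono mult_mono t) (auto simp: assms(4)[OF x])
    also have "\<dots> = (\<Sum>j\<le>k. C j / fact j * (D (k - j) / fact (k - j))) * (w i * v i)"
      unfolding sum_distrib_right by (intro sum.cong refl) (simp add: mult_ac)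
    finally have "fact k * (r x ^ k * norm (taylor_coeff k (\<lambda>x. f i x * g i x) x)) \<le> fact k * \<dots>"
      by (intro mult_left_mono) auto
    then show ?thesis by (simp add: nth_deriv_taylor_coeff norm_mult mult_ac)
  qed
  moreover have "?E \<ge> 0" using C(1) D(1) by (intro mult_nonneg_nonneg sum_nonneg) auto
  ultimately show "\<exists>C\<ge>0. \<forall>i. \<forall>x\<in>U. r x ^ k * norm (nth_deriv k (\<lambda>x. f i x * g i x) x) \<le> C * (w i * v i)"
    by blast
qed (use assms symbols_smooth symbols_nonneg[OF assms(2)] symbols_nonneg[OF assms(3)] in \<open>auto intro!: smooth_on_mult\<close>)

lemma symbols_cnj:
  assumes "open U" "symbols r U f w"
  shows "symbols r U (\<lambda>i x. cnj (f i x)) w"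
  using assms(2) smooth_on_linear[OF assms(1) _ bounded_linear_cnj] nth_deriv_linear[OF assms(1) _ bounded_linear_cnj]
  by (simp add: symbols_def)

lemma symbols_subset:
  assumes "symbols r U f w" "V \<subseteq> U" "\<And>x. x \<in> V \<Longrightarrow> 0 \<le> r' x" "\<And>x. x \<in> V \<Longrightarrow> r' x \<le> r x"
  shows "symbols r' V f w"
proof (rule symbolsI)
  fix k
  obtain C where C: "C \<ge> 0" "\<And>i x. x \<in> U \<Longrightarrow> r x ^ k * norm (nth_deriv k (f i) x) \<le> C * w i"
    using symbols_bound[OF assms(1)] by blast
  have "r' x ^ k * norm (nth_deriv k (f i) x) \<le> C * w i" if "x \<in> V" for i x
  proof -
    have "r' x ^ k * norm (nth_deriv k (f i) x) \<le> r x ^ k * norm (nth_deriv k (f i) x)"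
      by (intro mult_right_mono power_mono assms(3,4) that) simp
    also have "\<dots> \<le> C * w i" using that assms(2) by (intro C(2)) auto
    finally show ?thesis .
  qed
  with C(1) show "\<exists>C\<ge>0. \<forall>i. \<forall>x\<in>V. r' x ^ k * norm (nth_deriv k (f i) x) \<le> C * w i" by blast
next
  show "smooth_on V (f i)" for i by (rule smooth_on_subset[OF symbols_smooth[OF assms(1)] assms(2)])
qed (rule symbols_nonneg[OF assms(1)])

lemma symbols_deriv:
  assumes "symbols r U f w" "\<And>x. x \<in> U \<Longrightarrow> 1 \<le> r x"
  shows "symbols r U (\<lambda>i. nth_deriv 1 (f i)) w"
proof (rule symbolsI)
  fix k
  obtain C where C: "C \<ge> 0" "\<And>i x. x \<in> U \<Longrightarrow> r x ^ Suc k * norm (nth_deriv (Suc k) (f i) x) \<le> C * w i"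
    using symbols_bound[OF assms(1)] by blast
  have "r x ^ k * norm (nth_deriv k (nth_deriv 1 (f i)) x) \<le> C * w i" if "x \<in> U" for i x
  proof -
    have "r x ^ k * norm (nth_deriv (Suc k) (f i) x) \<le> r x ^ Suc k * norm (nth_deriv (Suc k) (f i) x)"
      using assms(2)[OF that] by (intro mult_right_mono power_increasing) auto
    also have "\<dots> \<le> C * w i" by (rule C(2)[OF that])
    finally show ?thesis by (simp add: nth_deriv_Suc_shift[of k "f i"])
  qed
  then show "\<exists>C\<ge>0. \<forall>i. \<forall>x\<in>U. r x ^ k * norm (nth_deriv k (nth_deriv 1 (f i)) x) \<le> C * w i"
    by (intro exI[of _ C] conjI C(1)) simp
next
  show "smooth_on U (nth_deriv 1 (f i))" for i by (rule smooth_on_deriv[OF symbols_smooth[OF assms(1)]])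
qed (rule symbols_nonneg[OF assms(1)])

lemma
  fixes f :: "'a \<Rightarrow> 'e \<Rightarrow> real \<Rightarrow> complex"
  assumes U: "open U" "convex U" and r: "\<And>x. x \<in> U \<Longrightarrow> 1 \<le> r x"
    and f: "symbols r U (\<lambda>(a, e). f a e) (\<lambda>(a, e). w a e)"
    and w: "\<And>a. w a summable_on UNIV"
  shows symbols_infsum: "symbols r U (\<lambda>a x. \<Sum>\<^sub>\<infinity>e. f a e x) (\<lambda>a. \<Sum>\<^sub>\<infinity>e. w a e)"
    and symbols_nth_deriv_infsum: "x \<in> U \<Longrightarrow> nth_deriv k (\<lambda>x. \<Sum>\<^sub>\<infinity>e. f a e x) x = (\<Sum>\<^sub>\<infinity>e. nth_deriv k (f a e) x)"
    and symbols_summable: "x \<in> U \<Longrightarrow> (\<lambda>e. nth_deriv k (f a e) x) summable_on UNIV"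
proof -
  have sm: "smooth_on U (f a e)" for a e using symbols_smooth[OF f, of "(a, e)"] by simp
  have w0: "0 \<le> w a e" for a e using symbols_nonneg[OF f, of "(a, e)"] by simp
  have "\<exists>C\<ge>0. \<forall>a e. \<forall>x\<in>U. norm (nth_deriv k (f a e) x) \<le> C * w a e" for k
    using symbols_bound0[OF f r, of k] by (metis case_prod_conv)
  then obtain C where C: "\<And>k. C k \<ge> 0" "\<And>k a e x. x \<in> U \<Longrightarrow> norm (nth_deriv k (f a e) x) \<le> C k * w a e"
    by metis
  have m: "(\<lambda>e. C k * w a e) summable_on UNIV" for k a by (intro summable_on_cmult_right w)
  note I = smooth_on_infsum[OF U sm m C(2)] nth_deriv_infsum[OF U sm m C(2)] summable_nth_deriv[OF U sm m C(2)]
  show "x \<in> U \<Longrightarrow> nth_deriv k (\<lambda>x. \<Sum>\<^sub>\<infinity>e. f a e x) x = (\<Sum>\<^sub>\<infinity>e. nth_deriv k (f a e) x)"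
    by (rule I(2)) simp_all
  show "x \<in> U \<Longrightarrow> (\<lambda>e. nth_deriv k (f a e) x) summable_on UNIV"
    by (rule abs_summable_summable, rule I(3)) simp_all
  show "symbols r U (\<lambda>a x. \<Sum>\<^sub>\<infinity>e. f a e x) (\<lambda>a. \<Sum>\<^sub>\<infinity>e. w a e)"
  proof (rule symbolsI)
    show "0 \<le> (\<Sum>\<^sub>\<infinity>e. w a e)" for a by (intro infsum_nonneg w0)
    show "smooth_on U (\<lambda>x. \<Sum>\<^sub>\<infinity>e. f a e x)" for a by (rule I(1)) simp_all
    fix k
    obtain D where D: "D \<ge> 0" "\<And>i x. x \<in> U \<Longrightarrow> r x ^ k * norm (nth_deriv k (case i of (a, e) \<Rightarrow> f a e) x) \<le> D * (case i of (a, e) \<Rightarrow> w a e)"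
      using symbols_bound[OF f] by blast
    have "r x ^ k * norm (nth_deriv k (\<lambda>x. \<Sum>\<^sub>\<infinity>e. f a e x) x) \<le> D * (\<Sum>\<^sub>\<infinity>e. w a e)" if x: "x \<in> U" for a x
    proof -
      have rp: "r x ^ k > 0" using r[OF x] by simp
      have "norm (\<Sum>\<^sub>\<infinity>e. nth_deriv k (f a e) x) \<le> (\<Sum>\<^sub>\<infinity>e. (D / r x ^ k) * w a e)"
        by (rule dominated_infsum[OF summable_on_cmult_right[OF w]])
          (use D(2)[OF x, of "(a, _)"] rp in \<open>auto simp: field_simps\<close>)
      also have "\<dots> = (D / r x ^ k) * (\<Sum>\<^sub>\<infinity>e. w a e)"
        by (rule infsum_cmult_right[OF w])
      finally show ?thesis
        using rp by (subst I(2)) (auto simp: x field_simps)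
    qed
    with D(1) show "\<exists>C\<ge>0. \<forall>a. \<forall>x\<in>U. r x ^ k * norm (nth_deriv k (\<lambda>x. \<Sum>\<^sub>\<infinity>e. f a e x) x) \<le> C * (\<Sum>\<^sub>\<infinity>e. w a e)"
      by blast
  qed
qed

section \<open>Infinite linear systems with symbol coefficients\<close>

text \<open>For a small enough weight \<open>\<rho>\<close> (depending on \<open>K\<close>) the jet norm is close to the supremum norm;
  as it is submultiplicative, a Neumann series that converges geometrically for the supremum norm
  converges geometrically for all the jet norms.\<close>
definition jet_norm :: "real \<Rightarrow> nat \<Rightarrow> (real \<Rightarrow> complex) \<Rightarrow> real \<Rightarrow> real" where
  "jet_norm \<rho> K f x = (\<Sum>j\<le>K. \<rho> ^ j * norm (taylor_coeff j f x))"

lemma jet_norm_nonneg: "\<rho> \<ge> 0 \<Longrightarrow> 0 \<le> jet_norm \<rho> K f x"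
  by (auto simp: jet_norm_def intro!: sum_nonneg)

lemma norm_le_jet_norm:
  assumes "\<rho> \<ge> 0" "k \<le> K"
  shows "\<rho> ^ k * norm (nth_deriv k f x) \<le> fact k * jet_norm \<rho> K f x"
proof -
  have "\<rho> ^ k * norm (taylor_coeff k f x) \<le> jet_norm \<rho> K f x"
    unfolding jet_norm_def using assms by (intro member_le_sum) auto
  then show ?thesis by (simp add: nth_deriv_taylor_coeff norm_mult)
qed

lemma jet_norm_mult:
  assumes "open U" "smooth_on U f" "smooth_on U g" "x \<in> U" "\<rho> \<ge> 0"
  shows "jet_norm \<rho> K (\<lambda>x. f x * g x) x \<le> jet_norm \<rho> K f x * jet_norm \<rho> K g x"
proof -
  let ?a = "\<lambda>j. \<rho> ^ j * norm (taylor_coeff j f x)" and ?b = "\<lambda>j. \<rho> ^ j * norm (taylor_coeff j g x)"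
  have "jet_norm \<rho> K (\<lambda>x. f x * g x) x \<le> (\<Sum>k\<le>K. \<Sum>j\<le>k. ?a j * ?b (k - j))"
    unfolding jet_norm_def
  proof (rule sum_mono)
    fix k
    have "\<rho> ^ k * norm (taylor_coeff k (\<lambda>x. f x * g x) x)
        \<le> \<rho> ^ k * (\<Sum>j\<le>k. norm (taylor_coeff j f x) * norm (taylor_coeff (k - j) g x))"
      unfolding taylor_coeff_mult[OF assms(1-4)] using assms(5)
      by (intro mult_left_mono order_trans[OF norm_sum] sum_mono) (simp_all add: norm_mult)
    also have "\<dots> = (\<Sum>j\<le>k. ?a j * ?b (k - j))"
      unfolding sum_distrib_left by (intro sum.cong refl) (simp add: mult_ac flip: power_add)
    finally show "\<rho> ^ k * norm (taylor_coeff k (\<lambda>x. f x * g x) x) \<le> (\<Sum>j\<le>k. ?a j * ?b (k - j))" .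
  qed
  also have "\<dots> = (\<Sum>(k, j)\<in>(SIGMA k:{..K}. {..k}). ?a j * ?b (k - j))"
    by (simp add: sum.Sigma)
  also have "\<dots> = (\<Sum>(j, l)\<in>(\<lambda>(k, j). (j, k - j)) ` (SIGMA k:{..K}. {..k}). ?a j * ?b l)"
    by (subst sum.reindex) (auto simp: inj_on_def case_prod_unfold)
  also have "\<dots> \<le> (\<Sum>(j, l)\<in>{..K} \<times> {..K}. ?a j * ?b l)"
    using assms(5) by (intro sum_mono2) auto
  also have "\<dots> = jet_norm \<rho> K f x * jet_norm \<rho> K g x"
    by (simp add: jet_norm_def sum_product sum.cartesian_product)
  finally show ?thesis .
qed

lemma jet_norm_infsum:
  assumes D: "\<And>k. nth_deriv k F x = (\<Sum>\<^sub>\<infinity>e. nth_deriv k (f e) x)"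
    and s: "\<And>k. (\<lambda>e. norm (nth_deriv k (f e) x)) summable_on UNIV"
    and b: "b summable_on UNIV" "\<And>e. jet_norm \<rho> K (f e) x \<le> b e" and "\<rho> \<ge> 0"
  shows "jet_norm \<rho> K F x \<le> (\<Sum>\<^sub>\<infinity>e. b e)"
proof -
  have s': "(\<lambda>e. norm (taylor_coeff k (f e) x)) summable_on UNIV" for k
    using summable_on_cmult_right[OF s[of k], of "1 / fact k"] by (simp add: taylor_coeff_def norm_divide)
  have tc: "taylor_coeff k F x = (\<Sum>\<^sub>\<infinity>e. taylor_coeff k (f e) x)" for k
    using infsum_cmult_right[OF abs_summable_summable[OF s[of k]], of "1 / fact k"]
    by (simp add: taylor_coeff_def D)
  have "((\<lambda>e. jet_norm \<rho> K (f e) x) has_sum (\<Sum>k\<le>K. \<rho> ^ k * (\<Sum>\<^sub>\<infinity>e. norm (taylor_coeff k (f e) x)))) UNIV"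
    unfolding jet_norm_def by (intro has_sum_finite_sum has_sum_cmult_right has_sum_infsum s') simp
  then have "(\<Sum>k\<le>K. \<rho> ^ k * (\<Sum>\<^sub>\<infinity>e. norm (taylor_coeff k (f e) x))) \<le> (\<Sum>\<^sub>\<infinity>e. b e)"
    by (rule has_sum_mono[OF _ has_sum_infsum[OF b(1)] b(2)])
  moreover have "jet_norm \<rho> K F x \<le> (\<Sum>k\<le>K. \<rho> ^ k * (\<Sum>\<^sub>\<infinity>e. norm (taylor_coeff k (f e) x)))"
    unfolding jet_norm_def tc using assms(5)
    by (intro sum_mono mult_left_mono norm_infsum_bound s') auto
  ultimately show ?thesis by linarith
qed

text \<open>The unknowns are indexed by \<open>'a\<close>, and equation \<open>a\<close> couples to the unknown \<open>g a e\<close> for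
  every edge \<open>e\<close>. Both a plain infinite matrix and the convolution systems for Fourier coefficients
  have this form. The solution is the Neumann series. By \<open>small\<close> the matrix has norm at most \<open>1 / 4\<close> on the space with
  weights \<open>u\<close>; for small \<open>\<rho>\<close> its derivatives contribute at most another \<open>1 / 4\<close> to the jet norm, so that the terms
  of the series shrink by \<open>1 / 2\<close> in every jet norm.\<close>
lemma symbol_system_solvable:
  fixes T :: "'a \<Rightarrow> 'e \<Rightarrow> real \<Rightarrow> complex" and g :: "'a \<Rightarrow> 'e \<Rightarrow> 'a"
  assumes U: "open U" "convex U" and r: "\<And>x. x \<in> U \<Longrightarrow> 1 \<le> r x"
    and T: "symbols r U (\<lambda>(a, e). T a e) (\<lambda>(a, e). t a e)"
    and f: "symbols r U f u"
    and small: "\<And>a e x. x \<in> U \<Longrightarrow> norm (T a e x) \<le> t a e / 4"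
    and row: "\<And>a. (\<lambda>e. t a e * u (g a e)) summable_on UNIV" "\<And>a. (\<Sum>\<^sub>\<infinity>e. t a e * u (g a e)) \<le> u a"
  obtains \<psi> where "symbols r U \<psi> u"
    "\<And>a x. x \<in> U \<Longrightarrow> ((\<lambda>e. T a e x * \<psi> (g a e) x) has_sum (\<psi> a x - f a x)) UNIV"
proof -
  have smT: "smooth_on U (T a e)" for a e using symbols_smooth[OF T, of "(a, e)"] by simp
  have t0: "0 \<le> t a e" for a e using symbols_nonneg[OF T, of "(a, e)"] by simp
  have u0: "0 \<le> u a" for a using symbols_nonneg[OF f] .
  have "\<exists>C\<ge>0. \<forall>a e. \<forall>x\<in>U. r x ^ k * norm (nth_deriv k (T a e) x) \<le> C * t a e" for k
    using symbols_bound[OF T, of k] by (metis case_prod_conv)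
  then obtain CT where CT: "\<And>k. CT k \<ge> 0" "\<And>k a e x. x \<in> U \<Longrightarrow> r x ^ k * norm (nth_deriv k (T a e) x) \<le> CT k * t a e"
    by metis
  have "\<exists>C\<ge>0. \<forall>a. \<forall>x\<in>U. r x ^ k * norm (nth_deriv k (f a) x) \<le> C * u a" for k
    using symbols_bound[OF f, of k] by metis
  then obtain Cf where Cf: "\<And>k. Cf k \<ge> 0" "\<And>k a x. x \<in> U \<Longrightarrow> r x ^ k * norm (nth_deriv k (f a) x) \<le> Cf k * u a"
    by metis
  define \<rho> where "\<rho> K = 1 / (4 * ((\<Sum>j\<le>K. CT j) + 1))" for K :: nat
  define B where "B K = (\<Sum>j\<le>K. Cf j)" for K :: nat
  have sCT: "(\<Sum>j\<le>K. CT j) \<ge> 0" for K using CT(1) by (intro sum_nonneg) auto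
  have \<rho>: "0 < \<rho> K" "\<rho> K \<le> 1" "\<rho> K * (\<Sum>j\<le>K. CT j) \<le> 1/4" for K
    using sCT[of K] by (auto simp: \<rho>_def field_simps)
  have B0: "B K \<ge> 0" for K using Cf(1) by (auto simp: B_def intro!: sum_nonneg)
  have r0: "0 \<le> \<rho> K * r x" if "x \<in> U" for K x using \<rho>(1)[of K] r[OF that] by simp
  have tay: "r x ^ j * norm (taylor_coeff j h x) \<le> c" if "r x ^ j * norm (nth_deriv j h x) \<le> c" "x \<in> U" for j h x c
  proof -
    have "norm (taylor_coeff j h x) \<le> norm (nth_deriv j h x)"
      by (simp add: taylor_coeff_def norm_divide divide_le_eq mult_left_le_one_le fact_ge_1 mult_right_le_one_le)
        (metis fact_ge_1 mult.right_neutral mult_left_mono norm_ge_zero)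
    then have "r x ^ j * norm (taylor_coeff j h x) \<le> r x ^ j * norm (nth_deriv j h x)"
      using r[OF that(2)] by (intro mult_left_mono) auto
    with that(1) show ?thesis by linarith
  qed
  have JT: "jet_norm (\<rho> K * r x) K (T a e) x \<le> t a e / 2" if x: "x \<in> U" for K a e x
  proof -
    have "jet_norm (\<rho> K * r x) K (T a e) x = norm (T a e x) + (\<Sum>j\<in>{1..K}. (\<rho> K * r x) ^ j * norm (taylor_coeff j (T a e) x))"
    proof -
      have "{..K} = insert 0 {1..K}" by auto
      then show ?thesis by (simp add: jet_norm_def taylor_coeff_def)
    qed
    also have "(\<Sum>j\<in>{1..K}. (\<rho> K * r x) ^ j * norm (taylor_coeff j (T a e) x)) \<le> (\<Sum>j\<in>{1..K}. \<rho> K * (CT j * t a e))"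
    proof (rule sum_mono)
      fix j assume "j \<in> {1..K}"
      then have "\<rho> K ^ j \<le> \<rho> K ^ 1" using \<rho>[of K] by (intro power_decreasing) auto
      moreover have "r x ^ j * norm (taylor_coeff j (T a e) x) \<le> CT j * t a e" by (rule tay[OF CT(2)[OF x] x])
      moreover have "0 \<le> r x ^ j * norm (taylor_coeff j (T a e) x)" using r[OF x] by auto
      ultimately have "\<rho> K ^ j * (r x ^ j * norm (taylor_coeff j (T a e) x)) \<le> \<rho> K * (CT j * t a e)"
        using \<rho>(1)[of K] by (intro mult_mono[of "\<rho> K ^ j" "\<rho> K"]) auto
      then show "(\<rho> K * r x) ^ j * norm (taylor_coeff j (T a e) x) \<le> \<rho> K * (CT j * t a e)"
        by (simp add: power_mult_distrib mult_ac)
    qed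
    also have "\<dots> \<le> (\<Sum>j\<le>K. \<rho> K * (CT j * t a e))"
      using CT(1) t0 \<rho>(1)[of K] by (intro sum_mono2) auto
    also have "\<dots> = (\<rho> K * (\<Sum>j\<le>K. CT j)) * t a e"
      by (simp add: sum_distrib_left sum_distrib_right mult_ac)
    also have "\<dots> \<le> 1/4 * t a e" by (intro mult_right_mono \<rho>(3) t0)
    finally show ?thesis using small[OF x, of a e] by linarith
  qed
  have Jf: "jet_norm (\<rho> K * r x) K (f a) x \<le> B K * u a" if x: "x \<in> U" for K a x
    unfolding jet_norm_def B_def sum_distrib_right
  proof (rule sum_mono)
    fix j assume "j \<in> {..K}"
    have "\<rho> K ^ j \<le> 1" using \<rho>[of K] by (intro power_le_one) auto
    moreover have "r x ^ j * norm (taylor_coeff j (f a) x) \<le> Cf j * u a" by (rule tay[OF Cf(2)[OF x] x])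
    moreover have "0 \<le> r x ^ j * norm (taylor_coeff j (f a) x)" using r[OF x] by auto
    ultimately have "\<rho> K ^ j * (r x ^ j * norm (taylor_coeff j (f a) x)) \<le> 1 * (Cf j * u a)"
      using \<rho>(1)[of K] by (intro mult_mono[of "\<rho> K ^ j" 1]) auto
    then show "(\<rho> K * r x) ^ j * norm (taylor_coeff j (f a) x) \<le> Cf j * u a"
      by (simp add: power_mult_distrib mult_ac)
  qed
  have nd: "r x ^ k * norm (nth_deriv k h x) \<le> fact k / \<rho> k ^ k * c"
    if "x \<in> U" "jet_norm (\<rho> k * r x) k h x \<le> c" for k h x c
  proof -
    have "(\<rho> k * r x) ^ k * norm (nth_deriv k h x) \<le> fact k * c"
      using norm_le_jet_norm[OF r0[OF that(1), of k] order_refl[of k], of h x]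
        mult_left_mono[OF that(2) fact_ge_zero[of k]] by linarith
    then show ?thesis using \<rho>(1)[of k] by (simp add: power_mult_distrib field_simps)
  qed
  have nd': "norm (nth_deriv k h x) \<le> fact k / \<rho> k ^ k * c"
    if "x \<in> U" "jet_norm (\<rho> k * r x) k h x \<le> c" for k h x c
    using nd[OF that] mult_right_mono[OF one_le_power[OF r[OF that(1)], of k], of "norm (nth_deriv k h x)"] by simp
  \<comment> \<open>the terms of the Neumann series\<close>
  define \<phi> where "\<phi> m = rec_nat f (\<lambda>_ \<phi> a x. \<Sum>\<^sub>\<infinity>e. T a e x * \<phi> (g a e) x) m" for m
  have \<phi>0: "\<phi> 0 = f" and \<phi>Suc: "\<phi> (Suc m) a = (\<lambda>x. \<Sum>\<^sub>\<infinity>e. T a e x * \<phi> m (g a e) x)" for m a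
    by (simp_all add: \<phi>_def)
  have main: "(\<forall>a. smooth_on U (\<phi> m a)) \<and>
      (\<forall>K a. \<forall>x\<in>U. jet_norm (\<rho> K * r x) K (\<phi> m a) x \<le> B K * (1/2) ^ m * u a)" for m
  proof (induction m)
    case 0
    then show ?case using symbols_smooth[OF f] Jf by (simp add: \<phi>0)
  next
    case (Suc m)
    then have sm: "smooth_on U (\<phi> m a)" and J: "x \<in> U \<Longrightarrow> jet_norm (\<rho> K * r x) K (\<phi> m a) x \<le> B K * (1/2) ^ m * u a" for a K x
      by auto
    have sm': "smooth_on U (\<lambda>x. T a e x * \<phi> m (g a e) x)" for a e
      by (rule smooth_on_mult[OF U(1) smT sm])
    define b where "b K a e = (B K * (1/2) ^ Suc m) * (t a e * u (g a e))" for K a e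
    have J': "jet_norm (\<rho> K * r x) K (\<lambda>x. T a e x * \<phi> m (g a e) x) x \<le> b K a e" if x: "x \<in> U" for K a e x
    proof -
      have "jet_norm (\<rho> K * r x) K (\<lambda>x. T a e x * \<phi> m (g a e) x) x
          \<le> jet_norm (\<rho> K * r x) K (T a e) x * jet_norm (\<rho> K * r x) K (\<phi> m (g a e)) x"
        by (rule jet_norm_mult[OF U(1) smT sm x r0[OF x]])
      also have "\<dots> \<le> (t a e / 2) * (B K * (1/2) ^ m * u (g a e))"
        by (intro mult_mono JT J x jet_norm_nonneg r0) (simp add: t0)
      finally show ?thesis by (simp add: b_def mult_ac)
    qed
    have bs: "b K a summable_on UNIV" for K a
      unfolding b_def by (intro summable_on_cmult_right row)
    have m: "(\<lambda>e. fact k / \<rho> k ^ k * b k a e) summable_on UNIV" for k a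
      by (intro summable_on_cmult_right bs)
    have le: "norm (nth_deriv k (\<lambda>x. T a e x * \<phi> m (g a e) x) x) \<le> fact k / \<rho> k ^ k * b k a e" if "x \<in> U" for k a e x
      by (rule nd'[OF that J'[OF that]])
    note I = smooth_on_infsum[OF U sm' m le] nth_deriv_infsum[OF U sm' m le] summable_nth_deriv[OF U sm' m le]
    have "jet_norm (\<rho> K * r x) K (\<phi> (Suc m) a) x \<le> B K * (1/2) ^ Suc m * u a" if x: "x \<in> U" for K a x
    proof -
      have "jet_norm (\<rho> K * r x) K (\<phi> (Suc m) a) x \<le> (\<Sum>\<^sub>\<infinity>e. b K a e)"
        unfolding \<phi>Suc by (rule jet_norm_infsum[OF I(2) I(3) bs J']) (auto simp: x r0)
      also have "\<dots> = (B K * (1/2) ^ Suc m) * (\<Sum>\<^sub>\<infinity>e. t a e * u (g a e))"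
        unfolding b_def by (rule infsum_cmult_right[OF row(1)])
      also have "\<dots> \<le> (B K * (1/2) ^ Suc m) * u a"
        using B0[of K] by (intro mult_left_mono row(2)) auto
      finally show ?thesis .
    qed
    moreover have "smooth_on U (\<phi> (Suc m) a)" for a
      unfolding \<phi>Suc by (rule I(1)) auto
    ultimately show ?case by blast
  qed
  have sm\<phi>: "smooth_on U (\<phi> m a)" for m a using main by auto
  define b where "b k a m = (fact k / \<rho> k ^ k * B k * u a) * (1/2) ^ m" for k a and m :: nat
  have le: "r x ^ k * norm (nth_deriv k (\<phi> m a) x) \<le> b k a m"
    and le': "norm (nth_deriv k (\<phi> m a) x) \<le> b k a m" if "x \<in> U" for k m a x
  proof -
    have "jet_norm (\<rho> k * r x) k (\<phi> m a) x \<le> B k * (1/2) ^ m * u a" using main that by blast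
    from nd[OF that this] nd'[OF that this]
    show "r x ^ k * norm (nth_deriv k (\<phi> m a) x) \<le> b k a m" "norm (nth_deriv k (\<phi> m a) x) \<le> b k a m"
      by (simp_all add: b_def mult_ac)
  qed
  have geo: "((\<lambda>m. (1/2::real) ^ m) has_sum 2) UNIV"
    by (rule norm_summable_imp_has_sum) (use geometric_sums[of "1/2::real"] in \<open>auto intro: summable_geometric\<close>)
  have bsum: "(b k a has_sum (fact k / \<rho> k ^ k * B k * u a) * 2) UNIV" for k a
    unfolding b_def by (rule has_sum_cmult_right[OF geo])
  define \<psi> where "\<psi> a x = (\<Sum>\<^sub>\<infinity>m. \<phi> m a x)" for a x
  note bsm = has_sum_imp_summable[OF bsum]
  note I = smooth_on_infsum[OF U sm\<phi> bsm le'] nth_deriv_infsum[OF U sm\<phi> bsm le']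
    summable_nth_deriv[OF U sm\<phi> bsm le', THEN abs_summable_summable]
  have "symbols r U \<psi> u"
  proof (rule symbolsI)
    show "smooth_on U (\<psi> a)" for a unfolding \<psi>_def[abs_def] by (rule I(1)) auto
    fix k
    have "r x ^ k * norm (nth_deriv k (\<psi> a) x) \<le> (fact k / \<rho> k ^ k * B k * 2) * u a" if x: "x \<in> U" for a x
    proof -
      have "((\<lambda>m. of_real (r x ^ k) * nth_deriv k (\<phi> m a) x) has_sum (of_real (r x ^ k) * nth_deriv k (\<psi> a) x)) UNIV"
        unfolding \<psi>_def[abs_def]
        by (intro has_sum_cmult_right, subst I(2)) (use x I(3) in auto)
      then have "norm (of_real (r x ^ k) * nth_deriv k (\<psi> a) x) \<le> (fact k / \<rho> k ^ k * B k * u a) * 2"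
        by (rule norm_infsum_le[OF _ bsum]) (use le[OF x] r[OF x] in \<open>auto simp: norm_mult norm_power\<close>)
      then show ?thesis using r[OF x] by (simp add: norm_mult norm_power mult_ac)
    qed
    then show "\<exists>C\<ge>0. \<forall>a. \<forall>x\<in>U. r x ^ k * norm (nth_deriv k (\<psi> a) x) \<le> C * u a"
      using \<rho>(1)[of k] B0[of k] by (intro exI[of _ "fact k / \<rho> k ^ k * B k * 2"]) (auto intro!: mult_nonneg_nonneg divide_nonneg_nonneg)
  qed (rule u0)
  moreover have "((\<lambda>e. T a e x * \<psi> (g a e) x) has_sum (\<psi> a x - f a x)) UNIV" if x: "x \<in> U" for a x
  proof -
    have s\<phi>: "(\<lambda>m. \<phi> m a x) summable_on UNIV" for a
    proof -
      have "(\<lambda>m. nth_deriv 0 (\<phi> m a) x) summable_on UNIV" by (rule I(3)) (use x in auto)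
      then show ?thesis by simp
    qed
    define c where "c = B 0"
    have bd: "norm (T a e x * \<phi> m (g a e) x) \<le> (t a e * u (g a e)) * (c * (1/2) ^ m)" for e m
    proof -
      have "norm (\<phi> m (g a e) x) \<le> b 0 (g a e) m" using le'[OF x, of 0] by simp
      then have "norm (T a e x) * norm (\<phi> m (g a e) x) \<le> t a e * b 0 (g a e) m"
        using small[OF x, of a e] t0[of a e] by (intro mult_mono) auto
      then show ?thesis by (simp add: norm_mult b_def c_def mult_ac)
    qed
    have "(\<lambda>(e, m). (t a e * u (g a e)) * (c * (1/2) ^ m)) summable_on UNIV"
      using geo B0[of 0] t0 u0
      by (intro summable_on_product row summable_on_cmult_right has_sum_imp_summable[OF geo]) (auto simp: c_def)
    note S = infsum_swap_dominated[OF this bd]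
    have e1: "(\<Sum>\<^sub>\<infinity>m. T a e x * \<phi> m (g a e) x) = T a e x * \<psi> (g a e) x" for e
      unfolding \<psi>_def by (rule infsum_cmult_right[OF s\<phi>])
    have "(\<Sum>\<^sub>\<infinity>e. T a e x * \<psi> (g a e) x) = (\<Sum>\<^sub>\<infinity>m. \<phi> (Suc m) a x)"
      using S(3) by (simp add: e1 \<phi>Suc)
    also have "\<dots> = \<psi> a x - f a x"
    proof -
      have "(\<lambda>m. \<phi> m a x) sums \<psi> a x" using has_sum_imp_sums[OF has_sum_infsum[OF s\<phi>[of a]]] by (simp add: \<psi>_def)
      then have "(\<lambda>m. \<phi> (Suc m) a x) sums (\<psi> a x - f a x)"
        using sums_Suc_iff[of "\<lambda>m. \<phi> m a x"] by (simp add: \<phi>0)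
      moreover have "(\<lambda>m. \<phi> (Suc m) a x) summable_on UNIV"
        using S(2) by (simp add: \<phi>Suc)
      ultimately show ?thesis
        using has_sum_imp_sums[OF has_sum_infsum] sums_unique2 by blast
    qed
    finally show ?thesis using has_sum_infsum[OF S(1)] by (simp add: e1)
  qed
  ultimately show ?thesis using that by blast
qed

section \<open>Antiderivatives and a uniqueness principle\<close>

definition primitive :: "(real \<Rightarrow> complex) \<Rightarrow> real \<Rightarrow> complex" where
  "primitive g x = (LBINT t=0..x. g t)"

lemma primitive_0 [simp]: "primitive g 0 = 0"
  by (simp add: primitive_def zero_ereal_def)

lemma primitive_has_derivative:
  assumes "continuous_on UNIV g"
  shows "(primitive g has_vector_derivative g x) (at x)"
proof -
  let ?b = "\<bar>x\<bar> + 1"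
  have "((\<lambda>u. LBINT t=0..u. g t) has_vector_derivative g x) (at x within {-?b..?b})"
    using interval_integral_FTC2[of "-?b" 0 ?b g x] continuous_on_subset[OF assms] by (auto simp: zero_ereal_def)
  then have "((\<lambda>u. LBINT t=0..u. g t) has_vector_derivative g x) (at x within {-?b<..<?b})"
    by (rule has_vector_derivative_within_subset) auto
  then have "((\<lambda>u. LBINT t=0..u. g t) has_vector_derivative g x) (at x)"
    by (subst (asm) at_within_open) auto
  then show ?thesis by (simp add: primitive_def[abs_def])
qed

lemma norm_le_from_zero:
  fixes F :: "real \<Rightarrow> 'a::real_normed_vector"
  assumes "F 0 = 0" "\<And>t. t \<in> closed_segment 0 x \<Longrightarrow> (F has_vector_derivative g t) (at t)"
    "\<And>t. t \<in> closed_segment 0 x \<Longrightarrow> norm (g t) \<le> C"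
  shows "norm (F x) \<le> C * \<bar>x\<bar>"
proof -
  have "norm (F x - F 0) \<le> C * norm (x - 0)"
  proof (rule differentiable_bound[of "closed_segment 0 x" F "\<lambda>t h. h *\<^sub>R g t"])
    fix t assume t: "t \<in> closed_segment 0 x"
    show "(F has_derivative (\<lambda>h. h *\<^sub>R g t)) (at t within closed_segment 0 x)"
      using assms(2)[OF t] by (simp add: has_vector_derivative_def has_derivative_at_withinI)
    show "onorm (\<lambda>h. h *\<^sub>R g t) \<le> C"
      using assms(3)[OF t] by (intro onorm_bound) (auto simp: mult.commute[of C] intro!: mult_left_mono intro: order_trans[OF norm_ge_zero])
  qed auto
  then show ?thesis by (simp add: assms(1))
qed

lemma gronwall_forward:
  fixes b :: "real \<Rightarrow> 'a::real_inner"
  assumes "0 \<le> x" "b 0 = 0" "\<And>t. 0 \<le> t \<Longrightarrow> t \<le> x \<Longrightarrow> (b has_vector_derivative b' t) (at t)"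
    "\<And>t. 0 \<le> t \<Longrightarrow> t \<le> x \<Longrightarrow> norm (b' t) \<le> C * norm (b t)"
  shows "b x = 0"
proof -
  define h where "h t = (b t \<bullet> b t) * exp (- 2 * C * t)" for t
  have "\<exists>y. (h has_real_derivative y) (at t) \<and> y \<le> 0" if t: "0 \<le> t" "t \<le> x" for t
  proof -
    have b: "(b has_derivative (\<lambda>d. d *\<^sub>R b' t)) (at t)"
      using assms(3)[OF t] by (simp add: has_vector_derivative_def)
    have "((\<lambda>t. b t \<bullet> b t) has_derivative (\<lambda>d. b t \<bullet> (d *\<^sub>R b' t) + (d *\<^sub>R b' t) \<bullet> b t)) (at t)"
      by (rule has_derivative_inner[OF b b])
    then have "((\<lambda>t. b t \<bullet> b t) has_real_derivative (2 * (b t \<bullet> b' t))) (at t)"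
      by (simp add: has_field_derivative_def inner_commute algebra_simps mult_commute_abs)
    then have "(h has_real_derivative (2 * (b t \<bullet> b' t)) * exp (- 2 * C * t) + (b t \<bullet> b t) * (exp (- 2 * C * t) * (- 2 * C))) (at t)"
      unfolding h_def by (auto intro!: derivative_eq_intros)
    moreover have "b t \<bullet> b' t \<le> C * (b t \<bullet> b t)"
    proof -
      have "b t \<bullet> b' t \<le> norm (b t) * norm (b' t)" by (rule norm_cauchy_schwarz)
      also have "\<dots> \<le> norm (b t) * (C * norm (b t))" by (intro mult_left_mono assms(4) t) simp
      finally show ?thesis by (simp add: power2_norm_eq_inner[symmetric] power2_eq_square mult_ac)
    qed
    ultimately have "(h has_real_derivative 2 * (b t \<bullet> b' t - C * (b t \<bullet> b t)) * exp (- 2 * C * t)) (at t)"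
      and "2 * (b t \<bullet> b' t - C * (b t \<bullet> b t)) * exp (- 2 * C * t) \<le> 0"
      by (auto simp: algebra_simps mult_le_0_iff)
    then show ?thesis by blast
  qed
  then have "h x \<le> h 0" by (intro DERIV_nonpos_imp_nonincreasing[OF assms(1)])
  then show ?thesis
    using inner_ge_zero[of "b x"] by (auto simp: h_def assms(2) mult_le_0_iff)
qed

lemma gronwall_zero:
  fixes b :: "real \<Rightarrow> 'a::real_inner"
  assumes "convex S" "0 \<in> S" "x \<in> S" "b 0 = 0" "\<And>t. t \<in> S \<Longrightarrow> (b has_vector_derivative b' t) (at t)"
    "\<And>t. t \<in> S \<Longrightarrow> norm (b' t) \<le> C * norm (b t)"
  shows "b x = 0"
proof (cases "0 \<le> x")
  case True
  have "t \<in> S" if "0 \<le> t" "t \<le> x" for t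
    using closed_segment_subset[OF assms(2,3,1)] that by (auto simp: closed_segment_eq_real_ivl)
  then show ?thesis using gronwall_forward[of x b b' C] True assms by blast
next
  case False
  have S: "- t \<in> S" if "0 \<le> t" "t \<le> - x" for t
    using closed_segment_subset[OF assms(2,3,1)] that by (auto simp: closed_segment_eq_real_ivl split: if_splits)
  have "((\<lambda>t. b (- t)) has_vector_derivative - b' (- t)) (at t)" if "0 \<le> t" "t \<le> - x" for t
  proof -
    have "((b \<circ> uminus) has_vector_derivative (-1) *\<^sub>R b' (- t)) (at t)"
      by (rule vector_diff_chain_at) (use S[OF that] assms(5) in \<open>auto intro!: derivative_eq_intros\<close>)
    then show ?thesis by (simp add: o_def)
  qed
  then have "(\<lambda>t. b (- t)) (- x) = 0"
    by (rule gronwall_forward[rotated 2]) (use False assms S in auto)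
  then show ?thesis by simp
qed

section \<open>Double commutation with infinitely many functions\<close>

lemma
  assumes "open U" "smooth_on U f" "smooth_on U g" "x \<in> U"
  shows nth_deriv_mult_1: "nth_deriv 1 (\<lambda>x. f x * g x) x = nth_deriv 1 f x * g x + f x * nth_deriv 1 g x"
    and nth_deriv_mult_2: "nth_deriv 2 (\<lambda>x. f x * g x) x
      = nth_deriv 2 f x * g x + 2 * nth_deriv 1 f x * nth_deriv 1 g x + f x * nth_deriv 2 (g :: real \<Rightarrow> complex) x"
  unfolding nth_deriv_taylor_coeff[of _ "\<lambda>x. f x * g x"] taylor_coeff_mult[OF assms]
  by (simp_all add: taylor_coeff_def numeral_2_eq_2 algebra_simps)

text \<open>The interval has to be bounded, as the diagonal Gram functions grow linearly.\<close>
lemma gram_symbols: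
  assumes U: "open U" "convex U" "0 \<in> U" "U \<subseteq> {-R..R}"
    and s: "symbols (\<lambda>_. 1) U s v"
    and G: "\<And>i j. G i j 0 = 0" "\<And>i j x. x \<in> U \<Longrightarrow> (G i j has_vector_derivative s i x * s j x) (at x)"
  shows "symbols (\<lambda>_. 1) U (\<lambda>(i, j). G i j) (\<lambda>(i, j). v i * v j)"
proof -
  have ss: "symbols (\<lambda>_. 1) U (\<lambda>(i, j) x. s i x * s j x) (\<lambda>(i, j). v i * v j)"
    using symbols_mult[OF U(1) symbols_reindex[OF s, of fst] symbols_reindex[OF s, of snd]]
    by (simp add: case_prod_unfold)
  have sm: "smooth_on U (\<lambda>x. s i x * s j x)" for i j
    using symbols_smooth[OF ss, of "(i, j)"] by simp
  note A = smooth_on_antideriv[OF U(1) sm G(2)]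
  have v0: "0 \<le> v i" for i using symbols_nonneg[OF s] .
  have R: "R \<ge> 0" using U(3,4) by auto
  show ?thesis
  proof (rule symbolsI; clarify?)
    fix k
    show "\<exists>C\<ge>0. \<forall>i. \<forall>x\<in>U. 1 ^ k * norm (nth_deriv k (case i of (i, j) \<Rightarrow> G i j) x) \<le> C * (case i of (i, j) \<Rightarrow> v i * v j)"
    proof (cases k)
      case 0
      obtain C where C: "C \<ge> 0" "\<And>p x. x \<in> U \<Longrightarrow> norm (case p of (i, j) \<Rightarrow> s i x * s j x) \<le> C * (case p of (i, j) \<Rightarrow> v i * v j)"
        using symbols_bound[OF ss, of 0] by (auto simp: case_prod_unfold)
      have "norm (G i j x) \<le> (C * R) * (v i * v j)" if x: "x \<in> U" for i j x
      proof -
        have sub: "closed_segment 0 x \<subseteq> U" by (rule closed_segment_subset[OF U(3) x U(2)])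
        have "norm (G i j x) \<le> (C * (v i * v j)) * \<bar>x\<bar>"
          by (rule norm_le_from_zero[OF G(1) G(2)]) (use sub C(2)[of _ "(i, j)"] in auto)
        also have "\<dots> \<le> (C * (v i * v j)) * R"
          using C(1) v0 subsetD[OF U(4) x] by (intro mult_left_mono) (auto simp: abs_le_iff)
        finally show ?thesis by (simp add: mult_ac)
      qed
      then show ?thesis using C(1) R 0 by (intro exI[of _ "C * R"]) auto
    next
      case (Suc l)
      obtain C where C: "C \<ge> 0" "\<And>p x. x \<in> U \<Longrightarrow> norm (nth_deriv l (case p of (i, j) \<Rightarrow> \<lambda>x. s i x * s j x) x) \<le> C * (case p of (i, j) \<Rightarrow> v i * v j)"
        using symbols_bound[OF ss, of l] by (auto simp: case_prod_unfold)
      then show ?thesis using Suc C(2)[of _ "(_, _)"] by (intro exI[of _ C]) (auto simp: A(2))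
    qed
  qed (use v0 A(1) in auto)
qed

text \<open>Both sides vanish at the origin and have the derivative \<open>(a - b) * s * t\<close>.\<close>
lemma wronskian_gram:
  fixes G :: "real \<Rightarrow> complex"
  assumes U: "open U" "convex U" "0 \<in> U" "x \<in> U"
    and s: "smooth_on U s" "smooth_on U t" "s 0 = 0" "t 0 = 0"
    and ode: "\<And>x. x \<in> U \<Longrightarrow> nth_deriv 2 s x = (W x - a) * s x" "\<And>x. x \<in> U \<Longrightarrow> nth_deriv 2 t x = (W x - b) * t x"
    and G: "G 0 = 0" "\<And>x. x \<in> U \<Longrightarrow> (G has_vector_derivative s x * t x) (at x)"
  shows "(a - b) * G x = s x * nth_deriv 1 t x - nth_deriv 1 s x * t x"
proof -
  define F where "F x = s x * nth_deriv 1 t x - nth_deriv 1 s x * t x - (a - b) * G x" for x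
  have "(F has_vector_derivative 0) (at x)" if x: "x \<in> U" for x
  proof -
    have "(F has_vector_derivative (s x * nth_deriv 2 t x + nth_deriv 1 s x * nth_deriv 1 t x)
        - (nth_deriv 1 s x * nth_deriv 1 t x + nth_deriv 2 s x * t x) - (a - b) * (s x * t x)) (at x)"
      unfolding F_def[abs_def]
      by (intro has_vector_derivative_diff has_vector_derivative_mult
          has_vector_derivative_mult_right smooth_on_has_derivs[OF s(1) x] smooth_on_has_derivs[OF s(2) x] G(2) x)
    then show ?thesis by (simp add: ode x algebra_simps)
  qed
  moreover have "F 0 = 0" by (simp add: F_def s G)
  ultimately have "norm (F x) \<le> 0 * \<bar>x\<bar>"
    using closed_segment_subset[OF U(3,4,2)] by (intro norm_le_from_zero[where g="\<lambda>_. 0"]) auto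
  then show ?thesis by (simp add: F_def)
qed

text \<open>With \<open>M = 1 + \<sigma> G\<close> the hypothesis reads \<open>M \<psi> = s\<close>. Differentiating it twice and using
  \<open>(\<kappa> i\<^sup>2 - \<kappa> j\<^sup>2) G i j = s i * s j' - s i' * s j\<close> for the commutator of \<open>M\<close> with the diagonal matrix \<open>\<kappa>\<^sup>2\<close>
  gives \<open>M (\<psi>'' + \<kappa>\<^sup>2 \<psi> - (W - 2 \<sigma> q') \<psi>) = 0\<close>, and \<open>M\<close> is injective.
  With \<open>\<sigma> = 1\<close> the transformation inserts eigenvalues; \<open>\<sigma> = - 1\<close> is its inverse.\<close>
lemma double_commutation:
  fixes s \<psi> :: "'i \<Rightarrow> real \<Rightarrow> complex" and \<kappa> :: "'i \<Rightarrow> real" and \<sigma> :: complex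
  defines "q \<equiv> \<lambda>x. \<Sum>\<^sub>\<infinity>j. s j x * \<psi> j x"
  assumes U: "open U" "convex U" "0 \<in> U" "U \<subseteq> {-R..R}" and \<sigma>: "\<sigma> * \<sigma> = 1"
    and s: "symbols (\<lambda>_. 1) U s v" and \<psi>: "symbols (\<lambda>_. 1) U \<psi> w"
    and vw: "(\<lambda>j. v j * w j) summable_on UNIV"
    and s0: "\<And>i. s i 0 = 0"
    and ode: "\<And>i x. x \<in> U \<Longrightarrow> nth_deriv 2 (s i) x = (W x - of_real ((\<kappa> i)\<^sup>2)) * s i x"
    and G: "\<And>i j. G i j 0 = 0" "\<And>i j x. x \<in> U \<Longrightarrow> (G i j has_vector_derivative s i x * s j x) (at x)"
    and eq: "\<And>i x. x \<in> U \<Longrightarrow> ((\<lambda>j. G i j x * \<psi> j x) has_sum (\<sigma> * (s i x - \<psi> i x))) UNIV"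
    and inj: "\<forall>x\<in>U. \<forall>y. bounded (range y) \<longrightarrow>
        (\<forall>i. ((\<lambda>j. G i j x * y j) has_sum (- (\<sigma> * y i))) UNIV) \<longrightarrow> (\<forall>i. y i = 0)"
    and bdd: "\<And>j. (1 + (\<kappa> j)\<^sup>2) * w j \<le> C0"
    and x: "x \<in> U"
  shows "nth_deriv 2 (\<psi> i) x = (W x - 2 * \<sigma> * nth_deriv 1 q x - of_real ((\<kappa> i)\<^sup>2)) * \<psi> i x"
    and "smooth_on U q"
proof -
  have Gsym: "symbols (\<lambda>_. 1) U (\<lambda>(i, j). G i j) (\<lambda>(i, j). v i * v j)"
    by (rule gram_symbols[OF U s G])
  have sms: "smooth_on U (s i)" and sm\<psi>: "smooth_on U (\<psi> i)" for i
    using symbols_smooth[OF s] symbols_smooth[OF \<psi>] by auto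
  have smG: "smooth_on U (G i j)" for i j using symbols_smooth[OF Gsym, of "(i, j)"] by simp
  have v0: "0 \<le> v i" and w0: "0 \<le> w i" for i using symbols_nonneg[OF s] symbols_nonneg[OF \<psi>] by auto
  have "symbols (\<lambda>_. 1) U (\<lambda>(a::unit, j) x. s j x * \<psi> j x) (\<lambda>(a, j). v j * w j)"
    using symbols_reindex[OF symbols_mult[OF U(1) s \<psi>], of snd] by (simp add: case_prod_unfold)
  note q = symbols_infsum[OF U(1,2) _ this vw] symbols_nth_deriv_infsum[OF U(1,2) _ this vw]
    symbols_summable[OF U(1,2) _ this vw]
  show "smooth_on U q"
    unfolding q_def using symbols_smooth[OF q(1)] by auto
  have "symbols (\<lambda>_. 1) U (\<lambda>p x. G (fst p) (snd p) x * \<psi> (snd p) x) (\<lambda>p. v (fst p) * (v (snd p) * w (snd p)))"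
    using symbols_mult[OF U(1) Gsym symbols_reindex[OF \<psi>, of snd]] by (simp add: case_prod_unfold mult.assoc)
  then have "symbols (\<lambda>_. 1) U (\<lambda>(i, j) x. G i j x * \<psi> j x) (\<lambda>(i, j). v i * (v j * w j))"
    by (simp add: case_prod_unfold)
  note g = symbols_nth_deriv_infsum[OF U(1,2) _ this summable_on_cmult_right[OF vw]]
    symbols_summable[OF U(1,2) _ this summable_on_cmult_right[OF vw]]
  define p p1 p2 where "p j = \<psi> j x" and "p1 j = nth_deriv 1 (\<psi> j) x" and "p2 j = nth_deriv 2 (\<psi> j) x" for j
  define a a1 a2 where "a j = s j x" and "a1 j = nth_deriv 1 (s j) x" and "a2 j = nth_deriv 2 (s j) x" for j
  define Q Q1 where "Q = q x" and "Q1 = nth_deriv 1 q x"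
  obtain Cs where Cs: "Cs \<ge> 0" "\<And>j k. k \<in> {0, 1} \<Longrightarrow> norm (nth_deriv k (s j) x) \<le> Cs * v j"
  proof -
    obtain C where C: "C \<ge> 0" "\<And>i x. x \<in> U \<Longrightarrow> norm (nth_deriv 0 (s i) x) \<le> C * v i"
      using symbols_bound0[OF s, of 0] by blast
    obtain D where D: "D \<ge> 0" "\<And>i x. x \<in> U \<Longrightarrow> norm (nth_deriv 1 (s i) x) \<le> D * v i"
      using symbols_bound0[OF s, of 1] by blast
    show ?thesis
    proof (rule that[of "C + D"])
      show "norm (nth_deriv k (s j) x) \<le> (C + D) * v j" if "k \<in> {0, 1}" for j k
        using that C(2)[OF x, of j] D(2)[OF x, of j] mult_nonneg_nonneg[OF C(1) v0[of j]] mult_nonneg_nonneg[OF D(1) v0[of j]]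
        by (auto simp: distrib_right)
    qed (use C D in auto)
  qed
  obtain C\<psi> where C\<psi>: "C\<psi> \<ge> 0" "\<And>j k. k \<in> {0, 1, 2} \<Longrightarrow> norm (nth_deriv k (\<psi> j) x) \<le> C\<psi> * w j"
  proof -
    obtain C where C: "C \<ge> 0" "\<And>i x. x \<in> U \<Longrightarrow> norm (nth_deriv 0 (\<psi> i) x) \<le> C * w i"
      using symbols_bound0[OF \<psi>, of 0] by blast
    obtain D where D: "D \<ge> 0" "\<And>i x. x \<in> U \<Longrightarrow> norm (nth_deriv 1 (\<psi> i) x) \<le> D * w i"
      using symbols_bound0[OF \<psi>, of 1] by blast
    obtain E where E: "E \<ge> 0" "\<And>i x. x \<in> U \<Longrightarrow> norm (nth_deriv 2 (\<psi> i) x) \<le> E * w i"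
      using symbols_bound0[OF \<psi>, of 2] by blast
    show ?thesis
    proof (rule that[of "C + D + E"])
      show "norm (nth_deriv k (\<psi> j) x) \<le> (C + D + E) * w j" if "k \<in> {0, 1, 2}" for j k
        using that C(2)[OF x, of j] D(2)[OF x, of j] E(2)[OF x, of j] mult_nonneg_nonneg[OF C(1) w0[of j]] mult_nonneg_nonneg[OF D(1) w0[of j]]
          mult_nonneg_nonneg[OF E(1) w0[of j]]
        by (auto simp: distrib_right)
    qed (use C D E in auto)
  qed
  have sumprod: "(\<lambda>j. nth_deriv k (s j) x * nth_deriv l (\<psi> j) x) summable_on UNIV" if "k \<in> {0, 1}" "l \<in> {0, 1}" for k l
  proof (rule dominated_summable[OF summable_on_cmult_right[OF vw, of "Cs * C\<psi>"]])
    fix j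
    have "norm (nth_deriv k (s j) x) * norm (nth_deriv l (\<psi> j) x) \<le> (Cs * v j) * (C\<psi> * w j)"
      using Cs C\<psi>(1) that v0 by (intro mult_mono C\<psi>(2) Cs(2)) auto
    then show "norm (nth_deriv k (s j) x * nth_deriv l (\<psi> j) x) \<le> Cs * C\<psi> * (v j * w j)"
      by (simp add: norm_mult mult_ac)
  qed
  define R1 R2 where "R1 = (\<Sum>\<^sub>\<infinity>j. a j * p1 j)" and "R2 = (\<Sum>\<^sub>\<infinity>j. a1 j * p j)"
  have hQ: "((\<lambda>j. a j * p j) has_sum Q) UNIV"
    using sumprod[of 0 0] by (simp add: Q_def q_def a_def p_def)
  have hR1: "((\<lambda>j. a j * p1 j) has_sum R1) UNIV"
    using sumprod[of 0 1] by (simp add: R1_def a_def p1_def)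
  have hR2: "((\<lambda>j. a1 j * p j) has_sum R2) UNIV"
    using sumprod[of 1 0] by (simp add: R2_def a1_def p_def)
  have Q1: "Q1 = R2 + R1"
  proof -
    have "Q1 = (\<Sum>\<^sub>\<infinity>j. nth_deriv 1 (\<lambda>x. s j x * \<psi> j x) x)"
      unfolding Q1_def q_def by (rule q(2)) (use x in auto)
    also have "\<dots> = (\<Sum>\<^sub>\<infinity>j. a1 j * p j + a j * p1 j)"
      by (simp only: nth_deriv_mult_1[OF U(1) sms sm\<psi> x] a_def a1_def p_def p1_def)
    also have "\<dots> = R2 + R1" by (rule infsumI[OF has_sum_add[OF hR2 hR1]])
    finally show ?thesis .
  qed
  have hG2: "((\<lambda>j. G i j x * p2 j) has_sum (\<sigma> * (a2 i - p2 i) - a1 i * Q - a i * R2 - 2 * a i * R1)) UNIV" for i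
  proof -
    have G1: "nth_deriv 1 (G i j) y = s i y * s j y" if "y \<in> U" for j y
      using smooth_on_antideriv(2)[OF U(1) smooth_on_mult[OF U(1) sms[of i] sms[of j]] G(2)[of _ i j] that, of 0] by simp
    have G2: "nth_deriv 2 (G i j) x = a1 i * a j + a i * a1 j" for j
      using smooth_on_antideriv(2)[OF U(1) smooth_on_mult[OF U(1) sms[of i] sms[of j]] G(2)[of _ i j] x, of 1]
        nth_deriv_mult_1[OF U(1) sms[of i] sms[of j] x] by (simp add: numeral_2_eq_2 a_def a1_def)
    have "(\<Sum>\<^sub>\<infinity>j. nth_deriv 2 (\<lambda>x. G i j x * \<psi> j x) x) = nth_deriv 2 (\<lambda>x. \<Sum>\<^sub>\<infinity>j. G i j x * \<psi> j x) x"
      by (rule g(1)[symmetric]) (use x in auto)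
    also have "\<dots> = nth_deriv 2 (\<lambda>x. \<sigma> * (s i x - \<psi> i x)) x"
      by (rule nth_deriv_cong[OF U(1) infsumI[OF eq] x])
    also have "\<dots> = \<sigma> * (a2 i - p2 i)"
      by (simp add: nth_deriv_cmult[OF U(1) smooth_on_diff[OF U(1) sms sm\<psi>] x] nth_deriv_diff[OF U(1) sms sm\<psi> x] a2_def p2_def)
    finally have "(\<Sum>\<^sub>\<infinity>j. nth_deriv 2 (\<lambda>x. G i j x * \<psi> j x) x) = \<sigma> * (a2 i - p2 i)" .
    moreover have "(\<lambda>j. nth_deriv 2 (\<lambda>x. G i j x * \<psi> j x) x) summable_on UNIV"
      by (rule g(2)) (use x in auto)
    ultimately have "((\<lambda>j. nth_deriv 2 (\<lambda>x. G i j x * \<psi> j x) x) has_sum \<sigma> * (a2 i - p2 i)) UNIV"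
      unfolding has_sum_iff by blast
    then have h: "((\<lambda>j. (a1 i * a j + a i * a1 j) * p j + 2 * (a i * a j) * p1 j + G i j x * p2 j) has_sum \<sigma> * (a2 i - p2 i)) UNIV"
      unfolding nth_deriv_mult_2[OF U(1) smG sm\<psi> x] G1[OF x] G2 p_def p1_def p2_def a_def .
    have "((\<lambda>j. - a1 i * (a j * p j) + (- a i * (a1 j * p j) + (- 2 * a i) * (a j * p1 j))) has_sum
        (- a1 i * Q + (- a i * R2 + (- 2 * a i) * R1))) UNIV"
      by (intro has_sum_add has_sum_cmult_right hQ hR1 hR2)
    from has_sum_add[OF h this] show ?thesis by (simp add: algebra_simps)
  qed
  have hG0: "((\<lambda>j. G i j x * p j) has_sum (\<sigma> * (a i - p i))) UNIV" for i
    using eq[OF x, of i] by (simp add: p_def a_def)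
  \<comment> \<open>the commutator of the Gram matrix with the diagonal matrix of the energies has rank two\<close>
  have hGk: "((\<lambda>j. G i j x * (of_real ((\<kappa> j)\<^sup>2) * p j)) has_sum (of_real ((\<kappa> i)\<^sup>2) * (\<sigma> * (a i - p i)) - a i * R2 + a1 i * Q)) UNIV" for i
  proof -
    have e: "G i j x * (of_real ((\<kappa> j)\<^sup>2) * p j) = of_real ((\<kappa> i)\<^sup>2) * (G i j x * p j) + (- a i * (a1 j * p j) + a1 i * (a j * p j))" for j
    proof -
      have w: "(of_real ((\<kappa> i)\<^sup>2) - of_real ((\<kappa> j)\<^sup>2)) * G i j x = a i * a1 j - a1 i * a j"
        unfolding a_def a1_def by (rule wronskian_gram[OF U(1-3) x sms sms s0 s0 ode ode G])
      have "G i j x * (of_real ((\<kappa> j)\<^sup>2) * p j) = of_real ((\<kappa> i)\<^sup>2) * (G i j x * p j)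
          - ((of_real ((\<kappa> i)\<^sup>2) - of_real ((\<kappa> j)\<^sup>2)) * G i j x) * p j"
        by (simp add: algebra_simps)
      then show ?thesis unfolding w by (simp add: algebra_simps)
    qed
    have "((\<lambda>j. of_real ((\<kappa> i)\<^sup>2) * (G i j x * p j) + (- a i * (a1 j * p j) + a1 i * (a j * p j))) has_sum
        (of_real ((\<kappa> i)\<^sup>2) * (\<sigma> * (a i - p i)) + (- a i * R2 + a1 i * Q))) UNIV"
      by (intro has_sum_add has_sum_cmult_right hQ hR2 hG0)
    then show ?thesis unfolding e by (simp add: algebra_simps)
  qed
  define V where "V = W x - 2 * \<sigma> * Q1"
  define y where "y j = p2 j + of_real ((\<kappa> j)\<^sup>2) * p j - V * p j" for j
  have "bounded (range y)"
  proof (rule boundedI, clarify)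
    fix j
    have "norm (y j) \<le> norm (p2 j) + (\<kappa> j)\<^sup>2 * norm (p j) + norm V * norm (p j)"
      unfolding y_def by (rule order_trans[OF norm_triangle_ineq4 add_mono[OF order_trans[OF norm_triangle_ineq]]])
        (auto simp: norm_mult norm_power)
    also have "\<dots> \<le> C\<psi> * w j + (\<kappa> j)\<^sup>2 * (C\<psi> * w j) + norm V * (C\<psi> * w j)"
      using C\<psi>(2)[of 0 j] C\<psi>(2)[of 2 j] by (intro add_mono mult_left_mono) (auto simp: p_def p2_def)
    also have "\<dots> = C\<psi> * ((1 + (\<kappa> j)\<^sup>2) * w j) + norm V * C\<psi> * w j"
      by (simp add: algebra_simps)
    also have "\<dots> \<le> C\<psi> * C0 + norm V * C\<psi> * C0"
    proof (intro add_mono mult_left_mono bdd C\<psi>(1))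
      have "w j \<le> (1 + (\<kappa> j)\<^sup>2) * w j" using w0[of j] by (simp add: distrib_right)
      then show "w j \<le> C0" using bdd[of j] by linarith
    qed (use C\<psi>(1) in auto)
    finally show "norm (y j) \<le> C\<psi> * C0 + norm V * C\<psi> * C0" .
  qed
  moreover have "((\<lambda>j. G i j x * y j) has_sum - (\<sigma> * y i)) UNIV" for i
  proof -
    have "((\<lambda>j. G i j x * p2 j + (G i j x * (of_real ((\<kappa> j)\<^sup>2) * p j) + (- V) * (G i j x * p j))) has_sum
       ((\<sigma> * (a2 i - p2 i) - a1 i * Q - a i * R2 - 2 * a i * R1)
        + ((of_real ((\<kappa> i)\<^sup>2) * (\<sigma> * (a i - p i)) - a i * R2 + a1 i * Q) + (- V) * (\<sigma> * (a i - p i))))) UNIV"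
      by (intro has_sum_add has_sum_cmult_right hG0 hG2 hGk)
    moreover have "(\<sigma> * (a2 i - p2 i) - a1 i * Q - a i * R2 - 2 * a i * R1)
        + ((of_real ((\<kappa> i)\<^sup>2) * (\<sigma> * (a i - p i)) - a i * R2 + a1 i * Q) + (- V) * (\<sigma> * (a i - p i)))
        = - (\<sigma> * y i)"
    proof -
      have a2: "a2 i = (W x - of_real ((\<kappa> i)\<^sup>2)) * a i" using ode[OF x] by (simp add: a2_def a_def)
      have "\<sigma> * (\<sigma> * z) = z" for z using \<sigma> by (simp add: mult.assoc[symmetric])
      then have "2 * \<sigma> * Q1 * (\<sigma> * a i) = 2 * Q1 * a i" by (simp add: mult_ac)
      then show ?thesis unfolding y_def V_def a2 Q1 by (simp add: algebra_simps)
    qed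
    moreover have "G i j x * p2 j + (G i j x * (of_real ((\<kappa> j)\<^sup>2) * p j) + (- V) * (G i j x * p j)) = G i j x * y j" for j
      by (simp add: y_def algebra_simps)
    ultimately show ?thesis by (simp only:)
  qed
  ultimately have "y i = 0" using inj x by blast
  then show "nth_deriv 2 (\<psi> i) x = (W x - 2 * \<sigma> * nth_deriv 1 q x - of_real ((\<kappa> i)\<^sup>2)) * \<psi> i x"
    by (simp add: y_def V_def p_def p2_def Q1_def algebra_simps)
qed

section \<open>Smooth cutoff functions\<close>

lemma diff_upto_inverse:
  fixes h :: "real \<Rightarrow> real"
  assumes "open U" "\<And>x. x \<in> U \<Longrightarrow> h x \<noteq> 0" "diff_upto n U h"
  shows "diff_upto n U (\<lambda>x. inverse (h x))"
  using assms(3)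
proof (induction n)
  case 0
  then show ?case using assms(2) by (auto simp: diff_upto_0 intro!: differentiable_inverse)
next
  case (Suc n)
  have IH: "diff_upto n U (\<lambda>x. inverse (h x))" using Suc.IH diff_upto_mono[OF Suc.prems] by simp
  show ?case
  proof (rule diff_upto_SucI[OF assms(1), where f'="\<lambda>x. (- 1 * nth_deriv (Suc 0) h x) * (inverse (h x) * inverse (h x))"])
    fix x assume x: "x \<in> U"
    show "((\<lambda>x. inverse (h x)) has_vector_derivative (- 1 * nth_deriv (Suc 0) h x) * (inverse (h x) * inverse (h x))) (at x)"
      using diff_uptoD[OF Suc.prems x] assms(2)[OF x]
      unfolding has_real_derivative_iff_has_vector_derivative[symmetric]
      by (auto intro!: derivative_eq_intros simp: power2_eq_square)
  next
    show "diff_upto n U (\<lambda>x. (- 1 * nth_deriv (Suc 0) h x) * (inverse (h x) * inverse (h x)))"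
      using Suc.prems by (intro diff_upto_mult[OF assms(1)] diff_upto_const IH) (auto simp: diff_upto_Suc[of n U h])
  qed
qed

text \<open>The family is closed under differentiation up to linear combinations, so that all derivatives of
  \<open>exp (- 1 / x)\<close> at the origin are handled by one quadratic estimate.\<close>
definition flat_exp :: "nat \<Rightarrow> real \<Rightarrow> real" where
  "flat_exp n x = (if x > 0 then (1 / x) ^ n * exp (- (1 / x)) else 0)"

lemma power_div_fact_le_exp: "0 \<le> (z::real) \<Longrightarrow> z ^ m / fact m \<le> exp z"
  using sum_le_suminf[OF summable_exp[of z], of "{m}"] by (simp add: exp_def divide_inverse mult.commute scaleR_conv_of_real)

lemma flat_exp_quadratic: "\<bar>flat_exp n x\<bar> \<le> fact (n + 2) * x\<^sup>2"
proof (cases "x > 0")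
  case True
  have e: "z ^ m * exp (- z) \<le> fact m" if "0 \<le> z" for z :: real and m
  proof -
    have "z ^ m \<le> fact m * exp z"
      using power_div_fact_le_exp[OF that, of m] by (simp add: divide_le_eq mult.commute)
    then have "z ^ m * exp (- z) \<le> fact m * exp z * exp (- z)" by (intro mult_right_mono) auto
    then show ?thesis by (simp add: mult.assoc flip: exp_add)
  qed
  have "(1 / x) ^ (n + 2) * exp (- (1 / x)) \<le> fact (n + 2)" using True by (intro e) auto
  then have "(1 / x) ^ (n + 2) * exp (- (1 / x)) * x\<^sup>2 \<le> fact (n + 2) * x\<^sup>2"
    by (intro mult_right_mono) auto
  moreover have "(1 / x) ^ (n + 2) * exp (- (1 / x)) * x\<^sup>2 = flat_exp n x"
    using True by (simp add: flat_exp_def power_add field_simps power2_eq_square)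
  moreover have "flat_exp n x \<ge> 0" using True by (simp add: flat_exp_def)
  ultimately show ?thesis by simp
qed (simp add: flat_exp_def)

lemma flat_exp_has_derivative:
  "(flat_exp n has_vector_derivative (- of_nat n * flat_exp (Suc n) x + flat_exp (n + 2) x)) (at x)"
proof -
  consider "x > 0" | "x = 0" | "x < 0" by linarith
  then show ?thesis
  proof cases
    case 1
    have "((\<lambda>x. (1 / x) ^ n * exp (- (1 / x))) has_real_derivative (- of_nat n * flat_exp (Suc n) x + flat_exp (n + 2) x)) (at x)"
    proof -
      have D: "((\<lambda>x. (1 / x) ^ n * exp (- (1 / x))) has_real_derivative
          of_nat n * (1 / x) ^ (n - 1) * (- (1 / x)\<^sup>2) * exp (- (1 / x)) + (1 / x) ^ n * (exp (- (1 / x)) * (1 / x)\<^sup>2)) (at x)"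
        using 1 by (auto intro!: derivative_eq_intros simp: power2_eq_square)
      have e: "of_nat n * (1 / x) ^ (n - 1) * (- (1 / x)\<^sup>2) = - of_nat n * (1 / x) ^ Suc n"
        by (cases n) (simp_all add: power2_eq_square del: of_nat_Suc)
      show ?thesis
        using D unfolding e using 1 by (simp add: flat_exp_def power2_eq_square mult_ac)
    qed
    then have "((\<lambda>x. (1 / x) ^ n * exp (- (1 / x))) has_vector_derivative (- of_nat n * flat_exp (Suc n) x + flat_exp (n + 2) x)) (at x)"
      by (simp add: has_real_derivative_iff_has_vector_derivative)
    then show ?thesis
      by (rule has_vector_derivative_transform_within_open[of _ _ _ "{0<..}"]) (use 1 in \<open>auto simp: flat_exp_def\<close>)
  next
    case 2
    show ?thesis
      by (rule has_vector_derivative_quadratic[of UNIV _ _ _ "fact (n + 2)"])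
        (use flat_exp_quadratic[of n] in \<open>auto simp: 2 flat_exp_def[of _ 0]\<close>)
  next
    case 3
    have "((\<lambda>x. 0) has_vector_derivative (- of_nat n * flat_exp (Suc n) x + flat_exp (n + 2) x)) (at x)"
      using 3 by (simp add: flat_exp_def)
    then show ?thesis
      by (rule has_vector_derivative_transform_within_open[of _ _ _ "{..<0}"]) (use 3 in \<open>auto simp: flat_exp_def\<close>)
  qed
qed

lemma diff_upto_flat_exp: "diff_upto k UNIV (flat_exp n)"
proof (induction k arbitrary: n)
  case 0
  then show ?case using flat_exp_has_derivative by (auto simp: diff_upto_0 intro: differentiableI_vector)
next
  case (Suc k)
  show ?case
    by (rule diff_upto_SucI[OF open_UNIV flat_exp_has_derivative])
      (intro diff_upto_add diff_upto_mult diff_upto_const open_UNIV Suc)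
qed

lemma smooth_step:
  fixes a b :: real
  assumes "a < b"
  shows "\<exists>\<zeta> :: real \<Rightarrow> real. smooth_on UNIV \<zeta> \<and> (\<forall>x\<le>a. \<zeta> x = 0) \<and> (\<forall>x\<ge>b. \<zeta> x = 1) \<and> (\<forall>x. \<bar>\<zeta> x\<bar> \<le> 1)"
proof -
  define h where "h x = flat_exp 0 x + flat_exp 0 ((-1) * x + 1)" for x
  have sm: "smooth_on UNIV (flat_exp 0)"
    using diff_upto_flat_exp by (simp add: smooth_on_iff_diff_upto)
  have smh: "smooth_on UNIV h"
    unfolding h_def by (intro smooth_on_add smooth_on_affine smooth_on_subset[OF sm] sm) auto
  have pos: "flat_exp 0 x \<ge> 0" "x > 0 \<Longrightarrow> flat_exp 0 x > 0" for x by (auto simp: flat_exp_def)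
  have h: "h x > 0" for x
    using pos(1)[of x] pos(1)[of "1 - x"] pos(2)[of x] pos(2)[of "1 - x"] by (cases "x > 0") (auto simp: h_def)
  define \<eta> where "\<eta> x = flat_exp 0 x * inverse (h x)" for x
  have sm\<eta>: "smooth_on UNIV \<eta>"
  proof -
    have "smooth_on UNIV (\<lambda>x. inverse (h x))"
      using smh h diff_upto_inverse[of UNIV h] by (auto simp: smooth_on_iff_diff_upto less_imp_neq[symmetric])
    then show ?thesis unfolding \<eta>_def by (intro smooth_on_mult sm) auto
  qed
  define c where "c = 1 / (b - a)"
  have c: "c > 0" using assms by (simp add: c_def)
  define \<zeta> where "\<zeta> x = \<eta> (c * x + (- c * a))" for x
  show ?thesis
  proof (intro exI[of _ \<zeta>] conjI allI impI)
    show "smooth_on UNIV \<zeta>" unfolding \<zeta>_def by (intro smooth_on_affine smooth_on_subset[OF sm\<eta>]) auto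
    show "\<zeta> x = 0" if "x \<le> a" for x
    proof -
      have "c * x + (- c * a) \<le> 0" using that c by (simp add: mult_left_mono)
      then show ?thesis by (simp add: \<zeta>_def \<eta>_def flat_exp_def)
    qed
    show "\<zeta> x = 1" if "b \<le> x" for x
    proof -
      have "c * (x - a) \<ge> c * (b - a)" using that c by (intro mult_left_mono) auto
      moreover have "c * (b - a) = 1" using assms by (simp add: c_def)
      ultimately have "c * x + (- c * a) \<ge> 1" by (simp add: algebra_simps)
      then show ?thesis using h[of "c * x + (- c * a)"] by (simp add: \<zeta>_def \<eta>_def h_def flat_exp_def)
    qed
    have "\<bar>\<eta> y\<bar> \<le> 1" for y
      using h[of y] pos(1)[of y] pos(1)[of "1 - y"] by (simp add: \<eta>_def h_def abs_mult field_simps)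
    then show "\<bar>\<zeta> x\<bar> \<le> 1" for x by (simp add: \<zeta>_def)
  qed
qed

lemma smooth_bump:
  fixes \<epsilon> :: real
  assumes "\<epsilon> > 0"
  shows "\<exists>\<beta> :: real \<Rightarrow> real. smooth_on UNIV \<beta> \<and> (\<forall>x. \<bar>x\<bar> \<le> \<epsilon> / 2 \<longrightarrow> \<beta> x = 1) \<and>
    (\<forall>x. 3 * \<epsilon> / 4 \<le> \<bar>x\<bar> \<longrightarrow> \<beta> x = 0) \<and> (\<forall>x. \<bar>\<beta> x\<bar> \<le> 1)"
proof -
  obtain \<zeta> :: "real \<Rightarrow> real" where \<zeta>: "smooth_on UNIV \<zeta>" "\<And>x. x \<le> - (3 * \<epsilon> / 4) \<Longrightarrow> \<zeta> x = 0" "\<And>x. - (\<epsilon> / 2) \<le> x \<Longrightarrow> \<zeta> x = 1"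
    "\<And>x. \<bar>\<zeta> x\<bar> \<le> 1"
    using smooth_step[of "- (3 * \<epsilon> / 4)" "- (\<epsilon> / 2)"] assms by auto
  show ?thesis
  proof (intro exI[of _ "\<lambda>x. \<zeta> x * \<zeta> ((-1) * x + 0)"] conjI allI impI)
    show "smooth_on UNIV (\<lambda>x. \<zeta> x * \<zeta> ((-1) * x + 0))"
      by (intro smooth_on_mult smooth_on_affine smooth_on_subset[OF \<zeta>(1)]) auto
    show "\<zeta> x * \<zeta> ((-1) * x + 0) = 1" if "\<bar>x\<bar> \<le> \<epsilon> / 2" for x
    proof -
      have "- (\<epsilon> / 2) \<le> x" "- (\<epsilon> / 2) \<le> - x" using that by linarith+
      then show ?thesis using \<zeta>(3)[of x] \<zeta>(3)[of "- x"] by simp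
    qed
    show "\<zeta> x * \<zeta> ((-1) * x + 0) = 0" if "3 * \<epsilon> / 4 \<le> \<bar>x\<bar>" for x
    proof (cases "x \<ge> 0")
      case True
      then have "- x \<le> - (3 * \<epsilon> / 4)" using that by linarith
      then show ?thesis using \<zeta>(2)[of "- x"] by simp
    next
      case False
      then have "x \<le> - (3 * \<epsilon> / 4)" using that by linarith
      then show ?thesis using \<zeta>(2)[of x] by simp
    qed
    show "\<bar>\<zeta> x * \<zeta> ((-1) * x + 0)\<bar> \<le> 1" for x
      unfolding abs_mult by (intro mult_le_one \<zeta>(4)) simp
  qed
qed

lemma smooth_compact_support_bounded:
  fixes f :: "real \<Rightarrow> complex"
  assumes "smooth_on UNIV f" "\<And>x. R \<le> \<bar>x\<bar> \<Longrightarrow> f x = 0"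
  obtains C where "C \<ge> 0" "\<And>x. norm (nth_deriv k f x) \<le> C"
proof -
  have "compact (nth_deriv k f ` {-\<bar>R\<bar>..\<bar>R\<bar>})"
    by (intro compact_continuous_image continuous_on_subset[OF smooth_on_continuous[OF assms(1)]]) auto
  then obtain C where C: "\<And>x. x \<in> {-\<bar>R\<bar>..\<bar>R\<bar>} \<Longrightarrow> norm (nth_deriv k f x) \<le> C"
    using compact_imp_bounded bounded_iff by (metis image_eqI)
  have "norm (nth_deriv k f x) \<le> max 0 C" for x
  proof (cases "x \<in> {-\<bar>R\<bar>..\<bar>R\<bar>}")
    case False
    have "open ({..<-\<bar>R\<bar>} \<union> {\<bar>R\<bar><..})" by auto
    then have "nth_deriv k f x = nth_deriv k (\<lambda>_. 0) x"
      by (rule nth_deriv_cong) (use False assms(2) in auto)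
    then show ?thesis by (simp add: nth_deriv_const)
  next
    case True
    then show ?thesis using C[OF True] by linarith
  qed
  then show ?thesis using that[of "max 0 C"] by auto
qed

section \<open>The frequencies, their weights and the local potential\<close>

definition wave :: "real \<Rightarrow> real \<Rightarrow> complex" where
  "wave \<theta> x = exp (\<i> * complex_of_real (\<theta> * x))"

lemma wave_0 [simp]: "wave \<theta> 0 = 1" "wave 0 x = 1"
  by (simp_all add: wave_def)

lemma norm_wave [simp]: "norm (wave \<theta> x) = 1"
  by (simp add: wave_def)

lemma wave_nonzero [simp]: "wave \<theta> x \<noteq> 0"
  by (simp add: wave_def)

lemma wave_add: "wave (\<theta> + \<eta>) x = wave \<theta> x * wave \<eta> x"
  by (simp add: wave_def distrib_left distrib_right exp_add)

lemma cnj_wave: "cnj (wave \<theta> x) = wave (- \<theta>) x"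
  by (simp add: wave_def exp_cnj)

lemma wave_minus: "wave (- \<theta>) x = inverse (wave \<theta> x)"
  by (simp add: wave_def exp_minus)

lemma wave_cancel [simp]: "wave \<theta> x * wave (- \<theta>) x = 1" "wave (- \<theta>) x * wave \<theta> x = 1"
  by (simp_all add: wave_minus)

lemma wave_has_derivative: "(wave \<theta> has_vector_derivative \<i> * of_real \<theta> * wave \<theta> x) (at x)"
proof -
  have "((\<lambda>z. exp (\<i> * of_real \<theta> * z)) has_field_derivative \<i> * of_real \<theta> * exp (\<i> * of_real \<theta> * of_real x)) (at (of_real x))"
    by (auto intro!: derivative_eq_intros)
  then have "((\<lambda>x. exp (\<i> * of_real \<theta> * of_real x)) has_vector_derivative \<i> * of_real \<theta> * exp (\<i> * of_real \<theta> * of_real x)) (at x)"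
    by (rule has_vector_derivative_real_field)
  then show ?thesis by (simp add: wave_def[abs_def] mult.assoc)
qed

lemma smooth_on_wave: "smooth_on U (wave \<theta>)"
  and nth_deriv_wave: "nth_deriv k (wave \<theta>) x = (\<i> * of_real \<theta>) ^ k * wave \<theta> x"
proof -
  have "((\<lambda>x. (\<i> * of_real \<theta>) ^ k * wave \<theta> x) has_vector_derivative (\<i> * of_real \<theta>) ^ Suc k * wave \<theta> x) (at x)" for k x
    using has_vector_derivative_mult_right[OF wave_has_derivative, of "(\<i> * of_real \<theta>) ^ k"] by (simp add: mult_ac)
  note * = smooth_on_tower_eq[of UNIV "\<lambda>k x. (\<i> * of_real \<theta>) ^ k * wave \<theta> x" "wave \<theta>", OF _ _ this]
  show "smooth_on U (wave \<theta>)" using *(1) smooth_on_subset[of UNIV "wave \<theta>" U] by simp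
  show "nth_deriv k (wave \<theta>) x = (\<i> * of_real \<theta>) ^ k * wave \<theta> x" using *(2) by simp
qed

lemma symbols_wave:
  assumes "\<And>k. \<exists>C\<ge>0. \<forall>i. \<bar>\<theta> i\<bar> ^ k \<le> C * w i" "\<And>i. 0 \<le> w i"
  shows "symbols (\<lambda>_. 1) U (\<lambda>i. wave (\<theta> i)) w"
proof (rule symbolsI)
  fix k
  obtain C where "C \<ge> 0" "\<forall>i. \<bar>\<theta> i\<bar> ^ k \<le> C * w i" using assms(1)[of k] by blast
  then show "\<exists>C\<ge>0. \<forall>i. \<forall>x\<in>U. 1 ^ k * norm (nth_deriv k (wave (\<theta> i)) x) \<le> C * w i"
    by (intro exI[of _ C]) (simp add: nth_deriv_wave norm_mult norm_power)
qed (use assms(2) smooth_on_wave in auto)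

lemma of_real_sin_wave: "complex_of_real (sin (k * x)) = (wave k x - wave (- k) x) / (2 * \<i>)"
  by (simp add: wave_def sin_of_real[symmetric] sin_exp_eq)

text \<open>Iterating the estimate \<open>norm (y i) \<le> sup (norm \<circ> y) / 2\<close>. Only bounded solutions are excluded, which is why the
  injectivity hypothesis of \<open>double_commutation\<close> is restricted to bounded sequences.\<close>
lemma contraction_zero:
  fixes M :: "'i \<Rightarrow> 'i \<Rightarrow> complex"
  assumes y: "\<And>j. norm (y j) \<le> C" and M: "\<And>i j. norm (M i j) \<le> m i j"
    and m: "\<And>i. m i summable_on UNIV" "\<And>i. (\<Sum>\<^sub>\<infinity>j. m i j) \<le> 1 / 2"
    and e: "\<And>i. ((\<lambda>j. M i j * y j) has_sum z i) UNIV" "\<And>i. norm (z i) = norm (y i)"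
  shows "y i = 0"
proof -
  have m0: "0 \<le> m i j" for i j using M[of i j] norm_ge_zero order_trans by blast
  have "norm (y j) \<le> C * (1/2) ^ n" for n j
  proof (induction n arbitrary: j)
    case (Suc n)
    have "norm (z j) \<le> (\<Sum>\<^sub>\<infinity>i. m j i) * (C * (1/2) ^ n)"
      by (rule norm_infsum_le[OF e(1) has_sum_cmult_left[OF has_sum_infsum[OF m(1)]]])
        (auto simp: norm_mult intro!: mult_mono M Suc m0)
    also have "\<dots> \<le> 1/2 * (C * (1/2) ^ n)"
      using m(2)[of j] order_trans[OF norm_ge_zero Suc.IH[of j]] by (intro mult_right_mono)
    finally show ?case by (simp add: e(2))
  qed (simp add: y)
  moreover have "(\<lambda>n. C * (1/2) ^ n) \<longlonglongrightarrow> C * 0"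
    by (intro tendsto_mult tendsto_const LIMSEQ_power_zero) simp
  ultimately have "norm (y i) \<le> C * 0" by (intro LIMSEQ_le_const) auto
  then show ?thesis by simp
qed

text \<open>What the construction on the half line needs to know of the diophantine condition. In the application \<open>v i\<close> is
  exponentially small in a lattice vector in which \<open>\<kappa> i\<close>, \<open>1 / \<kappa> i\<close> and the small denominators grow polynomially.
  The factor \<open>1000\<close> leaves ample room for the sums over four waves and for the remainder of the diagonal Gram functions.\<close>
locale eigen_data =
  fixes \<kappa> v :: "nat \<Rightarrow> real" and Cg \<delta> :: real
  assumes \<kappa>_pos: "\<And>i. 0 < \<kappa> i" and \<kappa>_inj: "inj \<kappa>"
    and v_pos: "\<And>i. 0 < v i" and v_le_1: "\<And>i. v i \<le> 1" and v_summable: "v summable_on UNIV"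
    and tame: "\<And>k. \<exists>C\<ge>0. \<forall>i. (1 + \<kappa> i + 1 / \<kappa> i) ^ k \<le> C / v i"
    and Cg: "1 \<le> Cg" "\<And>i. 1 / \<kappa> i \<le> Cg / v i" "\<And>i j. i \<noteq> j \<Longrightarrow> 1 / \<bar>\<kappa> i - \<kappa> j\<bar> \<le> Cg / (v i * v j)"
    and \<delta>: "0 < \<delta>" "\<delta>\<^sup>2 * (1000 * Cg * (1 + infsum v UNIV)) \<le> 1"
begin

text \<open>The amplitudes of the solutions. Six powers of \<open>v\<close> are available for spending: one on the denominator
  \<open>1 / (\<kappa> i \<plusminus> \<kappa> j)\<close>, one or two on derivatives, one on the shift of the lattice (\<open>E_shift\<close>), and the rest on summability.\<close>
definition "\<gamma> i = \<delta> * v i ^ 6"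

text \<open>The size of the matrix entries for which all rows, weighted with powers of \<open>v\<close>, sum to at most \<open>1 / 4\<close>.\<close>
definition "A = 1 / (4 * (1 + infsum v UNIV))"

lemma vs_nonneg: "0 \<le> infsum v UNIV"
  by (intro infsum_nonneg less_imp_le v_pos)

lemma A_pos: "0 < A"
  using vs_nonneg by (simp add: A_def)

lemma \<gamma>_pos: "0 < \<gamma> i"
  unfolding \<gamma>_def by (intro mult_pos_pos zero_less_power \<delta>(1) v_pos)

lemma \<delta>_A: "\<delta>\<^sup>2 * Cg \<le> A / 250"
  using \<delta>(2) vs_nonneg by (simp add: A_def field_simps)

lemma v_power_le: "m \<le> n \<Longrightarrow> v i ^ n \<le> v i ^ m"
  using v_pos[of i] v_le_1[of i] by (intro power_decreasing) auto

lemma v_power_le_1: "v i ^ n \<le> 1"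
  using v_pos[of i] v_le_1[of i] by (intro power_le_one) auto

lemma v_power_summable: "0 < n \<Longrightarrow> (\<lambda>i. v i ^ n) summable_on UNIV"
  using v_power_le[of 1 n] less_imp_le[OF v_pos]
  by (intro dominated_summable[OF v_summable]) (auto simp: power_abs)

lemma v_power_infsum: "0 < n \<Longrightarrow> (\<Sum>\<^sub>\<infinity>i. v i ^ n) \<le> infsum v UNIV"
  using v_power_le[of 1 n] by (intro infsum_mono v_power_summable v_summable) auto

lemma A_infsum: "0 < n \<Longrightarrow> A * (\<Sum>\<^sub>\<infinity>i. v i ^ n) \<le> 1 / 4"
proof -
  assume "0 < n"
  then have "A * (\<Sum>\<^sub>\<infinity>i. v i ^ n) \<le> A * (1 + infsum v UNIV)"
    using v_power_infsum[of n] A_pos by (intro mult_left_mono) auto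
  also have "\<dots> = 1 / 4" using vs_nonneg by (simp add: A_def)
  finally show ?thesis .
qed

lemma \<kappa>_power: "\<exists>C\<ge>0. \<forall>i. \<kappa> i ^ k \<le> C / v i"
proof -
  obtain C where C: "C \<ge> 0" "\<And>i. (1 + \<kappa> i + 1 / \<kappa> i) ^ k \<le> C / v i" using tame[of k] by auto
  have "\<kappa> i ^ k \<le> C / v i" for i
    using C(2)[of i] power_mono[of "\<kappa> i" "1 + \<kappa> i + 1 / \<kappa> i" k] \<kappa>_pos[of i] by fastforce
  with C(1) show ?thesis by blast
qed

lemma symbols_wave_\<kappa>: "symbols (\<lambda>_. 1) U (\<lambda>i. wave (c * \<kappa> i)) (\<lambda>i. 1 / v i)"
proof (rule symbols_wave)
  fix k
  obtain C where C: "C \<ge> 0" "\<And>i. \<kappa> i ^ k \<le> C / v i" using \<kappa>_power by blast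
  have "\<bar>c * \<kappa> i\<bar> ^ k \<le> (\<bar>c\<bar> ^ k * C) * (1 / v i)" for i
    using mult_left_mono[OF C(2)[of i], of "\<bar>c\<bar> ^ k"] \<kappa>_pos[of i] by (simp add: abs_mult power_mult_distrib)
  then show "\<exists>C\<ge>0. \<forall>i. \<bar>c * \<kappa> i\<bar> ^ k \<le> C * (1 / v i)"
    using C(1) by (intro exI[of _ "\<bar>c\<bar> ^ k * C"]) auto
qed (use v_pos less_imp_le in auto)

definition free :: "nat \<Rightarrow> real \<Rightarrow> complex" where
  "free i x = complex_of_real (\<gamma> i * sin (\<kappa> i * x))"

definition free_gram :: "nat \<Rightarrow> nat \<Rightarrow> real \<Rightarrow> complex" where
  "free_gram i j = primitive (\<lambda>x. free i x * free j x)"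

lemma free_eq: "free i x = of_real (\<gamma> i) / (2 * \<i>) * wave (1 * \<kappa> i) x + (- of_real (\<gamma> i) / (2 * \<i>)) * wave ((-1) * \<kappa> i) x"
  unfolding free_def of_real_mult of_real_sin_wave by (simp add: field_simps)

lemma free_smooth: "smooth_on U (free i)"
proof -
  have "smooth_on UNIV (free i)"
    unfolding free_eq[abs_def] by (intro smooth_on_add smooth_on_cmult smooth_on_wave) auto
  then show ?thesis by (rule smooth_on_subset) auto
qed

lemma free_deriv: "nth_deriv 1 (free i) x = complex_of_real (\<gamma> i * \<kappa> i * cos (\<kappa> i * x))"
proof -
  have "((\<lambda>x. \<gamma> i * sin (\<kappa> i * x)) has_vector_derivative \<gamma> i * \<kappa> i * cos (\<kappa> i * x)) (at x)"
    unfolding has_real_derivative_iff_has_vector_derivative[symmetric]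
    by (auto intro!: derivative_eq_intros)
  then have "(free i has_vector_derivative complex_of_real (\<gamma> i * \<kappa> i * cos (\<kappa> i * x))) (at x)"
    unfolding free_def by (rule bounded_linear.has_vector_derivative[OF bounded_linear_of_real])
  then show ?thesis by (simp add: nth_deriv_Suc vector_derivative_at)
qed

lemma free_deriv2: "nth_deriv 2 (free i) x = (0 - of_real ((\<kappa> i)\<^sup>2)) * free i x"
proof -
  have "((\<lambda>x. \<gamma> i * \<kappa> i * cos (\<kappa> i * x)) has_vector_derivative - ((\<kappa> i)\<^sup>2 * (\<gamma> i * sin (\<kappa> i * x)))) (at x)"
    unfolding has_real_derivative_iff_has_vector_derivative[symmetric]
    by (auto intro!: derivative_eq_intros simp: power2_eq_square)
  then have "((\<lambda>x. complex_of_real (\<gamma> i * \<kappa> i * cos (\<kappa> i * x))) has_vector_derivative of_real (- ((\<kappa> i)\<^sup>2 * (\<gamma> i * sin (\<kappa> i * x))))) (at x)"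
    by (rule bounded_linear.has_vector_derivative[OF bounded_linear_of_real])
  moreover have "nth_deriv 2 (free i) x = vector_derivative (nth_deriv 1 (free i)) (at x)"
    by (simp add: numeral_2_eq_2 nth_deriv_Suc)
  moreover have "nth_deriv 1 (free i) = (\<lambda>x. complex_of_real (\<gamma> i * \<kappa> i * cos (\<kappa> i * x)))"
    using free_deriv by auto
  ultimately show ?thesis by (simp add: vector_derivative_at free_def)
qed

lemma symbols_free: "symbols (\<lambda>_. 1) U (\<lambda>i. free i) (\<lambda>i. v i ^ 5)"
proof -
  have "symbols (\<lambda>_. 1) UNIV (\<lambda>i. free i) (\<lambda>i. v i ^ 5)"
    unfolding free_eq[abs_def]
  proof (rule symbols_add)
    have le: "norm c * (1 / v i) \<le> \<delta> * v i ^ 5" if "norm c = \<gamma> i / 2" for c :: complex and i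
    proof -
      have "norm c * (1 / v i) = (\<delta> * v i ^ 5) / 2"
        using v_pos[of i] by (simp add: that \<gamma>_def power_numeral_reduce)
      moreover have "0 \<le> \<delta> * v i ^ 5" using \<delta>(1) v_pos[of i] by simp
      ultimately show ?thesis by linarith
    qed
    show "symbols (\<lambda>_. 1) UNIV (\<lambda>i x. of_real (\<gamma> i) / (2 * \<i>) * wave (1 * \<kappa> i) x) (\<lambda>i. v i ^ 5)"
      by (rule symbols_weight[OF symbols_cmult[OF open_UNIV symbols_wave_\<kappa>] less_imp_le[OF \<delta>(1)] le])
        (use v_pos \<gamma>_pos in \<open>auto simp: norm_divide norm_mult less_imp_le\<close>)
    show "symbols (\<lambda>_. 1) UNIV (\<lambda>i x. (- of_real (\<gamma> i) / (2 * \<i>)) * wave ((-1) * \<kappa> i) x) (\<lambda>i. v i ^ 5)"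
      by (rule symbols_weight[OF symbols_cmult[OF open_UNIV symbols_wave_\<kappa>] less_imp_le[OF \<delta>(1)] le])
        (use v_pos \<gamma>_pos in \<open>auto simp: norm_divide norm_mult less_imp_le\<close>)
  qed auto
  then show ?thesis by (rule symbols_subset) auto
qed

lemma free_continuous: "continuous_on UNIV (\<lambda>x. free i x * free j x)"
  unfolding free_def by (intro continuous_intros)

lemma free_gram_derivative: "(free_gram i j has_vector_derivative free i x * free j x) (at x)"
  unfolding free_gram_def by (rule primitive_has_derivative[OF free_continuous])

lemma free_gram_0 [simp]: "free_gram i j 0 = 0"
  by (simp add: free_gram_def)

lemma norm_free_le: "norm (free i x) \<le> \<gamma> i"
  using \<gamma>_pos[of i] by (simp add: free_def norm_mult mult_left_le)

lemma free_gram_bound: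
  assumes "\<bar>x\<bar> \<le> 1"
  shows "norm (free_gram i j x) \<le> A * (v i ^ 5 * v j ^ 5) / 4"
proof -
  have "norm (free_gram i j x) \<le> (\<gamma> i * \<gamma> j) * \<bar>x\<bar>"
    by (rule norm_le_from_zero[OF free_gram_0 free_gram_derivative])
      (auto simp: norm_mult intro!: mult_mono norm_free_le less_imp_le[OF \<gamma>_pos])
  also have "\<dots> \<le> \<gamma> i * \<gamma> j" using assms \<gamma>_pos by (simp add: mult_left_le)
  also have "\<dots> = \<delta>\<^sup>2 * (v i ^ 6 * v j ^ 6)" by (simp add: \<gamma>_def power2_eq_square mult_ac)
  also have "\<dots> \<le> (A / 250) * (v i ^ 5 * v j ^ 5)"
  proof (intro mult_mono v_power_le)
    show "\<delta>\<^sup>2 \<le> A / 250" using \<delta>_A mult_left_mono[OF Cg(1), of "\<delta>\<^sup>2"] by simp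
  qed (use A_pos v_pos less_imp_le in auto)
  also have "\<dots> \<le> A * (v i ^ 5 * v j ^ 5) / 4" using A_pos v_pos by (simp add: less_imp_le)
  finally show ?thesis .
qed

text \<open>Double commutation run backwards, \<open>H\<close> being the matrix \<open>free_gram\<close>: \<open>s = (1 - H)\<^sup>-\<^sup>1 free\<close> solves the equation with the potential
  \<open>V = 2 q'\<close>, and the forward transformation will turn \<open>V\<close> back into zero.\<close>
lemma near_origin:
  defines "U \<equiv> {-1<..<1::real}"
  obtains s where "symbols (\<lambda>_. 1) U s (\<lambda>i. v i ^ 5)"
    and "\<And>i x. x \<in> U \<Longrightarrow> ((\<lambda>j. free_gram i j x * s j x) has_sum (s i x - free i x)) UNIV"
    and "\<And>i x. x \<in> U \<Longrightarrow> nth_deriv 2 (s i) x = (2 * nth_deriv 1 (\<lambda>x. \<Sum>\<^sub>\<infinity>j. free j x * s j x) x - of_real ((\<kappa> i)\<^sup>2)) * s i x"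
    and "smooth_on U (\<lambda>x. \<Sum>\<^sub>\<infinity>j. free j x * s j x)"
    and "\<And>i x. x \<in> U \<Longrightarrow> cnj (s i x) = s i x"
    and "\<And>i. s i 0 = 0" and "\<And>i. nth_deriv 1 (s i) 0 = of_real (\<gamma> i * \<kappa> i)"
proof -
  have U: "open U" "convex U" "0 \<in> U" "U \<subseteq> {-1..1}" by (auto simp: U_def)
  have v0: "0 \<le> v i" for i using v_pos less_imp_le by auto
  have gram: "symbols (\<lambda>_. 1) U (\<lambda>(i, j). free_gram i j) (\<lambda>(i, j). v i ^ 5 * v j ^ 5)"
    by (rule gram_symbols[OF U symbols_free free_gram_0 free_gram_derivative])
  have gramA: "symbols (\<lambda>_. 1) U (\<lambda>(i, j). free_gram i j) (\<lambda>(i, j). A * (v i ^ 5 * v j ^ 5))"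
    by (rule symbols_weight[OF gram, of "1 / A"]) (use A_pos v0 in auto)
  have row: "(\<lambda>j. A * (v i ^ 5 * v j ^ 5) * v j ^ n) summable_on UNIV"
    "(\<Sum>\<^sub>\<infinity>j. A * (v i ^ 5 * v j ^ 5) * v j ^ n) \<le> 1/4 * v i ^ 5" for i n
  proof -
    have e: "A * (v i ^ 5 * v j ^ 5) * v j ^ n = (v i ^ 5 * A) * v j ^ (5 + n)" for j
      by (simp add: power_add mult_ac)
    show "(\<lambda>j. A * (v i ^ 5 * v j ^ 5) * v j ^ n) summable_on UNIV"
      unfolding e by (intro summable_on_cmult_right v_power_summable) simp
    have "(\<Sum>\<^sub>\<infinity>j. (v i ^ 5 * A) * v j ^ (5 + n)) = v i ^ 5 * (A * (\<Sum>\<^sub>\<infinity>j. v j ^ (5 + n)))"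
      by (subst infsum_cmult_right) (auto intro!: v_power_summable simp: mult_ac)
    also have "\<dots> \<le> v i ^ 5 * (1/4)" using A_infsum[of "5 + n"] v0 by (intro mult_left_mono) auto
    finally show "(\<Sum>\<^sub>\<infinity>j. A * (v i ^ 5 * v j ^ 5) * v j ^ n) \<le> 1/4 * v i ^ 5" unfolding e by simp
  qed
  have x1: "\<bar>x\<bar> \<le> 1" if "x \<in> U" for x using that by (auto simp: U_def)
  obtain s where s: "symbols (\<lambda>_. 1) U s (\<lambda>i. v i ^ 5)"
    "\<And>i x. x \<in> U \<Longrightarrow> ((\<lambda>j. free_gram i j x * s j x) has_sum (s i x - free i x)) UNIV"
  proof (rule symbol_system_solvable[OF U(1,2) _ gramA symbols_free, where g="\<lambda>_ e. e"])
    show "norm (free_gram a e x) \<le> A * (v a ^ 5 * v e ^ 5) / 4" if "x \<in> U" for a e x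
      by (rule free_gram_bound[OF x1[OF that]])
    show "(\<Sum>\<^sub>\<infinity>e. A * (v a ^ 5 * v e ^ 5) * v e ^ 5) \<le> v a ^ 5" for a
      using row(2)[of a 5] zero_le_power[OF v0[of a], of 5] by linarith
  qed (use row in auto)
  have inj: "y i = 0" if "x \<in> U" "\<And>j. norm (y j) \<le> C"
    "\<And>i. ((\<lambda>j. free_gram i j x * y j) has_sum y i) UNIV" for x y C i
  proof (rule contraction_zero[OF that(2), where m="\<lambda>i j. A * (v i ^ 5 * v j ^ 5) * v j ^ 0"])
    show "norm (free_gram i j x) \<le> A * (v i ^ 5 * v j ^ 5) * v j ^ 0" for i j
    proof -
      have "0 \<le> A * (v i ^ 5 * v j ^ 5)" using A_pos v0 by simp
      then have "norm (free_gram i j x) \<le> A * (v i ^ 5 * v j ^ 5)"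
        using free_gram_bound[OF x1[OF that(1)], of i j] by linarith
      then show ?thesis by simp
    qed
    show "(\<Sum>\<^sub>\<infinity>j. A * (v i ^ 5 * v j ^ 5) * v j ^ 0) \<le> 1 / 2" for i
      using row(2)[of i 0] v_power_le_1[of i 5] by simp
  qed (rule row(1), rule that(3), rule refl)
  have fs: "((\<lambda>j. free_gram i j x * s j x) has_sum (- 1 * (free i x - s i x))) UNIV" if "x \<in> U" for i x
    using s(2)[OF that] by simp
  obtain C where C: "C \<ge> 0" "\<And>i. (1 + \<kappa> i + 1 / \<kappa> i) ^ 2 \<le> C / v i" using tame[of 2] by auto
  have bdd: "(1 + (\<kappa> j)\<^sup>2) * v j ^ 5 \<le> C" for j
  proof -
    have "1 + (\<kappa> j)\<^sup>2 \<le> (1 + \<kappa> j + 1 / \<kappa> j)\<^sup>2"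
    proof -
      have "1 + (\<kappa> j)\<^sup>2 \<le> (1 + \<kappa> j)\<^sup>2" using \<kappa>_pos[of j] by (simp add: power2_eq_square algebra_simps)
      also have "\<dots> \<le> (1 + \<kappa> j + 1 / \<kappa> j)\<^sup>2" using \<kappa>_pos[of j] by (intro power_mono) auto
      finally show ?thesis .
    qed
    also have "\<dots> \<le> C / v j" by (rule C(2))
    finally have "(1 + (\<kappa> j)\<^sup>2) * v j ^ 5 \<le> C / v j * v j ^ 5" using v0 by (intro mult_right_mono) auto
    also have "\<dots> = C * v j ^ 4" using v_pos[of j] by (simp add: power_numeral_reduce)
    also have "\<dots> \<le> C" using C(1) v_power_le_1[of j 4] by (simp add: mult_left_le)
    finally show ?thesis .
  qed
  have vw: "(\<lambda>j. v j ^ 5 * v j ^ 5) summable_on UNIV"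
    using v_power_summable[of 10] by (simp flip: power_add)
  have inj': "\<forall>x\<in>U. \<forall>y. bounded (range y) \<longrightarrow>
      (\<forall>i. ((\<lambda>j. free_gram i j x * y j) has_sum (- (- 1 * y i))) UNIV) \<longrightarrow> (\<forall>i. y i = 0)"
    using inj by (auto simp: bounded_iff)
  have m1: "- 1 * - 1 = (1::complex)" by simp
  have free0: "free i 0 = 0" for i by (simp add: free_def)
  note DC = double_commutation[OF U m1 symbols_free s(1) vw free0 free_deriv2 free_gram_0 free_gram_derivative fs inj' bdd]
  show ?thesis
  proof (rule that[OF s])
    fix i x assume x: "x \<in> U"
    show "nth_deriv 2 (s i) x = (2 * nth_deriv 1 (\<lambda>x. \<Sum>\<^sub>\<infinity>j. free j x * s j x) x - of_real ((\<kappa> i)\<^sup>2)) * s i x"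
      using DC(1)[OF _ x, of i] by simp
    show "cnj (s i x) = s i x"
    proof -
      obtain B where B: "B \<ge> 0" "\<And>i x. x \<in> U \<Longrightarrow> norm (s i x) \<le> B * v i ^ 5"
        using symbols_bound[OF s(1), of 0] by auto
      have "cnj (s i x) - s i x = 0"
      proof (rule inj[OF x])
        fix j
        have "norm (s j x) \<le> B" using B(2)[OF x, of j] mult_left_le[OF v_power_le_1[of j 5] B(1)] by linarith
        then show "norm (cnj (s j x) - s j x) \<le> B + B"
          by (intro order_trans[OF norm_triangle_ineq4]) simp
      next
        fix i
        have real: "cnj (free_gram i j x) = free_gram i j x" for j
        proof -
          have "cnj (free_gram i j x) - free_gram i j x = 0"
          proof -
            have "norm (cnj (free_gram i j x) - free_gram i j x) \<le> 0 * \<bar>x\<bar>"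
            proof (rule norm_le_from_zero[where F="\<lambda>x. cnj (free_gram i j x) - free_gram i j x"])
              fix t
              have "((\<lambda>x. cnj (free_gram i j x)) has_vector_derivative cnj (free i t * free j t)) (at t)"
                by (rule bounded_linear.has_vector_derivative[OF bounded_linear_cnj free_gram_derivative])
              from has_vector_derivative_diff[OF this free_gram_derivative]
              show "((\<lambda>x. cnj (free_gram i j x) - free_gram i j x) has_vector_derivative cnj (free i t * free j t) - free i t * free j t) (at t)" .
            qed (auto simp: free_def)
            then show ?thesis by simp
          qed
          then show ?thesis by simp
        qed
        have "((\<lambda>j. cnj (free_gram i j x * s j x)) has_sum cnj (s i x - free i x)) UNIV"
          unfolding has_sum_cnj_iff by (rule s(2)[OF x])
        from has_sum_add[OF this has_sum_uminusI[OF s(2)[OF x, of i]]]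
        have "((\<lambda>j. free_gram i j x * cnj (s j x) - free_gram i j x * s j x) has_sum (cnj (s i x - free i x) - (s i x - free i x))) UNIV"
          by (simp add: real diff_conv_add_uminus del: add_uminus_conv_diff)
        then show "((\<lambda>j. free_gram i j x * (cnj (s j x) - s j x)) has_sum (cnj (s i x) - s i x)) UNIV"
          by (simp add: right_diff_distrib free_def)
      qed
      then show ?thesis by simp
    qed
  next
    show "smooth_on U (\<lambda>x. \<Sum>\<^sub>\<infinity>j. free j x * s j x)"
      by (rule DC(2)[OF _ U(3)])
  next
    fix i
    show "s i 0 = 0" using has_sum_unique[OF s(2)[OF U(3), of i]] by (simp add: free_def)
    have "symbols (\<lambda>_. 1) U (\<lambda>(i, j) x. free_gram i j x * s j x) (\<lambda>(i, j). v i ^ 5 * (v j ^ 5 * v j ^ 5))"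
      using symbols_mult[OF U(1) gram symbols_reindex[OF s(1), of snd]] by (simp add: case_prod_unfold mult.assoc)
    note I = symbols_nth_deriv_infsum[OF U(1,2) _ this summable_on_cmult_right[OF vw]]
    have sms: "smooth_on U (s i)" for i by (rule symbols_smooth[OF s(1)])
    have smG: "smooth_on U (free_gram i j)" for i j using symbols_smooth[OF gram, of "(i, j)"] by simp
    have "nth_deriv 1 (\<lambda>x. s i x - free i x) 0 = nth_deriv 1 (\<lambda>x. \<Sum>\<^sub>\<infinity>j. free_gram i j x * s j x) 0"
      by (rule nth_deriv_cong[OF U(1) infsumI[OF s(2), symmetric] U(3)])
    also have "\<dots> = (\<Sum>\<^sub>\<infinity>j. nth_deriv 1 (\<lambda>x. free_gram i j x * s j x) 0)"
      by (rule I) (use U in auto)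
    also have "\<dots> = 0"
    proof -
      have "nth_deriv 1 (free_gram i j) 0 = 0" for j
        using free_gram_derivative[of i j 0] by (simp add: nth_deriv_Suc vector_derivative_at free_def)
      then show ?thesis by (simp add: nth_deriv_mult_1[OF U(1) smG sms U(3)] del: One_nat_def)
    qed
    finally show "nth_deriv 1 (s i) 0 = of_real (\<gamma> i * \<kappa> i)"
      using nth_deriv_diff[OF U(1) sms free_smooth U(3), of 1 i i] free_deriv[of i 0] by simp
  qed
qed

end

section \<open>Plane waves perturbed by a compactly supported potential\<close>

text \<open>The solution is written as \<open>2 Re (a e\<^sup>i\<^sup>\<kappa>\<^sup>x)\<close> by variation of constants. The fixed point equation is
  solved on \<open>[-\<epsilon>, \<epsilon>]\<close> only, where its kernel \<open>sin (\<kappa> (y - t)) / \<kappa>\<close> is small uniformly in \<open>\<kappa>\<close>.\<close>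
lemma perturbed_wave:
  fixes W0 :: "real \<Rightarrow> real" and \<kappa> \<epsilon> CV :: real
  assumes \<kappa>: "0 < \<kappa>" and \<epsilon>: "0 < \<epsilon>" "\<epsilon> \<le> 1 / 2"
    and W0: "continuous_on UNIV W0" "\<And>x. \<epsilon> \<le> \<bar>x\<bar> \<Longrightarrow> W0 x = 0" "\<And>x. \<bar>W0 x\<bar> \<le> CV" "CV * \<epsilon> \<le> 1 / 8"
  shows "\<exists>a. a 0 = 1 / (2 * \<i>) \<and>
    (\<forall>x. (a has_vector_derivative of_real (W0 x) * (a x * wave \<kappa> x + cnj (a x) * wave (- \<kappa>) x) * wave (- \<kappa>) x / (2 * \<i> * of_real \<kappa>)) (at x)) \<and>
    (\<forall>x. norm (a x - 1 / (2 * \<i>)) \<le> 1 / 4)"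
proof -
  define c where "c x = max (- \<epsilon>) (min \<epsilon> x)" for x
  have c: "\<bar>c x\<bar> \<le> \<epsilon>" "\<bar>x\<bar> \<le> \<epsilon> \<Longrightarrow> c x = x" for x using \<epsilon>(1) by (auto simp: c_def)
  have CV0: "0 \<le> CV" using W0(3)[of 0] by linarith
  define d where "d \<sigma> t = of_real (W0 t) * of_real (apply_bcontfun \<sigma> t) * wave (- \<kappa>) t / (2 * \<i> * of_real \<kappa>)"
    for \<sigma> :: "real \<Rightarrow>\<^sub>C real" and t
  have contd: "continuous_on UNIV (d \<sigma>)" for \<sigma>
    unfolding d_def wave_def by (intro continuous_intros W0(1)) (use \<kappa> in auto)
  define amp where "amp \<sigma> x = 1 / (2 * \<i>) + primitive (d \<sigma>) x" for \<sigma> x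
  have amp: "(amp \<sigma> has_vector_derivative d \<sigma> x) (at x)" for \<sigma> x
    unfolding amp_def[abs_def]
    using has_vector_derivative_add[OF has_vector_derivative_const[of "1 / (2 * \<i>)"] primitive_has_derivative[OF contd, of \<sigma> x]]
    by (simp only: add_0_left)
  have amp0: "amp \<sigma> 0 = 1 / (2 * \<i>)" for \<sigma> by (simp add: amp_def)
  define T0 where "T0 \<sigma> x = 2 * Re (amp \<sigma> (c x) * wave \<kappa> (c x))" for \<sigma> x
  have kernel: "\<bar>2 * Re (z y * wave \<kappa> y)\<bar> \<le> B / 8"
    if z: "z 0 = 0" "\<And>t. (z has_vector_derivative of_real (W0 t) * of_real (h t) * wave (- \<kappa>) t / (2 * \<i> * of_real \<kappa>)) (at t)"
      and h: "\<And>t. \<bar>h t\<bar> \<le> B" and y: "\<bar>y\<bar> \<le> \<epsilon>" for z h B y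
  proof -
    have B: "0 \<le> B" using h[of 0] by linarith
    have D: "((\<lambda>t. 2 * Re (z t * wave \<kappa> y)) has_vector_derivative W0 t * h t * (sin (\<kappa> * (y - t)) / \<kappa>)) (at t)" for t
    proof -
      have "((\<lambda>t. z t * wave \<kappa> y) has_vector_derivative (of_real (W0 t) * of_real (h t) * wave (- \<kappa>) t / (2 * \<i> * of_real \<kappa>)) * wave \<kappa> y) (at t)"
        by (rule has_vector_derivative_mult_left[OF z(2)])
      then have "((\<lambda>t. 2 * Re (z t * wave \<kappa> y)) has_vector_derivative 2 * Re ((of_real (W0 t) * of_real (h t) * wave (- \<kappa>) t / (2 * \<i> * of_real \<kappa>)) * wave \<kappa> y)) (at t)"
        by (intro has_vector_derivative_mult_right bounded_linear.has_vector_derivative[OF bounded_linear_Re])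
      moreover have "(of_real (W0 t) * of_real (h t) * wave (- \<kappa>) t / (2 * \<i> * of_real \<kappa>)) * wave \<kappa> y
          = of_real (W0 t * h t / (2 * \<kappa>)) * (- \<i> * exp (\<i> * of_real (\<kappa> * (y - t))))"
      proof -
        have "wave (- \<kappa>) t * wave \<kappa> y = exp (\<i> * of_real (\<kappa> * (y - t)))"
          by (simp add: wave_def algebra_simps flip: exp_add)
        then show ?thesis using \<kappa> by (simp add: field_simps)
      qed
      moreover have "2 * Re (of_real (W0 t * h t / (2 * \<kappa>)) * (- \<i> * exp (\<i> * of_real (\<kappa> * (y - t))))) = W0 t * h t * (sin (\<kappa> * (y - t)) / \<kappa>)"
        using \<kappa> by (simp add: Re_exp Im_exp)
      ultimately show ?thesis by (simp only:)
    qed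
    have "norm (2 * Re (z y * wave \<kappa> y)) \<le> (CV * B * (2 * \<epsilon>)) * \<bar>y\<bar>"
    proof (rule norm_le_from_zero[OF _ D])
      fix t assume t: "t \<in> closed_segment 0 y"
      have "\<bar>y - t\<bar> \<le> 2 * \<epsilon>" using t y by (auto simp: closed_segment_eq_real_ivl split: if_splits)
      moreover have "\<bar>sin (\<kappa> * (y - t)) / \<kappa>\<bar> \<le> \<bar>y - t\<bar>"
      proof -
        have "\<bar>sin (\<kappa> * (y - t))\<bar> \<le> \<kappa> * \<bar>y - t\<bar>"
          using abs_sin_x_le_abs_x[of "\<kappa> * (y - t)"] \<kappa> by (simp only: abs_mult abs_of_pos)
        then show ?thesis using \<kappa> by (simp add: divide_le_eq mult.commute)
      qed
      ultimately have "\<bar>sin (\<kappa> * (y - t)) / \<kappa>\<bar> \<le> 2 * \<epsilon>" by linarith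
      then show "norm (W0 t * h t * (sin (\<kappa> * (y - t)) / \<kappa>)) \<le> CV * B * (2 * \<epsilon>)"
        unfolding real_norm_def abs_mult[of "W0 t * h t"] abs_mult[of "W0 t"]
        using CV0 B by (intro mult_mono W0(3) h) auto
    qed (simp add: z(1))
    also have "\<dots> \<le> (CV * B * (2 * \<epsilon>)) * (1 / 2)"
      using y \<epsilon> CV0 B by (intro mult_left_mono) auto
    also have "\<dots> = (CV * \<epsilon>) * B" by simp
    also have "\<dots> \<le> 1 / 8 * B" using W0(4) B by (intro mult_right_mono)
    finally show ?thesis by simp
  qed
  have "T0 \<sigma> \<in> bcontfun" for \<sigma>
  proof -
    have "continuous_on UNIV (amp \<sigma>)"
      using amp by (meson continuous_at_imp_continuous_on has_vector_derivative_continuous)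
    moreover have cc: "continuous_on UNIV c" unfolding c_def by (intro continuous_intros)
    ultimately have "continuous_on UNIV (\<lambda>x. amp \<sigma> (c x))"
      using continuous_on_compose2 by blast
    then have cont: "continuous_on UNIV (T0 \<sigma>)"
      unfolding T0_def wave_def by (intro continuous_intros cc)
    have "compact ((\<lambda>y. 2 * Re (amp \<sigma> y * wave \<kappa> y)) ` {-\<epsilon>..\<epsilon>})"
      unfolding wave_def
      by (intro compact_continuous_image continuous_intros continuous_on_subset[OF \<open>continuous_on UNIV (amp \<sigma>)\<close>]) auto
    then obtain B where B: "\<And>y. y \<in> {-\<epsilon>..\<epsilon>} \<Longrightarrow> norm (2 * Re (amp \<sigma> y * wave \<kappa> y)) \<le> B"
      using compact_imp_bounded bounded_iff by (metis (no_types, lifting) image_eqI)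
    have "norm (T0 \<sigma> x) \<le> B" for x
      using B[of "c x"] c(1)[of x] by (simp add: T0_def abs_le_iff)
    with cont show ?thesis by (rule bcontfun_normI)
  qed
  then have T0: "apply_bcontfun (Bcontfun (T0 \<sigma>)) = T0 \<sigma>" for \<sigma>
    by (rule Bcontfun_inverse)
  have "\<exists>!\<sigma>. Bcontfun (T0 \<sigma>) = \<sigma>"
  proof (rule banach_fix_type[of "1/2"])
    show "\<forall>\<sigma> \<tau>. dist (Bcontfun (T0 \<sigma>)) (Bcontfun (T0 \<tau>)) \<le> 1 / 2 * dist \<sigma> \<tau>"
    proof (intro allI dist_bound)
      fix \<sigma> \<tau> :: "real \<Rightarrow>\<^sub>C real" and x
      have "\<bar>2 * Re ((amp \<sigma> (c x) - amp \<tau> (c x)) * wave \<kappa> (c x))\<bar> \<le> dist \<sigma> \<tau> / 8"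
      proof (rule kernel[where h="\<lambda>t. apply_bcontfun \<sigma> t - apply_bcontfun \<tau> t", OF _ _ _ c(1)])
        show "amp \<sigma> 0 - amp \<tau> 0 = 0" by (simp add: amp0)
        show "((\<lambda>x. amp \<sigma> x - amp \<tau> x) has_vector_derivative of_real (W0 t) * of_real (apply_bcontfun \<sigma> t - apply_bcontfun \<tau> t) * wave (- \<kappa>) t / (2 * \<i> * of_real \<kappa>)) (at t)" for t
          using has_vector_derivative_diff[OF amp amp] by (simp add: d_def diff_divide_distrib algebra_simps)
        show "\<bar>apply_bcontfun \<sigma> t - apply_bcontfun \<tau> t\<bar> \<le> dist \<sigma> \<tau>" for t
          using dist_bounded[of \<sigma> t \<tau>] by (simp add: dist_real_def)
      qed
      moreover have "dist (apply_bcontfun (Bcontfun (T0 \<sigma>)) x) (apply_bcontfun (Bcontfun (T0 \<tau>)) x)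
          = \<bar>2 * Re ((amp \<sigma> (c x) - amp \<tau> (c x)) * wave \<kappa> (c x))\<bar>"
        by (simp add: T0 T0_def dist_real_def left_diff_distrib algebra_simps)
      ultimately show "dist (apply_bcontfun (Bcontfun (T0 \<sigma>)) x) (apply_bcontfun (Bcontfun (T0 \<tau>)) x) \<le> 1 / 2 * dist \<sigma> \<tau>"
        using zero_le_dist[of \<sigma> \<tau>] by linarith
    qed
  qed auto
  then obtain \<sigma> where \<sigma>: "Bcontfun (T0 \<sigma>) = \<sigma>" by blast
  have \<sigma>_eq: "apply_bcontfun \<sigma> x = T0 \<sigma> x" for x using T0[of \<sigma>] \<sigma> by simp
  have S: "complex_of_real (apply_bcontfun \<sigma> x) = amp \<sigma> x * wave \<kappa> x + cnj (amp \<sigma> x) * wave (- \<kappa>) x" if "\<bar>x\<bar> \<le> \<epsilon>" for x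
    using complex_add_cnj[of "amp \<sigma> x * wave \<kappa> x"] by (simp add: \<sigma>_eq T0_def c(2)[OF that] cnj_wave)
  have deriv: "d \<sigma> x = of_real (W0 x) * (amp \<sigma> x * wave \<kappa> x + cnj (amp \<sigma> x) * wave (- \<kappa>) x) * wave (- \<kappa>) x / (2 * \<i> * of_real \<kappa>)" for x
    using W0(2)[of x] S[of x] by (cases "\<bar>x\<bar> \<le> \<epsilon>") (auto simp: d_def)
  have ampd: "((\<lambda>x. amp \<sigma> x - 1 / (2 * \<i>)) has_vector_derivative d \<sigma> t) (at t)" for t
    using has_vector_derivative_diff[OF amp[of \<sigma> t] has_vector_derivative_const[of "1 / (2 * \<i>)"]]
    by (simp only: diff_0_right)
  have \<sigma>_norm: "norm \<sigma> \<le> \<kappa>"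
  proof -
    have "norm (apply_bcontfun \<sigma> x) \<le> \<kappa> / 2 + norm \<sigma> / 8" for x
    proof -
      have "\<bar>2 * Re ((amp \<sigma> (c x) - 1 / (2 * \<i>)) * wave \<kappa> (c x))\<bar> \<le> norm \<sigma> / 8"
      proof (rule kernel[where h="apply_bcontfun \<sigma>", OF _ _ _ c(1)])
        show "amp \<sigma> 0 - 1 / (2 * \<i>) = 0" by (simp add: amp0)
        show "((\<lambda>x. amp \<sigma> x - 1 / (2 * \<i>)) has_vector_derivative of_real (W0 t) * of_real (apply_bcontfun \<sigma> t) * wave (- \<kappa>) t / (2 * \<i> * of_real \<kappa>)) (at t)" for t
          using ampd[of t] unfolding d_def .
        show "\<bar>apply_bcontfun \<sigma> t\<bar> \<le> norm \<sigma>" for t using norm_bounded[of \<sigma> t] by simp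
      qed
      moreover have "2 * Re (1 / (2 * \<i>) * wave \<kappa> (c x)) = sin (\<kappa> * c x)"
        by (simp add: wave_def Im_exp Re_divide)
      moreover have "\<bar>sin (\<kappa> * c x)\<bar> \<le> \<kappa> / 2"
      proof -
        have "\<bar>sin (\<kappa> * c x)\<bar> \<le> \<kappa> * \<bar>c x\<bar>" using abs_sin_x_le_abs_x[of "\<kappa> * c x"] \<kappa> by (simp add: abs_mult)
        also have "\<dots> \<le> \<kappa> * (1/2)" using c(1)[of x] \<epsilon>(2) \<kappa> by (intro mult_left_mono) auto
        finally show ?thesis by simp
      qed
      moreover have "apply_bcontfun \<sigma> x = 2 * Re ((amp \<sigma> (c x) - 1 / (2 * \<i>)) * wave \<kappa> (c x)) + 2 * Re (1 / (2 * \<i>) * wave \<kappa> (c x))"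
        unfolding \<sigma>_eq T0_def by (simp add: left_diff_distrib algebra_simps)
      ultimately show ?thesis unfolding real_norm_def by linarith
    qed
    then have "norm \<sigma> \<le> \<kappa> / 2 + norm \<sigma> / 8" by (rule norm_bound)
    then show ?thesis using \<kappa> by simp
  qed
  have d_le: "norm (d \<sigma> t) \<le> CV / 2" for t
  proof -
    have "norm (d \<sigma> t) = \<bar>W0 t\<bar> * \<bar>apply_bcontfun \<sigma> t\<bar> / (2 * \<kappa>)"
      using \<kappa> by (simp add: d_def norm_mult norm_divide)
    also have "\<dots> \<le> CV * \<kappa> / (2 * \<kappa>)"
      using norm_bounded[of \<sigma> t] \<sigma>_norm \<kappa> CV0 by (intro divide_right_mono mult_mono W0(3)) auto
    finally show ?thesis using \<kappa> by simp
  qed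
  have near: "norm (amp \<sigma> x - 1 / (2 * \<i>)) \<le> 1 / 4" for x
  proof -
    have "norm (amp \<sigma> (c x) - 1 / (2 * \<i>)) \<le> CV / 2 * \<bar>c x\<bar>"
      by (rule norm_le_from_zero[of "\<lambda>x. amp \<sigma> x - 1 / (2 * \<i>)" _ "d \<sigma>"])
        (rule ampd d_le | simp add: amp0)+
    also have "\<dots> \<le> CV / 2 * \<epsilon>" using c(1)[of x] CV0 by (intro mult_left_mono) auto
    also have "\<dots> \<le> 1 / 4" using W0(4) by simp
    finally have 1: "norm (amp \<sigma> (c x) - 1 / (2 * \<i>)) \<le> 1 / 4" .
    have "amp \<sigma> x = amp \<sigma> (c x)"
    proof (cases "c x = x")
      case False
      have "norm (amp \<sigma> (c x + (x - c x)) - amp \<sigma> (c x)) \<le> 0 * \<bar>x - c x\<bar>"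
      proof (rule norm_le_from_zero[of "\<lambda>t. amp \<sigma> (c x + t) - amp \<sigma> (c x)" _ "\<lambda>t. d \<sigma> (c x + t)"])
        fix t assume t: "t \<in> closed_segment 0 (x - c x)"
        have "((amp \<sigma> \<circ> (\<lambda>t. c x + t)) has_vector_derivative 1 *\<^sub>R d \<sigma> (c x + t)) (at t)"
          by (rule vector_diff_chain_at) (auto intro!: derivative_eq_intros amp)
        from has_vector_derivative_diff[OF this has_vector_derivative_const[of "amp \<sigma> (c x)"]]
        show "((\<lambda>t. amp \<sigma> (c x + t) - amp \<sigma> (c x)) has_vector_derivative d \<sigma> (c x + t)) (at t)"
          by (simp add: o_def)
        have "\<epsilon> \<le> \<bar>c x + t\<bar>"
          using t \<epsilon>(1) False by (auto simp: c_def closed_segment_eq_real_ivl max_def min_def split: if_splits)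
        then show "norm (d \<sigma> (c x + t)) \<le> 0" by (simp add: d_def W0(2))
      qed simp
      then show ?thesis by simp
    qed simp
    with 1 show ?thesis by simp
  qed
  show ?thesis
  proof (intro exI[of _ "amp \<sigma>"] conjI allI)
    show "(amp \<sigma> has_vector_derivative of_real (W0 x) * (amp \<sigma> x * wave \<kappa> x + cnj (amp \<sigma> x) * wave (- \<kappa>) x) * wave (- \<kappa>) x / (2 * \<i> * of_real \<kappa>)) (at x)" for x
      using amp[of \<sigma> x] by (simp only: deriv)
  qed (rule amp0, rule near)
qed

text \<open>The amplitudes of the perturbed waves solve a real linear equation that involves their complex conjugates,
  so their smoothness is obtained by raising the order of differentiability step by step.\<close>
lemma diff_upto_linear:
  assumes "open U" "bounded_linear h" "diff_upto n U f"
  shows "diff_upto n U (\<lambda>x. h (f x))"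
  using assms(3)
proof (induction n arbitrary: f)
  case 0
  then show ?case
    using bounded_linear.has_vector_derivative[OF assms(2) diff_uptoD[OF 0]]
    by (auto simp: diff_upto_0 intro: differentiableI_vector)
next
  case (Suc n)
  show ?case
    by (rule diff_upto_SucI[OF assms(1) bounded_linear.has_vector_derivative[OF assms(2) diff_uptoD[OF Suc.prems]]])
      (use Suc in \<open>auto simp: diff_upto_Suc[of n U f]\<close>)
qed

lemma diff_upto_cnj: "open U \<Longrightarrow> diff_upto n U f \<Longrightarrow> diff_upto n U (\<lambda>x. cnj (f x))"
  by (rule diff_upto_linear[OF _ bounded_linear_cnj])

lemma smooth_on_cnj: "open U \<Longrightarrow> smooth_on U f \<Longrightarrow> smooth_on U (\<lambda>x. cnj (f x))"
  by (rule smooth_on_linear[OF _ _ bounded_linear_cnj])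

lemma nth_deriv_mult_bound:
  fixes f g :: "real \<Rightarrow> complex"
  assumes "open U" "smooth_on U f" "smooth_on U g" "x \<in> U"
    and "\<And>j. j \<le> k \<Longrightarrow> norm (nth_deriv j f x) \<le> P" "\<And>j. j \<le> k \<Longrightarrow> norm (nth_deriv j g x) \<le> Q"
  shows "norm (nth_deriv k (\<lambda>x. f x * g x) x) \<le> fact k * of_nat (Suc k) * (P * Q)"
proof -
  have tc: "norm (taylor_coeff j h x) \<le> norm (nth_deriv j h x)" for j h
    by (simp add: taylor_coeff_def norm_divide divide_le_eq)
      (metis fact_ge_1 mult.right_neutral mult_left_mono norm_ge_zero)
  have P: "0 \<le> P" using assms(5)[of 0] order_trans[OF norm_ge_zero] by blast
  have "norm (taylor_coeff k (\<lambda>x. f x * g x) x) \<le> (\<Sum>j\<le>k. P * Q)"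
    unfolding taylor_coeff_mult[OF assms(1-4)]
  proof (rule order_trans[OF norm_sum sum_mono])
    fix j assume "j \<in> {..k}"
    then have "norm (taylor_coeff j f x) \<le> P" "norm (taylor_coeff (k - j) g x) \<le> Q"
      using order_trans[OF tc assms(5)[of j]] order_trans[OF tc assms(6)[of "k - j"]] by auto
    then show "norm (taylor_coeff j f x * taylor_coeff (k - j) g x) \<le> P * Q"
      unfolding norm_mult using P by (intro mult_mono) auto
  qed
  then have "fact k * norm (taylor_coeff k (\<lambda>x. f x * g x) x) \<le> fact k * (of_nat (Suc k) * (P * Q))"
    by (intro mult_left_mono) auto
  then show ?thesis by (simp add: nth_deriv_taylor_coeff norm_mult mult.assoc)
qed

text \<open>The estimate \<open>a_near\<close> is uniform in \<open>i\<close>; it bounds the amplitudes away from zero, and hence the growth rates \<open>c i\<close>.\<close>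
locale scattering = eigen_data +
  fixes W0 :: "real \<Rightarrow> real" and \<epsilon> :: real and a :: "nat \<Rightarrow> real \<Rightarrow> complex"
  assumes \<epsilon>: "0 < \<epsilon>" "\<epsilon> \<le> 1 / 2"
    and W0_smooth: "smooth_on UNIV (\<lambda>x. complex_of_real (W0 x))"
    and W0_support: "\<And>x. \<epsilon> \<le> \<bar>x\<bar> \<Longrightarrow> W0 x = 0"
    and a_0: "\<And>i. a i 0 = 1 / (2 * \<i>)"
    and a_deriv: "\<And>i x. (a i has_vector_derivative of_real (W0 x) *
        (a i x * wave (\<kappa> i) x + cnj (a i x) * wave (- \<kappa> i) x) * wave (- \<kappa> i) x / (2 * \<i> * of_real (\<kappa> i))) (at x)"
    and a_near: "\<And>i x. norm (a i x - 1 / (2 * \<i>)) \<le> 1 / 4"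
begin

lemma a_le: "norm (a i x) \<le> 3 / 4"
  using norm_triangle_ineq[of "a i x - 1 / (2 * \<i>)" "1 / (2 * \<i>)"] a_near[of i x] by (simp add: norm_divide norm_mult)

lemma a_ge: "1 / 4 \<le> norm (a i x)"
  using norm_triangle_ineq[of "1 / (2 * \<i>) - a i x" "a i x"] a_near[of i x] by (simp add: norm_divide norm_mult norm_minus_commute)

text \<open>The right hand side of the equation for the amplitude, with the two waves multiplied out.\<close>
definition "a' i x = of_real (W0 x) * ((a i x + cnj (a i x) * wave (- 2 * \<kappa> i) x) * (1 / (2 * \<i> * of_real (\<kappa> i))))"

lemma a_deriv': "(a i has_vector_derivative a' i x) (at x)"
proof -
  have "wave (- \<kappa> i) x * wave (- \<kappa> i) x = wave (- 2 * \<kappa> i) x" by (simp flip: wave_add)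
  then have "(a i x * wave (\<kappa> i) x + cnj (a i x) * wave (- \<kappa> i) x) * wave (- \<kappa> i) x = a i x + cnj (a i x) * wave (- 2 * \<kappa> i) x"
    by (simp add: distrib_right mult.assoc)
  then show ?thesis using a_deriv[of i x] by (simp add: a'_def mult.assoc)
qed

lemma a_diff_upto: "diff_upto n UNIV (a i)"
proof (induction n)
  case 0
  then show ?case using a_deriv' by (auto simp: diff_upto_0 intro: differentiableI_vector)
next
  case (Suc n)
  show ?case
    by (rule diff_upto_SucI[OF open_UNIV a_deriv'], unfold a'_def[abs_def])
      (intro diff_upto_mult diff_upto_add diff_upto_const open_UNIV Suc diff_upto_cnj,
       use W0_smooth smooth_on_wave in \<open>auto simp: smooth_on_iff_diff_upto\<close>)
qed

lemma a_smooth: "smooth_on U (a i)"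
  using a_diff_upto smooth_on_subset[of UNIV "a i" U] by (simp add: smooth_on_iff_diff_upto)

lemma a_nth_deriv: "nth_deriv (Suc k) (a i) x = nth_deriv k (a' i) x"
proof -
  have "smooth_on UNIV (a' i)"
    unfolding a'_def[abs_def]
    by (intro smooth_on_mult smooth_on_add smooth_on_const open_UNIV a_smooth smooth_on_cnj
        W0_smooth smooth_on_wave)
  from smooth_on_antideriv(2)[OF open_UNIV this a_deriv'] show ?thesis by simp
qed

lemma a_const: 
  assumes "\<epsilon> \<le> x" "\<epsilon> \<le> y"
  shows "a i x = a i y"
proof -
  have "norm (a i (y + (x - y)) - a i y) \<le> 0 * \<bar>x - y\<bar>"
  proof (rule norm_le_from_zero[of "\<lambda>t. a i (y + t) - a i y" _ "\<lambda>t. a' i (y + t)"])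
    fix t assume t: "t \<in> closed_segment 0 (x - y)"
    have "((a i \<circ> (\<lambda>t. y + t)) has_vector_derivative 1 *\<^sub>R a' i (y + t)) (at t)"
      by (rule vector_diff_chain_at) (auto intro!: derivative_eq_intros a_deriv')
    from has_vector_derivative_diff[OF this has_vector_derivative_const[of "a i y"]]
    show "((\<lambda>t. a i (y + t) - a i y) has_vector_derivative a' i (y + t)) (at t)"
      by (simp add: o_def)
    have "\<epsilon> \<le> y + t" using t assms by (auto simp: closed_segment_eq_real_ivl split: if_splits)
    then have "W0 (y + t) = 0" by (intro W0_support) linarith
    then show "norm (a' i (y + t)) \<le> 0" by (simp add: a'_def)
  qed simp
  then show ?thesis by simp
qed

text \<open>Each derivative costs further powers of \<open>\<kappa> i\<close> and \<open>1 / \<kappa> i\<close>, which the weights absorb.\<close>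
lemma a_nth_deriv_bound:
  "\<exists>C\<ge>0. \<exists>p. \<forall>j\<le>k. \<forall>i x. norm (nth_deriv j (a i) x) \<le> C * (1 + \<kappa> i + 1 / \<kappa> i) ^ p"
proof (induction k)
  case 0
  show ?case by (rule exI[of _ "3/4"], simp, rule exI[of _ 0]) (use a_le in simp)
next
  case (Suc k)
  define h where "h i = 1 + \<kappa> i + 1 / \<kappa> i" for i
  have h: "1 \<le> h i" "\<kappa> i \<le> h i" "1 / \<kappa> i \<le> h i" for i using \<kappa>_pos[of i] by (auto simp: h_def)
  obtain C p where C: "C \<ge> 0" "\<And>j i x. j \<le> k \<Longrightarrow> norm (nth_deriv j (a i) x) \<le> C * h i ^ p"
    using Suc unfolding h_def by blast
  have "\<exists>B\<ge>0. \<forall>x. norm (nth_deriv j (\<lambda>x. complex_of_real (W0 x)) x) \<le> B" for j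
    using smooth_compact_support_bounded[OF W0_smooth, of \<epsilon> j] W0_support by (metis of_real_0)
  then obtain B where B: "\<And>j. B j \<ge> 0" "\<And>j x. norm (nth_deriv j (\<lambda>x. complex_of_real (W0 x)) x) \<le> B j" by metis
  define BB where "BB = (\<Sum>j\<le>k. B j)"
  have BB: "BB \<ge> 0" "\<And>j. j \<le> k \<Longrightarrow> B j \<le> BB"
    unfolding BB_def using B(1) by (auto intro!: sum_nonneg member_le_sum)
  define c :: "nat \<Rightarrow> real" where "c m = fact m * of_nat (Suc m)" for m
  have c: "c m \<ge> 1" for m
  proof -
    have "1 * 1 \<le> fact m * real (Suc m)" by (intro mult_mono fact_ge_1) auto
    then show ?thesis by (simp add: c_def)
  qed
  have cmono: "c j \<le> c k" if "j \<le> k" for j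
    unfolding c_def using that by (intro mult_mono fact_mono) auto
  have D1: "norm (nth_deriv j (\<lambda>x. cnj (a i x) * wave (- 2 * \<kappa> i) x) x) \<le> c k * (C * h i ^ p * (2 ^ k * h i ^ k))" if "j \<le> k" for i x j
  proof -
    have "norm (nth_deriv j (\<lambda>x. cnj (a i x) * wave (- 2 * \<kappa> i) x) x) \<le> fact j * of_nat (Suc j) * (C * h i ^ p * (2 ^ k * h i ^ k))"
    proof (rule nth_deriv_mult_bound[OF open_UNIV])
      show "smooth_on UNIV (\<lambda>x. cnj (a i x))" by (intro smooth_on_cnj open_UNIV a_smooth)
      show "norm (nth_deriv l (\<lambda>x. cnj (a i x)) x) \<le> C * h i ^ p" if "l \<le> j" for l
        using C(2)[of l i x] that \<open>j \<le> k\<close> by (simp add: nth_deriv_linear[OF open_UNIV a_smooth bounded_linear_cnj])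
      show "norm (nth_deriv l (wave (- 2 * \<kappa> i)) x) \<le> 2 ^ k * h i ^ k" if "l \<le> j" for l
      proof -
        have "norm (nth_deriv l (wave (- 2 * \<kappa> i)) x) = (2 * \<kappa> i) ^ l"
          using \<kappa>_pos[of i] by (simp add: nth_deriv_wave norm_mult norm_power)
        also have "\<dots> \<le> (2 * h i) ^ l" using h(2)[of i] \<kappa>_pos[of i] by (intro power_mono) auto
        also have "\<dots> \<le> (2 * h i) ^ k" using h(1)[of i] that \<open>j \<le> k\<close> by (intro power_increasing) auto
        finally show ?thesis by (simp add: power_mult_distrib)
      qed
    qed (auto simp: smooth_on_wave)
    also have "\<dots> \<le> c k * (C * h i ^ p * (2 ^ k * h i ^ k))"
      using cmono[OF that] C(1) h(1)[of i] unfolding c_def[symmetric] by (intro mult_right_mono) auto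
    finally show ?thesis .
  qed
  define C1 where "C1 = C + c k * C * 2 ^ k"
  have C1: "C1 \<ge> 0" "C \<le> C1" using C(1) c[of k] by (auto simp: C1_def)
  have D2: "norm (nth_deriv j (\<lambda>x. a i x + cnj (a i x) * wave (- 2 * \<kappa> i) x) x) \<le> C1 * h i ^ (p + k)" if "j \<le> k" for i x j
  proof -
    have sm: "smooth_on UNIV (\<lambda>x. cnj (a i x) * wave (- 2 * \<kappa> i) x)"
      by (intro smooth_on_mult smooth_on_cnj open_UNIV a_smooth smooth_on_wave)
    have "norm (nth_deriv j (\<lambda>x. a i x + cnj (a i x) * wave (- 2 * \<kappa> i) x) x) \<le> C * h i ^ p + c k * (C * h i ^ p * (2 ^ k * h i ^ k))"
      unfolding nth_deriv_add[OF open_UNIV a_smooth sm UNIV_I]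
      by (intro order_trans[OF norm_triangle_ineq] add_mono C(2) D1 that)
    moreover have "C * h i ^ p \<le> C * h i ^ (p + k)"
      using C(1) h(1)[of i] by (intro mult_left_mono power_increasing) auto
    ultimately have "norm (nth_deriv j (\<lambda>x. a i x + cnj (a i x) * wave (- 2 * \<kappa> i) x) x)
        \<le> C * h i ^ (p + k) + c k * (C * h i ^ p * (2 ^ k * h i ^ k))" by linarith
    also have "\<dots> = C1 * h i ^ (p + k)" by (simp add: C1_def power_add algebra_simps)
    finally show ?thesis .
  qed
  have D3: "norm (nth_deriv j (a' i) x) \<le> c k * (BB * (C1 * h i ^ (p + k + 1)))" if "j \<le> k" for i x j
  proof -
    have sm: "smooth_on UNIV (\<lambda>x. a i x + cnj (a i x) * wave (- 2 * \<kappa> i) x)"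
      by (intro smooth_on_mult smooth_on_add smooth_on_cnj open_UNIV a_smooth smooth_on_wave)
    let ?k = "1 / (2 * \<i> * complex_of_real (\<kappa> i))"
    have smk: "smooth_on UNIV (\<lambda>x. (a i x + cnj (a i x) * wave (- 2 * \<kappa> i) x) * ?k)"
      using smooth_on_mult[OF open_UNIV sm smooth_on_const] .
    have "norm (nth_deriv j (\<lambda>x. of_real (W0 x) * ((a i x + cnj (a i x) * wave (- 2 * \<kappa> i) x) * ?k)) x)
        \<le> fact j * of_nat (Suc j) * (BB * (C1 * h i ^ (p + k + 1)))"
    proof (rule nth_deriv_mult_bound[OF open_UNIV W0_smooth smk UNIV_I])
      show "norm (nth_deriv l (\<lambda>x. complex_of_real (W0 x)) x) \<le> BB" if "l \<le> j" for l
        using B(2)[of l x] BB(2)[of l] that \<open>j \<le> k\<close> by linarith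
      show "norm (nth_deriv l (\<lambda>x. (a i x + cnj (a i x) * wave (- 2 * \<kappa> i) x) * ?k) x) \<le> C1 * h i ^ (p + k + 1)" if "l \<le> j" for l
      proof -
        have "norm (nth_deriv l (\<lambda>x. ?k * (a i x + cnj (a i x) * wave (- 2 * \<kappa> i) x)) x) \<le> h i * (C1 * h i ^ (p + k))"
          unfolding nth_deriv_cmult[OF open_UNIV sm UNIV_I] norm_mult
        proof (intro mult_mono D2)
          show "norm ?k \<le> h i" using h(3)[of i] h(1)[of i] \<kappa>_pos[of i] by (simp add: norm_divide norm_mult field_simps)
        qed (use that \<open>j \<le> k\<close> h(1)[of i] in auto)
        then show ?thesis by (simp add: mult_ac)
      qed
    qed
    also have "\<dots> \<le> c k * (BB * (C1 * h i ^ (p + k + 1)))"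
      using cmono[OF that] BB(1) C1 h(1)[of i] unfolding c_def[symmetric] by (intro mult_right_mono) auto
    finally show ?thesis by (simp add: a'_def[abs_def])
  qed
  have "norm (nth_deriv j (a i) x) \<le> (C + c k * BB * C1) * h i ^ (p + k + 1)" if "j \<le> Suc k" for i x j
  proof (cases j)
    case 0
    have "norm (nth_deriv 0 (a i) x) \<le> C * h i ^ p" by (rule C(2)) simp
    also have "\<dots> \<le> C * h i ^ (p + k + 1)" using C(1) h(1)[of i] by (intro mult_left_mono power_increasing) auto
    also have "\<dots> \<le> (C + c k * BB * C1) * h i ^ (p + k + 1)"
      using c[of k] BB(1) C1(1) h(1)[of i] by (intro mult_right_mono) auto
    finally show ?thesis using 0 by simp
  next
    case (Suc l)
    then have "norm (nth_deriv j (a i) x) \<le> (c k * BB * C1) * h i ^ (p + k + 1)"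
      using D3[of l i x] that by (simp add: a_nth_deriv mult_ac)
    also have "\<dots> \<le> (C + c k * BB * C1) * h i ^ (p + k + 1)"
      using C(1) h(1)[of i] by (intro mult_right_mono) auto
    finally show ?thesis .
  qed
  moreover have "C + c k * BB * C1 \<ge> 0" using C(1) c[of k] BB(1) C1(1) by auto
  ultimately show ?case unfolding h_def by blast
qed

lemma symbols_a: "symbols (\<lambda>x. 1 + \<bar>x\<bar>) {-1<..} a (\<lambda>i. 1 / v i)"
proof (rule symbolsI)
  fix k
  obtain C p where C: "C \<ge> 0" "\<And>i x. norm (nth_deriv k (a i) x) \<le> C * (1 + \<kappa> i + 1 / \<kappa> i) ^ p"
    using a_nth_deriv_bound[of k] by blast
  obtain D where D: "D \<ge> 0" "\<And>i. (1 + \<kappa> i + 1 / \<kappa> i) ^ p \<le> D / v i" using tame by blast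
  have le: "norm (nth_deriv k (a i) x) \<le> (C * D) * (1 / v i)" for i x
    using C(2)[of i x] mult_left_mono[OF D(2)[of i] C(1)] by simp
  have "(1 + \<bar>x\<bar>) ^ k * norm (nth_deriv k (a i) x) \<le> (2 ^ k * (C * D)) * (1 / v i)" for i x
  proof (cases "\<bar>x\<bar> \<le> 1 \<or> k = 0")
    case True
    then have "(1 + \<bar>x\<bar>) ^ k \<le> 2 ^ k" by (cases "k = 0") (auto intro!: power_mono)
    then have "(1 + \<bar>x\<bar>) ^ k * norm (nth_deriv k (a i) x) \<le> 2 ^ k * ((C * D) * (1 / v i))"
      using le by (intro mult_mono) auto
    then show ?thesis by simp
  next
    case False
    then obtain l where l: "k = Suc l" by (cases k) auto
    have "open ({..<-\<epsilon>} \<union> {\<epsilon><..})" by auto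
    then have "nth_deriv l (a' i) x = nth_deriv l (\<lambda>_. 0) x"
      by (rule nth_deriv_cong) (use False \<epsilon> W0_support in \<open>auto simp: a'_def\<close>)
    then have "nth_deriv k (a i) x = 0" by (simp add: l a_nth_deriv nth_deriv_const)
    then show ?thesis using C(1) D(1) v_pos[of i] by simp
  qed
  then show "\<exists>C\<ge>0. \<forall>i. \<forall>x\<in>{-1<..}. (1 + \<bar>x\<bar>) ^ k * norm (nth_deriv k (a i) x) \<le> C * (1 / v i)"
    using C(1) D(1) by (intro exI[of _ "2 ^ k * (C * D)"]) auto
qed (use less_imp_le[OF v_pos] a_smooth in auto)

end

section \<open>The Gram matrix on the half line\<close>

lemma symbols_if:
  fixes f g :: "'i \<Rightarrow> real \<Rightarrow> complex"
  assumes "symbols r U f w" "symbols r U g w"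
  shows "symbols r U (\<lambda>(i, b::bool) x. if b then f i x else g i x) (\<lambda>(i, b). w i)"
proof -
  define h where "h p = (if snd p then f (fst p) else g (fst p))" for p :: "'i \<times> bool"
  have "symbols r U h (\<lambda>p. w (fst p))"
  proof (rule symbolsI)
    fix k
    obtain C where C: "C \<ge> 0" "\<And>i x. x \<in> U \<Longrightarrow> r x ^ k * norm (nth_deriv k (f i) x) \<le> C * w i"
      using symbols_bound[OF assms(1)] by blast
    obtain D where D: "D \<ge> 0" "\<And>i x. x \<in> U \<Longrightarrow> r x ^ k * norm (nth_deriv k (g i) x) \<le> D * w i"
      using symbols_bound[OF assms(2)] by blast
    have "r x ^ k * norm (nth_deriv k (h p) x) \<le> (C + D) * w (fst p)" if "x \<in> U" for p x
      using C(2)[OF that, of "fst p"] D(2)[OF that, of "fst p"] mult_nonneg_nonneg[OF C(1) symbols_nonneg[OF assms(1), of "fst p"]]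
        mult_nonneg_nonneg[OF D(1) symbols_nonneg[OF assms(1), of "fst p"]]
      by (simp add: h_def distrib_right)
    then show "\<exists>C\<ge>0. \<forall>p. \<forall>x\<in>U. r x ^ k * norm (nth_deriv k (h p) x) \<le> C * w (fst p)"
      using C(1) D(1) by (intro exI[of _ "C + D"]) simp
  next
    show "smooth_on U (h p)" for p
      using symbols_smooth[OF assms(1)] symbols_smooth[OF assms(2)] by (simp add: h_def)
  qed (rule symbols_nonneg[OF assms(1)])
  moreover have "(\<lambda>(i, b) x. if b then f i x else g i x) = h"
    by (rule ext) (simp add: h_def case_prod_unfold)
  moreover have "(\<lambda>(i, b). w i) = (\<lambda>p :: 'i \<times> bool. w (fst p))" by (rule ext) (simp add: case_prod_unfold)
  ultimately show ?thesis by (simp only:)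
qed

text \<open>The derivatives live on a bounded set, where the weight \<open>1 + \<bar>x\<bar>\<close> costs only a constant.\<close>
lemma symbols_eventually_const:
  assumes f: "symbols (\<lambda>_. 1) {-1<..<2} f w" and const: "\<And>i x. 1 \<le> x \<Longrightarrow> f i x = f i 1"
  shows "symbols (\<lambda>x. 1 + \<bar>x\<bar>) {-1<..} f w"
proof (rule symbolsI)
  have D: "nth_deriv k (f i) x = (if k = 0 then f i 1 else 0)" if "1 < x" for k i x
  proof -
    have "nth_deriv k (f i) x = nth_deriv k (\<lambda>_. f i 1) x"
      by (rule nth_deriv_cong[of "{1<..}"], simp, rule const, simp, use that in simp)
    then show ?thesis by (simp add: nth_deriv_const)
  qed
  show "smooth_on {-1<..} (f i)" for i
  proof -
    have "smooth_on {1<..} (f i)"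
      by (subst smooth_on_cong[of "{1<..}" "f i" "\<lambda>_. f i 1"], simp, rule const, simp, rule smooth_on_const)
    from smooth_on_Un[OF symbols_smooth[OF f, of i] this]
    show ?thesis by (rule smooth_on_subset) auto
  qed
  show "0 \<le> w i" for i by (rule symbols_nonneg[OF f])
  fix k
  obtain C where C: "C \<ge> 0" "\<And>i x. x \<in> {-1<..<2} \<Longrightarrow> norm (nth_deriv k (f i) x) \<le> C * w i"
    using symbols_bound[OF f, of k] by auto
  have "(1 + \<bar>x\<bar>) ^ k * norm (nth_deriv k (f i) x) \<le> (3 ^ k * C) * w i" if "-1 < x" for i x
  proof (cases "x < 2")
    case True
    then have "(1 + \<bar>x\<bar>) ^ k \<le> 3 ^ k" using that by (intro power_mono) auto
    then have "(1 + \<bar>x\<bar>) ^ k * norm (nth_deriv k (f i) x) \<le> 3 ^ k * (C * w i)"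
      using C(2)[of x i] True that by (intro mult_mono) auto
    then show ?thesis by simp
  next
    case False
    show ?thesis
    proof (cases "k = 0")
      case True
      then show ?thesis using C(2)[of 1 i] const[of x i] False by simp
    qed (use D False C(1) symbols_nonneg[OF f, of i] in auto)
  qed
  then show "\<exists>C\<ge>0. \<forall>i. \<forall>x\<in>{-1<..}. (1 + \<bar>x\<bar>) ^ k * norm (nth_deriv k (f i) x) \<le> C * w i"
    using C(1) by (intro exI[of _ "3 ^ k * C"]) auto
qed

text \<open>The bound is uniform although the scale \<open>1 / c i\<close> is not: every derivative produces a factor
  \<open>c i / (1 + c i * x)\<close>, which is at most a constant times \<open>1 / (1 + \<bar>x\<bar>)\<close>.\<close>
lemma symbols_inverse_linear:
  fixes c :: "'i \<Rightarrow> real"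
  assumes c: "\<And>i. 0 \<le> c i" "\<And>i. c i \<le> 1 / 4"
  shows "symbols (\<lambda>x. 1 + \<bar>x\<bar>) {-1<..} (\<lambda>i x. 1 / of_real (1 + c i * x)) (\<lambda>_. 1)"
proof -
  have pos: "1 / 2 \<le> 1 + c i * x" and le: "(1 + \<bar>x\<bar>) * c i \<le> 1 + c i * x" if "-1 < x" for x i
  proof -
    have "c i * (-1) \<le> c i * x" using that c by (intro mult_left_mono) auto
    then show "1 / 2 \<le> 1 + c i * x" using c(2)[of i] by linarith
    have "\<bar>x\<bar> * c i \<le> c i * x + 2 * c i"
    proof -
      have "(\<bar>x\<bar> - x) * c i \<le> 2 * c i" using that c by (intro mult_right_mono) auto
      then show ?thesis by (simp add: algebra_simps)
    qed
    then show "(1 + \<bar>x\<bar>) * c i \<le> 1 + c i * x" using c(2)[of i] by (simp add: distrib_right)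
  qed
  define F where "F i k x = complex_of_real (fact k * (- c i) ^ k * inverse (1 + c i * x) ^ Suc k)" for i k x
  have "(F i k has_vector_derivative F i (Suc k) x) (at x)" if "x \<in> {-1<..}" for i k x
  proof -
    have "1 + c i * x \<noteq> 0" using pos[of x i] that by auto
    then have "((\<lambda>x. fact k * (- c i) ^ k * inverse (1 + c i * x) ^ Suc k) has_real_derivative
        fact k * (- c i) ^ k * (of_nat (Suc k) * inverse (1 + c i * x) ^ k * (- (inverse (1 + c i * x) * c i * inverse (1 + c i * x))))) (at x)"
      by (auto intro!: derivative_eq_intros simp del: power_Suc of_nat_Suc)
    also have "fact k * (- c i) ^ k * (of_nat (Suc k) * inverse (1 + c i * x) ^ k * (- (inverse (1 + c i * x) * c i * inverse (1 + c i * x))))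
       = fact (Suc k) * (- c i) ^ Suc k * inverse (1 + c i * x) ^ Suc (Suc k)"
      by (simp add: mult_ac del: of_nat_Suc)
    finally show ?thesis
      unfolding F_def has_real_derivative_iff_has_vector_derivative
      by (rule bounded_linear.has_vector_derivative[OF bounded_linear_of_real])
  qed
  from smooth_on_tower_eq[of "{-1<..}" "F i" "\<lambda>x. 1 / of_real (1 + c i * x)" for i, OF _ _ this]
  have sm: "smooth_on {-1<..} (\<lambda>x. 1 / complex_of_real (1 + c i * x))"
    and nd: "x \<in> {-1<..} \<Longrightarrow> nth_deriv k (\<lambda>x. 1 / complex_of_real (1 + c i * x)) x = F i k x" for i k x
    by (auto simp: F_def fun_eq_iff divide_inverse)
  show ?thesis
  proof (rule symbolsI)
    fix k
    have "(1 + \<bar>x\<bar>) ^ k * norm (F i k x) \<le> (2 * fact k) * 1" if "-1 < x" for i x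
    proof -
      have p: "0 < 1 + c i * x" using pos[OF that, of i] by linarith
      have "(1 + \<bar>x\<bar>) ^ k * norm (F i k x) = fact k * (((1 + \<bar>x\<bar>) * c i) * inverse (1 + c i * x)) ^ k * inverse (1 + c i * x)"
        using p c(1)[of i] unfolding F_def norm_of_real
        by (simp add: abs_mult power_abs power_mult_distrib mult_ac)
      also have "\<dots> \<le> fact k * 1 * 2"
      proof (intro mult_mono power_le_one)
        show "(1 + \<bar>x\<bar>) * c i * inverse (1 + c i * x) \<le> 1"
          using le[OF that, of i] p by (simp add: divide_inverse[symmetric])
        show "inverse (1 + c i * x) \<le> 2"
          using le_imp_inverse_le[OF pos[OF that, of i]] by simp
      qed (use p c(1)[of i] in auto)
      finally show ?thesis by simp
    qed
    note bound = this
    show "\<exists>C\<ge>0. \<forall>i. \<forall>x\<in>{-1<..}. (1 + \<bar>x\<bar>) ^ k * norm (nth_deriv k (\<lambda>x. 1 / complex_of_real (1 + c i * x)) x) \<le> C * 1"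
    proof (intro exI[of _ "2 * fact k"] conjI allI ballI)
      fix i and x :: real assume x: "x \<in> {-1<..}"
      show "(1 + \<bar>x\<bar>) ^ k * norm (nth_deriv k (\<lambda>x. 1 / complex_of_real (1 + c i * x)) x) \<le> 2 * fact k * 1"
        unfolding nd[OF x] using bound x by simp
    qed simp
  qed (use sm in auto)
qed

context scattering
begin

definition s :: "nat \<Rightarrow> real \<Rightarrow> complex" where
  "s i x = of_real (\<gamma> i) * (a i x * wave (\<kappa> i) x + cnj (a i x) * wave (- \<kappa> i) x)"

lemma cnj_s [simp]: "cnj (s i x) = s i x"
  by (simp add: s_def cnj_wave)

lemma s_0 [simp]: "s i 0 = 0"
  by (simp add: s_def a_0)

lemma s_smooth: "smooth_on U (s i)"
proof -
  have "smooth_on UNIV (s i)"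
    unfolding s_def[abs_def] by (intro smooth_on_cmult smooth_on_mult smooth_on_add smooth_on_cnj a_smooth smooth_on_wave open_UNIV)
  then show ?thesis by (rule smooth_on_subset) auto
qed

lemma a'_wave:
  "a' i x * wave (\<kappa> i) x = - \<i> * of_real (W0 x * Re (a i x * wave (\<kappa> i) x) / \<kappa> i)"
proof -
  have e: "a' i x = of_real (W0 x) * (a i x * wave (\<kappa> i) x + cnj (a i x) * wave (- \<kappa> i) x) * wave (- \<kappa> i) x / (2 * \<i> * of_real (\<kappa> i))"
    by (rule vector_derivative_unique_at[OF a_deriv' a_deriv])
  define R where "R = Re (a i x * wave (\<kappa> i) x)"
  have S: "a i x * wave (\<kappa> i) x + cnj (a i x) * wave (- \<kappa> i) x = of_real (2 * R)"
    using complex_add_cnj[of "a i x * wave (\<kappa> i) x"] by (simp add: cnj_wave R_def)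
  have "X * wave (- \<kappa> i) x / k * wave (\<kappa> i) x = X / k" for X k
    by (simp add: mult.assoc)
  then have "a' i x * wave (\<kappa> i) x = of_real (W0 x) * of_real (2 * R) / (2 * \<i> * of_real (\<kappa> i))"
    unfolding e S by blast
  also have "\<dots> = - \<i> * of_real (W0 x * R / \<kappa> i)"
    using \<kappa>_pos[of i] by (simp add: complex_eq_iff Re_divide Im_divide power2_eq_square)
  finally show ?thesis unfolding R_def .
qed

lemma s_derivative: "(s i has_vector_derivative of_real (\<gamma> i) * (\<i> * of_real (\<kappa> i) * (a i x * wave (\<kappa> i) x - cnj (a i x) * wave (- \<kappa> i) x))) (at x)"
proof -
  let ?P = "a' i x * wave (\<kappa> i) x"
  have c: "((\<lambda>x. cnj (a i x)) has_vector_derivative cnj (a' i x)) (at x)"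
    by (rule bounded_linear.has_vector_derivative[OF bounded_linear_cnj a_deriv'])
  have D: "(s i has_vector_derivative of_real (\<gamma> i) * ((a i x * (\<i> * of_real (\<kappa> i) * wave (\<kappa> i) x) + a' i x * wave (\<kappa> i) x)
     + (cnj (a i x) * (\<i> * of_real (- \<kappa> i) * wave (- \<kappa> i) x) + cnj (a' i x) * wave (- \<kappa> i) x))) (at x)"
    unfolding s_def[abs_def]
    by (intro has_vector_derivative_mult_right has_vector_derivative_add has_vector_derivative_mult a_deriv' c wave_has_derivative)
  have C: "cnj (a' i x) * wave (- \<kappa> i) x = - ?P"
  proof -
    have "cnj (a' i x) * wave (- \<kappa> i) x = cnj ?P" by (simp add: cnj_wave)
    also have "\<dots> = - ?P" unfolding a'_wave by simp
    finally show ?thesis .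
  qed
  show ?thesis using D unfolding C by (simp add: algebra_simps)
qed

lemma s_deriv1: "nth_deriv 1 (s i) x = of_real (\<gamma> i) * (\<i> * of_real (\<kappa> i) * (a i x * wave (\<kappa> i) x - cnj (a i x) * wave (- \<kappa> i) x))"
  using s_derivative[of i x] by (simp add: nth_deriv_Suc vector_derivative_at)

lemma s_deriv2: "nth_deriv 2 (s i) x = (of_real (W0 x) - of_real ((\<kappa> i)\<^sup>2)) * s i x"
proof -
  let ?P = "a' i x * wave (\<kappa> i) x"
  have c: "((\<lambda>x. cnj (a i x)) has_vector_derivative cnj (a' i x)) (at x)"
    by (rule bounded_linear.has_vector_derivative[OF bounded_linear_cnj a_deriv'])
  have "((\<lambda>x. of_real (\<gamma> i) * (\<i> * of_real (\<kappa> i) * (a i x * wave (\<kappa> i) x - cnj (a i x) * wave (- \<kappa> i) x))) has_vector_derivative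
     of_real (\<gamma> i) * (\<i> * of_real (\<kappa> i) * ((a i x * (\<i> * of_real (\<kappa> i) * wave (\<kappa> i) x) + a' i x * wave (\<kappa> i) x)
     - (cnj (a i x) * (\<i> * of_real (- \<kappa> i) * wave (- \<kappa> i) x) + cnj (a' i x) * wave (- \<kappa> i) x)))) (at x)"
    by (intro has_vector_derivative_mult_right has_vector_derivative_diff has_vector_derivative_mult a_deriv' c wave_has_derivative)
  moreover have "nth_deriv 1 (s i) = (\<lambda>x. of_real (\<gamma> i) * (\<i> * of_real (\<kappa> i) * (a i x * wave (\<kappa> i) x - cnj (a i x) * wave (- \<kappa> i) x)))"
    using s_deriv1 by auto
  ultimately have "nth_deriv 2 (s i) x = of_real (\<gamma> i) * (\<i> * of_real (\<kappa> i) * ((a i x * (\<i> * of_real (\<kappa> i) * wave (\<kappa> i) x) + a' i x * wave (\<kappa> i) x)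
     - (cnj (a i x) * (\<i> * of_real (- \<kappa> i) * wave (- \<kappa> i) x) + cnj (a' i x) * wave (- \<kappa> i) x)))"
    by (simp add: numeral_2_eq_2 nth_deriv_Suc[of "Suc 0"] vector_derivative_at)
  also have "cnj (a' i x) * wave (- \<kappa> i) x = cnj ?P" by (simp add: cnj_wave)
  also have "of_real (\<gamma> i) * (\<i> * of_real (\<kappa> i) * ((a i x * (\<i> * of_real (\<kappa> i) * wave (\<kappa> i) x) + ?P)
     - (cnj (a i x) * (\<i> * of_real (- \<kappa> i) * wave (- \<kappa> i) x) + cnj ?P)))
     = of_real (\<gamma> i) * (\<i> * of_real (\<kappa> i)) * (?P - cnj ?P) - of_real ((\<kappa> i)\<^sup>2) * s i x"
    by (simp add: s_def algebra_simps power2_eq_square)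
  also have "of_real (\<gamma> i) * (\<i> * of_real (\<kappa> i)) * (?P - cnj ?P) = of_real (W0 x) * s i x"
  proof -
    define R where "R = Re (a i x * wave (\<kappa> i) x)"
    have 1: "s i x = of_real (\<gamma> i) * of_real (2 * R)"
      using complex_add_cnj[of "a i x * wave (\<kappa> i) x"] by (simp add: cnj_wave s_def R_def)
    have 2: "?P - cnj ?P = - 2 * \<i> * of_real (W0 x * R / \<kappa> i)"
      unfolding a'_wave R_def by simp
    show ?thesis unfolding 1 2 using \<kappa>_pos[of i] by (simp add: complex_eq_iff)
  qed
  finally show ?thesis by (simp add: left_diff_distrib)
qed

lemma s_deriv1_0: "nth_deriv 1 (s i) 0 = of_real (\<gamma> i * \<kappa> i)"
  unfolding s_deriv1 a_0 by (simp add: complex_eq_iff)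

lemma norm_s_le: "norm (s i x) \<le> 3 / 2 * \<gamma> i"
proof -
  have "norm (s i x) \<le> \<gamma> i * (norm (a i x) + norm (a i x))"
    using \<gamma>_pos[of i] by (auto simp: s_def norm_mult intro!: mult_left_mono order_trans[OF norm_triangle_ineq])
  also have "\<dots> \<le> \<gamma> i * (3 / 4 + 3 / 4)"
    using \<gamma>_pos[of i] by (intro mult_left_mono add_mono a_le) auto
  finally show ?thesis by simp
qed

lemma symbols_a1: "symbols (\<lambda>_. 1) {-1<..} a (\<lambda>i. 1 / v i)"
  by (rule symbols_subset[OF symbols_a]) auto

lemma symbols_s: "symbols (\<lambda>_. 1) {-1<..} s (\<lambda>i. v i ^ 4)"
proof -
  have "symbols (\<lambda>_. 1) {-1<..} (\<lambda>i x. a i x * wave (1 * \<kappa> i) x + cnj (a i x) * wave ((-1) * \<kappa> i) x) (\<lambda>i. 1 / v i * (1 / v i))"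
    by (intro symbols_add symbols_mult symbols_cnj symbols_a1 symbols_wave_\<kappa>) auto
  from symbols_cmult[OF _ this, of "\<lambda>i. of_real (\<gamma> i)"]
  have "symbols (\<lambda>_. 1) {-1<..} s (\<lambda>i. norm (complex_of_real (\<gamma> i)) * (1 / v i * (1 / v i)))"
    by (simp add: s_def[abs_def])
  then show ?thesis
  proof (rule symbols_weight[OF _ less_imp_le[OF \<delta>(1)]])
    show "norm (complex_of_real (\<gamma> i)) * (1 / v i * (1 / v i)) \<le> \<delta> * v i ^ 4" for i
      unfolding norm_of_real abs_of_pos[OF \<gamma>_pos] using v_pos[of i] by (simp add: \<gamma>_def power_numeral_reduce)
  qed (use less_imp_le[OF v_pos] in auto)
qed

definition gram :: "nat \<Rightarrow> nat \<Rightarrow> real \<Rightarrow> complex" where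
  "gram i j = primitive (\<lambda>x. s i x * s j x)"

lemma gram_0 [simp]: "gram i j 0 = 0"
  by (simp add: gram_def)

lemma gram_derivative: "(gram i j has_vector_derivative s i x * s j x) (at x)"
proof -
  have "continuous_on UNIV (\<lambda>x. s i x * s j x)"
    using smooth_on_continuous[OF s_smooth, of UNIV 0] by (auto intro!: continuous_intros)
  then show ?thesis unfolding gram_def by (rule primitive_has_derivative)
qed

lemma gram_wronskian: "(of_real ((\<kappa> i)\<^sup>2) - of_real ((\<kappa> j)\<^sup>2)) * gram i j x = s i x * nth_deriv 1 (s j) x - nth_deriv 1 (s i) x * s j x"
  by (rule wronskian_gram[OF open_UNIV convex_UNIV UNIV_I UNIV_I s_smooth s_smooth s_0 s_0 s_deriv2 s_deriv2 gram_0 gram_derivative])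

definition sg :: "bool \<Rightarrow> real" where "sg b = (if b then 1 else -1)"

definition amp :: "nat \<Rightarrow> bool \<Rightarrow> real \<Rightarrow> complex" where
  "amp i b x = (if b then a i x else cnj (a i x))"

text \<open>The mean value of the square of \<open>s i\<close> beyond the support of \<open>W0\<close>, where the amplitude is constant.\<close>
definition c :: "nat \<Rightarrow> real" where
  "c i = 2 * (\<gamma> i)\<^sup>2 * (norm (a i \<epsilon>))\<^sup>2"

lemma c_pos: "0 < c i"
  using a_ge[of i \<epsilon>] \<gamma>_pos[of i] by (auto simp: c_def intro!: mult_pos_pos)

lemma \<gamma>_mult_le: "\<gamma> i * \<gamma> j \<le> \<delta>\<^sup>2 * (v i ^ 6 * v j ^ 6)"
  by (simp add: \<gamma>_def power2_eq_square mult_ac)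

lemma \<delta>2_le: "\<delta>\<^sup>2 \<le> 1 / 1000"
proof -
  have "\<delta>\<^sup>2 \<le> \<delta>\<^sup>2 * Cg" using mult_left_mono[OF Cg(1), of "\<delta>\<^sup>2"] by simp
  also have "\<dots> \<le> A / 250" by (rule \<delta>_A)
  also have "A \<le> 1 / 4" using vs_nonneg by (simp add: A_def divide_le_eq)
  finally show ?thesis by simp
qed

lemma \<gamma>2_le: "(\<gamma> i)\<^sup>2 \<le> 1 / 1000"
proof -
  have "(\<gamma> i)\<^sup>2 \<le> \<delta>\<^sup>2 * (v i ^ 6 * v i ^ 6)" using \<gamma>_mult_le[of i i] by (simp add: power2_eq_square)
  also have "\<dots> \<le> \<delta>\<^sup>2 * (1 * 1)" using v_power_le_1 less_imp_le[OF v_pos] by (intro mult_left_mono mult_mono) auto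
  finally show ?thesis using \<delta>2_le by simp
qed

lemma a2_le: "(norm (a i x))\<^sup>2 \<le> 9 / 16"
  using power_mono[OF a_le[of i x], of 2] by (simp add: power2_eq_square)

lemma c_le: "c i \<le> 9 / 8 * (\<gamma> i)\<^sup>2" "c i \<le> 1 / 4"
proof -
  show *: "c i \<le> 9 / 8 * (\<gamma> i)\<^sup>2"
    using mult_left_mono[OF a2_le[of i \<epsilon>], of "2 * (\<gamma> i)\<^sup>2"] by (simp add: c_def)
  show "c i \<le> 1 / 4" using * \<gamma>2_le[of i] by simp
qed

text \<open>The coefficient of \<open>wave (sg \<sigma> * \<kappa> i + sg \<tau> * \<kappa> j)\<close> in the Gram matrix, except that the
  two resonant diagonal coefficients are not oscillatory.\<close>
definition osc :: "nat \<Rightarrow> nat \<Rightarrow> bool \<Rightarrow> bool \<Rightarrow> complex" where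
  "osc i j \<sigma> \<tau> = (if i \<noteq> j \<or> \<sigma> = \<tau> then of_real (\<gamma> i * \<gamma> j) / (\<i> * of_real (sg \<sigma> * \<kappa> i + sg \<tau> * \<kappa> j)) else 0)"

text \<open>The value at \<open>x\<close> is what is left of the diagonal Gram function after its linear growth and its oscillation with
  frequency \<open>2 * \<kappa> i\<close>; it is constant beyond \<open>\<epsilon>\<close>.\<close>
definition rem :: "nat \<Rightarrow> real \<Rightarrow> complex" where
  "rem i x = gram i i x - of_real (c i * x)
    - (\<Sum>\<sigma>\<in>UNIV. osc i i \<sigma> \<sigma> * (amp i \<sigma> x * amp i \<sigma> x) * wave (sg \<sigma> * \<kappa> i + sg \<sigma> * \<kappa> i) x)"

text \<open>The remainder is attributed to the resonant pair of signs \<open>(+, -)\<close>, whose wave is \<open>1\<close> on the diagonal.\<close>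
definition b :: "nat \<Rightarrow> nat \<Rightarrow> bool \<Rightarrow> bool \<Rightarrow> real \<Rightarrow> complex" where
  "b i j \<sigma> \<tau> x = osc i j \<sigma> \<tau> * (amp i \<sigma> x * amp j \<tau> x) + (if i = j \<and> \<sigma> \<and> \<not> \<tau> then 1 else 0) * rem i x"

lemma sum_bool: "(\<Sum>\<sigma>\<in>UNIV. f \<sigma>) = f True + f False" for f :: "bool \<Rightarrow> 'a::comm_monoid_add"
  by (simp add: UNIV_bool add.commute)

text \<open>Off the diagonal this is the Wronskian identity for \<open>(\<kappa> i\<^sup>2 - \<kappa> j\<^sup>2) * gram i j\<close> with the solutions and their first
  derivatives written as waves; on the diagonal it is the definition of \<open>rem\<close>.\<close>
lemma gram_expansion:
  "gram i j x = (\<Sum>\<sigma>\<in>UNIV. \<Sum>\<tau>\<in>UNIV. b i j \<sigma> \<tau> x * wave (sg \<sigma> * \<kappa> i + sg \<tau> * \<kappa> j) x) + (if i = j then of_real (c i * x) else 0)"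
proof (cases "i = j")
  case True
  then show ?thesis by (simp add: sum_bool b_def rem_def osc_def sg_def)
next
  case False
  then have ne: "\<kappa> i \<noteq> \<kappa> j" using \<kappa>_inj by (auto simp: inj_def)
  define K L where "K = complex_of_real (\<kappa> i)" and "L = complex_of_real (\<kappa> j)"
  have KL: "K - L \<noteq> 0" "K + L \<noteq> 0"
    using ne \<kappa>_pos[of i] \<kappa>_pos[of j] by (auto simp: K_def L_def simp flip: of_real_add of_real_diff)
  define P P' Q Q' where "P = a i x * wave (\<kappa> i) x" and "P' = cnj (a i x) * wave (- \<kappa> i) x"
    and "Q = a j x * wave (\<kappa> j) x" and "Q' = cnj (a j x) * wave (- \<kappa> j) x"
  define g where "g = complex_of_real (\<gamma> i) * complex_of_real (\<gamma> j)"
  have w: "wave (\<kappa> i + \<kappa> j) x = wave (\<kappa> i) x * wave (\<kappa> j) x" "wave (\<kappa> i - \<kappa> j) x = wave (\<kappa> i) x * wave (- \<kappa> j) x"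
    "wave (\<kappa> j - \<kappa> i) x = wave (- \<kappa> i) x * wave (\<kappa> j) x" "wave (- \<kappa> i - \<kappa> j) x = wave (- \<kappa> i) x * wave (- \<kappa> j) x"
    by (simp_all flip: wave_add)
  have "(\<Sum>\<sigma>\<in>UNIV. \<Sum>\<tau>\<in>UNIV. b i j \<sigma> \<tau> x * wave (sg \<sigma> * \<kappa> i + sg \<tau> * \<kappa> j) x)
      = g / (\<i> * (K + L)) * (P * Q) + g / (\<i> * (K - L)) * (P * Q') + (g / (\<i> * (L - K)) * (P' * Q) + g / (\<i> * (- K - L)) * (P' * Q'))"
    using False by (simp add: sum_bool b_def osc_def sg_def amp_def g_def K_def L_def P_def P'_def Q_def Q'_def w mult_ac)
  also have "\<dots> = (- \<i> * g / (K + L)) * (P * Q - P' * Q') + (- \<i> * g / (K - L)) * (P * Q' - P' * Q)"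
  proof -
    have 1: "g / (\<i> * z) = - \<i> * g / z" for z by (simp add: divide_inverse)
    have 2: "g / (\<i> * (L - K)) = \<i> * g / (K - L)" "g / (\<i> * (- K - L)) = \<i> * g / (K + L)"
    proof -
      have 3: "g / (\<i> * (- z)) = \<i> * g / z" for z unfolding 1 by simp
      show "g / (\<i> * (L - K)) = \<i> * g / (K - L)" "g / (\<i> * (- K - L)) = \<i> * g / (K + L)"
        using 3[of "K - L"] 3[of "K + L"] by simp_all
    qed
    show ?thesis unfolding 2 unfolding 1 by (simp add: algebra_simps diff_divide_distrib)
  qed
  finally have e: "(\<Sum>\<sigma>\<in>UNIV. \<Sum>\<tau>\<in>UNIV. b i j \<sigma> \<tau> x * wave (sg \<sigma> * \<kappa> i + sg \<tau> * \<kappa> j) x)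
      = (- \<i> * g / (K + L)) * (P * Q - P' * Q') + (- \<i> * g / (K - L)) * (P * Q' - P' * Q)" .
  have "((K + L) * (K - L)) * gram i j x = - \<i> * g * ((K - L) * (P * Q - P' * Q') + (K + L) * (P * Q' - P' * Q))"
  proof -
    have "((K + L) * (K - L)) * gram i j x = s i x * nth_deriv 1 (s j) x - nth_deriv 1 (s i) x * s j x"
      using gram_wronskian[of i j x] by (simp add: K_def L_def power2_eq_square algebra_simps)
    also have "\<dots> = g * \<i> * ((P + P') * (L * (Q - Q')) - K * (P - P') * (Q + Q'))"
      unfolding s_deriv1 by (simp add: s_def g_def P_def P'_def Q_def Q'_def K_def L_def algebra_simps)
    also have "\<dots> = - \<i> * g * ((K - L) * (P * Q - P' * Q') + (K + L) * (P * Q' - P' * Q))"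
      by (simp add: algebra_simps)
    finally show ?thesis .
  qed
  then have "gram i j x = (- \<i> * g * ((K - L) * (P * Q - P' * Q') + (K + L) * (P * Q' - P' * Q))) / ((K + L) * (K - L))"
    using KL by (metis (no_types, lifting) mult_eq_0_iff nonzero_mult_div_cancel_left)
  also have "\<dots> = (- \<i> * g / (K + L)) * (P * Q - P' * Q') + (- \<i> * g / (K - L)) * (P * Q' - P' * Q)"
    using KL by (simp add: divide_simps) (simp add: algebra_simps)
  finally show ?thesis using False by (simp add: e)
qed

lemma osc_bound: "norm (osc i j \<sigma> \<tau>) \<le> \<delta>\<^sup>2 * Cg * (v i ^ 5 * v j ^ 5)"
proof (cases "i \<noteq> j \<or> \<sigma> = \<tau>")
  case True
  have v: "0 < v i" "0 < v j" "v j \<le> 1" using v_pos v_le_1 by auto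
  have "1 / \<bar>sg \<sigma> * \<kappa> i + sg \<tau> * \<kappa> j\<bar> \<le> Cg / (v i * v j)"
  proof (cases "\<sigma> = \<tau>")
    case same: True
    then have "\<bar>sg \<sigma> * \<kappa> i + sg \<tau> * \<kappa> j\<bar> = \<kappa> i + \<kappa> j" using \<kappa>_pos[of i] \<kappa>_pos[of j] by (auto simp: sg_def)
    then have "1 / \<bar>sg \<sigma> * \<kappa> i + sg \<tau> * \<kappa> j\<bar> \<le> 1 / \<kappa> i" using \<kappa>_pos[of i] \<kappa>_pos[of j] by (simp add: frac_le)
    also have "\<dots> \<le> Cg / v i" by (rule Cg)
    also have "\<dots> \<le> Cg / (v i * v j)" using Cg(1) v by (intro divide_left_mono) (auto simp: mult_left_le)
    finally show ?thesis .
  next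
    case False
    then have "\<bar>sg \<sigma> * \<kappa> i + sg \<tau> * \<kappa> j\<bar> = \<bar>\<kappa> i - \<kappa> j\<bar>" by (cases \<sigma>; cases \<tau>) (auto simp: sg_def)
    then show ?thesis using Cg(3)[of i j] True False by simp
  qed
  then have "(\<gamma> i * \<gamma> j) * (1 / \<bar>sg \<sigma> * \<kappa> i + sg \<tau> * \<kappa> j\<bar>) \<le> (\<gamma> i * \<gamma> j) * (Cg / (v i * v j))"
    using \<gamma>_pos by (intro mult_left_mono) (auto simp: less_imp_le)
  also have "\<dots> = \<delta>\<^sup>2 * Cg * (v i ^ 5 * v j ^ 5)"
    using v by (simp add: \<gamma>_def power_numeral_reduce field_simps)
  finally show ?thesis
    using True \<gamma>_pos[of i] \<gamma>_pos[of j] by (auto simp: osc_def norm_divide norm_mult simp flip: of_real_mult of_real_add)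
next
  case False
  then show ?thesis using Cg(1) v_pos by (simp add: osc_def less_imp_le)
qed

lemma norm_amp [simp]: "norm (amp i \<sigma> x) = norm (a i x)"
  by (simp add: amp_def)

lemma symbols_amp: "symbols (\<lambda>x. 1 + \<bar>x\<bar>) {-1<..} (\<lambda>(i, \<sigma>). amp i \<sigma>) (\<lambda>(i, \<sigma>). 1 / v i)"
  using symbols_if[OF symbols_a symbols_cnj[OF _ symbols_a]] by (simp add: amp_def[abs_def])

lemma symbols_oscillating:
  "symbols (\<lambda>x. 1 + \<bar>x\<bar>) {-1<..} (\<lambda>((i, j), (\<sigma>, \<tau>)) x. osc i j \<sigma> \<tau> * (amp i \<sigma> x * amp j \<tau> x)) (\<lambda>((i, j), _). v i ^ 4 * v j ^ 4)"
proof -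
  have "symbols (\<lambda>x. 1 + \<bar>x\<bar>) {-1<..} (\<lambda>((i, j), (\<sigma>, \<tau>)) x. amp i \<sigma> x * amp j \<tau> x) (\<lambda>((i, j), _). 1 / v i * (1 / v j))"
    using symbols_mult[OF _ symbols_reindex[OF symbols_amp, of "\<lambda>((i, j), (\<sigma>, \<tau>)). (i, \<sigma>)"]
      symbols_reindex[OF symbols_amp, of "\<lambda>((i, j), (\<sigma>, \<tau>)). (j, \<tau>)"]]
    by (simp add: case_prod_unfold)
  from symbols_cmult[OF _ this, of "\<lambda>((i, j), (\<sigma>, \<tau>)). osc i j \<sigma> \<tau>"]
  have "symbols (\<lambda>x. 1 + \<bar>x\<bar>) {-1<..} (\<lambda>((i, j), (\<sigma>, \<tau>)) x. osc i j \<sigma> \<tau> * (amp i \<sigma> x * amp j \<tau> x))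
      (\<lambda>((i, j), (\<sigma>, \<tau>)). norm (osc i j \<sigma> \<tau>) * (1 / v i * (1 / v j)))"
    by (simp add: case_prod_unfold)
  then show ?thesis
  proof (rule symbols_weight)
    show "(case p of (ij, st) \<Rightarrow> (case ij of (i, j) \<Rightarrow> \<lambda>(\<sigma>, \<tau>). norm (osc i j \<sigma> \<tau>) * (1 / v i * (1 / v j))) st)
        \<le> (\<delta>\<^sup>2 * Cg) * (case p of (ij, st) \<Rightarrow> (case ij of (i, j) \<Rightarrow> \<lambda>_. v i ^ 4 * v j ^ 4) st)" for p
    proof -
      obtain i j \<sigma> \<tau> where p: "p = ((i, j), (\<sigma>, \<tau>))" by (metis surj_pair)
      have v: "0 < v i" "0 < v j" using v_pos by auto
      have "norm (osc i j \<sigma> \<tau>) * (1 / v i * (1 / v j)) \<le> (\<delta>\<^sup>2 * Cg * (v i ^ 5 * v j ^ 5)) * (1 / v i * (1 / v j))"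
        using v by (intro mult_right_mono osc_bound) auto
      also have "\<dots> = \<delta>\<^sup>2 * Cg * (v i ^ 4 * v j ^ 4)" using v by (simp add: power_numeral_reduce)
      finally show ?thesis by (simp add: p)
    qed
  qed (use Cg(1) less_imp_le[OF v_pos] in auto)
qed

lemma rem_const:
  assumes "\<epsilon> \<le> x"
  shows "rem i x = rem i \<epsilon>"
proof -
  define g where "g = complex_of_real (\<gamma> i * \<gamma> i)"
  define \<alpha> where "\<alpha> = a i \<epsilon>"
  define R where "R x = gram i i x - of_real (c i * x)
    - (g / (\<i> * of_real (2 * \<kappa> i)) * (\<alpha> * \<alpha>) * wave (2 * \<kappa> i) x + g / (\<i> * of_real (- 2 * \<kappa> i)) * (cnj \<alpha> * cnj \<alpha>) * wave (- 2 * \<kappa> i) x)" for x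
  have R: "rem i y = R y" if "\<epsilon> \<le> y" for y
    using a_const[OF that order_refl, of i]
    by (simp add: rem_def R_def sum_bool osc_def sg_def amp_def \<alpha>_def g_def)
  have "norm (R (\<epsilon> + (x - \<epsilon>)) - R \<epsilon>) \<le> 0 * \<bar>x - \<epsilon>\<bar>"
  proof (rule norm_le_from_zero[of "\<lambda>t. R (\<epsilon> + t) - R \<epsilon>" _ "\<lambda>_. 0"])
    fix t assume "t \<in> closed_segment 0 (x - \<epsilon>)"
    then have t: "\<epsilon> \<le> \<epsilon> + t" using assms by (auto simp: closed_segment_eq_real_ivl split: if_splits)
    let ?y = "\<epsilon> + t"
    have lin: "((\<lambda>x. complex_of_real (c i * x)) has_vector_derivative of_real (c i)) (at ?y)"
    proof -
      have "((\<lambda>x. c i * x) has_vector_derivative c i) (at ?y)"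
        unfolding has_real_derivative_iff_has_vector_derivative[symmetric] by (auto intro!: derivative_eq_intros)
      then show ?thesis by (rule bounded_linear.has_vector_derivative[OF bounded_linear_of_real])
    qed
    have "(R has_vector_derivative (s i ?y * s i ?y - of_real (c i)
      - (g / (\<i> * of_real (2 * \<kappa> i)) * (\<alpha> * \<alpha>) * (\<i> * of_real (2 * \<kappa> i) * wave (2 * \<kappa> i) ?y)
        + g / (\<i> * of_real (- 2 * \<kappa> i)) * (cnj \<alpha> * cnj \<alpha>) * (\<i> * of_real (- 2 * \<kappa> i) * wave (- 2 * \<kappa> i) ?y)))) (at ?y)"
      unfolding R_def[abs_def]
      by (intro has_vector_derivative_diff has_vector_derivative_add has_vector_derivative_mult_right wave_has_derivative gram_derivative lin)
    moreover have "s i ?y * s i ?y - of_real (c i)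
      - (g / (\<i> * of_real (2 * \<kappa> i)) * (\<alpha> * \<alpha>) * (\<i> * of_real (2 * \<kappa> i) * wave (2 * \<kappa> i) ?y)
        + g / (\<i> * of_real (- 2 * \<kappa> i)) * (cnj \<alpha> * cnj \<alpha>) * (\<i> * of_real (- 2 * \<kappa> i) * wave (- 2 * \<kappa> i) ?y)) = 0"
    proof -
      have a: "a i ?y = \<alpha>" using a_const[OF t order_refl] by (simp add: \<alpha>_def)
      have w: "wave (2 * \<kappa> i) ?y = wave (\<kappa> i) ?y * wave (\<kappa> i) ?y" "wave (- 2 * \<kappa> i) ?y = wave (- \<kappa> i) ?y * wave (- \<kappa> i) ?y"
        by (simp_all flip: wave_add)
      have c: "complex_of_real (c i) = 2 * g * (\<alpha> * cnj \<alpha>)"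
      proof -
        have "complex_of_real (c i) = 2 * of_real ((\<gamma> i)\<^sup>2) * of_real ((norm \<alpha>)\<^sup>2)" by (simp add: c_def \<alpha>_def)
        then show ?thesis unfolding complex_norm_square g_def by (simp add: power2_eq_square)
      qed
      have "s i ?y * s i ?y = g * ((\<alpha> * wave (\<kappa> i) ?y + cnj \<alpha> * wave (- \<kappa> i) ?y) * (\<alpha> * wave (\<kappa> i) ?y + cnj \<alpha> * wave (- \<kappa> i) ?y))"
        by (simp add: s_def a g_def mult_ac)
      also have "\<dots> = g * (\<alpha> * \<alpha> * wave (2 * \<kappa> i) ?y + cnj \<alpha> * cnj \<alpha> * wave (- 2 * \<kappa> i) ?y + 2 * (\<alpha> * cnj \<alpha>) * (wave (\<kappa> i) ?y * wave (- \<kappa> i) ?y))"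
        unfolding w by (simp add: algebra_simps del: wave_cancel)
      finally have ss: "s i ?y * s i ?y = g * (\<alpha> * \<alpha> * wave (2 * \<kappa> i) ?y + cnj \<alpha> * cnj \<alpha> * wave (- 2 * \<kappa> i) ?y + 2 * (\<alpha> * cnj \<alpha>))" by simp
      have k: "\<i> * complex_of_real (2 * \<kappa> i) \<noteq> 0" "\<i> * complex_of_real (- 2 * \<kappa> i) \<noteq> 0" using \<kappa>_pos[of i] by auto
      have d: "g / z * p * (z * q) = g * p * q" if "z \<noteq> 0" for p q z using that by simp
      show ?thesis unfolding ss c d[OF k(1)] d[OF k(2)] by (simp add: algebra_simps)
    qed
    ultimately have D: "(R has_vector_derivative 0) (at ?y)" by simp
    have "((R \<circ> (\<lambda>t. \<epsilon> + t)) has_vector_derivative 1 *\<^sub>R 0) (at t)"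
      by (rule vector_diff_chain_at) (auto intro!: derivative_eq_intros D)
    from has_vector_derivative_diff[OF this has_vector_derivative_const[of "R \<epsilon>"]]
    show "((\<lambda>t. R (\<epsilon> + t) - R \<epsilon>) has_vector_derivative 0) (at t)" by (simp add: o_def)
  qed auto
  then show ?thesis using R[OF assms] R[OF order_refl] by simp
qed

lemma norm_rem_le:
  assumes "-1 < x"
  shows "norm (rem i x) \<le> 6 * (\<delta>\<^sup>2 * Cg) * v i ^ 10"
proof -
  have main: "norm (rem i x) \<le> 6 * (\<delta>\<^sup>2 * Cg) * v i ^ 10" if "-1 < x" "x \<le> 1" for x
  proof -
    have x: "\<bar>x\<bar> \<le> 1" using that by auto
    have \<gamma>2: "(\<gamma> i)\<^sup>2 \<le> (\<delta>\<^sup>2 * Cg) * v i ^ 10"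
    proof -
      have "(\<gamma> i)\<^sup>2 = \<delta>\<^sup>2 * v i ^ 12" by (simp add: \<gamma>_def power_mult_distrib flip: power_mult)
      also have "\<dots> \<le> (\<delta>\<^sup>2 * Cg) * v i ^ 10"
        using Cg(1) less_imp_le[OF v_pos] v_power_le[of 10 12 i] by (intro mult_mono) (auto simp: mult_le_cancel_left1)
      finally show ?thesis .
    qed
    have "norm (gram i i x) \<le> (3 / 2 * \<gamma> i * (3 / 2 * \<gamma> i)) * \<bar>x\<bar>"
    proof (rule norm_le_from_zero[OF gram_0 gram_derivative])
      show "norm (s i t * s i t) \<le> 3 / 2 * \<gamma> i * (3 / 2 * \<gamma> i)" for t
        unfolding norm_mult using \<gamma>_pos[of i] by (intro mult_mono norm_s_le) auto
    qed
    also have "\<dots> \<le> 9 / 4 * (\<gamma> i)\<^sup>2" using x by (simp add: power2_eq_square mult_left_le_one_le)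
    finally have 1: "norm (gram i i x) \<le> 9 / 4 * (\<gamma> i)\<^sup>2" .
    have 2: "norm (complex_of_real (c i * x)) \<le> 9 / 8 * (\<gamma> i)\<^sup>2"
    proof -
      have "c i * \<bar>x\<bar> \<le> c i" using x c_pos[of i] by (simp add: mult_left_le)
      then show ?thesis using c_le(1)[of i] unfolding norm_of_real abs_mult abs_of_pos[OF c_pos] by linarith
    qed
    have 3: "norm (osc i i \<sigma> \<sigma> * (amp i \<sigma> x * amp i \<sigma> x) * wave (sg \<sigma> * \<kappa> i + sg \<sigma> * \<kappa> i) x) \<le> (\<delta>\<^sup>2 * Cg) * v i ^ 10" for \<sigma>
    proof -
      have "norm (osc i i \<sigma> \<sigma>) * (norm (a i x))\<^sup>2 \<le> (\<delta>\<^sup>2 * Cg * (v i ^ 5 * v i ^ 5)) * 1"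
        using a2_le[of i x] Cg(1) less_imp_le[OF v_pos] by (intro mult_mono osc_bound) auto
      then show ?thesis by (simp add: norm_mult power2_eq_square flip: power_add)
    qed
    have "norm (rem i x) \<le> norm (gram i i x) + norm (complex_of_real (c i * x))
      + (norm (osc i i True True * (amp i True x * amp i True x) * wave (sg True * \<kappa> i + sg True * \<kappa> i) x)
       + norm (osc i i False False * (amp i False x * amp i False x) * wave (sg False * \<kappa> i + sg False * \<kappa> i) x))"
      unfolding rem_def sum_bool
      by (intro order_trans[OF norm_triangle_ineq4] add_mono norm_triangle_ineq4 norm_triangle_ineq order_refl)
    then show ?thesis using 1 2 3[of True] 3[of False] \<gamma>2 zero_le_power2[of "\<gamma> i"] by linarith
  qed
  show ?thesis
  proof (cases "x \<le> 1")
    case False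
    then have "rem i x = rem i 1" using rem_const[of x i] rem_const[of 1 i] \<epsilon> by simp
    then show ?thesis using main[of 1] by simp
  qed (use main assms in auto)
qed

lemma symbols_rem: "symbols (\<lambda>x. 1 + \<bar>x\<bar>) {-1<..} rem (\<lambda>i. v i ^ 7)"
proof (rule symbols_eventually_const)
  let ?U = "{-1<..<2::real}"
  have v0: "0 \<le> v i" for i using less_imp_le[OF v_pos] .
  show "rem i x = rem i 1" if "1 \<le> x" for i x
    using rem_const[of x i] rem_const[of 1 i] \<epsilon> that by simp
  have sub: "symbols (\<lambda>_. 1) ?U f w" if "symbols (\<lambda>x. 1 + \<bar>x\<bar>) {-1<..} f w" for f :: "'b \<Rightarrow> real \<Rightarrow> complex" and w
    by (rule symbols_subset[OF that]) auto
  have "symbols (\<lambda>_. 1) ?U (\<lambda>(i, j). gram i j) (\<lambda>(i, j). v i ^ 4 * v j ^ 4)"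
    by (rule gram_symbols[where R=2]) (auto intro: gram_derivative symbols_subset[OF symbols_s])
  from symbols_reindex[OF this, of "\<lambda>i. (i, i)"]
  have "symbols (\<lambda>_. 1) ?U (\<lambda>i. gram i i) (\<lambda>i. v i ^ 8)" by (simp flip: power_add)
  then have g: "symbols (\<lambda>_. 1) ?U (\<lambda>i. gram i i) (\<lambda>i. v i ^ 7)"
    by (rule symbols_weight[where c=1]) (use v0 v_power_le[of 7 8] in auto)
  have l: "symbols (\<lambda>_. 1) ?U (\<lambda>i x. - of_real (c i) * of_real x) (\<lambda>i. v i ^ 7)"
  proof -
    have D: "((\<lambda>x. complex_of_real x) has_vector_derivative 1) (at x)" for x
      using has_vector_derivative_id[of "at x"] bounded_linear.has_vector_derivative[OF bounded_linear_of_real, of "\<lambda>x. x" 1] by auto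
    have sm: "smooth_on ?U complex_of_real" "nth_deriv (Suc k) complex_of_real x = (if k = 0 then 1 else 0)" if "x \<in> ?U \<or> x = 0" for k x
      using smooth_on_antideriv[OF _ smooth_on_const D, of UNIV] smooth_on_subset[of UNIV complex_of_real ?U] by (auto simp: nth_deriv_const)
    have "symbols (\<lambda>_. 1) ?U (\<lambda>i x. complex_of_real x) (\<lambda>i::nat. 1)"
    proof (rule symbolsI)
      show "smooth_on ?U complex_of_real" using sm(1)[of 0] by simp
      show "\<exists>C\<ge>0. \<forall>i::nat. \<forall>x\<in>?U. 1 ^ k * norm (nth_deriv k complex_of_real x) \<le> C * 1" for k
        by (rule exI[of _ 2]) (cases k, auto simp: sm(2))
    qed auto
    from symbols_cmult[OF _ this, of "\<lambda>i. - of_real (c i)"]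
    have *: "symbols (\<lambda>_. 1) ?U (\<lambda>i x. - of_real (c i) * of_real x) (\<lambda>i. norm (- complex_of_real (c i)) * 1)" by simp
    show ?thesis
    proof (rule symbols_weight[OF *, of 2])
      show "norm (- complex_of_real (c i)) * 1 \<le> 2 * v i ^ 7" for i
      proof -
        have "c i \<le> 2 * (\<gamma> i)\<^sup>2" using c_le(1)[of i] zero_le_power2[of "\<gamma> i"] by linarith
        also have "(\<gamma> i)\<^sup>2 = \<delta>\<^sup>2 * v i ^ 12" by (simp add: \<gamma>_def power_mult_distrib flip: power_mult)
        also have "2 * (\<delta>\<^sup>2 * v i ^ 12) \<le> 2 * (1 * v i ^ 7)"
          using \<delta>2_le v0 by (intro mult_left_mono mult_mono v_power_le) auto
        finally show ?thesis using c_pos[of i] by simp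
      qed
    qed (use v0 in auto)
  qed
  have o: "symbols (\<lambda>_. 1) ?U (\<lambda>i x. (-1) * (osc i i \<sigma> \<sigma> * (amp i \<sigma> x * amp i \<sigma> x)) * wave ((2 * sg \<sigma>) * \<kappa> i) x) (\<lambda>i. v i ^ 7)" for \<sigma>
  proof -
    have "symbols (\<lambda>_. 1) ?U (\<lambda>i x. amp i \<sigma> x * amp i \<sigma> x) (\<lambda>i. 1 / v i * (1 / v i))"
      using symbols_mult[OF _ sub[OF symbols_reindex[OF symbols_amp, of "\<lambda>i. (i, \<sigma>)"]] sub[OF symbols_reindex[OF symbols_amp, of "\<lambda>i. (i, \<sigma>)"]]] by simp
    from symbols_mult[OF _ symbols_cmult[OF _ this, of "\<lambda>i. (-1) * osc i i \<sigma> \<sigma>"] symbols_wave_\<kappa>, of "2 * sg \<sigma>"]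
    have *: "symbols (\<lambda>_. 1) ?U (\<lambda>i x. (-1) * (osc i i \<sigma> \<sigma> * (amp i \<sigma> x * amp i \<sigma> x)) * wave ((2 * sg \<sigma>) * \<kappa> i) x)
       (\<lambda>i. norm ((-1) * osc i i \<sigma> \<sigma>) * (1 / v i * (1 / v i)) * (1 / v i))"
      by (simp add: mult.assoc)
    show ?thesis
    proof (rule symbols_weight[OF *, of "\<delta>\<^sup>2 * Cg"])
      show "norm ((-1) * osc i i \<sigma> \<sigma>) * (1 / v i * (1 / v i)) * (1 / v i) \<le> \<delta>\<^sup>2 * Cg * v i ^ 7" for i
      proof -
        have "norm (osc i i \<sigma> \<sigma>) * (1 / v i * (1 / v i) * (1 / v i)) \<le> (\<delta>\<^sup>2 * Cg * (v i ^ 5 * v i ^ 5)) * (1 / v i * (1 / v i) * (1 / v i))"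
          using v_pos[of i] by (intro mult_right_mono osc_bound) auto
        also have "\<dots> = \<delta>\<^sup>2 * Cg * v i ^ 7" using v_pos[of i] by (simp add: power_numeral_reduce)
        finally show ?thesis by (simp add: norm_mult mult_ac)
      qed
    qed (use v0 Cg(1) in auto)
  qed
  have "symbols (\<lambda>_. 1) ?U (\<lambda>i x. gram i i x + (- of_real (c i) * of_real x) +
      ((-1) * (osc i i True True * (amp i True x * amp i True x)) * wave ((2 * sg True) * \<kappa> i) x
      + (-1) * (osc i i False False * (amp i False x * amp i False x)) * wave ((2 * sg False) * \<kappa> i) x)) (\<lambda>i. v i ^ 7)"
    by (intro symbols_add g l o) auto
  moreover have "rem = (\<lambda>i x. gram i i x + (- of_real (c i) * of_real x) +
      ((-1) * (osc i i True True * (amp i True x * amp i True x)) * wave ((2 * sg True) * \<kappa> i) x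
      + (-1) * (osc i i False False * (amp i False x * amp i False x)) * wave ((2 * sg False) * \<kappa> i) x))"
    by (simp add: rem_def sum_bool fun_eq_iff sg_def)
  ultimately show "symbols (\<lambda>_. 1) ?U rem (\<lambda>i. v i ^ 7)" by simp
qed

end

section \<open>The solutions near the origin\<close>

text \<open>The local solutions \<open>s0\<close> belong to the potential that \<open>W0\<close> agrees with near the origin.\<close>
locale matched = scattering +
  fixes s0 :: "nat \<Rightarrow> real \<Rightarrow> complex"
  assumes symbols_s0: "symbols (\<lambda>_. 1) {-1<..<1} s0 (\<lambda>i. v i ^ 5)"
    and s0_eq: "\<And>i x. x \<in> {-1<..<1} \<Longrightarrow> ((\<lambda>j. free_gram i j x * s0 j x) has_sum (s0 i x - free i x)) UNIV"
    and s0_ode: "\<And>i x. x \<in> {-1<..<1} \<Longrightarrow> nth_deriv 2 (s0 i) x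
        = (2 * nth_deriv 1 (\<lambda>x. \<Sum>\<^sub>\<infinity>j. free j x * s0 j x) x - of_real ((\<kappa> i)\<^sup>2)) * s0 i x"
    and s0_0: "\<And>i. s0 i 0 = 0" "\<And>i. nth_deriv 1 (s0 i) 0 = of_real (\<gamma> i * \<kappa> i)"
    and W0_eq: "\<And>x. \<bar>x\<bar> < \<epsilon> / 2 \<Longrightarrow> of_real (W0 x) = 2 * nth_deriv 1 (\<lambda>x. \<Sum>\<^sub>\<infinity>j. free j x * s0 j x) x"
begin

definition X :: "real set" where "X = {- (\<epsilon> / 2)<..<\<epsilon> / 2}"

lemma X: "open X" "convex X" "0 \<in> X" "X \<subseteq> {-1<..<1}" "X \<subseteq> {-1..1}" "X \<subseteq> {-1<..}"
  using \<epsilon> by (auto simp: X_def)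

text \<open>Two solutions of the same initial value problem.\<close>
lemma s_eq_s0:
  assumes x: "x \<in> X"
  shows "s i x = s0 i x"
proof -
  obtain B where B: "B \<ge> 0" "\<And>x. norm (nth_deriv 0 (\<lambda>x. complex_of_real (W0 x)) x) \<le> B"
    using smooth_compact_support_bounded[OF W0_smooth, of \<epsilon> 0] W0_support by (metis of_real_0)
  define d where "d t = s i t - s0 i t" for t
  define d1 where "d1 t = nth_deriv 1 (s i) t - nth_deriv 1 (s0 i) t" for t
  define C where "C = 1 + B + (\<kappa> i)\<^sup>2"
  have "(d x, d1 x) = 0"
  proof (rule gronwall_zero[OF X(2,3) x, of "\<lambda>t. (d t, d1 t)" "\<lambda>t. (d1 t, (of_real (W0 t) - of_real ((\<kappa> i)\<^sup>2)) * d t)" C])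
    show "(d 0, d1 0) = 0" by (simp add: d_def d1_def s0_0 s_deriv1_0 zero_prod_def del: One_nat_def)
    fix t assume t: "t \<in> X"
    then have t1: "t \<in> {-1<..<1}" using X(4) by auto
    have "(d has_vector_derivative d1 t) (at t)"
      unfolding d_def[abs_def] d1_def
      by (intro has_vector_derivative_diff smooth_on_has_derivs(1)[OF s_smooth UNIV_I] smooth_on_has_derivs(1)[OF symbols_smooth[OF symbols_s0] t1])
    moreover have "(d1 has_vector_derivative (of_real (W0 t) - of_real ((\<kappa> i)\<^sup>2)) * d t) (at t)"
    proof -
      have "(d1 has_vector_derivative (nth_deriv 2 (s i) t - nth_deriv 2 (s0 i) t)) (at t)"
        unfolding d1_def[abs_def]
        by (intro has_vector_derivative_diff smooth_on_has_derivs(2)[OF s_smooth UNIV_I] smooth_on_has_derivs(2)[OF symbols_smooth[OF symbols_s0] t1])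
      moreover have "2 * nth_deriv 1 (\<lambda>x. \<Sum>\<^sub>\<infinity>j. free j x * s0 j x) t = of_real (W0 t)"
        using W0_eq[of t] t by (auto simp: X_def)
      ultimately show ?thesis
        unfolding s_deriv2 s0_ode[OF t1] d_def by (simp add: right_diff_distrib)
    qed
    ultimately show "((\<lambda>t. (d t, d1 t)) has_vector_derivative (d1 t, (of_real (W0 t) - of_real ((\<kappa> i)\<^sup>2)) * d t)) (at t)"
      by (rule has_vector_derivative_Pair)
    have "norm (d1 t, (of_real (W0 t) - of_real ((\<kappa> i)\<^sup>2)) * d t) \<le> norm (d1 t) + norm ((complex_of_real (W0 t) - of_real ((\<kappa> i)\<^sup>2)) * d t)"
      by (rule norm_Pair_le)
    also have "\<dots> \<le> norm (d t, d1 t) + (B + (\<kappa> i)\<^sup>2) * norm (d t, d1 t)"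
    proof (intro add_mono)
      show "norm (d1 t) \<le> norm (d t, d1 t)" by (rule norm_snd_le)
      have "norm (complex_of_real (W0 t) - of_real ((\<kappa> i)\<^sup>2)) \<le> B + (\<kappa> i)\<^sup>2"
        using B(2)[of t] by (intro order_trans[OF norm_triangle_ineq4] add_mono) (auto simp: norm_power)
      then show "norm ((complex_of_real (W0 t) - of_real ((\<kappa> i)\<^sup>2)) * d t) \<le> (B + (\<kappa> i)\<^sup>2) * norm (d t, d1 t)"
        unfolding norm_mult using norm_fst_le[of "d t" "d1 t"] B(1) by (intro mult_mono) auto
    qed
    finally show "norm (d1 t, (of_real (W0 t) - of_real ((\<kappa> i)\<^sup>2)) * d t) \<le> C * norm (d t, d1 t)"
      by (simp add: C_def algebra_simps)
  qed
  then show ?thesis by (simp add: d_def zero_prod_def)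
qed

lemma free_gram_sym: "free_gram i j x = free_gram j i x"
  by (simp add: free_gram_def mult.commute)

lemma symbols_s_X: "symbols (\<lambda>_. 1) X s (\<lambda>i. v i ^ 4)"
  using X(6) by (intro symbols_subset[OF symbols_s]) auto

lemma symbols_gram_X: "symbols (\<lambda>_. 1) X (\<lambda>(i, j). gram i j) (\<lambda>(i, j). v i ^ 4 * v j ^ 4)"
  by (rule gram_symbols[OF X(1-3,5) symbols_s_X gram_0 gram_derivative])

lemma symbols_free_gram_X: "symbols (\<lambda>_. 1) X (\<lambda>(i, j). free_gram i j) (\<lambda>(i, j). v i ^ 5 * v j ^ 5)"
  by (rule gram_symbols[OF X(1-3,5) symbols_free free_gram_0 free_gram_derivative])

text \<open>In matrix form, with \<open>G\<close> for \<open>gram\<close> and \<open>H\<close> for \<open>free_gram\<close>: \<open>P = 1 - H\<close> satisfies \<open>P s = free\<close>, and \<open>Z = (1 + G) (1 - H) - 1\<close> solves a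
  linear homogeneous equation with \<open>Z = 0\<close> at the origin. So \<open>1 + G\<close> inverts \<open>P\<close>.\<close>
lemma gram_free:
  assumes x: "x \<in> X"
  shows "((\<lambda>j. gram i j x * free j x) has_sum (s i x - free i x)) UNIV"
proof -
  have v0: "0 \<le> v i" for i using less_imp_le[OF v_pos] .
  obtain CG where CG: "CG \<ge> 0" "\<And>i j x. x \<in> X \<Longrightarrow> norm (gram i j x) \<le> CG * (v i ^ 4 * v j ^ 4)"
    using symbols_bound[OF symbols_gram_X, of 0] by (metis (mono_tags, lifting) case_prod_conv mult_1 nth_deriv_0 power_0)
  obtain CH where CH: "CH \<ge> 0" "\<And>i j x. x \<in> X \<Longrightarrow> norm (free_gram i j x) \<le> CH * (v i ^ 5 * v j ^ 5)"
    using symbols_bound[OF symbols_free_gram_X, of 0] by (metis (mono_tags, lifting) case_prod_conv mult_1 nth_deriv_0 power_0)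
  have s_le: "norm (s j x) \<le> 1 * v j ^ 4" for j x
  proof -
    have "3 / 2 * \<gamma> j \<le> 1 * v j ^ 4"
    proof -
      have "\<delta> \<le> 1 / 2"
      proof (rule power2_le_imp_le)
        show "\<delta>\<^sup>2 \<le> (1 / 2)\<^sup>2" using \<delta>2_le by (simp add: power2_eq_square)
      qed simp
      then have "3 / 2 * \<delta> * v j ^ 6 \<le> 1 * v j ^ 4" using v0 \<delta>(1) by (intro mult_mono v_power_le) auto
      then show ?thesis by (simp add: \<gamma>_def)
    qed
    then show ?thesis using norm_s_le[of j x] by linarith
  qed
  have free_le: "norm (free j x) \<le> v j ^ 4" for j x
    using order_trans[OF norm_free_le[of j x], of "3 / 2 * \<gamma> j"] s_le \<gamma>_pos[of j]
  proof -
    have "\<delta> \<le> 1"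
      by (rule power2_le_imp_le) (use \<delta>2_le in auto)
    then have "\<delta> * v j ^ 6 \<le> 1 * v j ^ 4" using v0 \<delta>(1) by (intro mult_mono v_power_le) auto
    then show ?thesis using norm_free_le[of j x] by (simp add: \<gamma>_def)
  qed
  have sum_G: "(\<lambda>j. gram i j x * h j) summable_on UNIV" if x: "x \<in> X" and h: "\<And>j. norm (h j) \<le> v j ^ 4" for i x h
  proof (rule dominated_summable[OF summable_on_cmult_right[OF v_power_summable[of 8], of "CG * v i ^ 4"]])
    fix j
    have "norm (gram i j x) * norm (h j) \<le> (CG * (v i ^ 4 * v j ^ 4)) * v j ^ 4"
      using CG(1) v0 by (intro mult_mono CG(2) x h) auto
    then show "norm (gram i j x * h j) \<le> CG * v i ^ 4 * v j ^ 8"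
      by (simp add: norm_mult mult.assoc flip: power_add)
  qed simp
  have sum_Gf: "(\<lambda>j. gram i j x * free j x) summable_on UNIV" if "x \<in> X" for i x
    by (rule sum_G[OF that free_le])
  have sum_Gs: "(\<lambda>j. gram i j x * s j x) summable_on UNIV" if "x \<in> X" for i x
    using sum_G[OF that, of "\<lambda>j. s j x"] s_le by simp
  have Hs: "((\<lambda>j. free_gram i j x * s j x) has_sum (s i x - free i x)) UNIV" if "x \<in> X" for i x
    using s0_eq[of x i] that X(4) s_eq_s0[OF that] by auto
  define y where "y i x = (\<Sum>\<^sub>\<infinity>j. gram i j x * free j x) - (s i x - free i x)" for i x
  define Z where "Z i j x = gram i j x - free_gram i j x - (\<Sum>\<^sub>\<infinity>k. gram i k x * free_gram k j x)" for i j x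
  have GH: "symbols (\<lambda>_. 1) X (\<lambda>((i, j), k) x. gram i k x * free_gram k j x) (\<lambda>((i, j), k). v i ^ 4 * v k ^ 4 * (v k ^ 5 * v j ^ 5))"
    using symbols_mult[OF X(1) symbols_reindex[OF symbols_gram_X, of "\<lambda>((i, j), k). (i, k)"]
      symbols_reindex[OF symbols_free_gram_X, of "\<lambda>((i, j), k). (k, j)"]]
    by (simp add: case_prod_unfold)
  have GHs: "(\<lambda>k. v i ^ 4 * v k ^ 4 * (v k ^ 5 * v j ^ 5)) summable_on UNIV" for i j
    using summable_on_cmult_right[OF v_power_summable[of 9], of "v i ^ 4 * v j ^ 5"] by (simp add: mult_ac power_add[symmetric] flip: power_add)
  have GH': "symbols (\<lambda>_. 1) X (\<lambda>(p, k). \<lambda>x. gram (fst p) k x * free_gram k (snd p) x) (\<lambda>(p, k). v (fst p) ^ 4 * v k ^ 4 * (v k ^ 5 * v (snd p) ^ 5))"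
    using GH by (simp add: case_prod_unfold)
  note I = symbols_nth_deriv_infsum[OF X(1,2) _ GH' GHs] symbols_infsum[OF X(1,2) _ GH' GHs]
    symbols_summable[OF X(1,2) _ GH' GHs]
  have Zderiv: "(Z i j has_vector_derivative - (y i x * free j x)) (at x)" if x: "x \<in> X" for i j x
  proof -
    have sm: "smooth_on X (\<lambda>x. \<Sum>\<^sub>\<infinity>k. gram i k x * free_gram k j x)"
      using symbols_smooth[OF I(2), of "(i, j)"] by simp
    have smG: "smooth_on X (gram i k)" for k using symbols_smooth[OF symbols_gram_X, of "(i, k)"] by simp
    have smH: "smooth_on X (free_gram k j)" for k using symbols_smooth[OF symbols_free_gram_X, of "(k, j)"] by simp
    have "nth_deriv 1 (\<lambda>x. \<Sum>\<^sub>\<infinity>k. gram i k x * free_gram k j x) x = (\<Sum>\<^sub>\<infinity>k. nth_deriv 1 (\<lambda>x. gram i k x * free_gram k j x) x)"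
      using I(1)[of x 1 "(i, j)"] x by simp
    also have "\<dots> = (\<Sum>\<^sub>\<infinity>k. s i x * (free_gram j k x * s k x) + free j x * (gram i k x * free k x))"
    proof (rule infsum_cong)
      fix k
      have "nth_deriv 1 (gram i k) x = s i x * s k x" "nth_deriv 1 (free_gram k j) x = free k x * free j x"
        using gram_derivative[of i k x] free_gram_derivative[of k j x] by (simp_all add: nth_deriv_Suc vector_derivative_at)
      then show "nth_deriv 1 (\<lambda>x. gram i k x * free_gram k j x) x = s i x * (free_gram j k x * s k x) + free j x * (gram i k x * free k x)"
        unfolding nth_deriv_mult_1[OF X(1) smG smH x] by (simp add: free_gram_sym[of k j] mult_ac)
    qed
    also have "\<dots> = s i x * (s j x - free j x) + free j x * (y i x + (s i x - free i x))"
      using has_sum_add[OF has_sum_cmult_right[OF Hs[OF x, of j], of "s i x"] has_sum_cmult_right[OF has_sum_infsum[OF sum_Gf[OF x, of i]], of "free j x"]]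
      by (intro infsumI) (simp add: y_def)
    finally have D: "((\<lambda>x. \<Sum>\<^sub>\<infinity>k. gram i k x * free_gram k j x) has_vector_derivative
        s i x * (s j x - free j x) + free j x * (y i x + (s i x - free i x))) (at x)"
      using smooth_on_has_derivs(1)[OF sm x] by simp
    have "(Z i j has_vector_derivative (s i x * s j x - free i x * free j x - (s i x * (s j x - free j x) + free j x * (y i x + (s i x - free i x))))) (at x)"
      unfolding Z_def[abs_def] by (intro has_vector_derivative_diff gram_derivative free_gram_derivative D)
    then show ?thesis by (simp add: algebra_simps)
  qed
  have Z0: "Z i j 0 = 0" for i j by (simp add: Z_def)
  have yZ: "((\<lambda>j. Z i j x * s j x) has_sum y i x) UNIV" if x: "x \<in> X" for i x
  proof -
    have bd: "norm (gram i k x * free_gram k j x * s j x) \<le> (CG * CH * v i ^ 4) * v k ^ 9 * v j ^ 9" for j k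
    proof -
      have "norm (gram i k x) * norm (free_gram k j x) * norm (s j x) \<le> (CG * (v i ^ 4 * v k ^ 4)) * (CH * (v k ^ 5 * v j ^ 5)) * (1 * v j ^ 4)"
        using CG(1) CH(1) v0 by (intro mult_mono CG(2) CH(2) s_le x) auto
      then show ?thesis by (simp add: norm_mult mult_ac flip: power_add)
    qed
    have "(\<lambda>(k, j). ((CG * CH * v i ^ 4) * v k ^ 9) * v j ^ 9) summable_on UNIV"
      using CG(1) CH(1) v0 by (intro summable_on_product summable_on_cmult_right v_power_summable) auto
    note S = infsum_swap_dominated[OF this bd]
    have 1: "(\<Sum>\<^sub>\<infinity>j. gram i k x * free_gram k j x * s j x) = gram i k x * (s k x - free k x)" for k
      using has_sum_cmult_right[OF Hs[OF x, of k], of "gram i k x"] by (intro infsumI) (simp add: mult.assoc)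
    have sumGH: "(\<lambda>k. gram i k x * free_gram k j x) summable_on UNIV" for j
      using I(3)[of x 0 "(i, j)"] x by simp
    have 2: "(\<Sum>\<^sub>\<infinity>k. gram i k x * free_gram k j x * s j x) = (\<Sum>\<^sub>\<infinity>k. gram i k x * free_gram k j x) * s j x" for j
      by (rule infsum_cmult_left[OF sumGH])
    have 3: "((\<lambda>k. gram i k x * (s k x - free k x)) has_sum ((\<Sum>\<^sub>\<infinity>k. gram i k x * s k x) - (\<Sum>\<^sub>\<infinity>k. gram i k x * free k x))) UNIV"
      using has_sum_add[OF has_sum_infsum[OF sum_Gs[OF x, of i]] has_sum_uminusI[OF has_sum_infsum[OF sum_Gf[OF x, of i]]]]
      by (simp add: right_diff_distrib)
    have 4: "((\<lambda>j. (\<Sum>\<^sub>\<infinity>k. gram i k x * free_gram k j x) * s j x) has_sum ((\<Sum>\<^sub>\<infinity>k. gram i k x * s k x) - (\<Sum>\<^sub>\<infinity>k. gram i k x * free k x))) UNIV"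
      using has_sum_infsum[OF S(2)] S(3) infsumI[OF 3] by (simp add: 1 2)
    have "((\<lambda>j. gram i j x * s j x + (- (free_gram i j x * s j x) + - ((\<Sum>\<^sub>\<infinity>k. gram i k x * free_gram k j x) * s j x))) has_sum
        ((\<Sum>\<^sub>\<infinity>k. gram i k x * s k x) + (- (s i x - free i x) + - ((\<Sum>\<^sub>\<infinity>k. gram i k x * s k x) - (\<Sum>\<^sub>\<infinity>k. gram i k x * free k x))))) UNIV"
      by (intro has_sum_add has_sum_uminusI 4 Hs[OF x] has_sum_infsum sum_Gs[OF x])
    then show ?thesis by (simp add: Z_def y_def algebra_simps)
  qed
  have ind: "\<exists>B. \<forall>i. \<forall>x\<in>X. norm (y i x) \<le> B"
  proof -
    have "norm (y i x) \<le> (CG * (\<Sum>\<^sub>\<infinity>j. v j ^ 8)) + 2" if x: "x \<in> X" for i x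
    proof -
      have "norm (\<Sum>\<^sub>\<infinity>j. gram i j x * free j x) \<le> (\<Sum>\<^sub>\<infinity>j. CG * v j ^ 8)"
      proof (rule dominated_infsum[OF summable_on_cmult_right[OF v_power_summable]])
        fix j
        have "norm (gram i j x * free j x) \<le> (CG * (v i ^ 4 * v j ^ 4)) * v j ^ 4"
          unfolding norm_mult using CG(1) v0 by (intro mult_mono CG(2) free_le x) auto
        also have "\<dots> \<le> (CG * (1 * v j ^ 4)) * v j ^ 4"
          using CG(1) v0 v_power_le_1 by (intro mult_right_mono mult_left_mono) auto
        finally show "norm (gram i j x * free j x) \<le> CG * v j ^ 8" by (simp add: mult.assoc flip: power_add)
      qed simp
      also have "\<dots> = CG * (\<Sum>\<^sub>\<infinity>j. v j ^ 8)" by (intro infsum_cmult_right v_power_summable) simp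
      finally have 1: "norm (\<Sum>\<^sub>\<infinity>j. gram i j x * free j x) \<le> CG * (\<Sum>\<^sub>\<infinity>j. v j ^ 8)" .
      have "norm (s i x - free i x) \<le> 1 + 1"
        using s_le[of i x] free_le[of i x] v_power_le_1[of i 4] by (intro order_trans[OF norm_triangle_ineq4] add_mono) auto
      with 1 show ?thesis unfolding y_def by (intro order_trans[OF norm_triangle_ineq4]) linarith
    qed
    then show ?thesis by blast
  qed
  then obtain B where B: "\<And>i x. x \<in> X \<Longrightarrow> norm (y i x) \<le> B" by blast
  have half: "norm (y i x) \<le> B * (1/2) ^ n" if "x \<in> X" for i x n
    using that
  proof (induction n arbitrary: i x)
    case (Suc n)
    have B0: "0 \<le> B * (1/2) ^ n" using Suc.IH[OF X(3)] norm_ge_zero order_trans by blast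
    have Zle: "norm (Z i j x) \<le> (B * (1/2) ^ n) * \<gamma> j" for j
    proof -
      have sub: "closed_segment 0 x \<subseteq> X" by (rule closed_segment_subset[OF X(3) Suc.prems X(2)])
      have "norm (Z i j x) \<le> (B * (1/2) ^ n * \<gamma> j) * \<bar>x\<bar>"
      proof (rule norm_le_from_zero[where F="Z i j", OF Z0])
        show "(Z i j has_vector_derivative - (y i t * free j t)) (at t)" if "t \<in> closed_segment 0 x" for t
          using that sub by (intro Zderiv) auto
        show "norm (- (y i t * free j t)) \<le> B * (1/2) ^ n * \<gamma> j" if "t \<in> closed_segment 0 x" for t
          using that sub B0 unfolding norm_minus_cancel norm_mult by (intro mult_mono Suc.IH norm_free_le) auto
      qed
      also have "\<dots> \<le> (B * (1/2) ^ n * \<gamma> j) * 1"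
        using Suc.prems X(5) B0 \<gamma>_pos[of j] by (intro mult_left_mono) (auto simp: abs_le_iff subset_iff)
      finally show ?thesis by simp
    qed
    have "norm (y i x) \<le> (B * (1/2) ^ n) * (3 / 2 * \<delta>\<^sup>2) * (\<Sum>\<^sub>\<infinity>j. v j ^ 12)"
    proof (rule norm_infsum_le[OF yZ[OF Suc.prems] has_sum_cmult_right[OF has_sum_infsum[OF v_power_summable]]])
      fix j
      have "norm (Z i j x) * norm (s j x) \<le> ((B * (1/2) ^ n) * \<gamma> j) * (3 / 2 * \<gamma> j)"
        using B0 \<gamma>_pos[of j] by (intro mult_mono Zle norm_s_le) auto
      also have "\<dots> = (B * (1/2) ^ n) * (3 / 2 * \<delta>\<^sup>2) * v j ^ 12"
        by (simp add: \<gamma>_def power2_eq_square mult_ac flip: power_add)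
      finally show "norm (Z i j x * s j x) \<le> (B * (1/2) ^ n) * (3 / 2 * \<delta>\<^sup>2) * v j ^ 12" by (simp add: norm_mult)
    qed simp
    also have "\<dots> = (B * (1/2) ^ n) * (3 / 2 * (\<delta>\<^sup>2 * (\<Sum>\<^sub>\<infinity>j. v j ^ 12)))" by simp
    also have "\<dots> \<le> (B * (1/2) ^ n) * (1 / 2)"
    proof (intro mult_left_mono B0)
      have "\<delta>\<^sup>2 * (\<Sum>\<^sub>\<infinity>j. v j ^ 12) \<le> A * (\<Sum>\<^sub>\<infinity>j. v j ^ 12)"
      proof (intro mult_right_mono infsum_nonneg)
        have "\<delta>\<^sup>2 \<le> \<delta>\<^sup>2 * Cg" using mult_left_mono[OF Cg(1), of "\<delta>\<^sup>2"] by simp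
        then show "\<delta>\<^sup>2 \<le> A" using \<delta>_A A_pos by linarith
      qed (use v0 in auto)
      then show "3 / 2 * (\<delta>\<^sup>2 * (\<Sum>\<^sub>\<infinity>j. v j ^ 12)) \<le> 1 / 2" using A_infsum[of 12] by simp
    qed
    finally show ?case by simp
  qed (use B in simp)
  have "(\<lambda>n. B * (1/2) ^ n) \<longlonglongrightarrow> B * 0"
    by (intro tendsto_mult tendsto_const LIMSEQ_power_zero) simp
  then have "norm (y i x) \<le> B * 0" by (rule LIMSEQ_le_const) (use half[OF x] in auto)
  then have "(\<Sum>\<^sub>\<infinity>j. gram i j x * free j x) = s i x - free i x" by (simp add: y_def)
  then show ?thesis using has_sum_infsum[OF sum_Gf[OF x, of i]] by simp
qed

end

text \<open>The potential of \<open>near_origin\<close> exists on \<open>(-1, 1)\<close> only and is real there. It is bounded by a constant \<open>CV\<close> on the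
  inner half, independently of the cutoff radius \<open>\<epsilon>\<close>, so \<open>CV * \<epsilon>\<close> can be made as small as \<open>perturbed_wave\<close> requires.\<close>
lemma (in eigen_data) matched_exists: "\<exists>W0 \<epsilon> a s0. matched \<kappa> v Cg \<delta> W0 \<epsilon> a s0"
proof -
  let ?U = "{-1<..<1::real}"
  obtain s0 where s0: "symbols (\<lambda>_. 1) ?U s0 (\<lambda>i. v i ^ 5)"
      "\<And>i x. x \<in> ?U \<Longrightarrow> ((\<lambda>j. free_gram i j x * s0 j x) has_sum (s0 i x - free i x)) UNIV"
      "\<And>i x. x \<in> ?U \<Longrightarrow> nth_deriv 2 (s0 i) x = (2 * nth_deriv 1 (\<lambda>x. \<Sum>\<^sub>\<infinity>j. free j x * s0 j x) x - of_real ((\<kappa> i)\<^sup>2)) * s0 i x"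
      "smooth_on ?U (\<lambda>x. \<Sum>\<^sub>\<infinity>j. free j x * s0 j x)" "\<And>i x. x \<in> ?U \<Longrightarrow> cnj (s0 i x) = s0 i x"
      "\<And>i. s0 i 0 = 0" "\<And>i. nth_deriv 1 (s0 i) 0 = of_real (\<gamma> i * \<kappa> i)"
    by (rule near_origin) blast
  define q0 where "q0 x = (\<Sum>\<^sub>\<infinity>j. free j x * s0 j x)" for x
  define V where "V x = 2 * nth_deriv 1 q0 x" for x
  have q0: "smooth_on ?U q0" using s0(4) by (simp add: q0_def[abs_def])
  have V_smooth: "smooth_on ?U V"
    unfolding V_def[abs_def] by (intro smooth_on_cmult smooth_on_deriv q0) auto
  have q0_real: "cnj (q0 x) = q0 x" if "x \<in> ?U" for x
    unfolding q0_def using s0(5)[OF that] by (subst infsum_cnj[symmetric]) (simp add: free_def)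
  have V_real: "of_real (Re (V x)) = V x" if x: "x \<in> ?U" for x
  proof -
    have "cnj (nth_deriv 1 q0 x) = nth_deriv 1 (\<lambda>x. cnj (q0 x)) x"
      by (rule nth_deriv_linear[OF _ q0 bounded_linear_cnj x, symmetric]) auto
    also have "\<dots> = nth_deriv 1 q0 x" by (rule nth_deriv_cong[of ?U]) (use x q0_real in auto)
    finally have "cnj (V x) = V x" by (simp add: V_def)
    then show ?thesis by (metis Reals_cnj_iff of_real_Re)
  qed
  have "compact (V ` {-1/2..1/2})"
    using smooth_on_continuous[OF V_smooth, of 0] by (intro compact_continuous_image) (auto intro: continuous_on_subset)
  then obtain B where B: "\<And>x. x \<in> {-1/2..1/2} \<Longrightarrow> norm (V x) \<le> B"
    by (meson compact_imp_bounded bounded_iff image_eqI)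
  define CV where "CV = max B 1"
  have CV: "1 \<le> CV" "\<And>x. x \<in> {-1/2..1/2} \<Longrightarrow> norm (V x) \<le> CV" using B by (auto simp: CV_def le_max_iff_disj)
  define \<epsilon> where "\<epsilon> = 1 / (8 * CV)"
  have \<epsilon>: "0 < \<epsilon>" "\<epsilon> \<le> 1 / 2" "CV * \<epsilon> \<le> 1 / 8" using CV(1) by (auto simp: \<epsilon>_def field_simps)
  obtain \<beta> :: "real \<Rightarrow> real" where \<beta>: "smooth_on UNIV \<beta>" "\<And>x. \<bar>x\<bar> \<le> \<epsilon> / 2 \<Longrightarrow> \<beta> x = 1"
      "\<And>x. 3 * \<epsilon> / 4 \<le> \<bar>x\<bar> \<Longrightarrow> \<beta> x = 0" "\<And>x. \<bar>\<beta> x\<bar> \<le> 1"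
    using smooth_bump[OF \<epsilon>(1)] by blast
  define W0 where "W0 x = \<beta> x * Re (V x)" for x
  have supp: "W0 x = 0" if "3 * \<epsilon> / 4 \<le> \<bar>x\<bar>" for x using \<beta>(3)[OF that] by (simp add: W0_def)
  have W0_smooth: "smooth_on UNIV (\<lambda>x. complex_of_real (W0 x))"
  proof -
    have o: "open ?U" "open {x. 3 * \<epsilon> / 4 < \<bar>x\<bar>}" by (auto intro!: open_Collect_less continuous_intros)
    have "smooth_on ?U (\<lambda>x. complex_of_real (W0 x)) = smooth_on ?U (\<lambda>x. of_real (\<beta> x) * V x)"
      by (rule smooth_on_cong[OF o(1)]) (use V_real in \<open>simp add: W0_def\<close>)
    moreover have "smooth_on ?U (\<lambda>x. of_real (\<beta> x) * V x)"
      by (intro smooth_on_mult V_smooth o smooth_on_linear[OF _ smooth_on_subset[OF \<beta>(1)] bounded_linear_of_real]) auto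
    moreover have "smooth_on {x. 3 * \<epsilon> / 4 < \<bar>x\<bar>} (\<lambda>x. complex_of_real (W0 x)) = smooth_on {x. 3 * \<epsilon> / 4 < \<bar>x\<bar>} (\<lambda>x. 0 :: complex)"
      by (rule smooth_on_cong[OF o(2)]) (use supp in simp)
    moreover have "UNIV = ?U \<union> {x. 3 * \<epsilon> / 4 < \<bar>x\<bar>}" using \<epsilon> by auto
    ultimately show ?thesis using smooth_on_Un smooth_on_const by metis
  qed
  have W0_cont: "continuous_on UNIV W0"
    using continuous_on_Re[OF smooth_on_continuous[OF W0_smooth, of 0]] by simp
  have W0_le: "\<bar>W0 x\<bar> \<le> CV" for x
  proof (cases "3 * \<epsilon> / 4 \<le> \<bar>x\<bar>")
    case True
    then show ?thesis using supp[of x] CV(1) by simp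
  next
    case False
    then have "norm (V x) \<le> CV" using \<epsilon> by (intro CV(2)) auto
    then have "\<bar>\<beta> x\<bar> * \<bar>Re (V x)\<bar> \<le> 1 * CV"
      using abs_Re_le_cmod[of "V x"] \<beta>(4)[of x] by (intro mult_mono) auto
    then show ?thesis by (simp add: W0_def abs_mult)
  qed
  have W0_supp: "W0 x = 0" if "\<epsilon> \<le> \<bar>x\<bar>" for x using supp[of x] that \<epsilon>(1) by simp
  have "\<forall>i. \<exists>a. a 0 = 1 / (2 * \<i>) \<and>
    (\<forall>x. (a has_vector_derivative of_real (W0 x) * (a x * wave (\<kappa> i) x + cnj (a x) * wave (- \<kappa> i) x) * wave (- \<kappa> i) x / (2 * \<i> * of_real (\<kappa> i))) (at x)) \<and>
    (\<forall>x. norm (a x - 1 / (2 * \<i>)) \<le> 1 / 4)"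
    using perturbed_wave[OF \<kappa>_pos \<epsilon>(1,2) W0_cont W0_supp W0_le \<epsilon>(3)] by blast
  then obtain a where a: "\<And>i. a i 0 = 1 / (2 * \<i>)"
    "\<And>i x. (a i has_vector_derivative of_real (W0 x) * (a i x * wave (\<kappa> i) x + cnj (a i x) * wave (- \<kappa> i) x) * wave (- \<kappa> i) x / (2 * \<i> * of_real (\<kappa> i))) (at x)"
    "\<And>i x. norm (a i x - 1 / (2 * \<i>)) \<le> 1 / 4" by metis
  have "matched \<kappa> v Cg \<delta> W0 \<epsilon> a s0"
  proof
    fix x :: real
    assume x: "\<bar>x\<bar> < \<epsilon> / 2"
    then have "x \<in> ?U" using \<epsilon> by auto
    from V_real[OF this] have "of_real (W0 x) = V x" using x \<beta>(2)[of x] by (simp add: W0_def)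
    then show "of_real (W0 x) = 2 * nth_deriv 1 (\<lambda>x. \<Sum>\<^sub>\<infinity>j. free j x * s0 j x) x"
      by (simp only: V_def q0_def[abs_def])
  qed (fact \<epsilon> W0_smooth W0_supp a s0)+
  then show ?thesis by blast
qed

section \<open>The eigenfunctions and their Fourier coefficients\<close>

lemma has_sum_single: "((\<lambda>j. if j = i then z else 0) has_sum z) UNIV"
  by (rule has_sum_finite_neutralI[of "{i}"]) auto

lemma has_sum_edges:
  fixes H :: "nat \<times> bool \<times> bool \<Rightarrow> complex"
  assumes "(H has_sum S) UNIV"
  shows "((\<lambda>j. \<Sum>\<sigma>\<in>UNIV. \<Sum>\<tau>\<in>UNIV. H (j, \<sigma>, \<tau>)) has_sum S) UNIV"
proof (rule has_sum_SigmaD[where B="\<lambda>_. UNIV"])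
  show "(H has_sum S) (Sigma UNIV (\<lambda>_. UNIV))" using assms by simp
  show "((\<lambda>y. H (j, y)) has_sum (\<Sum>\<sigma>\<in>UNIV. \<Sum>\<tau>\<in>UNIV. H (j, \<sigma>, \<tau>))) UNIV" for j
    by (rule has_sum_finiteI) (auto simp: sum.cartesian_product)
qed

lemma edges_summable:
  fixes h :: "nat \<Rightarrow> real"
  assumes "h summable_on UNIV" "\<And>j. 0 \<le> h j"
  shows "(\<lambda>ed. h (fst ed)) summable_on (UNIV :: (nat \<times> bool \<times> bool) set)"
    and "(\<Sum>\<^sub>\<infinity>ed\<in>(UNIV :: (nat \<times> bool \<times> bool) set). h (fst ed)) = 4 * infsum h UNIV"
proof -
  have "(\<lambda>(j, st). h j * (\<lambda>_::bool \<times> bool. 1) st) summable_on UNIV"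
    by (rule summable_on_product[OF assms(1)]) (auto simp: assms(2))
  then show s: "(\<lambda>ed. h (fst ed)) summable_on (UNIV :: (nat \<times> bool \<times> bool) set)"
    by (simp add: case_prod_unfold)
  have "(\<Sum>\<^sub>\<infinity>ed\<in>(UNIV :: (nat \<times> bool \<times> bool) set). h (fst ed)) = (\<Sum>\<^sub>\<infinity>j. \<Sum>\<^sub>\<infinity>st\<in>(UNIV :: (bool \<times> bool) set). h j)"
    using infsum_Sigma_banach[of "\<lambda>ed. h (fst ed)" UNIV "\<lambda>_. UNIV :: (bool \<times> bool) set"] s by simp
  also have "\<dots> = (\<Sum>\<^sub>\<infinity>j. 4 * h j)"
    by (intro infsum_cong) (simp add: card_UNIV_bool)
  also have "\<dots> = 4 * infsum h UNIV" by (rule infsum_cmult_right) (use assms in auto)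
  finally show "(\<Sum>\<^sub>\<infinity>ed\<in>(UNIV :: (nat \<times> bool \<times> bool) set). h (fst ed)) = 4 * infsum h UNIV" .
qed

text \<open>Only the group structure of the lattice and the submultiplicativity of the weights enter. The Fourier coefficients
  of \<open>\<psi>\<close> are weighted with \<open>e\<^sup>2\<close>; one factor \<open>e\<close> is spent on the derivatives of the waves, the other one remains for
  the estimate of the final coefficients.\<close>
locale lattice_problem = matched +
  fixes \<iota> :: "nat \<Rightarrow> 'n::ab_group_add" and e fr :: "'n \<Rightarrow> real"
  assumes e_pos: "\<And>n. 0 < e n" and e_le_1: "\<And>n. e n \<le> 1" and e_0: "e 0 = 1"
    and e_summable: "e summable_on UNIV" and e_mult: "\<And>m n. e m * e n \<le> e (m + n)"
    and e_minus: "\<And>n. e (- n) = e n" and e_\<iota>: "\<And>i. (e (\<iota> i))\<^sup>2 = v i"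
    and fr_add: "\<And>m n. fr (m + n) = fr m + fr n" and fr_\<iota>: "\<And>i. fr (\<iota> i) = 2 * \<kappa> i"
    and fr_tame: "\<And>k. \<exists>C\<ge>0. \<forall>n. \<bar>fr n\<bar> ^ k * e n \<le> C"
begin

abbreviation H :: "real set" where "H \<equiv> {-1<..}"

definition E :: "'n \<Rightarrow> real" where "E n = (e n)\<^sup>2"

lemma fr_0 [simp]: "fr 0 = 0"
  using fr_add[of 0 0] by simp

lemma fr_minus: "fr (- n) = - fr n"
  using fr_add[of n "- n"] by simp

lemma fr_diff: "fr (m - n) = fr m - fr n"
  using fr_add[of m "- n"] by (simp add: fr_minus)

lemma E_pos: "0 < E n" and E_le_1: "E n \<le> 1" and E_0 [simp]: "E 0 = 1" and E_minus: "E (- n) = E n"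
  and E_\<iota>: "E (\<iota> i) = v i"
  using e_pos[of n] e_le_1[of n] by (auto simp: E_def e_0 e_minus e_\<iota> power_le_one)

lemma E_mult: "E m * E n \<le> E (m + n)"
  using power_mono[OF e_mult[of m n], of 2] e_pos[of m] e_pos[of n]
  by (simp add: E_def power_mult_distrib)

lemma E_le_e: "E n \<le> e n"
  using e_pos[of n] e_le_1[of n] by (simp add: E_def power2_eq_square mult_left_le)

lemma E_summable: "E summable_on UNIV"
  by (rule dominated_summable[OF e_summable]) (use E_le_e less_imp_le[OF E_pos] in auto)

text \<open>The lattice shift caused by the wave with frequency \<open>\<plusminus>\<kappa> i \<plusminus> \<kappa> j\<close> when unknown \<open>j\<close> carries the factor
  \<open>wave (\<kappa> j)\<close> and equation \<open>i\<close> is divided by \<open>wave (\<kappa> i)\<close>; it lies in the lattice since \<open>2 * \<kappa> i = fr (\<iota> i)\<close>.\<close>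
definition \<nu> :: "nat \<Rightarrow> nat \<Rightarrow> bool \<Rightarrow> bool \<Rightarrow> 'n" where
  "\<nu> i j \<sigma> \<tau> = (if \<sigma> then 0 else - \<iota> i) + (if \<tau> then \<iota> j else 0)"

lemma fr_\<nu>: "fr (\<nu> i j \<sigma> \<tau>) = (sg \<sigma> - 1) * \<kappa> i + (sg \<tau> + 1) * \<kappa> j"
  by (simp add: \<nu>_def fr_add fr_minus fr_\<iota> sg_def)

text \<open>Submultiplicativity: a shift by \<open>\<iota> i\<close> costs at most the factor \<open>1 / v i\<close>.\<close>
lemma E_shift: "E (n - \<nu> i j \<sigma> \<tau>) * (v i * v j) \<le> E n"
proof -
  have "v i \<le> E (if \<sigma> then 0 else - \<iota> i)" "v j \<le> E (if \<tau> then \<iota> j else 0)"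
    using v_le_1 by (auto simp: E_minus E_\<iota>)
  then have "v i * v j \<le> E (if \<sigma> then 0 else - \<iota> i) * E (if \<tau> then \<iota> j else 0)"
    using v_pos E_pos by (intro mult_mono) (auto simp: less_imp_le)
  also have "\<dots> \<le> E (\<nu> i j \<sigma> \<tau>)" unfolding \<nu>_def by (rule E_mult)
  finally have "E (n - \<nu> i j \<sigma> \<tau>) * (v i * v j) \<le> E (n - \<nu> i j \<sigma> \<tau>) * E (\<nu> i j \<sigma> \<tau>)"
    using E_pos less_imp_le by (intro mult_left_mono) auto
  also have "\<dots> \<le> E (n - \<nu> i j \<sigma> \<tau> + \<nu> i j \<sigma> \<tau>)" by (rule E_mult)
  finally show ?thesis by simp
qed

lemma v0: "0 \<le> v i"
  using less_imp_le[OF v_pos] .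

lemma D_ge: "x \<in> H \<Longrightarrow> 1 / 2 \<le> 1 + c i * x"
proof -
  assume "x \<in> H"
  then have "c i * (-1) \<le> c i * x" using c_pos[of i] by (intro mult_left_mono) auto
  then show ?thesis using c_le(2)[of i] by linarith
qed

lemma b_bound:
  assumes "x \<in> H"
  shows "norm (b i j \<sigma> \<tau> x) \<le> A * (v i ^ 3 * v j ^ 3) / 8"
proof -
  have "norm (osc i j \<sigma> \<tau> * (amp i \<sigma> x * amp j \<tau> x)) \<le> (\<delta>\<^sup>2 * Cg) * (v i ^ 3 * v j ^ 3)"
  proof -
    have "norm (osc i j \<sigma> \<tau>) * (norm (a i x) * norm (a j x)) \<le> (\<delta>\<^sup>2 * Cg * (v i ^ 5 * v j ^ 5)) * (1 * 1)"
      using a_le[of i x] a_le[of j x] Cg(1) v0 by (intro mult_mono osc_bound) auto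
    also have "\<dots> \<le> (\<delta>\<^sup>2 * Cg) * (v i ^ 3 * v j ^ 3)"
      using v0 Cg(1) unfolding mult_1_right by (intro mult_left_mono mult_mono v_power_le) auto
    finally show ?thesis by (simp add: norm_mult)
  qed
  moreover have "norm ((if i = j \<and> \<sigma> \<and> \<not> \<tau> then 1 else 0) * rem i x) \<le> 6 * (\<delta>\<^sup>2 * Cg) * (v i ^ 3 * v j ^ 3)"
  proof (cases "i = j \<and> \<sigma> \<and> \<not> \<tau>")
    case True
    have "norm (rem i x) \<le> 6 * (\<delta>\<^sup>2 * Cg) * v i ^ 10" using assms by (intro norm_rem_le) simp
    also have "\<dots> \<le> 6 * (\<delta>\<^sup>2 * Cg) * v i ^ 6" using Cg(1) by (intro mult_left_mono v_power_le) auto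
    finally show ?thesis using True by (simp flip: power_add)
  next
    case False
    show ?thesis unfolding if_not_P[OF False] using v0 Cg(1) by simp
  qed
  ultimately have "norm (b i j \<sigma> \<tau> x) \<le> 7 * (\<delta>\<^sup>2 * Cg) * (v i ^ 3 * v j ^ 3)"
    unfolding b_def by (intro order_trans[OF norm_triangle_ineq]) linarith
  also have "\<dots> \<le> (A / 8) * (v i ^ 3 * v j ^ 3)"
    using \<delta>_A A_pos v0 by (intro mult_right_mono) auto
  finally show ?thesis by simp
qed

lemma symbols_b: "symbols (\<lambda>x. 1 + \<bar>x\<bar>) H (\<lambda>((i, j), (\<sigma>, \<tau>)). b i j \<sigma> \<tau>) (\<lambda>((i, j), _). v i ^ 3 * v j ^ 3)"
proof -
  let ?w = "\<lambda>p :: (nat \<times> nat) \<times> bool \<times> bool. v (fst (fst p)) ^ 3 * v (snd (fst p)) ^ 3"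
  have 1: "symbols (\<lambda>x. 1 + \<bar>x\<bar>) H (\<lambda>p x. osc (fst (fst p)) (snd (fst p)) (fst (snd p)) (snd (snd p)) *
      (amp (fst (fst p)) (fst (snd p)) x * amp (snd (fst p)) (snd (snd p)) x)) ?w"
  proof (rule symbols_weight[where c=1])
    show "symbols (\<lambda>x. 1 + \<bar>x\<bar>) H (\<lambda>p x. osc (fst (fst p)) (snd (fst p)) (fst (snd p)) (snd (snd p)) *
      (amp (fst (fst p)) (fst (snd p)) x * amp (snd (fst p)) (snd (snd p)) x)) (\<lambda>p. v (fst (fst p)) ^ 4 * v (snd (fst p)) ^ 4)"
      using symbols_oscillating by (simp add: case_prod_unfold)
  qed (use v0 in \<open>auto intro!: mult_mono v_power_le\<close>)
  have 2: "symbols (\<lambda>x. 1 + \<bar>x\<bar>) H (\<lambda>p x. (if fst (fst p) = snd (fst p) \<and> fst (snd p) \<and> \<not> snd (snd p) then 1 else 0) * rem (fst (fst p)) x) ?w"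
  proof (rule symbols_weight[where c=1, OF symbols_cmult[OF _ symbols_reindex[OF symbols_rem]]])
    show "norm (if fst (fst p) = snd (fst p) \<and> fst (snd p) \<and> \<not> snd (snd p) then 1 else (0::complex)) * v (fst (fst p)) ^ 7 \<le> 1 * ?w p"
      for p :: "(nat \<times> nat) \<times> bool \<times> bool"
      using v0 v_power_le[of 6 7] by (auto simp flip: power_add)
  qed (use v0 in auto)
  have "symbols (\<lambda>x. 1 + \<bar>x\<bar>) H (\<lambda>p x. b (fst (fst p)) (snd (fst p)) (fst (snd p)) (snd (snd p)) x) ?w"
    using symbols_add[OF _ 1 2] by (simp add: b_def[abs_def])
  then show ?thesis by (simp add: case_prod_unfold)
qed

text \<open>The next three definitions spell out the system for the Fourier coefficients: row \<open>i\<close> of \<open>(1 + G) \<psi> = s\<close> is divided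
  by \<open>1 + c i * x\<close>, and the coefficients of \<open>wave (\<kappa> i + fr n)\<close> are compared. An edge is a triple \<open>(j, \<sigma>, \<tau>)\<close>.\<close>
definition T :: "nat \<times> 'n \<Rightarrow> nat \<times> bool \<times> bool \<Rightarrow> real \<Rightarrow> complex" where
  "T p ed x = (- 1) * ((1 / of_real (1 + c (fst p) * x)) * b (fst p) (fst ed) (fst (snd ed)) (snd (snd ed)) x)"

definition target :: "nat \<times> 'n \<Rightarrow> nat \<times> bool \<times> bool \<Rightarrow> nat \<times> 'n" where
  "target p ed = (fst ed, snd p - \<nu> (fst p) (fst ed) (fst (snd ed)) (snd (snd ed)))"

definition source :: "nat \<times> 'n \<Rightarrow> real \<Rightarrow> complex" where
  "source p x = (1 / of_real (1 + c (fst p) * x)) * ((if snd p = 0 then of_real (\<gamma> (fst p)) else 0) * amp (fst p) True x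
     + (if snd p = - \<iota> (fst p) then of_real (\<gamma> (fst p)) else 0) * amp (fst p) False x)"

definition u :: "nat \<times> 'n \<Rightarrow> real" where "u p = v (fst p) ^ 2 * E (snd p)"

lemma u_nonneg: "0 \<le> u p"
  using v0 less_imp_le[OF E_pos] by (simp add: u_def)

lemma symbols_invD: "symbols (\<lambda>x. 1 + \<bar>x\<bar>) H (\<lambda>i x. 1 / of_real (1 + c i * x)) (\<lambda>_. 1)"
  using c_pos c_le(2) less_imp_le by (intro symbols_inverse_linear) auto

lemma \<delta>_le_1: "\<delta> \<le> 1"
  by (rule power2_le_imp_le) (use \<delta>2_le in auto)

lemma symbols_T: "symbols (\<lambda>x. 1 + \<bar>x\<bar>) H (\<lambda>(p, ed). T p ed) (\<lambda>(p, ed). A * (v (fst p) ^ 3 * v (fst ed) ^ 3))"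
proof -
  have "symbols (\<lambda>x. 1 + \<bar>x\<bar>) H (\<lambda>q x. b (fst (fst q)) (fst (snd q)) (fst (snd (snd q))) (snd (snd (snd q))) x)
      (\<lambda>q :: (nat \<times> 'n) \<times> nat \<times> bool \<times> bool. v (fst (fst q)) ^ 3 * v (fst (snd q)) ^ 3)"
    using symbols_reindex[OF symbols_b, of "\<lambda>q :: (nat \<times> 'n) \<times> nat \<times> bool \<times> bool. ((fst (fst q), fst (snd q)), snd (snd q))"]
    by (simp add: case_prod_unfold)
  from symbols_cmult[OF _ symbols_mult[OF _ symbols_reindex[OF symbols_invD, of "\<lambda>q. fst (fst q)"] this], of "\<lambda>_. -1"]
  have "symbols (\<lambda>x. 1 + \<bar>x\<bar>) H (\<lambda>(p, ed). T p ed) (\<lambda>(p, ed). v (fst p) ^ 3 * v (fst ed) ^ 3)"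
    by (simp add: T_def[abs_def] case_prod_unfold)
  then show ?thesis
    by (rule symbols_weight[where c="1 / A"]) (use A_pos v0 in auto)
qed

lemma symbols_source: "symbols (\<lambda>x. 1 + \<bar>x\<bar>) H source u"
proof -
  have amp: "symbols (\<lambda>x. 1 + \<bar>x\<bar>) H (\<lambda>p. amp (fst p) \<sigma>) (\<lambda>p :: nat \<times> 'n. 1 / v (fst p))" for \<sigma>
    using symbols_reindex[OF symbols_amp, of "\<lambda>p. (fst p, \<sigma>)"] by simp
  have le: "norm (if P then complex_of_real (\<gamma> i) else 0) * (1 / v i) \<le> 1 * (v i ^ 2 * E n)" if "P \<Longrightarrow> v i \<le> E n" for P i n
  proof (cases P)
    case True
    have "norm (complex_of_real (\<gamma> i)) * (1 / v i) = \<delta> * v i ^ 5"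
      using v_pos[of i] \<delta>(1) by (simp add: \<gamma>_def norm_mult norm_power power_numeral_reduce)
    also have "\<dots> \<le> 1 * v i ^ 3" using v0 \<delta>(1) \<delta>_le_1 by (intro mult_mono v_power_le) auto
    also have "\<dots> = v i ^ 2 * v i" by (simp add: power_numeral_reduce)
    also have "\<dots> \<le> v i ^ 2 * E n" using that[OF True] v0 by (intro mult_left_mono) auto
    finally show ?thesis using True by simp
  next
    case False
    then show ?thesis using v0 less_imp_le[OF E_pos] by simp
  qed
  have 1: "symbols (\<lambda>x. 1 + \<bar>x\<bar>) H (\<lambda>p x. (if snd p = 0 then of_real (\<gamma> (fst p)) else 0) * amp (fst p) True x) u"
  proof (rule symbols_weight[OF symbols_cmult[OF _ amp] zero_le_one])
    show "norm (if snd p = 0 then complex_of_real (\<gamma> (fst p)) else 0) * (1 / v (fst p)) \<le> 1 * u p" for p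
      unfolding u_def by (rule le) (simp add: v_le_1)
  qed (auto simp: u_nonneg)
  have 2: "symbols (\<lambda>x. 1 + \<bar>x\<bar>) H (\<lambda>p x. (if snd p = - \<iota> (fst p) then of_real (\<gamma> (fst p)) else 0) * amp (fst p) False x) u"
  proof (rule symbols_weight[OF symbols_cmult[OF _ amp] zero_le_one])
    show "norm (if snd p = - \<iota> (fst p) then complex_of_real (\<gamma> (fst p)) else 0) * (1 / v (fst p)) \<le> 1 * u p" for p
      unfolding u_def by (rule le) (simp add: E_minus E_\<iota>)
  qed (auto simp: u_nonneg)
  show ?thesis
    using symbols_mult[OF _ symbols_reindex[OF symbols_invD, of fst] symbols_add[OF _ 1 2]]
    by (simp add: source_def[abs_def])
qed

lemma T_bound: "x \<in> H \<Longrightarrow> norm (T p ed x) \<le> A * (v (fst p) ^ 3 * v (fst ed) ^ 3) / 4"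
proof -
  assume x: "x \<in> H"
  let ?b = "b (fst p) (fst ed) (fst (snd ed)) (snd (snd ed)) x"
  have "norm (T p ed x) = norm ?b / (1 + c (fst p) * x)"
    using D_ge[OF x, of "fst p"] unfolding T_def norm_mult norm_divide norm_of_real by simp
  also have "\<dots> \<le> norm ?b / (1 / 2)" using D_ge[OF x, of "fst p"] by (intro divide_left_mono) auto
  finally show ?thesis using b_bound[OF x, of "fst p" "fst ed" "fst (snd ed)" "snd (snd ed)"] by simp
qed

lemma row:
  "(\<lambda>ed. A * (v (fst p) ^ 3 * v (fst ed) ^ 3) * u (target p ed)) summable_on UNIV"
  "(\<Sum>\<^sub>\<infinity>ed. A * (v (fst p) ^ 3 * v (fst ed) ^ 3) * u (target p ed)) \<le> u p"
  and u_target: "v (fst p) ^ 3 * v (fst ed) ^ 3 * u (target p ed) \<le> u p * v (fst ed) ^ 4"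
proof -
  show le: "v (fst p) ^ 3 * v (fst ed) ^ 3 * u (target p ed) \<le> u p * v (fst ed) ^ 4" for ed
  proof -
    let ?E = "E (snd p - \<nu> (fst p) (fst ed) (fst (snd ed)) (snd (snd ed)))"
    have "v (fst p) ^ 3 * v (fst ed) ^ 3 * u (target p ed) = (v (fst p) ^ 2 * v (fst ed) ^ 4) * (?E * (v (fst p) * v (fst ed)))"
      by (simp add: u_def target_def power_numeral_reduce mult_ac)
    also have "\<dots> \<le> (v (fst p) ^ 2 * v (fst ed) ^ 4) * E (snd p)"
      using v0 by (intro mult_left_mono E_shift) auto
    finally show ?thesis by (simp add: u_def mult_ac)
  qed
  have bound: "norm (A * (v (fst p) ^ 3 * v (fst ed) ^ 3) * u (target p ed)) \<le> (A * u p) * v (fst ed) ^ 4" for ed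
    using mult_left_mono[OF le[of ed] less_imp_le[OF A_pos]] A_pos v0 u_nonneg by (simp add: abs_mult mult.assoc)
  note es = edges_summable[OF v_power_summable[of 4]]
  have s: "(\<lambda>ed :: nat \<times> bool \<times> bool. (A * u p) * v (fst ed) ^ 4) summable_on UNIV"
    by (intro summable_on_cmult_right es(1)) (use v0 in auto)
  show "(\<lambda>ed. A * (v (fst p) ^ 3 * v (fst ed) ^ 3) * u (target p ed)) summable_on UNIV"
    by (rule dominated_summable[OF s bound])
  have "(\<Sum>\<^sub>\<infinity>ed. A * (v (fst p) ^ 3 * v (fst ed) ^ 3) * u (target p ed)) \<le> (\<Sum>\<^sub>\<infinity>ed :: nat \<times> bool \<times> bool. (A * u p) * v (fst ed) ^ 4)"
    using dominated_infsum[OF s bound] by simp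
  also have "\<dots> = (A * u p) * (4 * (\<Sum>\<^sub>\<infinity>j. v j ^ 4))"
    using es v0 by (subst infsum_cmult_right) auto
  also have "\<dots> = u p * (4 * (A * (\<Sum>\<^sub>\<infinity>j. v j ^ 4)))" by simp
  also have "\<dots> \<le> u p * 1" using A_infsum[of 4] u_nonneg by (intro mult_left_mono) auto
  finally show "(\<Sum>\<^sub>\<infinity>ed. A * (v (fst p) ^ 3 * v (fst ed) ^ 3) * u (target p ed)) \<le> u p" by simp
qed

definition \<Psi> :: "nat \<times> 'n \<Rightarrow> real \<Rightarrow> complex" where
  "\<Psi> = (SOME \<Psi>. symbols (\<lambda>x. 1 + \<bar>x\<bar>) H \<Psi> u \<and>
     (\<forall>p. \<forall>x\<in>H. ((\<lambda>ed. T p ed x * \<Psi> (target p ed) x) has_sum (\<Psi> p x - source p x)) UNIV))"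

lemma symbols_\<Psi>: "symbols (\<lambda>x. 1 + \<bar>x\<bar>) H \<Psi> u"
  and \<Psi>_eq: "x \<in> H \<Longrightarrow> ((\<lambda>ed. T p ed x * \<Psi> (target p ed) x) has_sum (\<Psi> p x - source p x)) UNIV"
proof -
  have "\<exists>\<Psi>. symbols (\<lambda>x. 1 + \<bar>x\<bar>) H \<Psi> u \<and>
     (\<forall>p. \<forall>x\<in>H. ((\<lambda>ed. T p ed x * \<Psi> (target p ed) x) has_sum (\<Psi> p x - source p x)) UNIV)"
    by (rule symbol_system_solvable[OF _ _ _ symbols_T symbols_source T_bound row]) auto
  from someI_ex[OF this, folded \<Psi>_def]
  show "symbols (\<lambda>x. 1 + \<bar>x\<bar>) H \<Psi> u"
    "x \<in> H \<Longrightarrow> ((\<lambda>ed. T p ed x * \<Psi> (target p ed) x) has_sum (\<Psi> p x - source p x)) UNIV" by blast+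
qed

definition \<psi> :: "nat \<Rightarrow> real \<Rightarrow> complex" where
  "\<psi> i x = (\<Sum>\<^sub>\<infinity>n. wave (\<kappa> i + fr n) x * \<Psi> (i, n) x)"

lemma symbols_wave_fr: "symbols (\<lambda>_. 1) U (\<lambda>n. wave (fr n)) (\<lambda>n. 1 / e n)"
proof (rule symbols_wave)
  fix k
  obtain C where "C \<ge> 0" "\<forall>n. \<bar>fr n\<bar> ^ k * e n \<le> C" using fr_tame[of k] by blast
  then show "\<exists>C\<ge>0. \<forall>n. \<bar>fr n\<bar> ^ k \<le> C * (1 / e n)"
    using e_pos by (intro exI[of _ C]) (simp add: pos_le_divide_eq)
qed (use e_pos less_imp_le in auto)

lemma symbols_terms: "symbols (\<lambda>_. 1) H (\<lambda>(i, n) x. wave (\<kappa> i + fr n) x * \<Psi> (i, n) x) (\<lambda>(i, n). v i * e n)"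
proof -
  have w: "symbols (\<lambda>_. 1) H (\<lambda>p x. wave (1 * \<kappa> (fst p)) x * wave (fr (snd p)) x) (\<lambda>p. 1 / v (fst p) * (1 / e (snd p)))"
    by (intro symbols_mult symbols_reindex[OF symbols_wave_\<kappa>] symbols_reindex[OF symbols_wave_fr]) auto
  have p: "symbols (\<lambda>_. 1) H \<Psi> u" by (rule symbols_subset[OF symbols_\<Psi>]) auto
  have "symbols (\<lambda>_. 1) H (\<lambda>p x. wave (1 * \<kappa> (fst p)) x * wave (fr (snd p)) x * \<Psi> p x) (\<lambda>p. 1 / v (fst p) * (1 / e (snd p)) * u p)"
    by (rule symbols_mult[OF _ w p]) auto
  moreover have "1 / v i * (1 / e n) * u (i, n) = v i * e n" for i n
    using v_pos[of i] e_pos[of n] by (simp add: u_def E_def power2_eq_square)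
  then have "(\<lambda>p. 1 / v (fst p) * (1 / e (snd p)) * u p) = (\<lambda>p. v (fst p) * e (snd p))" by auto
  ultimately show ?thesis by (simp only: case_prod_unfold wave_add mult_1 prod.collapse)
qed

lemma symbols_\<psi>: "symbols (\<lambda>_. 1) H \<psi> v"
proof -
  have "symbols (\<lambda>_. 1) H \<psi> (\<lambda>i. \<Sum>\<^sub>\<infinity>n. v i * e n)"
    unfolding \<psi>_def[abs_def]
    by (rule symbols_infsum[OF _ _ _ symbols_terms]) (auto intro: summable_on_cmult_right e_summable)
  then show ?thesis
    by (rule symbols_weight[where c="infsum e UNIV"])
      (use v0 e_pos in \<open>auto simp: infsum_cmult_right[OF e_summable] less_imp_le intro!: infsum_nonneg\<close>)
qed

lemma \<psi>_has_sum: "x \<in> H \<Longrightarrow> ((\<lambda>n. wave (\<kappa> i + fr n) x * \<Psi> (i, n) x) has_sum \<psi> i x) UNIV"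
proof -
  assume "x \<in> H"
  have "(\<lambda>n. nth_deriv 0 (\<lambda>x. wave (\<kappa> i + fr n) x * \<Psi> (i, n) x) x) summable_on UNIV"
    by (rule symbols_summable[OF _ _ _ symbols_terms]) (use \<open>x \<in> H\<close> in \<open>auto intro: summable_on_cmult_right e_summable\<close>)
  then show ?thesis unfolding \<psi>_def by simp
qed

lemma source_has_sum:
  "x \<in> H \<Longrightarrow> ((\<lambda>n. wave (\<kappa> i + fr n) x * source (i, n) x) has_sum (s i x / of_real (1 + c i * x))) UNIV"
proof -
  assume "x \<in> H"
  let ?d = "1 / complex_of_real (1 + c i * x)"
  have w: "wave (\<kappa> i + fr (- \<iota> i)) x = wave (- \<kappa> i) x" by (simp add: fr_minus fr_\<iota>)
  have "((\<lambda>n. (if n = 0 then ?d * (of_real (\<gamma> i) * (a i x * wave (\<kappa> i) x)) else 0)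
      + (if n = - \<iota> i then ?d * (of_real (\<gamma> i) * (cnj (a i x) * wave (- \<kappa> i) x)) else 0)) has_sum
      (?d * (of_real (\<gamma> i) * (a i x * wave (\<kappa> i) x)) + ?d * (of_real (\<gamma> i) * (cnj (a i x) * wave (- \<kappa> i) x)))) UNIV"
    by (intro has_sum_add has_sum_single)
  moreover have "wave (\<kappa> i + fr n) x * source (i, n) x = (if n = 0 then ?d * (of_real (\<gamma> i) * (a i x * wave (\<kappa> i) x)) else 0)
      + (if n = - \<iota> i then ?d * (of_real (\<gamma> i) * (cnj (a i x) * wave (- \<kappa> i) x)) else 0)" for n
  proof -
    have ne: "- \<iota> i \<noteq> 0" using fr_\<iota>[of i] \<kappa>_pos[of i] by auto
    consider "n = 0" | "n = - \<iota> i" | "n \<noteq> 0" "n \<noteq> - \<iota> i" by blast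
    then show ?thesis by cases (use ne in \<open>auto simp: source_def amp_def w\<close>)
  qed
  moreover have "?d * (of_real (\<gamma> i) * (a i x * wave (\<kappa> i) x)) + ?d * (of_real (\<gamma> i) * (cnj (a i x) * wave (- \<kappa> i) x))
      = s i x / of_real (1 + c i * x)"
    by (simp add: s_def add_divide_distrib distrib_left)
  ultimately show ?thesis by (simp only:)
qed

text \<open>The system for the coefficients, multiplied by the waves and summed over the lattice; the sums over lattice and
  edges may be interchanged as both weights are summable.\<close>
lemma \<psi>_reduced:
  assumes x: "x \<in> H"
  shows "((\<lambda>ed. b i (fst ed) (fst (snd ed)) (snd (snd ed)) x * wave (sg (fst (snd ed)) * \<kappa> i + sg (snd (snd ed)) * \<kappa> (fst ed)) x * \<psi> (fst ed) x)
      has_sum (s i x - of_real (1 + c i * x) * \<psi> i x)) UNIV"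
proof -
  define w where "w n = wave (\<kappa> i + fr n) x" for n
  define F where "F n ed = w n * (T (i, n) ed x * \<Psi> (target (i, n) ed) x)" for n ed
  obtain C where C: "C \<ge> 0" "\<And>a. norm (\<Psi> a x) \<le> C * u a"
  proof -
    have "1 \<le> 1 + \<bar>x\<bar>" for x :: real by simp
    from symbols_bound0[OF symbols_\<Psi> this, of 0]
    obtain C where C: "C \<ge> 0" "\<And>p x. x \<in> H \<Longrightarrow> norm (nth_deriv 0 (\<Psi> p) x) \<le> C * u p" by blast
    show ?thesis by (rule that[OF C(1)]) (use C(2)[OF x] in simp)
  qed
  have bd: "norm (F n ed) \<le> (C * A * v i ^ 2) * E n * v (fst ed) ^ 4" for n ed
  proof -
    have "norm (F n ed) \<le> (A * (v i ^ 3 * v (fst ed) ^ 3) / 4) * (C * u (target (i, n) ed))"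
      unfolding F_def w_def norm_mult norm_wave mult_1
      using T_bound[OF x, of "(i, n)" ed] A_pos v0 by (intro mult_mono C(2)) auto
    also have "\<dots> = (A * C / 4) * (v i ^ 3 * v (fst ed) ^ 3 * u (target (i, n) ed))" by simp
    also have "\<dots> \<le> (A * C / 4) * (u (i, n) * v (fst ed) ^ 4)"
      using u_target[of "(i, n)" ed] A_pos C(1) by (intro mult_left_mono) auto
    also have "\<dots> \<le> (A * C) * (u (i, n) * v (fst ed) ^ 4)"
      using A_pos C(1) v0 u_nonneg by (intro mult_right_mono) auto
    finally show ?thesis by (simp add: u_def mult_ac)
  qed
  have "(\<lambda>(n, ed :: nat \<times> bool \<times> bool). ((C * A * v i ^ 2) * E n) * v (fst ed) ^ 4) summable_on UNIV"
    using C(1) A_pos v0 E_pos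
    by (intro summable_on_product summable_on_cmult_right E_summable edges_summable(1)[OF v_power_summable[of 4]]) (auto simp: less_imp_le)
  note S = infsum_swap_dominated[OF this bd]
  have row_n: "(\<Sum>\<^sub>\<infinity>ed. F n ed) = w n * \<Psi> (i, n) x - w n * source (i, n) x" for n
    using infsumI[OF has_sum_cmult_right[OF \<Psi>_eq[OF x, of "(i, n)"], of "w n"]] by (simp add: F_def right_diff_distrib)
  have sum_n: "((\<lambda>n. w n * \<Psi> (i, n) x - w n * source (i, n) x) has_sum (\<psi> i x - s i x / of_real (1 + c i * x))) UNIV"
    using has_sum_add[OF \<psi>_has_sum[OF x, of i] has_sum_uminusI[OF source_has_sum[OF x, of i]]] by (simp add: w_def)
  have col: "(\<Sum>\<^sub>\<infinity>n. F n ed) = (- 1 / of_real (1 + c i * x)) *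
     (b i (fst ed) (fst (snd ed)) (snd (snd ed)) x * wave (sg (fst (snd ed)) * \<kappa> i + sg (snd (snd ed)) * \<kappa> (fst ed)) x * \<psi> (fst ed) x)" for ed
  proof -
    obtain j \<sigma> \<tau> where ed: "ed = (j, \<sigma>, \<tau>)" by (metis surj_pair)
    let ?\<nu> = "\<nu> i j \<sigma> \<tau>" and ?w = "wave (sg \<sigma> * \<kappa> i + sg \<tau> * \<kappa> j) x"
    have w: "w n = ?w * wave (\<kappa> j + fr (n - ?\<nu>)) x" for n
      unfolding w_def wave_add[symmetric] fr_diff fr_\<nu> by (simp add: algebra_simps)
    have "bij_betw (\<lambda>n. n - ?\<nu>) UNIV UNIV"
      by (rule bij_betwI[of _ _ _ "\<lambda>n. n + ?\<nu>"]) auto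
    from infsum_reindex_bij_betw[OF this, of "\<lambda>n. wave (\<kappa> j + fr n) x * \<Psi> (j, n) x"]
    have "((\<lambda>n. wave (\<kappa> j + fr (n - ?\<nu>)) x * \<Psi> (j, n - ?\<nu>) x) has_sum \<psi> j x) UNIV"
      using summable_on_reindex_bij_betw[OF \<open>bij_betw (\<lambda>n. n - ?\<nu>) UNIV UNIV\<close>, of "\<lambda>n. wave (\<kappa> j + fr n) x * \<Psi> (j, n) x"]
        \<psi>_has_sum[OF x, of j] by (simp add: has_sum_iff)
    from has_sum_cmult_right[OF this, of "(- 1 / of_real (1 + c i * x)) * (b i j \<sigma> \<tau> x * ?w)"]
    show ?thesis
      by (intro infsumI) (simp add: F_def ed T_def target_def w mult_ac)
  qed
  have "((\<lambda>ed. (- 1 / of_real (1 + c i * x)) * (b i (fst ed) (fst (snd ed)) (snd (snd ed)) x * wave (sg (fst (snd ed)) * \<kappa> i + sg (snd (snd ed)) * \<kappa> (fst ed)) x * \<psi> (fst ed) x))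
      has_sum (\<psi> i x - s i x / of_real (1 + c i * x))) UNIV"
    using has_sum_infsum[OF S(2)] S(3) infsumI[OF sum_n] by (simp add: row_n col)
  from has_sum_cmult_right[OF this, of "- of_real (1 + c i * x)"]
  show ?thesis
    using D_ge[OF x, of i] by (simp add: right_diff_distrib del: of_real_add of_real_mult)
qed

lemma \<psi>_eq:
  assumes x: "x \<in> H"
  shows "((\<lambda>j. gram i j x * \<psi> j x) has_sum (s i x - \<psi> i x)) UNIV"
proof -
  have "((\<lambda>j. (\<Sum>\<sigma>\<in>UNIV. \<Sum>\<tau>\<in>UNIV. b i j \<sigma> \<tau> x * wave (sg \<sigma> * \<kappa> i + sg \<tau> * \<kappa> j) x * \<psi> j x) + (if j = i then of_real (c i * x) * \<psi> i x else 0))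
     has_sum (s i x - of_real (1 + c i * x) * \<psi> i x + of_real (c i * x) * \<psi> i x)) UNIV"
    using has_sum_edges[OF \<psi>_reduced[OF x, of i]] by (intro has_sum_add has_sum_single) simp
  moreover have "(\<Sum>\<sigma>\<in>UNIV. \<Sum>\<tau>\<in>UNIV. b i j \<sigma> \<tau> x * wave (sg \<sigma> * \<kappa> i + sg \<tau> * \<kappa> j) x * \<psi> j x) + (if j = i then of_real (c i * x) * \<psi> i x else 0)
     = gram i j x * \<psi> j x" for j
    by (simp add: gram_expansion[of i j x] distrib_right sum_distrib_right)
  ultimately show ?thesis by (simp add: distrib_right)
qed

text \<open>Divided by \<open>1 + c i * x\<close>, row \<open>i\<close> of \<open>1 + G\<close> is the identity plus a contraction.\<close>
lemma gram_inj:
  assumes x: "x \<in> H" and y: "bounded (range y)"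
    and eq: "\<And>i. ((\<lambda>j. gram i j x * y j) has_sum (- y i)) UNIV"
  shows "y i = 0"
proof -
  obtain C where C: "\<And>j. norm (y j) \<le> C" using y by (auto simp: bounded_iff)
  define M where "M i j = (- 1 / of_real (1 + c i * x)) * (gram i j x - (if j = i then of_real (c i * x) else 0))" for i j
  show ?thesis
  proof (rule contraction_zero[OF C, of M "\<lambda>i j. A * (v i ^ 3 * v j ^ 3)"])
    fix i
    have Mg: "gram i j x - (if j = i then of_real (c i * x) else 0) = (\<Sum>\<sigma>\<in>UNIV. \<Sum>\<tau>\<in>UNIV. b i j \<sigma> \<tau> x * wave (sg \<sigma> * \<kappa> i + sg \<tau> * \<kappa> j) x)" for j
      by (simp add: gram_expansion[of i j x])
    show "norm (M i j) \<le> A * (v i ^ 3 * v j ^ 3)" for j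
    proof -
      have "norm (gram i j x - (if j = i then of_real (c i * x) else 0)) \<le> (\<Sum>\<sigma>\<in>(UNIV::bool set). \<Sum>\<tau>\<in>(UNIV::bool set). A * (v i ^ 3 * v j ^ 3) / 8)"
        unfolding Mg by (intro order_trans[OF norm_sum] sum_mono) (simp only: norm_mult norm_wave mult_1_right b_bound[OF x])
      also have "\<dots> = A * (v i ^ 3 * v j ^ 3) / 2" by (simp add: sum_bool)
      finally have 1: "norm (gram i j x - (if j = i then of_real (c i * x) else 0)) \<le> A * (v i ^ 3 * v j ^ 3) / 2" .
      have "norm (M i j) = norm (gram i j x - (if j = i then of_real (c i * x) else 0)) / (1 + c i * x)"
        using D_ge[OF x, of i] unfolding M_def norm_mult norm_divide norm_of_real by simp
      also have "\<dots> \<le> norm (gram i j x - (if j = i then of_real (c i * x) else 0)) / (1 / 2)"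
        using D_ge[OF x, of i] by (intro divide_left_mono) auto
      finally show ?thesis using 1 by simp
    qed
    have e: "A * (v i ^ 3 * v j ^ 3) = (A * v i ^ 3) * v j ^ 3" for j by simp
    show "(\<lambda>j. A * (v i ^ 3 * v j ^ 3)) summable_on UNIV"
      unfolding e by (intro summable_on_cmult_right v_power_summable) simp
    have "(\<Sum>\<^sub>\<infinity>j. A * (v i ^ 3 * v j ^ 3)) = v i ^ 3 * (A * (\<Sum>\<^sub>\<infinity>j. v j ^ 3))"
      unfolding e by (subst infsum_cmult_right) (auto intro: v_power_summable)
    also have "\<dots> \<le> 1 * (1 / 4)" using A_infsum[of 3] v_power_le_1[of i 3] v0 A_pos
      by (intro mult_mono) (auto intro!: mult_nonneg_nonneg infsum_nonneg)
    finally show "(\<Sum>\<^sub>\<infinity>j. A * (v i ^ 3 * v j ^ 3)) \<le> 1 / 2" by simp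
    have "((\<lambda>j. gram i j x * y j + - (if j = i then of_real (c i * x) * y i else 0)) has_sum (- y i + - (of_real (c i * x) * y i))) UNIV"
      by (intro has_sum_add has_sum_uminusI has_sum_single eq)
    from has_sum_cmult_right[OF this, of "- 1 / of_real (1 + c i * x)"]
    have "((\<lambda>j. (- 1 / of_real (1 + c i * x)) * (gram i j x * y j + - (if j = i then of_real (c i * x) * y i else 0))) has_sum
        (- 1 / of_real (1 + c i * x)) * (- y i + - (of_real (c i * x) * y i))) UNIV" .
    moreover have "(- 1 / of_real (1 + c i * x)) * (gram i j x * y j + - (if j = i then of_real (c i * x) * y i else 0)) = M i j * y j" for j
      by (simp add: M_def left_diff_distrib)
    moreover have "(- 1 / of_real (1 + c i * x)) * (- y i + - (of_real (c i * x) * y i)) = y i"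
    proof -
      have "- y i + - (of_real (c i * x) * y i) = - (of_real (1 + c i * x) * y i)" by (simp add: distrib_right)
      then show ?thesis using D_ge[OF x, of i] by (simp del: of_real_add of_real_mult)
    qed
    ultimately show "((\<lambda>j. M i j * y j) has_sum y i) UNIV" by simp
  qed simp
qed

end

lemma has_sum_fst:
  fixes F :: "'j \<times> 'f::finite \<Rightarrow> complex"
  assumes "(F has_sum S) UNIV"
  shows "((\<lambda>j. \<Sum>f\<in>UNIV. F (j, f)) has_sum S) UNIV"
  by (rule has_sum_SigmaD[where B="\<lambda>_. UNIV" and f=F]) (use assms in \<open>auto intro: has_sum_finiteI\<close>)

lemma cnj_primitive:
  assumes "continuous_on UNIV g" "\<And>x. cnj (g x) = g x"
  shows "cnj (primitive g x) = primitive g x"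
proof -
  have "norm (cnj (primitive g x) - primitive g x) \<le> 0 * \<bar>x\<bar>"
  proof (rule norm_le_from_zero[where F="\<lambda>x. cnj (primitive g x) - primitive g x"])
    show "((\<lambda>x. cnj (primitive g x) - primitive g x) has_vector_derivative cnj (g t) - g t) (at t)" for t
      by (intro has_vector_derivative_diff bounded_linear.has_vector_derivative[OF bounded_linear_cnj]
          primitive_has_derivative[OF assms(1)])
  qed (auto simp: assms(2))
  then show ?thesis by simp
qed

context lattice_problem
begin

lemma \<psi>_smooth: "smooth_on H (\<psi> i)"
  by (rule symbols_smooth[OF symbols_\<psi>])

lemma \<psi>_bounded:
  obtains C where "C \<ge> 0" "\<And>i x. x \<in> H \<Longrightarrow> norm (\<psi> i x) \<le> C * v i"
proof -
  have "1 \<le> (1::real)" by simp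
  from symbols_bound0[OF symbols_\<psi> this, of 0]
  obtain C where "C \<ge> 0" "\<And>i x. x \<in> H \<Longrightarrow> norm (nth_deriv 0 (\<psi> i) x) \<le> C * v i" by blast
  then show ?thesis using that[of C] by simp
qed

lemma bounded_range_\<psi>: "x \<in> H \<Longrightarrow> bounded (range (\<lambda>i. \<psi> i x))"
proof -
  assume x: "x \<in> H"
  obtain C where C: "C \<ge> 0" "\<And>i x. x \<in> H \<Longrightarrow> norm (\<psi> i x) \<le> C * v i" by (rule \<psi>_bounded) blast
  have "norm (\<psi> i x) \<le> C" for i using C(2)[OF x, of i] mult_left_le[OF v_le_1[of i] C(1)] by linarith
  then show ?thesis by (intro boundedI) auto
qed

lemma cnj_gram [simp]: "cnj (gram i j x) = gram i j x"
  unfolding gram_def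
proof (rule cnj_primitive)
  show "continuous_on UNIV (\<lambda>x. s i x * s j x)"
    using smooth_on_continuous[OF s_smooth, of UNIV 0] by (auto intro!: continuous_intros)
qed simp

text \<open>The Gram matrix is real, so the imaginary part solves the homogeneous equation.\<close>
lemma cnj_\<psi>:
  assumes x: "x \<in> H"
  shows "cnj (\<psi> i x) = \<psi> i x"
proof -
  have "cnj (\<psi> i x) - \<psi> i x = 0"
  proof (rule gram_inj[OF x])
    have "bounded (range (\<lambda>i. cnj (\<psi> i x)))"
      using bounded_range_\<psi>[OF x] by (auto simp: bounded_iff)
    then show "bounded (range (\<lambda>j. cnj (\<psi> j x) - \<psi> j x))"
      by (rule bounded_minus_comp[OF _ bounded_range_\<psi>[OF x]])
    fix i
    have "((\<lambda>j. cnj (gram i j x * \<psi> j x)) has_sum cnj (s i x - \<psi> i x)) UNIV"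
      unfolding has_sum_cnj_iff by (rule \<psi>_eq[OF x])
    from has_sum_add[OF this has_sum_uminusI[OF \<psi>_eq[OF x, of i]]]
    have "((\<lambda>j. cnj (gram i j x * \<psi> j x) + - (gram i j x * \<psi> j x)) has_sum (cnj (s i x - \<psi> i x) + - (s i x - \<psi> i x))) UNIV" .
    moreover have "cnj (s i x - \<psi> i x) + - (s i x - \<psi> i x) = - (cnj (\<psi> i x) - \<psi> i x)" by simp
    moreover have "cnj (gram i j x * \<psi> j x) + - (gram i j x * \<psi> j x) = gram i j x * (cnj (\<psi> j x) - \<psi> j x)" for j
      by (simp add: right_diff_distrib)
    ultimately show "((\<lambda>j. gram i j x * (cnj (\<psi> j x) - \<psi> j x)) has_sum - (cnj (\<psi> i x) - \<psi> i x)) UNIV"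
      by (simp only:)
  qed
  then show ?thesis by simp
qed

text \<open>By \<open>gram_free\<close> both sides solve \<open>(1 + G) y = s\<close>, which has only one bounded solution.\<close>
lemma \<psi>_near_0:
  assumes x: "x \<in> X"
  shows "\<psi> i x = free i x"
proof -
  have xH: "x \<in> H" using x X(6) by auto
  have "\<psi> i x - free i x = 0"
  proof (rule gram_inj[OF xH])
    have "norm (free j x) \<le> 1" for j
    proof -
      have "\<gamma> j \<le> 1 * 1" unfolding \<gamma>_def using \<delta>_le_1 \<delta>(1) v_power_le_1 v0 by (intro mult_mono) auto
      then show ?thesis using norm_free_le[of j x] by linarith
    qed
    then have "bounded (range (\<lambda>j. free j x))" by (intro boundedI) auto
    then show "bounded (range (\<lambda>j. \<psi> j x - free j x))"
      by (rule bounded_minus_comp[OF bounded_range_\<psi>[OF xH]])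
    fix i
    from has_sum_add[OF \<psi>_eq[OF xH, of i] has_sum_uminusI[OF gram_free[OF x, of i]]]
    have "((\<lambda>j. gram i j x * \<psi> j x + - (gram i j x * free j x)) has_sum (s i x - \<psi> i x + - (s i x - free i x))) UNIV" .
    moreover have "s i x - \<psi> i x + - (s i x - free i x) = - (\<psi> i x - free i x)" by simp
    moreover have "gram i j x * \<psi> j x + - (gram i j x * free j x) = gram i j x * (\<psi> j x - free j x)" for j
      by (simp add: right_diff_distrib)
    ultimately show "((\<lambda>j. gram i j x * (\<psi> j x - free j x)) has_sum - (\<psi> i x - free i x)) UNIV" by (simp only:)
  qed
  then show ?thesis by simp
qed

definition q :: "real \<Rightarrow> complex" where "q x = (\<Sum>\<^sub>\<infinity>j. s j x * \<psi> j x)"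

text \<open>The potential on the right half line.\<close>
definition Wp :: "real \<Rightarrow> complex" where "Wp x = of_real (W0 x) - 2 * nth_deriv 1 q x"

lemma \<psi>_ode: "x \<in> H \<Longrightarrow> nth_deriv 2 (\<psi> i) x = (Wp x - of_real ((\<kappa> i)\<^sup>2)) * \<psi> i x"
  and q_smooth: "smooth_on H q"
proof -
  obtain C where C: "C \<ge> 0" "\<And>i. (1 + \<kappa> i + 1 / \<kappa> i) ^ 2 \<le> C / v i" using tame[of 2] by auto
  have bdd: "(1 + (\<kappa> j)\<^sup>2) * v j \<le> C" for j
  proof -
    have "1 + (\<kappa> j)\<^sup>2 \<le> (1 + \<kappa> j)\<^sup>2" using \<kappa>_pos[of j] by (simp add: power2_eq_square algebra_simps)
    also have "\<dots> \<le> (1 + \<kappa> j + 1 / \<kappa> j)\<^sup>2" using \<kappa>_pos[of j] by (intro power_mono) auto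
    also have "\<dots> \<le> C / v j" by (rule C(2))
    finally show ?thesis using v_pos[of j] by (simp add: field_simps)
  qed
  have vw: "(\<lambda>j. v j ^ 4 * v j) summable_on UNIV"
    using v_power_summable[of 5] by (simp add: power_numeral_reduce mult_ac)
  have q_eq: "q = (\<lambda>x. \<Sum>\<^sub>\<infinity>j. s j x * \<psi> j x)" by (simp add: q_def[abs_def])
  have *: "nth_deriv 2 (\<psi> i) x = (of_real (W0 x) - 2 * 1 * nth_deriv 1 q x - of_real ((\<kappa> i)\<^sup>2)) * \<psi> i x \<and> smooth_on {-1<..<\<bar>x\<bar> + 2} q"
    if x: "x \<in> H" for i x
  proof -
    let ?U = "{-1<..<\<bar>x\<bar> + 2}"
    have U: "open ?U" "convex ?U" "0 \<in> ?U" "?U \<subseteq> {- (\<bar>x\<bar> + 2)..\<bar>x\<bar> + 2}" by auto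
    have UH: "y \<in> ?U \<Longrightarrow> y \<in> H" for y by auto
    have xU: "x \<in> ?U" using x by auto
    have s': "symbols (\<lambda>_. 1) ?U s (\<lambda>i. v i ^ 4)" by (rule symbols_subset[OF symbols_s]) auto
    have \<psi>': "symbols (\<lambda>_. 1) ?U \<psi> v" by (rule symbols_subset[OF symbols_\<psi>]) auto
    have one: "1 * 1 = (1::complex)" by simp
    have eq: "((\<lambda>j. gram i j y * \<psi> j y) has_sum (1 * (s i y - \<psi> i y))) UNIV" if "y \<in> ?U" for i y
      using \<psi>_eq[OF UH[OF that]] by simp
    have inj: "\<forall>x\<in>?U. \<forall>y. bounded (range y) \<longrightarrow> (\<forall>i. ((\<lambda>j. gram i j x * y j) has_sum (- (1 * y i))) UNIV) \<longrightarrow> (\<forall>i. y i = 0)"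
    proof (intro ballI allI impI)
      fix x i and y :: "nat \<Rightarrow> complex"
      assume xU: "x \<in> ?U" and y: "bounded (range y)"
        and h: "\<forall>i. ((\<lambda>j. gram i j x * y j) has_sum (- (1 * y i))) UNIV"
      have h': "((\<lambda>j. gram i j x * y j) has_sum (- y i)) UNIV" for i using h by simp
      show "y i = 0" by (rule gram_inj[OF UH[OF xU] y h'])
    qed
    note DC = double_commutation[OF U one s' \<psi>' vw s_0 s_deriv2 gram_0 gram_derivative eq inj bdd xU]
    show ?thesis unfolding q_eq using DC by simp
  qed
  show "x \<in> H \<Longrightarrow> nth_deriv 2 (\<psi> i) x = (Wp x - of_real ((\<kappa> i)\<^sup>2)) * \<psi> i x"
    using * by (simp add: Wp_def)
  show "smooth_on H q"
    unfolding smooth_on_def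
  proof (intro allI ballI)
    fix k x assume "x \<in> H"
    then show "nth_deriv k q differentiable (at x)"
      using *[of x 0] by (auto simp: smooth_on_def)
  qed
qed

lemma Wp_smooth: "smooth_on H Wp"
proof -
  have "smooth_on H (\<lambda>x. complex_of_real (W0 x))" using W0_smooth smooth_on_subset by blast
  then show ?thesis
    unfolding Wp_def[abs_def] by (intro smooth_on_diff smooth_on_cmult smooth_on_deriv q_smooth) auto
qed

lemma cnj_q: "x \<in> H \<Longrightarrow> cnj (q x) = q x"
  unfolding q_def by (subst infsum_cnj[symmetric]) (simp add: cnj_\<psi>)

lemma cnj_Wp: "x \<in> H \<Longrightarrow> cnj (Wp x) = Wp x"
proof -
  assume x: "x \<in> H"
  have "cnj (nth_deriv 1 q x) = nth_deriv 1 (\<lambda>x. cnj (q x)) x"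
    by (rule nth_deriv_linear[OF _ q_smooth bounded_linear_cnj x, symmetric]) auto
  also have "\<dots> = nth_deriv 1 q x" by (rule nth_deriv_cong[of H]) (use x cnj_q in auto)
  finally show ?thesis by (simp add: Wp_def)
qed

text \<open>Near the origin \<open>q\<close> is the function whose derivative defined \<open>W0\<close>.\<close>
lemma Wp_near_0: "x \<in> X \<Longrightarrow> Wp x = 0"
proof -
  assume x: "x \<in> X"
  have "nth_deriv 1 q x = nth_deriv 1 (\<lambda>x. \<Sum>\<^sub>\<infinity>j. free j x * s0 j x) x"
    by (rule nth_deriv_cong[OF X(1) _ x]) (simp add: q_def \<psi>_near_0 s_eq_s0 mult.commute)
  then show ?thesis using W0_eq[of x] x by (auto simp: Wp_def X_def)
qed

subsection \<open>Fourier expansion of the potential\<close>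

text \<open>The wave of frequency \<open>\<plusminus>\<kappa> j\<close> in \<open>s j\<close> times \<open>wave (\<kappa> j + fr n)\<close> has the lattice frequency \<open>fr (n + \<mu> j \<sigma>)\<close>.\<close>
definition \<mu> :: "nat \<Rightarrow> bool \<Rightarrow> 'n" where "\<mu> j \<sigma> = (if \<sigma> then \<iota> j else 0)"

definition Q_term :: "'n \<Rightarrow> nat \<times> bool \<Rightarrow> real \<Rightarrow> complex" where
  "Q_term m p x = of_real (\<gamma> (fst p)) * (amp (fst p) (snd p) x * \<Psi> (fst p, m - \<mu> (fst p) (snd p)) x)"

definition Q :: "'n \<Rightarrow> real \<Rightarrow> complex" where
  "Q m x = (\<Sum>\<^sub>\<infinity>p. Q_term m p x)"

lemma symbols_Q_term: "symbols (\<lambda>x. 1 + \<bar>x\<bar>) H (\<lambda>(m, p). Q_term m p) (\<lambda>(m, p). E m * v (fst p))"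
proof -
  have "symbols (\<lambda>x. 1 + \<bar>x\<bar>) H (\<lambda>z x. amp (fst (snd z)) (snd (snd z)) x) (\<lambda>z :: 'n \<times> nat \<times> bool. 1 / v (fst (snd z)))"
    using symbols_reindex[OF symbols_amp, of snd] by (simp add: case_prod_unfold)
  moreover have "symbols (\<lambda>x. 1 + \<bar>x\<bar>) H (\<lambda>z x. \<Psi> (fst (snd z), fst z - \<mu> (fst (snd z)) (snd (snd z))) x)
      (\<lambda>z. u (fst (snd z), fst z - \<mu> (fst (snd z)) (snd (snd z))))"
    using symbols_reindex[OF symbols_\<Psi>, of "\<lambda>z. (fst (snd z), fst z - \<mu> (fst (snd z)) (snd (snd z)))"] by simp
  ultimately have "symbols (\<lambda>x. 1 + \<bar>x\<bar>) H (\<lambda>z x. amp (fst (snd z)) (snd (snd z)) x * \<Psi> (fst (snd z), fst z - \<mu> (fst (snd z)) (snd (snd z))) x)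
      (\<lambda>z. 1 / v (fst (snd z)) * u (fst (snd z), fst z - \<mu> (fst (snd z)) (snd (snd z))))"
    by (intro symbols_mult) auto
  from symbols_cmult[OF _ this, of "\<lambda>z. of_real (\<gamma> (fst (snd z)))"]
  have "symbols (\<lambda>x. 1 + \<bar>x\<bar>) H (\<lambda>z. Q_term (fst z) (snd z))
     (\<lambda>z. norm (complex_of_real (\<gamma> (fst (snd z)))) * (1 / v (fst (snd z)) * u (fst (snd z), fst z - \<mu> (fst (snd z)) (snd (snd z)))))"
    by (simp add: Q_term_def[abs_def])
  then have "symbols (\<lambda>x. 1 + \<bar>x\<bar>) H (\<lambda>z. Q_term (fst z) (snd z)) (\<lambda>z. E (fst z) * v (fst (snd z)))"
  proof (rule symbols_weight[OF _ zero_le_one])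
    show "norm (complex_of_real (\<gamma> (fst (snd z)))) * (1 / v (fst (snd z)) * u (fst (snd z), fst z - \<mu> (fst (snd z)) (snd (snd z))))
        \<le> 1 * (E (fst z) * v (fst (snd z)))" for z
    proof -
      obtain m j \<sigma> where z: "z = (m, j, \<sigma>)" by (metis surj_pair)
      have "E (m - \<mu> j \<sigma>) * v j \<le> E (m - \<mu> j \<sigma>) * E (\<mu> j \<sigma>)"
        using less_imp_le[OF E_pos] v_le_1[of j] by (intro mult_left_mono) (auto simp: \<mu>_def E_\<iota>)
      also have "\<dots> \<le> E m" using E_mult[of "m - \<mu> j \<sigma>" "\<mu> j \<sigma>"] by simp
      finally have sh: "E (m - \<mu> j \<sigma>) * v j \<le> E m" .
      have "norm (complex_of_real (\<gamma> j)) * (1 / v j * u (j, m - \<mu> j \<sigma>)) = (\<delta> * v j ^ 6) * (E (m - \<mu> j \<sigma>) * v j)"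
        using v_pos[of j] \<delta>(1) unfolding norm_of_real abs_of_pos[OF \<gamma>_pos]
        by (simp add: \<gamma>_def u_def power2_eq_square)
      also have "\<dots> \<le> (1 * v j ^ 1) * E m"
        using sh v0 \<delta>(1) \<delta>_le_1 less_imp_le[OF E_pos] by (intro mult_mono v_power_le) auto
      finally show ?thesis by (simp add: z mult.commute)
    qed
  qed (use v0 less_imp_le[OF E_pos] in auto)
  then show ?thesis by (simp add: case_prod_unfold)
qed

lemma pairs_summable: "(\<lambda>p :: nat \<times> bool. v (fst p)) summable_on UNIV"
proof -
  have "(\<lambda>(j, \<sigma> :: bool). v j * (\<lambda>_. 1) \<sigma>) summable_on UNIV"
    by (rule summable_on_product[OF v_summable]) (auto simp: v0)
  then show ?thesis by (simp add: case_prod_unfold)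
qed

lemma symbols_Q: "symbols (\<lambda>x. 1 + \<bar>x\<bar>) H Q E"
proof -
  have "symbols (\<lambda>x. 1 + \<bar>x\<bar>) H Q (\<lambda>m. \<Sum>\<^sub>\<infinity>p :: nat \<times> bool. E m * v (fst p))"
    unfolding Q_def[abs_def]
    by (rule symbols_infsum[OF _ _ _ symbols_Q_term]) (auto intro: summable_on_cmult_right pairs_summable)
  then show ?thesis
    by (rule symbols_weight[where c="\<Sum>\<^sub>\<infinity>p :: nat \<times> bool. v (fst p)"])
      (auto simp: infsum_cmult_right[OF pairs_summable] v0 less_imp_le[OF E_pos] intro!: infsum_nonneg)
qed

lemma q_expansion:
  assumes x: "x \<in> H"
  shows "((\<lambda>m. wave (fr m) x * Q m x) has_sum q x) UNIV"
proof -
  define F where "F m p = wave (fr m) x * Q_term m p x" for m p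
  obtain C where C: "C \<ge> 0" "\<And>m p. norm (Q_term m p x) \<le> C * (E m * v (fst p))"
  proof -
    have "1 \<le> 1 + \<bar>x\<bar>" for x :: real by simp
    from symbols_bound0[OF symbols_Q_term this, of 0]
    obtain C where C: "C \<ge> 0" "\<And>z x. x \<in> H \<Longrightarrow> norm (nth_deriv 0 (case z of (m, p) \<Rightarrow> Q_term m p) x) \<le> C * (case z of (m, p) \<Rightarrow> E m * v (fst p))" by blast
    show ?thesis by (rule that[OF C(1)]) (use C(2)[OF x, of "(_, _)"] in auto)
  qed
  have bd: "norm (F m p) \<le> (C * E m) * v (fst p)" for m p
    using C(2)[of m p] by (simp add: F_def norm_mult mult_ac)
  have "(\<lambda>(m, p :: nat \<times> bool). (C * E m) * v (fst p)) summable_on UNIV"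
    using C(1) v0 less_imp_le[OF E_pos]
    by (intro summable_on_product summable_on_cmult_right E_summable pairs_summable) auto
  note S = infsum_swap_dominated[OF this bd]
  have row: "(\<Sum>\<^sub>\<infinity>p. F m p) = wave (fr m) x * Q m x" for m
  proof -
    have "(\<lambda>p. Q_term m p x) summable_on UNIV"
      by (rule dominated_summable[OF summable_on_cmult_right[OF pairs_summable, of "C * E m"]]) (use C(2)[of m] in \<open>simp add: mult.assoc\<close>)
    then show ?thesis unfolding F_def Q_def by (rule infsum_cmult_right)
  qed
  have col: "(\<Sum>\<^sub>\<infinity>m. F m p) = of_real (\<gamma> (fst p)) * (amp (fst p) (snd p) x * wave (sg (snd p) * \<kappa> (fst p)) x) * \<psi> (fst p) x" for p
  proof -
    obtain j \<sigma> where p: "p = (j, \<sigma>)" by (metis surj_pair)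
    have w: "wave (fr m) x = wave (sg \<sigma> * \<kappa> j) x * wave (\<kappa> j + fr (m - \<mu> j \<sigma>)) x" for m
      unfolding wave_add[symmetric] by (cases \<sigma>) (simp_all add: fr_diff \<mu>_def fr_\<iota> sg_def)
    have bij: "bij_betw (\<lambda>n. n - \<mu> j \<sigma>) UNIV UNIV"
      by (rule bij_betwI[of _ _ _ "\<lambda>n. n + \<mu> j \<sigma>"]) auto
    have "((\<lambda>n. wave (\<kappa> j + fr (n - \<mu> j \<sigma>)) x * \<Psi> (j, n - \<mu> j \<sigma>) x) has_sum \<psi> j x) UNIV"
      using infsum_reindex_bij_betw[OF bij, of "\<lambda>n. wave (\<kappa> j + fr n) x * \<Psi> (j, n) x"]
        summable_on_reindex_bij_betw[OF bij, of "\<lambda>n. wave (\<kappa> j + fr n) x * \<Psi> (j, n) x"]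
        \<psi>_has_sum[OF x, of j] by (simp add: has_sum_iff)
    from has_sum_cmult_right[OF this, of "of_real (\<gamma> j) * (amp j \<sigma> x * wave (sg \<sigma> * \<kappa> j) x)"]
    show ?thesis by (intro infsumI) (simp add: F_def p Q_term_def w mult_ac)
  qed
  have "((\<lambda>p. of_real (\<gamma> (fst p)) * (amp (fst p) (snd p) x * wave (sg (snd p) * \<kappa> (fst p)) x) * \<psi> (fst p) x) has_sum (\<Sum>\<^sub>\<infinity>m. wave (fr m) x * Q m x)) UNIV"
    using has_sum_infsum[OF S(2)] S(3) by (simp add: row col)
  from has_sum_fst[OF this]
  have "((\<lambda>j. s j x * \<psi> j x) has_sum (\<Sum>\<^sub>\<infinity>m. wave (fr m) x * Q m x)) UNIV"
    by (simp add: sum_bool s_def amp_def sg_def distrib_left distrib_right)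
  then have "(\<Sum>\<^sub>\<infinity>m. wave (fr m) x * Q m x) = q x" unfolding q_def by (rule infsumI[symmetric])
  then show ?thesis using has_sum_infsum[OF S(1)] by (simp add: row)
qed

text \<open>The coefficients of \<open>W0 - 2 q'\<close>: differentiating \<open>wave (fr m) * Q m\<close> gives two terms, and \<open>W0\<close> counts for frequency zero.\<close>
definition wp :: "'n \<Rightarrow> real \<Rightarrow> complex" where
  "wp m x = (if m = 0 then 1 else 0) * of_real (W0 x) + ((- 2) * nth_deriv 1 (Q m) x + (- 2 * \<i> * of_real (fr m)) * Q m x)"

lemma symbols_wp: "symbols (\<lambda>x. 1 + \<bar>x\<bar>) H wp e"
proof -
  have e0: "0 \<le> e m" for m using less_imp_le[OF e_pos] .
  have W: "symbols (\<lambda>x. 1 + \<bar>x\<bar>) H (\<lambda>m :: 'n. \<lambda>x. complex_of_real (W0 x)) (\<lambda>m. 1)"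
  proof (rule symbols_eventually_const)
    show "complex_of_real (W0 x) = complex_of_real (W0 1)" if "1 \<le> x" for x
      using W0_support[of x] W0_support[of 1] \<epsilon> that by simp
    show "symbols (\<lambda>_. 1) {-1<..<2} (\<lambda>m :: 'n. \<lambda>x. complex_of_real (W0 x)) (\<lambda>m. 1)"
    proof (rule symbolsI)
      show "smooth_on {-1<..<2} (\<lambda>x. complex_of_real (W0 x))" by (rule smooth_on_subset[OF W0_smooth]) simp
      fix k
      obtain B where "B \<ge> 0" "\<And>x. norm (nth_deriv k (\<lambda>x. complex_of_real (W0 x)) x) \<le> B"
        using smooth_compact_support_bounded[OF W0_smooth, of \<epsilon> k] W0_support by (metis of_real_0)
      then show "\<exists>C\<ge>0. \<forall>m :: 'n. \<forall>x\<in>{-1<..<2}. 1 ^ k * norm (nth_deriv k (\<lambda>x. complex_of_real (W0 x)) x) \<le> C * 1"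
        by (intro exI[of _ B]) simp
    qed simp
  qed
  have 1: "symbols (\<lambda>x. 1 + \<bar>x\<bar>) H (\<lambda>m x. (if m = 0 then 1 else 0) * complex_of_real (W0 x)) e"
    by (rule symbols_weight[OF symbols_cmult[OF _ W] zero_le_one]) (use e_0 e0 in auto)
  have 2: "symbols (\<lambda>x. 1 + \<bar>x\<bar>) H (\<lambda>m x. (- 2) * nth_deriv 1 (Q m) x) e"
    by (rule symbols_weight[OF symbols_cmult[OF _ symbols_deriv[OF symbols_Q]], of 2]) (use e0 E_le_e in auto)
  obtain C where C: "C \<ge> 0" "\<And>n. \<bar>fr n\<bar> * e n \<le> C" using fr_tame[of 1] by auto
  have 3: "symbols (\<lambda>x. 1 + \<bar>x\<bar>) H (\<lambda>m x. (- 2 * \<i> * of_real (fr m)) * Q m x) e"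
  proof (rule symbols_weight[OF symbols_cmult[OF _ symbols_Q], of "2 * C"])
    show "norm (- 2 * \<i> * complex_of_real (fr m)) * E m \<le> 2 * C * e m" for m
      using mult_right_mono[OF C(2)[of m] e0[of m]] by (simp add: norm_mult E_def power2_eq_square)
  qed (use C(1) e0 in auto)
  show ?thesis
    unfolding wp_def[abs_def] by (intro symbols_add 1 2 3) auto
qed

lemma Wp_expansion:
  assumes x: "x \<in> H"
  shows "((\<lambda>m. wave (fr m) x * wp m x) has_sum Wp x) UNIV"
proof -
  have Q1: "symbols (\<lambda>_. 1) H Q E" by (rule symbols_subset[OF symbols_Q]) auto
  have "symbols (\<lambda>_. 1) H (\<lambda>m x. wave (fr m) x * Q m x) (\<lambda>m. 1 / e m * E m)"
    by (intro symbols_mult symbols_wave_fr Q1) auto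
  moreover have "(\<lambda>m. 1 / e m * E m) = e" using e_pos by (auto simp: E_def power2_eq_square less_imp_neq[symmetric])
  ultimately have "symbols (\<lambda>_. 1) H (\<lambda>m x. wave (fr m) x * Q m x) e" by simp
  from symbols_reindex[OF this, of snd]
  have sym: "symbols (\<lambda>_. 1) H (\<lambda>(a :: unit, m) x. wave (fr m) x * Q m x) (\<lambda>(a, m). e m)" by (simp add: case_prod_unfold)
  have d: "nth_deriv 1 (\<lambda>x. \<Sum>\<^sub>\<infinity>m. wave (fr m) x * Q m x) x = (\<Sum>\<^sub>\<infinity>m. nth_deriv 1 (\<lambda>x. wave (fr m) x * Q m x) x)"
    by (rule symbols_nth_deriv_infsum[OF _ _ _ sym]) (use x e_summable in auto)
  have s: "(\<lambda>m. nth_deriv 1 (\<lambda>x. wave (fr m) x * Q m x) x) summable_on UNIV"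
    by (rule symbols_summable[OF _ _ _ sym]) (use x e_summable in auto)
  have "nth_deriv 1 q x = nth_deriv 1 (\<lambda>x. \<Sum>\<^sub>\<infinity>m. wave (fr m) x * Q m x) x"
    by (rule nth_deriv_cong[of H]) (use x infsumI[OF q_expansion] in auto)
  then have hs: "((\<lambda>m. nth_deriv 1 (\<lambda>x. wave (fr m) x * Q m x) x) has_sum nth_deriv 1 q x) UNIV"
    using has_sum_infsum[OF s] d by simp
  have e: "nth_deriv 1 (\<lambda>x. wave (fr m) x * Q m x) x = wave (fr m) x * (nth_deriv 1 (Q m) x + \<i> * of_real (fr m) * Q m x)" for m
    using nth_deriv_mult_1[OF _ smooth_on_wave symbols_smooth[OF symbols_Q] x, of "fr m" m] nth_deriv_wave[of 1 "fr m" x]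
    by (simp add: algebra_simps)
  have "((\<lambda>m. (if m = 0 then of_real (W0 x) else 0) + (- 2) * (wave (fr m) x * (nth_deriv 1 (Q m) x + \<i> * of_real (fr m) * Q m x))) has_sum Wp x) UNIV"
    using has_sum_add[OF has_sum_single has_sum_cmult_right[OF hs[unfolded e], of "-2"], of 0 "of_real (W0 x)"]
    by (simp add: Wp_def del: One_nat_def)
  moreover have "(if m = 0 then of_real (W0 x) else 0) + (- 2) * (wave (fr m) x * (nth_deriv 1 (Q m) x + \<i> * of_real (fr m) * Q m x)) = wave (fr m) x * wp m x" for m
    by (simp add: wp_def algebra_simps)
  ultimately show ?thesis by (simp only:)
qed

subsection \<open>Decay of the eigenfunctions\<close>

text \<open>By \<open>\<psi>_reduced\<close> the product \<open>(1 + c i * x) * \<psi> i x\<close> is a sum of functions with bounded derivatives.\<close>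
lemma \<psi>_decay:
  obtains C where "\<And>x. 0 \<le> x \<Longrightarrow> norm (\<psi> i x) \<le> C / (1 + c i * x)"
    "\<And>x. 0 \<le> x \<Longrightarrow> norm (nth_deriv 1 (\<psi> i) x) \<le> C / (1 + c i * x)"
proof -
  define h where "h x = of_real (1 + c i * x) * \<psi> i x" for x
  define g where "g ed x = b i (fst ed) (fst (snd ed)) (snd (snd ed)) x * wave (sg (fst (snd ed)) * \<kappa> i + sg (snd (snd ed)) * \<kappa> (fst ed)) x * \<psi> (fst ed) x"
    for ed :: "nat \<times> bool \<times> bool" and x
  have W: "symbols (\<lambda>_. 1) H (\<lambda>ed :: nat \<times> bool \<times> bool. wave (sg (fst (snd ed)) * \<kappa> i + sg (snd (snd ed)) * \<kappa> (fst ed))) (\<lambda>ed. 1 / v (fst ed))"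
  proof (rule symbols_wave)
    fix k
    obtain C where C: "C \<ge> 0" "\<And>i. \<kappa> i ^ k \<le> C / v i" using \<kappa>_power by blast
    have "\<bar>sg (fst (snd ed)) * \<kappa> i + sg (snd (snd ed)) * \<kappa> (fst ed)\<bar> ^ k \<le> (2 ^ k * (C + C / v i)) * (1 / v (fst ed))" for ed :: "nat \<times> bool \<times> bool"
    proof -
      have "\<bar>sg (fst (snd ed)) * \<kappa> i + sg (snd (snd ed)) * \<kappa> (fst ed)\<bar> \<le> 2 * max (\<kappa> i) (\<kappa> (fst ed))"
        using \<kappa>_pos[of i] \<kappa>_pos[of "fst ed"] by (auto simp: sg_def)
      then have "\<bar>sg (fst (snd ed)) * \<kappa> i + sg (snd (snd ed)) * \<kappa> (fst ed)\<bar> ^ k \<le> (2 * max (\<kappa> i) (\<kappa> (fst ed))) ^ k"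
        by (intro power_mono) auto
      also have "\<dots> \<le> 2 ^ k * (\<kappa> i ^ k + \<kappa> (fst ed) ^ k)"
        using \<kappa>_pos[of i] \<kappa>_pos[of "fst ed"] by (auto simp: power_mult_distrib max_def)
      also have "\<dots> \<le> 2 ^ k * (C / v i * (1 / v (fst ed)) + C * (1 / v (fst ed)))"
      proof (intro mult_left_mono add_mono)
        have "C / v i * 1 \<le> C / v i * (1 / v (fst ed))"
          using C(1) v_pos[of i] v_pos[of "fst ed"] v_le_1[of "fst ed"] by (intro mult_left_mono) auto
        then show "\<kappa> i ^ k \<le> C / v i * (1 / v (fst ed))" using C(2)[of i] by simp
      qed (use C(2)[of "fst ed"] in auto)
      also have "\<dots> = (2 ^ k * (C + C / v i)) * (1 / v (fst ed))" by (simp add: algebra_simps)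
      finally show ?thesis .
    qed
    moreover have "0 \<le> 2 ^ k * (C + C / v i)" using C(1) v_pos[of i] by simp
    ultimately show "\<exists>C\<ge>0. \<forall>ed :: nat \<times> bool \<times> bool. \<bar>sg (fst (snd ed)) * \<kappa> i + sg (snd (snd ed)) * \<kappa> (fst ed)\<bar> ^ k \<le> C * (1 / v (fst ed))"
      by blast
  qed (use v_pos less_imp_le in auto)
  have B: "symbols (\<lambda>_. 1) H (\<lambda>ed. b i (fst ed) (fst (snd ed)) (snd (snd ed))) (\<lambda>ed. v i ^ 3 * v (fst ed) ^ 3)"
    using symbols_subset[OF symbols_reindex[OF symbols_b, of "\<lambda>ed. ((i, fst ed), snd ed)"], of H "\<lambda>_. 1"] by (simp add: case_prod_unfold)
  have "symbols (\<lambda>_. 1) H g (\<lambda>ed. v i ^ 3 * v (fst ed) ^ 3 * (1 / v (fst ed)) * v (fst ed))"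
    unfolding g_def[abs_def] by (intro symbols_mult B W symbols_reindex[OF symbols_\<psi>]) auto
  moreover have "(\<lambda>ed :: nat \<times> bool \<times> bool. v i ^ 3 * v (fst ed) ^ 3 * (1 / v (fst ed)) * v (fst ed)) = (\<lambda>ed. v i ^ 3 * v (fst ed) ^ 3)"
    using v_pos by (auto simp: less_imp_neq[symmetric])
  ultimately have "symbols (\<lambda>_. 1) H g (\<lambda>ed. v i ^ 3 * v (fst ed) ^ 3)" by simp
  from symbols_reindex[OF this, of snd]
  have sym: "symbols (\<lambda>_. 1) H (\<lambda>(a :: unit, ed). g ed) (\<lambda>(a, ed). v i ^ 3 * v (fst ed) ^ 3)" by (simp add: case_prod_unfold)
  have sm: "(\<lambda>ed :: nat \<times> bool \<times> bool. v i ^ 3 * v (fst ed) ^ 3) summable_on UNIV"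
    by (intro summable_on_cmult_right edges_summable(1)[OF v_power_summable[of 3]]) (use v0 in auto)
  have G: "symbols (\<lambda>_. 1) H (\<lambda>a :: unit. \<lambda>x. \<Sum>\<^sub>\<infinity>ed. g ed x) (\<lambda>a. \<Sum>\<^sub>\<infinity>ed. v i ^ 3 * v (fst (ed :: nat \<times> bool \<times> bool)) ^ 3)"
    by (rule symbols_infsum[OF _ _ _ sym]) (use sm in auto)
  have hG: "h x = s i x - (\<Sum>\<^sub>\<infinity>ed. g ed x)" if "x \<in> H" for x
    using infsumI[OF \<psi>_reduced[OF that, of i]] by (simp add: h_def g_def)
  have smh: "smooth_on H h"
    by (subst smooth_on_cong[OF _ hG]) (auto intro!: smooth_on_diff s_smooth symbols_smooth[OF G])
  have bound: "\<exists>C. \<forall>x\<in>H. norm (nth_deriv k h x) \<le> C" for k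
  proof -
    have one: "1 \<le> (1::real)" by simp
    from symbols_bound0[OF symbols_s one, of k]
    obtain C1 where "C1 \<ge> 0" and C1: "\<And>i x. x \<in> H \<Longrightarrow> norm (nth_deriv k (s i) x) \<le> C1 * v i ^ 4" by blast
    from symbols_bound0[OF G one, of k]
    obtain C2 where "C2 \<ge> 0" and C2: "\<And>(a :: unit) x. x \<in> H \<Longrightarrow> norm (nth_deriv k (\<lambda>x. \<Sum>\<^sub>\<infinity>ed. g ed x) x) \<le> C2 * (\<Sum>\<^sub>\<infinity>ed. v i ^ 3 * v (fst (ed :: nat \<times> bool \<times> bool)) ^ 3)" by blast
    have "norm (nth_deriv k h x) \<le> C1 * v i ^ 4 + C2 * (\<Sum>\<^sub>\<infinity>ed. v i ^ 3 * v (fst (ed :: nat \<times> bool \<times> bool)) ^ 3)" if x: "x \<in> H" for x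
    proof -
      have "nth_deriv k h x = nth_deriv k (\<lambda>x. s i x - (\<Sum>\<^sub>\<infinity>ed. g ed x)) x"
        by (rule nth_deriv_cong[OF _ hG x]) auto
      also have "\<dots> = nth_deriv k (s i) x - nth_deriv k (\<lambda>x. \<Sum>\<^sub>\<infinity>ed. g ed x) x"
        by (rule nth_deriv_diff[OF _ s_smooth symbols_smooth[OF G] x]) auto
      finally show ?thesis using order_trans[OF norm_triangle_ineq4 add_mono[OF C1[OF x, of i] C2[OF x]]] by simp
    qed
    then show ?thesis by blast
  qed
  obtain C0 where C0: "\<And>x. x \<in> H \<Longrightarrow> norm (h x) \<le> C0" using bound[of 0] by auto
  obtain C1 where C1: "\<And>x. x \<in> H \<Longrightarrow> norm (nth_deriv 1 h x) \<le> C1" using bound[of 1] by blast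
  have C0p: "0 \<le> C0" by (rule order_trans[OF norm_ge_zero C0[of 0]]) simp
  show ?thesis
  proof (rule that[of "C1 + C0"])
    fix x :: real assume x0: "0 \<le> x"
    then have x: "x \<in> H" by simp
    have D: "1 \<le> 1 + c i * x" using c_pos[of i] x0 by simp
    have C1p: "0 \<le> C1" by (rule order_trans[OF norm_ge_zero C1[OF x]])
    have nD: "norm (complex_of_real (1 + c i * x)) = 1 + c i * x" using D by (simp only: norm_of_real)
    have p: "(1 + c i * x) * norm (\<psi> i x) = norm (h x)" unfolding h_def norm_mult nD ..
    then have p': "(1 + c i * x) * norm (\<psi> i x) \<le> C0" using C0[OF x] by simp
    then show "norm (\<psi> i x) \<le> (C1 + C0) / (1 + c i * x)"
      using D C1p by (simp add: pos_le_divide_eq mult.commute)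
    have lin: "((\<lambda>x. complex_of_real (1 + c i * x)) has_vector_derivative of_real (c i)) (at x)"
    proof -
      have "((\<lambda>x. 1 + c i * x) has_vector_derivative c i) (at x)"
        unfolding has_real_derivative_iff_has_vector_derivative[symmetric] by (auto intro!: derivative_eq_intros)
      then show ?thesis by (rule bounded_linear.has_vector_derivative[OF bounded_linear_of_real])
    qed
    have "(h has_vector_derivative of_real (1 + c i * x) * nth_deriv 1 (\<psi> i) x + of_real (c i) * \<psi> i x) (at x)"
      unfolding h_def[abs_def] by (rule has_vector_derivative_mult[OF lin smooth_on_has_derivs(1)[OF \<psi>_smooth x]])
    then have "nth_deriv 1 h x = of_real (1 + c i * x) * nth_deriv 1 (\<psi> i) x + of_real (c i) * \<psi> i x"
      using vector_derivative_unique_at[OF smooth_on_has_derivs(1)[OF smh x]] by simp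
    then have "of_real (1 + c i * x) * nth_deriv 1 (\<psi> i) x = nth_deriv 1 h x - of_real (c i) * \<psi> i x" by simp
    then have "(1 + c i * x) * norm (nth_deriv 1 (\<psi> i) x) = norm (nth_deriv 1 h x - of_real (c i) * \<psi> i x)"
      using nD by (metis norm_mult)
    also have "\<dots> \<le> C1 + c i * norm (\<psi> i x)"
      using C1[OF x] c_pos[of i] by (intro order_trans[OF norm_triangle_ineq4] add_mono) (auto simp: norm_mult)
    also have "c i * norm (\<psi> i x) \<le> 1 * C0"
    proof -
      have "1 * norm (\<psi> i x) \<le> (1 + c i * x) * norm (\<psi> i x)" using D by (intro mult_right_mono) auto
      then have "norm (\<psi> i x) \<le> C0" using p' by linarith
      then show ?thesis using c_le(2)[of i] c_pos[of i] C0p by (intro mult_mono) auto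
    qed
    finally show "norm (nth_deriv 1 (\<psi> i) x) \<le> (C1 + C0) / (1 + c i * x)"
      using D by (simp add: pos_le_divide_eq mult.commute)
  qed
qed

end

section \<open>From decaying solutions to the point spectrum\<close>

lemma integrable_inverse_quadratic: "integrable lborel (\<lambda>x::real. 1 / (1 + x\<^sup>2))"
proof -
  have "set_integrable lborel (einterval (-\<infinity>) \<infinity>) (\<lambda>x::real. 1 / (1 + x\<^sup>2))"
  proof (rule interval_integral_FTC_nonneg(1)[where F=arctan and A="- (pi / 2)" and B="pi / 2"])
    show "DERIV arctan x :> 1 / (1 + x\<^sup>2)" for x
      using DERIV_arctan[of x] by (simp add: inverse_eq_divide)
    show "isCont (\<lambda>x::real. 1 / (1 + x\<^sup>2)) x" for x
      by (intro continuous_intros) (simp add: add_nonneg_eq_0_iff)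
    show "((arctan \<circ> real_of_ereal) \<longlongrightarrow> - (pi / 2)) (at_right (-\<infinity>))"
      by (simp add: ereal_tendsto_simps tendsto_arctan_at_bot)
    show "((arctan \<circ> real_of_ereal) \<longlongrightarrow> pi / 2) (at_left \<infinity>)"
      by (simp add: ereal_tendsto_simps tendsto_arctan_at_top)
  qed (auto simp: add_nonneg_nonneg)
  then show ?thesis by (simp add: set_integrable_def)
qed

text \<open>Comparison with \<open>1 / (1 + x\<^sup>2)\<close>.\<close>
lemma L2I_decay:
  fixes u :: "real \<Rightarrow> complex"
  assumes cont: "continuous_on UNIV u" and c: "0 < c"
    and decay: "\<And>x. norm (u x) \<le> C / (1 + c * \<bar>x\<bar>)"
  shows "u \<in> L2"
proof -
  have meas: "u \<in> borel_measurable lborel" using borel_measurable_continuous_onI[OF cont] by simp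
  define K where "K = C\<^sup>2 / min 1 (c\<^sup>2)"
  have le: "(norm (u x))\<^sup>2 \<le> K * (1 / (1 + x\<^sup>2))" for x
  proof -
    have D: "0 < 1 + c * \<bar>x\<bar>" using c by (simp add: add_pos_nonneg)
    have m: "0 < min 1 (c\<^sup>2)" using c by simp
    have "min 1 (c\<^sup>2) * (1 + x\<^sup>2) = min 1 (c\<^sup>2) * 1 + min 1 (c\<^sup>2) * x\<^sup>2" by (simp add: distrib_left)
    also have "\<dots> \<le> 1 * 1 + c\<^sup>2 * x\<^sup>2" by (intro add_mono mult_right_mono) auto
    also have "\<dots> \<le> (1 + c * \<bar>x\<bar>)\<^sup>2" using c by (simp add: power2_sum power_mult_distrib)
    finally have q: "min 1 (c\<^sup>2) * (1 + x\<^sup>2) \<le> (1 + c * \<bar>x\<bar>)\<^sup>2" .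
    have "(norm (u x))\<^sup>2 \<le> (C / (1 + c * \<bar>x\<bar>))\<^sup>2" by (rule power_mono[OF decay]) simp
    also have "\<dots> = C\<^sup>2 / (1 + c * \<bar>x\<bar>)\<^sup>2" by (simp add: power_divide)
    also have "\<dots> \<le> C\<^sup>2 / (min 1 (c\<^sup>2) * (1 + x\<^sup>2))"
      using q m D by (intro divide_left_mono mult_pos_pos) (auto simp: add_pos_nonneg)
    finally show ?thesis by (simp add: K_def)
  qed
  have "integrable lborel (\<lambda>x. (norm (u x))\<^sup>2)"
  proof (rule Bochner_Integration.integrable_bound)
    show "integrable lborel (\<lambda>x. K * (1 / (1 + x\<^sup>2)))"
      by (intro integrable_mult_right integrable_inverse_quadratic)
    show "(\<lambda>x. (norm (u x))\<^sup>2) \<in> borel_measurable lborel" using meas by measurable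
    show "AE x in lborel. norm ((norm (u x))\<^sup>2) \<le> norm (K * (1 / (1 + x\<^sup>2)))"
      using le by (intro AE_I2) (metis abs_ge_self norm_ge_zero order_trans real_norm_def abs_of_nonneg zero_le_power2)
  qed
  then show ?thesis using meas by (simp add: L2_def)
qed

lemma nth_deriv_outside:
  fixes \<phi> :: "real \<Rightarrow> complex"
  assumes "\<And>x. R < \<bar>x\<bar> \<Longrightarrow> \<phi> x = 0" "R < \<bar>x\<bar>"
  shows "nth_deriv k \<phi> x = 0"
proof -
  have "open {x::real. R < \<bar>x\<bar>}" by (intro open_Collect_less continuous_intros)
  from nth_deriv_cong[OF this, of \<phi> "\<lambda>_. 0" x k] show ?thesis
    using assms by (simp add: nth_deriv_const)
qed

lemma test_function_support:
  assumes "test_function \<phi>"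
  obtains R where "\<And>x. R < \<bar>x\<bar> \<Longrightarrow> \<phi> x = 0"
proof -
  have "bounded {x. \<phi> x \<noteq> 0}"
    using assms compact_imp_bounded bounded_subset closure_subset by (metis test_function_def)
  then obtain R where "\<And>x. \<phi> x \<noteq> 0 \<Longrightarrow> \<bar>x\<bar> \<le> R" by (auto simp: bounded_iff)
  then show ?thesis using that[of R] by force
qed

lemma integral_by_parts_compact:
  fixes u \<phi> :: "real \<Rightarrow> complex"
  assumes u: "smooth_on UNIV u" and \<phi>: "smooth_on UNIV \<phi>" and R: "\<And>x. R < \<bar>x\<bar> \<Longrightarrow> \<phi> x = 0"
  shows "(LINT x|lborel. u x * nth_deriv 1 \<phi> x) = - (LINT x|lborel. nth_deriv 1 u x * \<phi> x)"
proof -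
  define r where "r = \<bar>R\<bar> + 1"
  have out: "\<phi> x = 0" "nth_deriv 1 \<phi> x = 0" if "x \<notin> {-r..r}" for x
    using that R nth_deriv_outside[of R \<phi> x 1, OF R] by (auto simp: r_def)
  have cu: "continuous_on UNIV (nth_deriv k u)" "continuous_on UNIV (nth_deriv k \<phi>)" for k
    using smooth_on_continuous u \<phi> by auto
  have cont: "continuous_on {-r..r} (\<lambda>x. u x * nth_deriv 1 \<phi> x)" "continuous_on {-r..r} (\<lambda>x. nth_deriv 1 u x * \<phi> x)"
    using cu[of 0] cu[of 1] by (auto intro!: continuous_intros intro: continuous_on_subset)
  have "((\<lambda>x. u x * \<phi> x) has_vector_derivative u x * nth_deriv 1 \<phi> x + nth_deriv 1 u x * \<phi> x) (at x within {-r..r})" for x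
    by (rule has_vector_derivative_at_within[OF has_vector_derivative_mult[OF smooth_on_has_derivs(1)[OF u UNIV_I] smooth_on_has_derivs(1)[OF \<phi> UNIV_I]]])
  from has_bochner_integral_FTC_Icc[OF _ this continuous_on_add[OF cont]]
  have "has_bochner_integral lborel (\<lambda>x. indicator {-r..r} x *\<^sub>R (u x * nth_deriv 1 \<phi> x + nth_deriv 1 u x * \<phi> x))
      (u r * \<phi> r - u (- r) * \<phi> (- r))" by (simp add: r_def)
  moreover have "(\<lambda>x. indicator {-r..r} x *\<^sub>R (u x * nth_deriv 1 \<phi> x + nth_deriv 1 u x * \<phi> x)) = (\<lambda>x. u x * nth_deriv 1 \<phi> x + nth_deriv 1 u x * \<phi> x)"
    using out by (auto simp: indicator_def)
  moreover have "\<phi> r = 0" "\<phi> (- r) = 0" using R by (auto simp: r_def)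
  ultimately have "(LINT x|lborel. u x * nth_deriv 1 \<phi> x + nth_deriv 1 u x * \<phi> x) = 0"
    by (simp add: has_bochner_integral_iff)
  moreover have "integrable lborel (\<lambda>x. indicator {-r..r} x *\<^sub>R (u x * nth_deriv 1 \<phi> x))" "integrable lborel (\<lambda>x. indicator {-r..r} x *\<^sub>R (nth_deriv 1 u x * \<phi> x))"
    using cont by (auto intro: borel_integrable_compact)
  moreover have "(\<lambda>x. indicator {-r..r} x *\<^sub>R (u x * nth_deriv 1 \<phi> x)) = (\<lambda>x. u x * nth_deriv 1 \<phi> x)" "(\<lambda>x. indicator {-r..r} x *\<^sub>R (nth_deriv 1 u x * \<phi> x)) = (\<lambda>x. nth_deriv 1 u x * \<phi> x)"
    using out by (auto simp: indicator_def)
  ultimately show ?thesis by (simp add: add_eq_0_iff2)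
qed

lemma continuous_AE_zero:
  fixes u :: "real \<Rightarrow> complex"
  assumes cont: "continuous_on UNIV u" and AE: "AE x in lborel. u x = 0"
  shows "u x = 0"
proof (rule ccontr)
  assume "u x \<noteq> 0"
  moreover have "open {x. u x \<noteq> 0}" using cont by (intro open_Collect_neq continuous_intros)
  ultimately have "\<not> negligible {x. u x \<noteq> 0}" by (intro open_not_negligible) auto
  moreover have "{x. u x \<noteq> 0} \<in> null_sets lborel"
    using AE \<open>open {x. u x \<noteq> 0}\<close> by (subst AE_iff_null_sets) auto
  then have "{x. u x \<noteq> 0} \<in> null_sets lebesgue" by (rule null_sets_completionI)
  ultimately show False by (simp add: negligible_iff_null_sets)
qed

lemma eigenvalue_in_point_spectrum:
  fixes u :: "real \<Rightarrow> complex" and W :: "real \<Rightarrow> real"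
  assumes u: "smooth_on UNIV u" and nz: "u x0 \<noteq> 0"
    and W: "\<And>x. \<bar>W x\<bar> \<le> M"
    and ode: "\<And>x. nth_deriv 2 u x = (of_real (W x) - z) * u x"
    and c: "0 < c" and decay: "\<And>x. norm (u x) \<le> C / (1 + c * \<bar>x\<bar>)" "\<And>x. norm (nth_deriv 1 u x) \<le> C / (1 + c * \<bar>x\<bar>)"
  shows "z \<in> point_spectrum (schroedinger_op W)"
proof -
  have cont: "continuous_on UNIV (nth_deriv k u)" for k by (rule smooth_on_continuous[OF u])
  have L: "u \<in> L2" "nth_deriv 1 u \<in> L2"
    using L2I_decay[OF _ c decay(1)] L2I_decay[OF _ c decay(2)] cont[of 0] cont[of 1] by auto
  have L2: "nth_deriv 2 u \<in> L2"
  proof (rule L2I_decay[OF cont c])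
    fix x
    have "norm (nth_deriv 2 u x) \<le> (M + norm z) * (C / (1 + c * \<bar>x\<bar>))"
      unfolding ode norm_mult
      by (intro mult_mono decay(1) order_trans[OF norm_triangle_ineq4 add_mono])
        (use W[of x] abs_ge_zero[of "W x"] in auto)
    then show "norm (nth_deriv 2 u x) \<le> ((M + norm z) * C) / (1 + c * \<bar>x\<bar>)" by simp
  qed
  have parts: "(LINT x|lborel. u x * nth_deriv 1 \<phi> x) = - (LINT x|lborel. nth_deriv 1 u x * \<phi> x)"
      "(LINT x|lborel. u x * nth_deriv 2 \<phi> x) = (LINT x|lborel. nth_deriv 2 u x * \<phi> x)"
    if tf: "test_function \<phi>" for \<phi>
  proof -
    have \<phi>: "smooth_on UNIV \<phi>" using tf by (simp add: test_function_def smooth_on_UNIV)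
    obtain R where R: "\<And>x. R < \<bar>x\<bar> \<Longrightarrow> \<phi> x = 0" using test_function_support[OF tf] by blast
    have two: "nth_deriv 1 (nth_deriv 1 f) = nth_deriv 2 f" for f :: "real \<Rightarrow> complex"
      unfolding nth_deriv_add_index[symmetric] by (simp add: numeral_2_eq_2)
    show p: "(LINT x|lborel. u x * nth_deriv 1 \<phi> x) = - (LINT x|lborel. nth_deriv 1 u x * \<phi> x)"
      by (rule integral_by_parts_compact[OF u \<phi> R])
    have "(LINT x|lborel. u x * nth_deriv 1 (nth_deriv 1 \<phi>) x) = - (LINT x|lborel. nth_deriv 1 u x * nth_deriv 1 \<phi> x)"
      by (rule integral_by_parts_compact[OF u smooth_on_deriv[OF \<phi>], of R]) (rule nth_deriv_outside[OF R])
    also have "(LINT x|lborel. nth_deriv 1 u x * nth_deriv 1 \<phi> x) = - (LINT x|lborel. nth_deriv 1 (nth_deriv 1 u) x * \<phi> x)"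
      by (rule integral_by_parts_compact[OF smooth_on_deriv[OF u] \<phi> R])
    finally show "(LINT x|lborel. u x * nth_deriv 2 \<phi> x) = (LINT x|lborel. nth_deriv 2 u x * \<phi> x)"
      by (simp only: two minus_minus)
  qed
  have w: "weak_deriv_L2 0 u u" "weak_deriv_L2 1 u (nth_deriv 1 u)" "weak_deriv_L2 2 u (nth_deriv 2 u)"
    using L L2 parts by (auto simp: weak_deriv_L2_def simp del: One_nat_def)
  have "\<exists>v. weak_deriv_L2 j u v" if "j \<le> 2" for j
  proof -
    have "j = 0 \<or> j = 1 \<or> j = 2" using that by arith
    then show ?thesis using w by blast
  qed
  then have H2: "u \<in> sobolev_H 2" using L by (simp add: sobolev_H_def)
  have zL: "(\<lambda>x. z * u x) \<in> L2"
  proof (rule L2I_decay[OF _ c])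
    show "norm (z * u x) \<le> (norm z * C) / (1 + c * \<bar>x\<bar>)" for x
      using mult_left_mono[OF decay(1)[of x] norm_ge_zero[of z]] by (simp add: norm_mult)
  qed (use cont[of 0] in \<open>auto intro!: continuous_intros\<close>)
  have "(u, \<lambda>x. z * u x) \<in> schroedinger_op W"
    using H2 zL w(3) by (auto simp: schroedinger_op_def intro!: exI[of _ "nth_deriv 2 u"]) (simp add: ode algebra_simps)
  moreover have "\<not> (AE x in lborel. u x = 0)"
    using continuous_AE_zero[of u x0] cont[of 0] nz by auto
  ultimately show ?thesis using L by (auto simp: point_spectrum_def)
qed

section \<open>Even reflection\<close>

lemma sin_pos_somewhere:
  fixes k d :: real
  assumes "0 < k" "0 < d"
  obtains x where "0 < x" "x < d" "0 < sin (k * x)"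
proof -
  define x where "x = min (d / 2) (1 / k)"
  have "0 < x" "x < d" using assms by (auto simp: x_def)
  moreover have "k * x \<le> 1" using assms by (simp add: x_def min_def field_simps)
  then have "0 < sin (k * x)" using assms \<open>0 < x\<close> pi_gt3 by (intro sin_gt_zero) auto
  ultimately show ?thesis using that by blast
qed

context lattice_problem
begin

text \<open>Near the origin \<open>Wp\<close> vanishes and \<open>\<psi> i\<close> is a multiple of \<open>sin (\<kappa> i * x)\<close>, hence the even reflection of \<open>Wp\<close> and the odd
  reflection of \<open>\<psi> i\<close> are smooth. The single coefficients \<open>wp n\<close> do not vanish near the origin, only their sum does. So
  they are first multiplied by a smooth step inside the region where \<open>Wp = 0\<close>, which does not change the sum.\<close>
lemma even_potential:
  "\<exists>(W :: real \<Rightarrow> real) (w :: 'n \<Rightarrow> real \<Rightarrow> complex). smooth W \<and> symbols (\<lambda>x. 1 + \<bar>x\<bar>) UNIV w e \<and>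
     (\<forall>x. ((\<lambda>n. wave (fr n) x * w n x) has_sum of_real (W x)) UNIV) \<and>
     (\<forall>i. of_real ((\<kappa> i)\<^sup>2) \<in> point_spectrum (schroedinger_op W))"
proof -
  have "\<epsilon> / 8 < \<epsilon> / 4" using \<epsilon> by simp
  from smooth_step[OF this]
  obtain \<zeta> :: "real \<Rightarrow> real" where \<zeta>: "smooth_on UNIV \<zeta>" "\<And>x. x \<le> \<epsilon> / 8 \<Longrightarrow> \<zeta> x = 0" "\<And>x. \<epsilon> / 4 \<le> x \<Longrightarrow> \<zeta> x = 1" "\<And>x. \<bar>\<zeta> x\<bar> \<le> 1"
    by blast
  define Z where "Z x = complex_of_real (\<zeta> x)" for x
  have Z_smooth: "smooth_on U Z" for U
    using smooth_on_subset[OF smooth_on_linear[OF open_UNIV \<zeta>(1) bounded_linear_of_real] subset_UNIV] by (simp add: Z_def[abs_def])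
  have Z0: "Z x = 0" if "x \<le> \<epsilon> / 8" for x using \<zeta>(2)[OF that] by (simp add: Z_def)
  have Z1: "Z x = 1" if "\<epsilon> / 4 \<le> x" for x using \<zeta>(3)[OF that] by (simp add: Z_def)
  have open_sets: "open {..<\<epsilon> / 8}" "open {\<epsilon> / 4<..}" by auto
  have cover: "UNIV = H \<union> {..<\<epsilon> / 8}" using \<epsilon> by auto
  have cut_smooth: "smooth_on UNIV (\<lambda>x. Z x * f x)" and cut_0: "x < \<epsilon> / 8 \<Longrightarrow> nth_deriv k (\<lambda>x. Z x * f x) x = 0"
    if "smooth_on H f" for f k x
  proof -
    have "smooth_on {..<\<epsilon> / 8} (\<lambda>x. Z x * f x) = smooth_on {..<\<epsilon> / 8} (\<lambda>x. 0 :: complex)"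
      by (rule smooth_on_cong) (auto simp: Z0)
    then have "smooth_on {..<\<epsilon> / 8} (\<lambda>x. Z x * f x)" by (simp add: smooth_on_const)
    then show "smooth_on UNIV (\<lambda>x. Z x * f x)"
      unfolding cover by (intro smooth_on_Un smooth_on_mult[OF _ Z_smooth that]) auto
    show "nth_deriv k (\<lambda>x. Z x * f x) x = 0" if "x < \<epsilon> / 8"
      using nth_deriv_cong[OF open_sets(1), of "\<lambda>x. Z x * f x" "\<lambda>x. 0" x k] that by (simp add: Z0 nth_deriv_const)
  qed
  have Z_sym: "symbols (\<lambda>x. 1 + \<bar>x\<bar>) H (\<lambda>_ :: 'n. Z) (\<lambda>_. 1)"
  proof (rule symbolsI)
    fix k
    have "compact (nth_deriv k Z ` {-1..1})"
      using smooth_on_continuous[OF Z_smooth[of UNIV], of k] by (intro compact_continuous_image) (auto intro: continuous_on_subset)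
    then obtain B where B: "\<And>x. x \<in> {-1..1} \<Longrightarrow> norm (nth_deriv k Z x) \<le> B"
      by (meson compact_imp_bounded bounded_iff image_eqI)
    have B0: "0 \<le> B" by (rule order_trans[OF norm_ge_zero B[of 0]]) simp
    have "(1 + \<bar>x\<bar>) ^ k * norm (nth_deriv k Z x) \<le> max (2 ^ k * B) 1 * 1" if x: "x \<in> H" for x
    proof (cases "x \<le> 1")
      case True
      then have "(1 + \<bar>x\<bar>) ^ k * norm (nth_deriv k Z x) \<le> 2 ^ k * B"
        using x by (intro mult_mono power_mono B) auto
      then show ?thesis by simp
    next
      case False
      then have "x \<in> {\<epsilon> / 4<..}" using \<epsilon> by simp
      from nth_deriv_cong[OF open_sets(2) _ this, of Z "\<lambda>_. 1" k]
      have "nth_deriv k Z x = (if k = 0 then 1 else 0)" by (simp add: Z1 nth_deriv_const)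
      then show ?thesis by (cases "k = 0") auto
    qed
    then show "\<exists>C\<ge>0. \<forall>i :: 'n. \<forall>x\<in>H. (1 + \<bar>x\<bar>) ^ k * norm (nth_deriv k Z x) \<le> C * 1"
      by (intro exI[of _ "max (2 ^ k * B) 1"]) simp
  qed (auto intro: Z_smooth)
  have "symbols (\<lambda>x. 1 + \<bar>x\<bar>) H (\<lambda>n x. Z x * wp n x) (\<lambda>n. 1 * e n)"
    by (intro symbols_mult Z_sym symbols_wp) auto
  then have cutH: "symbols (\<lambda>x. 1 + \<bar>x\<bar>) H (\<lambda>n x. Z x * wp n x) e" by simp
  have cut: "symbols (\<lambda>x. 1 + \<bar>x\<bar>) UNIV (\<lambda>n x. Z x * wp n x) e"
  proof (rule symbolsI)
    fix k
    obtain C where C: "C \<ge> 0" "\<And>n x. x \<in> H \<Longrightarrow> (1 + \<bar>x\<bar>) ^ k * norm (nth_deriv k (\<lambda>x. Z x * wp n x) x) \<le> C * e n"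
      using symbols_bound[OF cutH, of k] by blast
    have "(1 + \<bar>x\<bar>) ^ k * norm (nth_deriv k (\<lambda>x. Z x * wp n x) x) \<le> C * e n" for n x
    proof (cases "x \<in> H")
      case False
      then show ?thesis using cut_0[OF symbols_smooth[OF symbols_wp], of x k n] \<epsilon> C(1) less_imp_le[OF e_pos[of n]] by simp
    qed (rule C(2))
    then show "\<exists>C\<ge>0. \<forall>n. \<forall>x\<in>UNIV. (1 + \<bar>x\<bar>) ^ k * norm (nth_deriv k (\<lambda>x. Z x * wp n x) x) \<le> C * e n"
      using C(1) by blast
  qed (auto intro: cut_smooth symbols_smooth[OF symbols_wp] less_imp_le[OF e_pos])
  define w where "w n x = Z x * wp n x + Z (- x) * wp (- n) (- x)" for n x
  have refl: "nth_deriv k (\<lambda>x. f (- x)) x = (- 1) ^ k *\<^sub>R nth_deriv k f (- x)" and refl_smooth: "smooth_on UNIV (\<lambda>x. f (- x))"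
    if "smooth_on UNIV f" for f :: "real \<Rightarrow> complex" and k x
    using nth_deriv_affine[of UNIV "-1" 0 f x k] smooth_on_affine[of UNIV "-1" 0 f] smooth_on_subset[OF that, of "range uminus"] that
    by (auto simp: surj_def minus_equation_iff)
  have refl_sym: "symbols (\<lambda>x. 1 + \<bar>x\<bar>) UNIV (\<lambda>n x. Z (- x) * wp (- n) (- x)) e"
  proof (rule symbolsI)
    fix k
    obtain C where C: "C \<ge> 0" "\<And>n x. x \<in> UNIV \<Longrightarrow> (1 + \<bar>x\<bar>) ^ k * norm (nth_deriv k (\<lambda>x. Z x * wp n x) x) \<le> C * e n"
      using symbols_bound[OF cut, of k] by blast
    have "(1 + \<bar>x\<bar>) ^ k * norm (nth_deriv k (\<lambda>x. Z (- x) * wp (- n) (- x)) x) \<le> C * e n" for n x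
      using C(2)[of "- x" "- n"] refl[OF symbols_smooth[OF cut], of k "- n" x] by (simp add: e_minus)
    then show "\<exists>C\<ge>0. \<forall>n. \<forall>x\<in>UNIV. (1 + \<bar>x\<bar>) ^ k * norm (nth_deriv k (\<lambda>x. Z (- x) * wp (- n) (- x)) x) \<le> C * e n"
      using C(1) by blast
  qed (auto intro: refl_smooth[OF symbols_smooth[OF cut]] less_imp_le[OF e_pos])
  have w_sym: "symbols (\<lambda>x. 1 + \<bar>x\<bar>) UNIV w e"
    unfolding w_def[abs_def] by (rule symbols_add[OF _ cut refl_sym]) auto
  define Wc where "Wc x = Z x * Wp x + Z (- x) * Wp (- x)" for x
  define W where "W x = Re (Wc x)" for x
  have cnj_cut: "cnj (Z x * Wp x) = Z x * Wp x" for x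
    using cnj_Wp[of x] Z0[of x] \<epsilon> by (cases "x \<in> H") (auto simp: Z_def)
  have W_real: "of_real (W x) = Wc x" for x
  proof -
    have "cnj (Wc x) = Wc x" using cnj_cut[of x] cnj_cut[of "- x"] by (simp add: Wc_def)
    then show ?thesis unfolding W_def by (metis Reals_cnj_iff of_real_Re)
  qed
  have W_smooth: "smooth_on UNIV W"
    unfolding W_def[abs_def] Wc_def
    by (intro smooth_on_linear[OF _ _ bounded_linear_Re] smooth_on_add refl_smooth[OF cut_smooth[OF Wp_smooth]] cut_smooth Wp_smooth open_UNIV)
  have cut_sum: "((\<lambda>n. wave (fr n) x * (Z x * wp n x)) has_sum (Z x * Wp x)) UNIV" for x
  proof (cases "x \<in> H")
    case True
    from has_sum_cmult_right[OF Wp_expansion[OF True], of "Z x"] show ?thesis by (simp add: mult_ac)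
  next
    case False
    then show ?thesis using Z0[of x] \<epsilon> by simp
  qed
  have w_sum: "((\<lambda>n. wave (fr n) x * w n x) has_sum of_real (W x)) UNIV" for x
  proof -
    have "((\<lambda>n. wave (fr (- n)) (- x) * (Z (- x) * wp (- n) (- x))) has_sum (Z (- x) * Wp (- x))) UNIV"
      using cut_sum[of "- x"] has_sum_reindex_bij_betw[OF bij_uminus, of "\<lambda>n. wave (fr n) (- x) * (Z (- x) * wp n (- x))"] by simp
    moreover have "wave (fr (- n)) (- x) = wave (fr n) x" for n by (simp add: fr_minus wave_def)
    ultimately show ?thesis
      using has_sum_add[OF cut_sum[of x]] by (simp add: W_real Wc_def w_def distrib_left)
  qed
  have W_even: "W (- x) = W x" for x by (simp add: W_def Wc_def)
  \<comment> \<open>the step is \<open>1\<close> from \<open>\<epsilon> / 4\<close> on, and before that both sides are \<open>0\<close>\<close>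
  have W_Wp: "of_real (W x) = Wp x" if "- (\<epsilon> / 2) < x" for x
  proof (cases "x < \<epsilon> / 2")
    case True
    then show ?thesis using Wp_near_0[of x] Wp_near_0[of "- x"] that by (simp add: W_real Wc_def X_def)
  next
    case False
    then show ?thesis using Z1[of x] Z0[of "- x"] \<epsilon> by (simp add: W_real Wc_def)
  qed
  have "1 \<le> 1 + \<bar>x\<bar>" for x :: real by simp
  from symbols_bound0[OF w_sym this, of 0]
  obtain M where M: "M \<ge> 0" "\<And>n x. x \<in> UNIV \<Longrightarrow> norm (nth_deriv 0 (w n) x) \<le> M * e n" by blast
  have W_bounded: "\<bar>W x\<bar> \<le> M * infsum e UNIV" for x
  proof -
    have "norm (complex_of_real (W x)) \<le> M * infsum e UNIV"
      by (rule norm_infsum_le[OF w_sum has_sum_cmult_right[OF has_sum_infsum[OF e_summable]]])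
        (use M(2) in \<open>simp add: norm_mult\<close>)
    then show ?thesis by simp
  qed
  have "of_real ((\<kappa> i)\<^sup>2) \<in> point_spectrum (schroedinger_op W)" for i
  proof -
    define u where "u x = (if 0 \<le> x then \<psi> i x else - \<psi> i (- x))" for x
    have free_odd: "free i (- x) = - free i x" for x by (simp add: free_def)
    \<comment> \<open>the two halves overlap, as \<open>\<psi> i\<close> is odd near the origin\<close>
    have right: "u x = \<psi> i x" if "- (\<epsilon> / 2) < x" for x
      using that \<psi>_near_0[of x i] \<psi>_near_0[of "- x" i] \<epsilon> by (auto simp: u_def X_def free_odd)
    have left: "u x = - \<psi> i (- x)" if "x < \<epsilon> / 2" for x
      using that \<psi>_near_0[of x i] \<psi>_near_0[of "- x" i] \<epsilon> by (auto simp: u_def X_def free_odd)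
    let ?R = "{- (\<epsilon> / 2)<..}" and ?L = "{..<\<epsilon> / 2}"
    have op: "open ?R" "open ?L" by auto
    have sub: "?R \<subseteq> H" "(\<lambda>x. (-1) * x + 0) ` ?L \<subseteq> H" using \<epsilon> by auto
    have LR: "UNIV = ?R \<union> ?L" using \<epsilon> by auto
    have \<psi>R: "smooth_on ?R (\<psi> i)" using \<psi>_smooth smooth_on_subset sub(1) by blast
    have \<psi>L: "smooth_on ((\<lambda>x. (-1) * x + 0) ` ?L) (\<psi> i)" using \<psi>_smooth smooth_on_subset sub(2) by blast
    have smL: "smooth_on ?L (\<lambda>x. \<psi> i (- x))" using smooth_on_affine[OF op(2) \<psi>L] by simp
    have dR: "nth_deriv k u x = nth_deriv k (\<psi> i) x" if "x \<in> ?R" for k x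
      by (rule nth_deriv_cong[OF op(1) _ that]) (use right in auto)
    have dL: "nth_deriv k u x = - ((- 1) ^ k *\<^sub>R nth_deriv k (\<psi> i) (- x))" if x: "x \<in> ?L" for k x
    proof -
      have "nth_deriv k u x = nth_deriv k (\<lambda>x. - \<psi> i (- x)) x"
        by (rule nth_deriv_cong[OF op(2) _ x]) (use left in auto)
      also have "\<dots> = - nth_deriv k (\<lambda>x. \<psi> i (- x)) x" by (rule nth_deriv_minus[OF op(2) smL x])
      finally show ?thesis using nth_deriv_affine[OF op(2) \<psi>L x, of k] by simp
    qed
    have sm: "smooth_on UNIV u"
    proof -
      have "smooth_on ?R u = smooth_on ?R (\<psi> i)" by (rule smooth_on_cong[OF op(1)]) (use right in auto)
      moreover have "smooth_on ?L u = smooth_on ?L (\<lambda>x. - \<psi> i (- x))" by (rule smooth_on_cong[OF op(2)]) (use left in auto)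
      ultimately show ?thesis unfolding LR using \<psi>R smooth_on_minus[OF op(2) smL] by (intro smooth_on_Un) auto
    qed
    have ode: "nth_deriv 2 u x = (of_real (W x) - of_real ((\<kappa> i)\<^sup>2)) * u x" for x
    proof (cases "x \<in> ?R")
      case True
      then show ?thesis using dR[OF True, of 2] \<psi>_ode[of x i] sub(1) W_Wp[of x] right[of x] by (auto simp: subset_iff)
    next
      case False
      then have x: "x \<in> ?L" "- x \<in> ?R" using \<epsilon> by auto
      then have "Wp (- x) = of_real (W x)" using W_Wp[of "- x"] W_even[of x] by simp
      moreover have "- x \<in> H" by (rule subsetD[OF sub(1) x(2)])
      ultimately show ?thesis using dL[OF x(1), of 2] \<psi>_ode[of "- x" i] x left[of x] by simp
    qed
    obtain C where C: "\<And>x. 0 \<le> x \<Longrightarrow> norm (\<psi> i x) \<le> C / (1 + c i * x)"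
      "\<And>x. 0 \<le> x \<Longrightarrow> norm (nth_deriv 1 (\<psi> i) x) \<le> C / (1 + c i * x)" by (rule \<psi>_decay) blast
    have dec: "norm (u x) \<le> C / (1 + c i * \<bar>x\<bar>)" "norm (nth_deriv 1 u x) \<le> C / (1 + c i * \<bar>x\<bar>)" for x
    proof -
      have "norm (u x) \<le> C / (1 + c i * \<bar>x\<bar>) \<and> norm (nth_deriv 1 u x) \<le> C / (1 + c i * \<bar>x\<bar>)"
      proof (cases "0 \<le> x")
        case True
        then have "x \<in> ?R" using \<epsilon> by simp
        then show ?thesis using C[OF True] True dR[of x 1] right[of x] by simp
      next
        case False
        then have "x \<in> ?L" "0 \<le> - x" using \<epsilon> by auto
        then show ?thesis using C[of "- x"] False dL[of x 1] left[of x] by simp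
      qed
      then show "norm (u x) \<le> C / (1 + c i * \<bar>x\<bar>)" "norm (nth_deriv 1 u x) \<le> C / (1 + c i * \<bar>x\<bar>)" by auto
    qed
    obtain x0 where x0: "0 < x0" "x0 < \<epsilon> / 2" "0 < sin (\<kappa> i * x0)"
      using sin_pos_somewhere[of "\<kappa> i" "\<epsilon> / 2"] \<kappa>_pos \<epsilon> by auto
    have "\<gamma> i \<noteq> 0" using \<delta>(1) v_pos[of i] by (simp add: \<gamma>_def)
    then have "u x0 \<noteq> 0" using x0 right[of x0] \<psi>_near_0[of x0 i] by (auto simp: X_def free_def)
    from eigenvalue_in_point_spectrum[OF sm this W_bounded ode c_pos[of i] dec]
    show ?thesis .
  qed
  then show ?thesis using W_smooth w_sym w_sum by (auto simp: smooth_on_UNIV)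
qed

end

section \<open>Diophantine frequencies\<close>

lemma power_le_exp:
  fixes b :: real
  assumes "0 < b"
  shows "\<exists>C\<ge>0. \<forall>t\<ge>0. (1 + t) ^ k \<le> C * exp (b * t)"
proof -
  define d where "d = b / (real k + 1)"
  define M where "M = max 1 (1 / d)"
  have d: "0 < d" "real k * d \<le> b" using assms by (auto simp: d_def field_simps)
  have M: "1 \<le> M" "1 \<le> M * d" using d(1) by (auto simp: M_def max_def field_simps)
  have "(1 + t) ^ k \<le> M ^ k * exp (b * t)" if t: "0 \<le> t" for t
  proof -
    have "1 * t \<le> M * d * t" using M(2) t by (intro mult_right_mono) auto
    then have "1 + t \<le> M * (1 + d * t)" using M(1) by (simp add: distrib_left)
    also have "\<dots> \<le> M * exp (d * t)" using M(1) by (intro mult_left_mono) auto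
    finally have "(1 + t) ^ k \<le> (M * exp (d * t)) ^ k" using t by (intro power_mono) auto
    also have "\<dots> = M ^ k * exp (real k * d * t)" by (simp add: power_mult_distrib exp_of_nat_mult mult.assoc)
    also have "\<dots> \<le> M ^ k * exp (b * t)" using M(1) d(2) t by (intro mult_left_mono) (auto intro: mult_right_mono)
    finally show ?thesis .
  qed
  then show ?thesis using M(1) by (intro exI[of _ "M ^ k"]) simp
qed

definition l1 :: "int ^ 'd \<Rightarrow> real" where "l1 n = (\<Sum>k\<in>UNIV. \<bar>real_of_int (n $ k)\<bar>)"

lemma l1_nonneg: "0 \<le> l1 n"
  by (simp add: l1_def sum_nonneg)

lemma l1_zero: "l1 0 = 0"
  by (simp add: l1_def)

lemma l1_minus: "l1 (- n) = l1 n"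
  by (simp add: l1_def)

lemma l1_add: "l1 (m + n) \<le> l1 m + l1 n"
  unfolding l1_def sum.distrib[symmetric] by (intro sum_mono) auto

lemma l1_diff: "l1 (m - n) \<le> l1 m + l1 n"
  using l1_add[of m "- n"] by (simp add: l1_minus)

lemma norm_le_l1: "norm (int_to_real_vec n) \<le> l1 n"
  using norm_le_l1_cart[of "int_to_real_vec n"] by (simp add: l1_def int_to_real_vec_def)

lemma int_to_real_vec_add: "int_to_real_vec (m + n) = int_to_real_vec m + int_to_real_vec n"
  by (simp add: int_to_real_vec_def vec_eq_iff)

lemma int_to_real_vec_diff: "int_to_real_vec (m - n) = int_to_real_vec m - int_to_real_vec n"
  by (simp add: int_to_real_vec_def vec_eq_iff)

lemma int_to_real_vec_eq_0: "int_to_real_vec n = 0 \<longleftrightarrow> n = 0"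
  by (simp add: int_to_real_vec_def vec_eq_iff)

lemma geometric_box_sum:
  fixes b :: real
  assumes "0 < b"
  obtains S where "0 \<le> S" "\<And>m :: nat. (\<Sum>k\<in>{- int m..int m}. exp (- b * \<bar>real_of_int k\<bar>)) \<le> S"
proof -
  define r where "r = exp (- b)"
  have r: "0 < r" "r < 1" using assms by (auto simp: r_def)
  have e: "exp (- b * \<bar>real_of_int k\<bar>) = r ^ nat \<bar>k\<bar>" for k
    by (simp add: r_def exp_of_nat_mult[symmetric] mult.commute)
  have step: "(\<Sum>k\<in>{- int m..int m}. r ^ nat \<bar>k\<bar>) \<le> 2 * (\<Sum>k\<le>m. r ^ k)" for m
  proof (induction m)
    case (Suc m)
    have "{- int (Suc m)..int (Suc m)} = insert (- int (Suc m)) (insert (int (Suc m)) {- int m..int m})" by auto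
    then have "(\<Sum>k\<in>{- int (Suc m)..int (Suc m)}. r ^ nat \<bar>k\<bar>) = r ^ Suc m + (r ^ Suc m + (\<Sum>k\<in>{- int m..int m}. r ^ nat \<bar>k\<bar>))"
      by (simp add: nat_add_distrib)
    then show ?case using Suc by simp
  qed auto
  have "(\<Sum>k\<in>{- int m..int m}. exp (- b * \<bar>real_of_int k\<bar>)) \<le> 2 * (1 / (1 - r))" for m
  proof -
    have "(\<Sum>k<Suc m. r ^ k) \<le> 1 / (1 - r)"
      using r by (subst sum_gp_strict) (auto simp: divide_right_mono)
    then show ?thesis using step[of m] unfolding e lessThan_Suc_atMost by linarith
  qed
  then show ?thesis using that[of "2 * (1 / (1 - r))"] r by simp
qed

text \<open>The sum over a box of lattice vectors is a product of one-dimensional geometric sums.\<close>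
lemma exp_l1_summable:
  fixes b :: real
  assumes "0 < b"
  shows "(\<lambda>n :: int ^ 'd. exp (- b * l1 n)) summable_on UNIV"
proof -
  obtain S where S: "0 \<le> S" "\<And>m :: nat. (\<Sum>k\<in>{- int m..int m}. exp (- b * \<bar>real_of_int k\<bar>)) \<le> S"
    using geometric_box_sum[OF assms] by blast
  have "sum (\<lambda>n. exp (- b * l1 n)) F \<le> S ^ CARD('d)" if F: "finite F" for F :: "(int ^ 'd) set"
  proof -
    define m where "m = nat (Max (insert 0 ((\<lambda>(n, k). \<bar>n $ k\<bar>) ` (F \<times> UNIV))))"
    have m: "\<bar>n $ k\<bar> \<le> int m" if "n \<in> F" for n k
    proof -
      have "\<bar>n $ k\<bar> \<le> Max (insert 0 ((\<lambda>(n, k). \<bar>n $ k\<bar>) ` (F \<times> UNIV)))"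
        using F that by (intro Max_ge) auto
      moreover have "0 \<le> Max (insert 0 ((\<lambda>(n, k). \<bar>n $ k\<bar>) ` (F \<times> UNIV)))"
        using F by (intro Max_ge) auto
      ultimately show ?thesis by (simp add: m_def)
    qed
    let ?P = "PiE UNIV (\<lambda>_ :: 'd. {- int m..int m})"
    have fin: "finite ?P" by (intro finite_PiE) auto
    have "sum (\<lambda>n. exp (- b * l1 n)) F \<le> sum (\<lambda>n. exp (- b * l1 n)) (vec_lambda ` ?P)"
    proof (rule sum_mono2)
      show "F \<subseteq> vec_lambda ` ?P"
      proof
        fix n assume "n \<in> F"
        then have "vec_nth n \<in> ?P" using m[of n] by (auto simp: abs_le_iff minus_le_iff)
        then show "n \<in> vec_lambda ` ?P" by (intro image_eqI[of _ _ "vec_nth n"]) auto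
      qed
    qed (use fin in auto)
    also have "\<dots> = (\<Sum>g\<in>?P. exp (- b * l1 (vec_lambda g)))"
      by (subst sum.reindex) (auto simp: inj_on_def vec_lambda_inject)
    also have "\<dots> = (\<Sum>g\<in>?P. \<Prod>k\<in>UNIV. exp (- b * \<bar>real_of_int (g k)\<bar>))"
      by (simp add: l1_def sum_distrib_left exp_sum)
    also have "\<dots> = (\<Prod>k\<in>(UNIV :: 'd set). \<Sum>y\<in>{- int m..int m}. exp (- b * \<bar>real_of_int y\<bar>))"
      by (rule prod_sum_PiE[symmetric]) auto
    also have "\<dots> \<le> S ^ CARD('d)"
      using S(2)[of m] by (simp add: power_mono sum_nonneg)
    finally show ?thesis .
  qed
  then show ?thesis
    by (intro nonneg_bounded_partial_sums_imp_summable_on[where C="S ^ CARD('d)"] eventually_finite_subsets_at_top_weakI) auto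
qed

lemma jbracket_power_le:
  "(jbracket x) ^ N \<le> (1 + norm x) ^ N" "1 \<le> jbracket x" "(0::real) < jbracket x"
proof -
  have "1 + (norm x)\<^sup>2 \<le> (1 + norm x)\<^sup>2" by (simp add: power2_sum)
  then have "jbracket x \<le> 1 + norm x" unfolding jbracket_def by (intro real_le_lsqrt) auto
  moreover show "1 \<le> jbracket x" by (simp add: jbracket_def)
  ultimately show "(jbracket x) ^ N \<le> (1 + norm x) ^ N" "(0::real) < jbracket x"
    by (auto intro: power_mono)
qed

text \<open>A polynomial bound with integer exponent, and in terms of the subadditive length \<open>l1\<close>.\<close>
lemma diophantine_inverse_bound:
  fixes \<omega> :: "real ^ 'd"
  assumes "diophantine \<omega>"
  obtains C p where "0 < C" "\<And>n. n \<noteq> 0 \<Longrightarrow> int_to_real_vec n \<bullet> \<omega> \<noteq> 0"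
    "\<And>n. n \<noteq> 0 \<Longrightarrow> 1 / \<bar>int_to_real_vec n \<bullet> \<omega>\<bar> \<le> C * (1 + l1 n) ^ p"
proof -
  obtain c \<mu> where c: "c > 0" "\<mu> > 0"
      "\<And>n. n \<noteq> 0 \<Longrightarrow> \<bar>int_to_real_vec n \<bullet> \<omega>\<bar> > c * norm (int_to_real_vec n) powr (- \<mu>)"
    using assms by (auto simp: diophantine_def)
  define p where "p = nat \<lceil>\<mu>\<rceil>"
  have pos: "0 < c * norm (int_to_real_vec n) powr (- \<mu>)" if "n \<noteq> 0" for n :: "int ^ 'd"
    using that c(1) by (simp add: int_to_real_vec_eq_0)
  have "1 / \<bar>int_to_real_vec n \<bullet> \<omega>\<bar> \<le> 1 / c * (1 + l1 n) ^ p" if n: "n \<noteq> 0" for n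
  proof -
    have "1 / \<bar>int_to_real_vec n \<bullet> \<omega>\<bar> \<le> 1 / (c * norm (int_to_real_vec n) powr (- \<mu>))"
      using c(3)[OF n] pos[OF n] by (intro divide_left_mono mult_pos_pos[of _ "c * _"]) linarith+
    also have "\<dots> = 1 / c * norm (int_to_real_vec n) powr \<mu>" by (simp add: powr_minus_divide)
    also have "\<dots> \<le> 1 / c * (1 + l1 n) powr \<mu>"
      using c(1,2) norm_le_l1[of n] by (intro mult_left_mono powr_mono2) auto
    also have "\<dots> \<le> 1 / c * (1 + l1 n) powr real p"
      using c(1,2) l1_nonneg[of n] by (intro mult_left_mono powr_mono) (auto simp: p_def of_nat_ceiling)
    also have "(1 + l1 n) powr real p = (1 + l1 n) ^ p" using l1_nonneg[of n] by (intro powr_realpow) auto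
    finally show ?thesis .
  qed
  moreover have "int_to_real_vec n \<bullet> \<omega> \<noteq> 0" if "n \<noteq> 0" for n using c(3)[OF that] pos[OF that] by auto
  ultimately show ?thesis using that[of "1 / c" p] c(1) by simp
qed

lemma positive_frequencies_infinite:
  fixes \<omega> :: "real ^ 'd"
  assumes "\<And>n :: int ^ 'd. n \<noteq> 0 \<Longrightarrow> int_to_real_vec n \<bullet> \<omega> \<noteq> 0"
  shows "infinite {n :: int ^ 'd. 0 < int_to_real_vec n \<bullet> \<omega>}"
proof -
  obtain k :: 'd where True by simp
  define b :: "int ^ 'd" where "b = axis k (if 0 < \<omega> $ k then 1 else - 1)"
  have b: "int_to_real_vec b \<bullet> \<omega> = \<bar>\<omega> $ k\<bar>"
  proof -
    have "int_to_real_vec b = axis k (if 0 < \<omega> $ k then 1 else - 1)"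
      by (simp add: b_def int_to_real_vec_def axis_def vec_eq_iff)
    then show ?thesis by (simp add: inner_axis')
  qed
  have "b \<noteq> 0" by (simp add: b_def axis_def vec_eq_iff)
  then have pos: "0 < int_to_real_vec b \<bullet> \<omega>" using assms[of b] b by simp
  have mult: "int_to_real_vec (\<chi> i. int m * b $ i) = real m *\<^sub>R int_to_real_vec b" for m
    by (simp add: int_to_real_vec_def vec_eq_iff)
  have "inj (\<lambda>m. (\<chi> i. int (Suc m) * b $ i) :: int ^ 'd)"
  proof
    fix m l assume "(\<chi> i. int (Suc m) * b $ i) = (\<chi> i. int (Suc l) * b $ i)"
    then have "real (Suc m) *\<^sub>R int_to_real_vec b = real (Suc l) *\<^sub>R int_to_real_vec b" by (metis mult)
    then show "m = l" using \<open>b \<noteq> 0\<close> by (simp add: int_to_real_vec_eq_0)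
  qed
  then have "infinite (range (\<lambda>m. (\<chi> i. int (Suc m) * b $ i) :: int ^ 'd))" by (rule range_inj_infinite)
  moreover have "range (\<lambda>m. (\<chi> i. int (Suc m) * b $ i) :: int ^ 'd) \<subseteq> {n. 0 < int_to_real_vec n \<bullet> \<omega>}"
    using pos by (auto simp: mult simp del: of_nat_Suc)
  ultimately show ?thesis by (meson finite_subset)
qed

text \<open>The weights are exponentials of \<open>l1\<close>, which is subadditive: \<open>v i = exp (- l1 (\<iota> i))\<close> and
  \<open>e n = exp (- l1 n / 2)\<close>. Both the frequencies and the small denominators \<open>\<kappa> i - \<kappa> j\<close>, half a frequency of \<open>\<iota> i - \<iota> j\<close>, are then controlled.\<close>
lemma lattice_problem_exists:
  fixes \<omega> :: "real ^ 'd"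
  assumes "diophantine \<omega>"
  shows "\<exists>\<kappa> v Cg \<delta> W0 \<epsilon> a s0 \<iota>. lattice_problem \<kappa> v Cg \<delta> W0 \<epsilon> a s0 \<iota> (\<lambda>n :: int ^ 'd. exp (- (1 / 2) * l1 n)) (\<lambda>n. int_to_real_vec n \<bullet> \<omega>)
    \<and> range \<iota> = {n. 0 < int_to_real_vec n \<bullet> \<omega>}"
proof -
  define fr where "fr n = int_to_real_vec n \<bullet> \<omega>" for n
  have fr_diff: "fr (m - n) = fr m - fr n" and fr_add: "fr (m + n) = fr m + fr n" for m n
    by (simp_all add: fr_def int_to_real_vec_diff int_to_real_vec_add inner_diff_left inner_add_left)
  have fr_le: "\<bar>fr n\<bar> \<le> norm \<omega> * l1 n" for n
    using order_trans[OF Cauchy_Schwarz_ineq2[of "int_to_real_vec n" \<omega>] mult_right_mono[OF norm_le_l1 norm_ge_zero]]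
    by (simp add: fr_def mult.commute)
  obtain C p where C: "0 < C" "\<And>n. n \<noteq> 0 \<Longrightarrow> fr n \<noteq> 0" "\<And>n. n \<noteq> 0 \<Longrightarrow> 1 / \<bar>fr n\<bar> \<le> C * (1 + l1 n) ^ p"
    unfolding fr_def by (rule diophantine_inverse_bound[OF assms]) blast
  have "infinite {n. 0 < fr n}" unfolding fr_def using C(2) by (intro positive_frequencies_infinite) (auto simp: fr_def)
  then obtain \<iota> where \<iota>: "bij_betw \<iota> (UNIV :: nat set) {n. 0 < fr n}"
    using countable_infiniteE'[of "{n. 0 < fr n}"] by blast
  have \<iota>_pos: "0 < fr (\<iota> i)" for i using bij_betwE[OF \<iota>] by auto
  have \<iota>_inj: "inj \<iota>" using \<iota> by (simp add: bij_betw_def)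
  have \<iota>_0: "\<iota> i \<noteq> 0" for i using \<iota>_pos[of i] fr_add[of 0 0] by auto
  define \<kappa> where "\<kappa> i = fr (\<iota> i) / 2" for i
  define v where "v i = exp (- l1 (\<iota> i))" for i
  have \<kappa>_pos: "0 < \<kappa> i" for i using \<iota>_pos[of i] by (simp add: \<kappa>_def)
  have v_pos: "0 < v i" for i by (simp add: v_def)
  have L: "0 \<le> l1 n" for n :: "int ^ 'd" by (rule l1_nonneg)
  obtain C1 :: real where C1: "0 \<le> C1" "\<And>t. 0 \<le> t \<Longrightarrow> (1 + t) ^ p \<le> C1 * exp (1 * t)" using power_le_exp[OF zero_less_one, of p] by metis
  define Cg where "Cg = max 1 (2 * C * C1)"
  have small_div: "2 / \<bar>fr n\<bar> \<le> Cg * exp (l1 n)" if "n \<noteq> 0" for n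
  proof -
    have "2 * (1 / \<bar>fr n\<bar>) \<le> 2 * (C * (C1 * exp (1 * l1 n)))"
      by (rule mult_left_mono[OF order_trans[OF C(3)[OF that] mult_left_mono[OF C1(2)[OF L[of n]]]]]) (use less_imp_le[OF C(1)] in simp_all)
    also have "\<dots> = (2 * C * C1) * exp (l1 n)" by (simp only: mult_1_left mult.assoc)
    also have "\<dots> \<le> Cg * exp (l1 n)" by (intro mult_right_mono) (auto simp: Cg_def)
    finally show ?thesis by (simp only: times_divide_eq_right mult_1_right)
  qed
  have v_sum: "v summable_on UNIV"
  proof -
    have "(\<lambda>n :: int ^ 'd. exp (- 1 * l1 n)) summable_on UNIV" by (rule exp_l1_summable) simp
    then have "(\<lambda>n :: int ^ 'd. exp (- 1 * l1 n)) summable_on (range \<iota>)" by (rule summable_on_subset_banach) auto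
    then show ?thesis unfolding summable_on_reindex[OF \<iota>_inj] by (simp add: o_def v_def[abs_def])
  qed
  define K where "K = 1000 * Cg * (1 + infsum v UNIV)"
  have "1 \<le> Cg" by (simp add: Cg_def)
  moreover have "0 \<le> infsum v UNIV" using v_pos by (intro infsum_nonneg) (auto simp: less_imp_le)
  ultimately have K: "0 < K" by (simp add: K_def)
  define \<delta> where "\<delta> = 1 / sqrt K"
  have "eigen_data \<kappa> v Cg \<delta>"
  proof
    show "inj \<kappa>"
    proof
      fix i j assume "\<kappa> i = \<kappa> j"
      then have "fr (\<iota> i - \<iota> j) = 0" by (simp add: \<kappa>_def fr_diff)
      then show "i = j" using C(2)[of "\<iota> i - \<iota> j"] \<iota>_inj by (auto simp: inj_def)
    qed
    show "v i \<le> 1" for i using L[of "\<iota> i"] by (simp add: v_def)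
    show "\<exists>C\<ge>0. \<forall>i. (1 + \<kappa> i + 1 / \<kappa> i) ^ k \<le> C / v i" for k
    proof -
      define M where "M = 1 + norm \<omega> + 2 * C"
      obtain C2 :: real where C2: "0 \<le> C2" "\<And>t. 0 \<le> t \<Longrightarrow> (1 + t) ^ (Suc p * k) \<le> C2 * exp (1 * t)"
        using power_le_exp[OF zero_less_one, of "Suc p * k"] by metis
      have M: "0 \<le> M" using C(1) by (simp add: M_def)
      have "(1 + \<kappa> i + 1 / \<kappa> i) ^ k \<le> (M ^ k * C2) / v i" for i
      proof -
        let ?t = "1 + l1 (\<iota> i)"
        have t: "1 \<le> ?t" using L[of "\<iota> i"] by simp
        have P: "1 \<le> ?t ^ Suc p" "?t \<le> ?t ^ Suc p" "?t ^ p \<le> ?t ^ Suc p"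
          using t one_le_power[OF t, of "Suc p"] power_increasing[OF _ t, of 1 "Suc p"] power_increasing[OF _ t, of p "Suc p"] by auto
        have "\<kappa> i \<le> norm \<omega> * ?t"
          using fr_le[of "\<iota> i"] \<iota>_pos[of i] norm_ge_zero[of \<omega>] mult_nonneg_nonneg[OF norm_ge_zero[of \<omega>] L[of "\<iota> i"]] unfolding \<kappa>_def distrib_left mult_1_right by linarith
        also have "\<dots> \<le> norm \<omega> * ?t ^ Suc p" using P(2) by (intro mult_left_mono) auto
        finally have 1: "\<kappa> i \<le> norm \<omega> * ?t ^ Suc p" .
        have "1 / \<kappa> i \<le> 2 * C * ?t ^ p" using C(3)[OF \<iota>_0[of i]] \<iota>_pos[of i] by (simp add: \<kappa>_def)
        also have "\<dots> \<le> 2 * C * ?t ^ Suc p" using P(3) C(1) by (intro mult_left_mono) auto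
        finally have "1 / \<kappa> i \<le> 2 * C * ?t ^ Suc p" .
        then have "1 + \<kappa> i + 1 / \<kappa> i \<le> M * ?t ^ Suc p" using 1 P(1) unfolding M_def distrib_right mult_1_left by linarith
        then have "(1 + \<kappa> i + 1 / \<kappa> i) ^ k \<le> (M * ?t ^ Suc p) ^ k" using \<kappa>_pos[of i] by (intro power_mono) auto
        also have "\<dots> = M ^ k * ?t ^ (Suc p * k)" by (simp only: power_mult_distrib power_mult)
        also have "\<dots> \<le> M ^ k * (C2 * exp (1 * l1 (\<iota> i)))" using M by (intro mult_left_mono C2 L) auto
        finally show ?thesis by (simp add: v_def exp_minus field_simps)
      qed
      then show ?thesis using M C2(1) by (intro exI[of _ "M ^ k * C2"]) auto
    qed
    show "1 \<le> Cg" by fact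
    show "1 / \<kappa> i \<le> Cg / v i" for i
      using small_div[OF \<iota>_0[of i]] \<iota>_pos[of i] by (simp add: \<kappa>_def v_def exp_minus field_simps)
    show "1 / \<bar>\<kappa> i - \<kappa> j\<bar> \<le> Cg / (v i * v j)" if "i \<noteq> j" for i j
    proof -
      have ne: "\<iota> i - \<iota> j \<noteq> 0" using that \<iota>_inj by (auto simp: inj_def)
      have "1 / \<bar>\<kappa> i - \<kappa> j\<bar> = 2 / \<bar>fr (\<iota> i - \<iota> j)\<bar>"
        by (simp add: \<kappa>_def fr_diff flip: diff_divide_distrib)
      also have "\<dots> \<le> Cg * exp (l1 (\<iota> i - \<iota> j))" by (rule small_div[OF ne])
      also have "\<dots> \<le> Cg * exp (l1 (\<iota> i) + l1 (\<iota> j))" using l1_diff \<open>1 \<le> Cg\<close> by (intro mult_left_mono) auto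
      finally show ?thesis by (simp add: v_def exp_minus exp_add field_simps)
    qed
    show "0 < \<delta>" using K by (simp add: \<delta>_def)
    show "\<delta>\<^sup>2 * (1000 * Cg * (1 + infsum v UNIV)) \<le> 1"
      using K unfolding K_def[symmetric] by (simp add: \<delta>_def power_divide)
  qed (fact \<kappa>_pos v_pos v_sum)+
  then obtain W0 \<epsilon> a s0 where "matched \<kappa> v Cg \<delta> W0 \<epsilon> a s0" using eigen_data.matched_exists by blast
  then interpret matched \<kappa> v Cg \<delta> W0 \<epsilon> a s0 .
  have "lattice_problem \<kappa> v Cg \<delta> W0 \<epsilon> a s0 \<iota> (\<lambda>n :: int ^ 'd. exp (- (1 / 2) * l1 n)) fr"
  proof
    show "(\<lambda>n :: int ^ 'd. exp (- (1 / 2) * l1 n)) summable_on UNIV" by (rule exp_l1_summable) simp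
    show "exp (- (1 / 2) * l1 m) * exp (- (1 / 2) * l1 n) \<le> exp (- (1 / 2) * l1 (m + n))" for m n :: "int ^ 'd"
      using l1_add[of m n] by (simp flip: exp_add)
    show "(exp (- (1 / 2) * l1 (\<iota> i)))\<^sup>2 = v i" for i by (simp add: v_def flip: exp_double)
    show "\<exists>C\<ge>0. \<forall>n. \<bar>fr n\<bar> ^ k * exp (- (1 / 2) * l1 n) \<le> C" for k
    proof -
      obtain C2 :: real where C2: "0 \<le> C2" "\<And>t. 0 \<le> t \<Longrightarrow> (1 + t) ^ k \<le> C2 * exp (1 / 2 * t)" using power_le_exp[of "1 / 2" k] half_gt_zero[OF zero_less_one] by metis
      have "\<bar>fr n\<bar> ^ k * exp (- (1 / 2) * l1 n) \<le> norm \<omega> ^ k * C2" for n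
      proof -
        have "\<bar>fr n\<bar> \<le> norm \<omega> * (1 + l1 n)" using fr_le[of n] norm_ge_zero[of \<omega>] unfolding distrib_left mult_1_right by linarith
        then have "\<bar>fr n\<bar> ^ k \<le> (norm \<omega> * (1 + l1 n)) ^ k" by (intro power_mono) auto
        also have "\<dots> \<le> norm \<omega> ^ k * (C2 * exp (1 / 2 * l1 n))"
          unfolding power_mult_distrib by (intro mult_left_mono C2 L) auto
        finally have "\<bar>fr n\<bar> ^ k * exp (- (1 / 2) * l1 n) \<le> norm \<omega> ^ k * (C2 * exp (1 / 2 * l1 n)) * exp (- (1 / 2) * l1 n)"
          by (intro mult_right_mono) auto
        then show ?thesis by (simp add: mult.assoc flip: exp_add)
      qed
      then show ?thesis using C2(1) by (intro exI[of _ "norm \<omega> ^ k * C2"]) auto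
    qed
  qed (auto simp: l1_zero l1_minus l1_nonneg fr_add \<kappa>_def)
  moreover have "range \<iota> = {n. 0 < fr n}" using \<iota> by (simp add: bij_betw_def)
  ultimately show ?thesis unfolding fr_def[abs_def] by blast
qed

lemma decay_from_weights:
  fixes y :: real
  assumes "P * y \<le> C * e" "e * Q \<le> D" "0 < P" "0 < Q" "0 \<le> C" "C * D \<le> K"
  shows "y \<le> K * inverse P * inverse Q"
proof -
  have "P * y * Q \<le> C * e * Q" using assms by (intro mult_right_mono) auto
  also have "\<dots> \<le> C * D" using mult_left_mono[OF assms(2,5)] by (simp add: mult.assoc)
  finally have "P * y * Q \<le> K" using assms(6) by linarith
  then show ?thesis using assms(3,4) by (simp add: field_simps)
qed

theorem theoremB1:
  fixes \<omega> :: "real ^ 'd"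
  assumes "diophantine \<omega>"
  shows "\<exists>(W :: real \<Rightarrow> real) (w :: real \<Rightarrow> real \<Rightarrow> complex).
     smooth W \<and>
     (\<forall>\<theta> \<in> frequency_set \<omega>. smooth (w \<theta>)) \<and>
     (\<forall>x. ((\<lambda>\<theta>. exp (\<i> * complex_of_real (\<theta> * x)) * w \<theta> x)
            has_sum complex_of_real (W x)) (frequency_set \<omega>)) \<and>
     (\<forall>k N :: nat. \<exists>C>0.
        (\<forall>\<theta> \<in> frequency_set \<omega>. \<forall>x.
           norm (nth_deriv k (w \<theta>) x)
             \<le> C * jbracket x powi (- int k) * jbracket \<theta> powi (- int N)) \<and>
        (\<forall>(n :: int ^ 'd) x.
           norm (nth_deriv k (w (int_to_real_vec n \<bullet> \<omega>)) x)
             \<le> C * jbracket x powi (- int k) * jbracket (int_to_real_vec n) powi (- int N))) \<and>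
     {complex_of_real (\<theta>\<^sup>2 / 4) | \<theta>. \<theta> \<in> frequency_set \<omega> - {0}}
       \<subseteq> point_spectrum (schroedinger_op W)"
proof -
  define fr where "fr n = int_to_real_vec n \<bullet> \<omega>" for n
  define e where "e n = exp (- (1 / 2) * l1 n)" for n :: "int ^ 'd"
  obtain \<kappa> v Cg \<delta> W0 \<epsilon> a s0 \<iota> where "lattice_problem \<kappa> v Cg \<delta> W0 \<epsilon> a s0 \<iota> e fr" and \<iota>: "range \<iota> = {n. 0 < fr n}"
    using lattice_problem_exists[OF assms] unfolding fr_def[abs_def] e_def[abs_def] by blast
  then interpret lattice_problem \<kappa> v Cg \<delta> W0 \<epsilon> a s0 \<iota> e fr by simp
  obtain W :: "real \<Rightarrow> real" and w where W: "smooth W" and w: "symbols (\<lambda>x. 1 + \<bar>x\<bar>) UNIV w e"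
    and sum: "\<And>x. ((\<lambda>n. wave (fr n) x * w n x) has_sum of_real (W x)) UNIV"
    and ev: "\<And>i. of_real ((\<kappa> i)\<^sup>2) \<in> point_spectrum (schroedinger_op W)"
    using even_potential by blast
  have inj: "inj fr"
  proof
    fix m n assume "fr m = fr n"
    then have "int_to_real_vec (m - n) \<bullet> \<omega> = 0" by (simp add: fr_def int_to_real_vec_diff inner_diff_left)
    then have "m - n = 0" using diophantine_inverse_bound[OF assms] by metis
    then show "m = n" by simp
  qed
  have freq: "frequency_set \<omega> = range fr" by (auto simp: frequency_set_def fr_def)
  \<comment> \<open>distinct lattice vectors have distinct frequencies, so the coefficients may be indexed by frequency\<close>
  define u where "u \<theta> = w (inv fr \<theta>)" for \<theta>
  have u: "u (fr n) = w n" for n using inj by (simp add: u_def)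
  have sum_freq: "((\<lambda>\<theta>. exp (\<i> * complex_of_real (\<theta> * x)) * u \<theta> x) has_sum of_real (W x)) (range fr)" for x
    unfolding has_sum_reindex[OF inj] o_def u using sum[of x] by (simp add: wave_def)
  have bound: "\<exists>C>0. \<forall>n x. norm (nth_deriv k (w n) x) \<le> C * jbracket x powi (- int k) * jbracket (fr n) powi (- int N) \<and>
     norm (nth_deriv k (w n) x) \<le> C * jbracket x powi (- int k) * jbracket (int_to_real_vec n) powi (- int N)" for k N
  proof -
    obtain C where C: "C \<ge> 0" "\<And>n x. x \<in> UNIV \<Longrightarrow> (1 + \<bar>x\<bar>) ^ k * norm (nth_deriv k (w n) x) \<le> C * e n"
      using symbols_bound[OF w, of k] by blast
    obtain D :: real where D: "0 \<le> D" "\<And>t. 0 \<le> t \<Longrightarrow> (1 + t) ^ N \<le> D * exp (1 / 2 * t)"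
      using power_le_exp[of "1 / 2" N] half_gt_zero[OF zero_less_one] by metis
    define M where "M = (1 + norm \<omega>) ^ N * D"
    define K where "K = C * M + 1"
    have M: "D \<le> M" using D(1) mult_right_mono[OF one_le_power[of "1 + norm \<omega>" N], of D] by (simp add: M_def)
    have De: "e n * (1 + l1 n) ^ N \<le> D" for n
    proof -
      have "e n * (1 + l1 n) ^ N \<le> e n * (D * exp (1 / 2 * l1 n))"
        using D(2)[OF l1_nonneg[of n]] by (intro mult_left_mono) (auto simp: e_def)
      also have "\<dots> = D" by (simp add: e_def mult.left_commute flip: exp_add)
      finally show ?thesis .
    qed
    have 1: "e n * jbracket (int_to_real_vec n) ^ N \<le> M" for n
    proof -
      have "jbracket (int_to_real_vec n) ^ N \<le> (1 + l1 n) ^ N"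
        using jbracket_power_le(1)[of "int_to_real_vec n" N] power_mono[of "1 + norm (int_to_real_vec n)" "1 + l1 n" N] norm_le_l1[of n] by auto
      then have "e n * jbracket (int_to_real_vec n) ^ N \<le> e n * (1 + l1 n) ^ N" by (intro mult_left_mono) (auto simp: e_def)
      then show ?thesis using De[of n] M by linarith
    qed
    have 2: "e n * jbracket (fr n) ^ N \<le> M" for n
    proof -
      have "\<bar>fr n\<bar> \<le> norm (int_to_real_vec n) * norm \<omega>" unfolding fr_def by (rule Cauchy_Schwarz_ineq2)
      also have "\<dots> \<le> l1 n * norm \<omega>" by (intro mult_right_mono norm_le_l1) auto
      finally have "1 + norm (fr n) \<le> (1 + norm \<omega>) * (1 + l1 n)"
        using l1_nonneg[of n] norm_ge_zero[of \<omega>]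
        unfolding distrib_left distrib_right mult_1_left mult_1_right real_norm_def mult.commute[of "norm \<omega>"] by linarith
      then have "jbracket (fr n) ^ N \<le> ((1 + norm \<omega>) * (1 + l1 n)) ^ N"
        using jbracket_power_le(1)[of "fr n" N] power_mono[of "1 + norm (fr n)" _ N] by fastforce
      then have "e n * jbracket (fr n) ^ N \<le> e n * ((1 + norm \<omega>) * (1 + l1 n)) ^ N" by (intro mult_left_mono) (auto simp: e_def)
      also have "\<dots> = (1 + norm \<omega>) ^ N * (e n * (1 + l1 n) ^ N)" by (simp add: power_mult_distrib)
      also have "\<dots> \<le> M" unfolding M_def by (intro mult_left_mono De) auto
      finally show ?thesis .
    qed
    have 3: "jbracket x ^ k * norm (nth_deriv k (w n) x) \<le> C * e n" for n x
      using C(2)[of x n] mult_right_mono[OF jbracket_power_le(1)[of x k], of "norm (nth_deriv k (w n) x)"] by simp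
    have K: "C * M \<le> K" "0 < K" using C(1) M D(1) by (auto simp: K_def intro: add_nonneg_pos)
    have J: "0 < jbracket z ^ m" for z :: "'z :: real_normed_vector" and m
      using jbracket_power_le(3)[of z] by simp
    show ?thesis
      using decay_from_weights[OF 3 1 J J C(1) K(1)] decay_from_weights[OF 3 2 J J C(1) K(1)] K(2)
      by (intro exI[of _ K]) (simp add: power_int_minus)
  qed
  have sym_freq: "\<exists>C>0. (\<forall>\<theta>\<in>range fr. \<forall>x. norm (nth_deriv k (u \<theta>) x) \<le> C * jbracket x powi (- int k) * jbracket \<theta> powi (- int N)) \<and>
     (\<forall>n x. norm (nth_deriv k (u (fr n)) x) \<le> C * jbracket x powi (- int k) * jbracket (int_to_real_vec n) powi (- int N))" for k N
  proof -
    obtain C where "C > 0" "\<And>n x. norm (nth_deriv k (w n) x) \<le> C * jbracket x powi (- int k) * jbracket (fr n) powi (- int N)"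
      "\<And>n x. norm (nth_deriv k (w n) x) \<le> C * jbracket x powi (- int k) * jbracket (int_to_real_vec n) powi (- int N)"
      using bound[of k N] by blast
    then show ?thesis by (intro exI[of _ C]) (auto simp: u)
  qed
  have smooth_u: "smooth (u \<theta>)" for \<theta>
    using symbols_smooth[OF w] by (simp add: u_def smooth_on_UNIV)
  have eigen: "complex_of_real (\<theta>\<^sup>2 / 4) \<in> point_spectrum (schroedinger_op W)" if \<theta>: "\<theta> \<in> range fr - {0}" for \<theta>
  proof -
    obtain n where n: "\<theta> = fr n" "fr n \<noteq> 0" using \<theta> by auto
    \<comment> \<open>one of \<open>n\<close> and \<open>- n\<close> has positive frequency, and only the square of \<open>\<theta>\<close> matters\<close>
    obtain i where "fr (\<iota> i) = \<bar>\<theta>\<bar>"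
    proof (cases "0 < fr n")
      case True
      then have "n \<in> range \<iota>" using \<iota> by simp
      then show ?thesis using that True n by auto
    next
      case False
      then have "- n \<in> range \<iota>" using \<iota> n fr_minus[of n] by simp
      then obtain i where "\<iota> i = - n" by (metis imageE)
      then show ?thesis using that[of i] False n fr_minus[of n] by simp
    qed
    then have "\<kappa> i = \<bar>\<theta>\<bar> / 2" using fr_\<iota>[of i] by simp
    then have "(\<kappa> i)\<^sup>2 = \<theta>\<^sup>2 / 4" by (simp only: power_divide power2_abs) simp
    then show ?thesis using ev[of i] by (simp only:)
  qed
  show ?thesis
    unfolding freq fr_def[symmetric]
    by (rule exI[of _ W], rule exI[of _ u]) (use W smooth_u sum_freq sym_freq eigen in blast)
qed

end
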